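(* For any integrable function $g$ on $T^\star\mathbb R^d$, one has $$\mathcal F_{\mathbb H}(g\otimes\mathbf 1)=(\mathcal G_{\mathbb H}g)\,\mu_{\widehat{\mathbb H}^d_0},$$ where $(g\otimes\mathbf 1)(Y,s)=g(Y)$ and $\mathcal G_{\mathbb H}g:\widehat{\mathbb H}^d_0\to\mathbb C$ is defined by $$\mathcal G_{\mathbb H}g(\dot x,k)=\int_{T^\star\mathbb R^d}\overline{\mathcal K_d(\dot x,k,Y)}\,g(Y)\,dY,\qquad \mathcal K_d(\dot x,k,Y)=\prod_{j=1}^d\mathcal K(\dot x_j,k_j,Y_j),\quad Y_j=(y_j,\eta_j),$$ $$\mathcal K(\dot x,k,y,\eta)=\frac1{2\pi}\int_{-\pi}^{\pi}e^{i\left(2|\dot x|^{1/2}(y\sin z+\eta\,\mathrm{sgn}(\dot x)\cos z)+kz\right)}\,dz .$$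
   Context: Fix an integer $d\ge 1$; $\mathbb N=\{0,1,2,\dots\}$. The Heisenberg group $\mathbb H^d$ is $T^\star\mathbb R^d\times\mathbb R\simeq\mathbb R^{2d}\times\mathbb R$, with elements $w=(Y,s)=(y,\eta,s)$, product $w\cdot w'=(y+y',\eta+\eta',s+s'+2\langle\eta,y'\rangle-2\langle\eta',y\rangle)$, and Haar measure $dw=dY\,ds$. $\mathcal S(\mathbb H^d)=\mathcal S(\mathbb R^{2d+1})$ and $\mathcal S'(\mathbb H^d)$ is its topological dual (tempered distributions); locally integrable functions of moderate growth act by integration with $dw$. Hermite functions: $H_0(x)=\pi^{-d/4}e^{-|x|^2/2}$, $H_n=(2^{|n|}n!)^{-1/2}\prod_{j}C_j^{n_j}H_0$, $C_j=-\partial_j+x_j$ (an orthonormal basis of $L^2(\mathbb R^d)$), and $H_{n,\lambda}(x)=|\lambda|^{d/4}H_n(|\lambda|^{1/2}x)$ for $\lambda\ne0$. $\widetilde{\mathbb H}^d=\mathbb N^d\times\mathbb N^d\times(\mathbb R\setminus\{0\})$, elements $\widehat w=(n,m,\lambda)$, measure $\int\theta\,d\widehat w=\sum_{n,m}\int_{\mathbb R}\theta(n,m,\lambda)|\lambda|^d d\lambda$, distance $\widehat d(\widehat w,\widehat w')=|\lambda(n+m)-\lambda'(n'+m')|_1+|(n-m)-(n'-m')|_1+|\lambda-\lambda'|$, where $|\cdot|_1$ is the $\ell^1$ norm. Its completion is $\widehat{\mathbb H}^d=\widetilde{\mathbb H}^d\cup\widehat{\mathbb H}^d_0$, $\widehat{\mathbb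 H}^d_0=((\mathbb R_-)^d\cup(\mathbb R_+)^d)\times\mathbb Z^d$, with $\widehat d(\widehat w,(\dot x,k))=|\lambda(n+m)-\dot x|_1+|m-n-k|_1+|\lambda|$ and $\widehat d((\dot x,k),(\dot x',k'))=|\dot x-\dot x'|_1+|k-k'|_1$; $d\widehat w$ is extended by giving no mass to $\widehat{\mathbb H}^d_0$. For $Y=(y,\eta)$, $$\mathcal W(\widehat w,Y)=\int_{\mathbb R^d}e^{2i\lambda\langle\eta,z\rangle}H_{n,\lambda}(y+z)H_{m,\lambda}(-y+z)\,dz .$$ For $\theta:\widetilde{\mathbb H}^d\to\mathbb C$ put $\widehat w_j^{\pm}=(n\pm\delta_j,m\pm\delta_j,\lambda)$, $\delta_j$ the $j$-th unit vector (terms with coefficient $\sqrt{n_jm_j}=0$ are read as $0$), and $$\widehat\Delta\theta(\widehat w)=-\tfrac{|n+m|+d}{2|\lambda|}\theta(\widehat w)+\tfrac1{2|\lambda|}\sum_{j=1}^d\bigl(\sqrt{(n_j+1)(m_j+1)}\,\theta(\widehat w_j^+)+\sqrt{n_jm_j}\,\theta(\widehat w_j^-)\bigr),$$ $$\widehat{\mathcal D}_\lambda\theta(\widehat w)=\tfrac{d\theta}{d\lambda}(\widehat w)+\tfrac d{2\lambda}\theta(\widehat w)+\tfrac1{2\lambda}\sum_{j=1}^d\bigl(\sqrt{n_jm_j}\,\theta(\widehat w_j^-)-\sqrt{(n_j+1)(m_j+1)}\,\theta(\widehat w_j^+)\bigr),$$ $$\widehat\Sigma_0\theta(\widehat w)=\lambda^{-1}\bigl(\theta(n,m,\lambda)-(-1)^{|n+m|}\theta(m,n,-\lambda)\bigr).$$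 With $\widehat d_0(\widehat w)=|\lambda|(|n+m|_1+d)+|m-n|_1$, $\mathcal S(\widetilde{\mathbb H}^d)$ is the set of $\theta$ smooth in $\lambda\in\mathbb R\setminus\{0\}$ for which all semi-norms $$\|\theta\|_{N,N'}=\sup_{\widehat w}(1+\widehat d_0(\widehat w))^N\bigl(|\widehat\Delta^{N'}\theta|+|\widehat{\mathcal D}_\lambda^{N'}\theta|+|\widehat\Sigma_0\widehat{\mathcal D}_\lambda^{N'}\theta|\bigr)(\widehat w),\quad N,N'\in\mathbb N,$$ are finite. Its elements extend continuously to $\widehat{\mathbb H}^d$; $\mathcal S(\widehat{\mathbb H}^d)$ is the Fréchet space of these extensions (same semi-norms), and $\mathcal S'(\widehat{\mathbb H}^d)$ is its space of continuous linear forms. The map ${}^t\mathcal F_{\mathbb H}\theta(Y,s)=\int_{\widehat{\mathbb H}^d}\overline{e^{is\lambda}\mathcal W(\widehat w,Y)}\,\theta(\widehat w)\,d\widehat w$ is a continuous isomorphism from $\mathcal S(\widehat{\mathbb H}^d)$ onto $\mathcal S(\mathbb H^d)$, and for $T\in\mathcal S'(\mathbb H^d)$, $\mathcal F_{\mathbb H}T\in\mathcal S'(\widehat{\mathbb H}^d)$ is defined by $\langle\mathcal F_{\mathbb H}T,\theta\rangle=\langle T,{}^t\mathcal F_{\mathbb H}\theta\rangle$. The measure $\mu_{\widehat{\mathbb H}^d_0}$ is the tempered distribution on $\widehat{\mathbb H}^d$ given by $$\langle\mu_{\widehat{\mathbb H}^d_0},\theta\rangle=2^{-d}\sum_{k\in\mathbb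 Z^d}\Bigl(\int_{(\mathbb R_-)^d}\theta(\dot x,k)\,d\dot x+\int_{(\mathbb R_+)^d}\theta(\dot x,k)\,d\dot x\Bigr).$$ For a bounded function $G$ on $\widehat{\mathbb H}^d_0$, $G\mu_{\widehat{\mathbb H}^d_0}$ denotes the distribution $\theta\mapsto\int_{\widehat{\mathbb H}^d_0}\theta\,G\,d\mu_{\widehat{\mathbb H}^d_0}$.
   Formalization: With the stated normalisations the printed identity is off by a factor π; what is proved is F_H(g⊗1) = π (G_H g) μ, for every integrable g, with all the definitions unchanged. *)

theory Defs
  imports "HOL-Analysis.Analysis"
begin

text \<open>
  The integer \<open>d \<ge> 1\<close> is \<open>CARD('d)\<close> for a finite index type \<open>'d\<close>.  Points \<open>Y = (y, \<eta>)\<close> of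
  \<open>T\<^sup>*R\<^sup>d\<close> have type \<open>'d phase\<close> and points \<open>w = (Y, s)\<close> of the Heisenberg group have type
  \<open>'d heis\<close>.  All integrals are taken with respect to the (completed) Lebesgue measure, which is
  the Haar measure \<open>dY ds\<close>.
\<close>

type_synonym 'd phase = "(real^'d) \<times> (real^'d)"
type_synonym 'd heis = "'d phase \<times> real"


subsection \<open>Schwartz functions and tempered distributions on a Euclidean space\<close>

definition dir_deriv ::
  "'a::real_normed_vector \<Rightarrow> ('a \<Rightarrow> 'b::real_normed_vector) \<Rightarrow> 'a \<Rightarrow> 'b" where
  "dir_deriv v f = (\<lambda>x. frechet_derivative f (at x) v)"

text \<open>\<open>foldr dir_deriv vs f\<close> is the iterated partial derivative of \<open>f\<close> along the basis vectors listed
  in \<open>vs\<close>; smoothness means that all of these exist and are differentiable everywhere.\<close>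

definition schwartz :: "('a::euclidean_space \<Rightarrow> complex) set" where
  "schwartz = {\<phi>. \<forall>vs. set vs \<subseteq> Basis \<longrightarrow>
      (\<forall>x. foldr dir_deriv vs \<phi> differentiable (at x)) \<and>
      (\<forall>N. bdd_above (range (\<lambda>x. (1 + norm x) ^ N * norm (foldr dir_deriv vs \<phi> x))))}"

definition schwartz_norm :: "nat \<Rightarrow> ('a::euclidean_space \<Rightarrow> complex) \<Rightarrow> real" where
  "schwartz_norm N \<phi> = (\<Sum>vs | set vs \<subseteq> Basis \<and> length vs \<le> N.
      (SUP x. (1 + norm x) ^ N * norm (foldr dir_deriv vs \<phi> x)))"

text \<open>Continuous linear forms on a function space \<open>S\<close> whose topology is generated by an increasing
  sequence \<open>p\<close> of semi-norms; only the values of \<open>T\<close> on \<open>S\<close> matter.\<close>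

definition continuous_forms ::
  "('x \<Rightarrow> complex) set \<Rightarrow> (nat \<Rightarrow> ('x \<Rightarrow> complex) \<Rightarrow> real) \<Rightarrow> (('x \<Rightarrow> complex) \<Rightarrow> complex) set" where
  "continuous_forms S p = {T.
      (\<forall>\<phi>\<in>S. \<forall>\<psi>\<in>S. T (\<lambda>x. \<phi> x + \<psi> x) = T \<phi> + T \<psi>) \<and>
      (\<forall>c. \<forall>\<phi>\<in>S. T (\<lambda>x. c * \<phi> x) = c * T \<phi>) \<and>
      (\<exists>C N. \<forall>\<phi>\<in>S. norm (T \<phi>) \<le> C * p N \<phi>)}"

definition tempered :: "(('a::euclidean_space \<Rightarrow> complex) \<Rightarrow> complex) set" where
  "tempered = continuous_forms schwartz schwartz_norm"

definition dist_of_fun :: "('a::euclidean_space \<Rightarrow> complex) \<Rightarrow> ('a \<Rightarrow> complex) \<Rightarrow> complex" where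
  "dist_of_fun f = (\<lambda>\<phi>. LINT w|lebesgue. f w * \<phi> w)"


subsection \<open>Hermite functions and the kernel \<open>\<W>\<close>\<close>

definition hermite0 :: "real^'d \<Rightarrow> real" where
  "hermite0 = (\<lambda>x. pi powr (- (real CARD('d) / 4)) * exp (- (norm x)\<^sup>2 / 2))"

definition creation :: "'d \<Rightarrow> (real^'d \<Rightarrow> real) \<Rightarrow> real^'d \<Rightarrow> real" where
  "creation j f = (\<lambda>x. - dir_deriv (axis j 1) f x + x $ j * f x)"

text \<open>The fold is the product of the operators \<open>C\<^sub>j\<close> to the power \<open>n\<^sub>j\<close> applied to \<open>H\<^sub>0\<close>.  These operators
  commute on smooth functions, so the order in which they are applied is immaterial.\<close>

definition hermite :: "nat^'d \<Rightarrow> real^'d \<Rightarrow> real" where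
  "hermite n = (\<lambda>x. Finite_Set.fold (\<lambda>j f. (creation j ^^ (n $ j)) f) hermite0 UNIV x
      / sqrt (2 ^ (\<Sum>j\<in>UNIV. n $ j) * (\<Prod>j\<in>UNIV. fact (n $ j))))"

definition hermite_scaled :: "nat^'d \<Rightarrow> real \<Rightarrow> real^'d \<Rightarrow> real" where
  "hermite_scaled n l = (\<lambda>x. \<bar>l\<bar> powr (real CARD('d) / 4) * hermite n (sqrt \<bar>l\<bar> *\<^sub>R x))"

definition W_kernel :: "nat^'d \<Rightarrow> nat^'d \<Rightarrow> real \<Rightarrow> 'd phase \<Rightarrow> complex" where
  "W_kernel n m l Y = (LINT z|lebesgue.
      exp (2 * \<i> * of_real (l * (snd Y \<bullet> z))) *
      of_real (hermite_scaled n l (fst Y + z) * hermite_scaled m l (- fst Y + z)))"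


subsection \<open>The frequency space\<close>

text \<open>\<open>Freq n m \<lambda>\<close> is the point \<open>(n, m, \<lambda>)\<close>, relevant for \<open>\<lambda> \<noteq> 0\<close>; \<open>Bdry x k\<close> is the point
  \<open>(x, k)\<close> added by the completion, relevant when the coordinates of \<open>x\<close> are all \<open>\<le> 0\<close> or all
  \<open>\<ge> 0\<close>.  The other values of the datatype are not points of the space.\<close>

datatype ('d::finite) freq = Freq "nat^'d" "nat^'d" real | Bdry "real^'d" "int^'d"

definition neg_orthant :: "(real^'d) set" where
  "neg_orthant = {x. \<forall>j. x $ j \<le> 0}"

definition pos_orthant :: "(real^'d) set" where
  "pos_orthant = {x. \<forall>j. 0 \<le> x $ j}"

definition freq_space :: "('d::finite) freq set" where
  "freq_space = {Freq n m l | n m l. l \<noteq> 0} \<union> {Bdry x k | x k. x \<in> neg_orthant \<union> pos_orthant}"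

fun freq_dist :: "('d::finite) freq \<Rightarrow> 'd freq \<Rightarrow> real" where
  "freq_dist (Freq n m l) (Freq n' m' l') =
     (\<Sum>j\<in>UNIV. \<bar>l * (real (n $ j) + real (m $ j)) - l' * (real (n' $ j) + real (m' $ j))\<bar>)
     + (\<Sum>j\<in>UNIV. \<bar>(real (n $ j) - real (m $ j)) - (real (n' $ j) - real (m' $ j))\<bar>)
     + \<bar>l - l'\<bar>"
| "freq_dist (Freq n m l) (Bdry x k) =
     (\<Sum>j\<in>UNIV. \<bar>l * (real (n $ j) + real (m $ j)) - x $ j\<bar>)
     + (\<Sum>j\<in>UNIV. \<bar>real (m $ j) - real (n $ j) - of_int (k $ j)\<bar>)
     + \<bar>l\<bar>"
| "freq_dist (Bdry x k) (Freq n m l) =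
     (\<Sum>j\<in>UNIV. \<bar>l * (real (n $ j) + real (m $ j)) - x $ j\<bar>)
     + (\<Sum>j\<in>UNIV. \<bar>real (m $ j) - real (n $ j) - of_int (k $ j)\<bar>)
     + \<bar>l\<bar>"
| "freq_dist (Bdry x k) (Bdry x' k') =
     (\<Sum>j\<in>UNIV. \<bar>x $ j - x' $ j\<bar>) + (\<Sum>j\<in>UNIV. \<bar>of_int (k $ j) - of_int (k' $ j)\<bar>)"

text \<open>The distance is the \<open>\<ell>\<^sup>1\<close> distance of the following coordinates.\<close>

fun freq_coords :: "('d::finite) freq \<Rightarrow> ('d \<Rightarrow> real) \<times> ('d \<Rightarrow> real) \<times> real" where
  "freq_coords (Freq n m l) =
     ((\<lambda>j. l * (real (n $ j) + real (m $ j))), (\<lambda>j. real (m $ j) - real (n $ j)), l)"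
| "freq_coords (Bdry x k) = ((\<lambda>j. x $ j), (\<lambda>j. of_int (k $ j)), 0)"

lemma freq_dist_coords:
  "freq_dist p q =
     (\<Sum>j\<in>UNIV. \<bar>fst (freq_coords p) j - fst (freq_coords q) j\<bar>)
     + (\<Sum>j\<in>UNIV. \<bar>fst (snd (freq_coords p)) j - fst (snd (freq_coords q)) j\<bar>)
     + \<bar>snd (snd (freq_coords p)) - snd (snd (freq_coords q))\<bar>"
  by (cases p; cases q) (auto simp: abs_minus_commute algebra_simps intro!: sum.cong)

lemma freq_coords_inj:
  assumes "p \<in> freq_space" "q \<in> freq_space" "freq_coords p = freq_coords q"
  shows "p = q"
proof (cases p; cases q)
  fix n m l n' m' l'
  assume pq: "p = Freq n m l" "q = Freq n' m' l'"
  have l: "l = l'" "l \<noteq> 0" using assms pq by (auto simp: freq_space_def)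
  have "real (n $ j) + real (m $ j) = real (n' $ j) + real (m' $ j)
      \<and> real (m $ j) - real (n $ j) = real (m' $ j) - real (n' $ j)" for j
    using assms(3) l by (auto simp: pq fun_eq_iff simp flip: distrib_left)
  hence "n $ j = n' $ j \<and> m $ j = m' $ j" for j
    by (smt (verit) of_nat_eq_iff)
  thus "p = q" using l by (simp add: pq vec_eq_iff)
qed (use assms in \<open>auto simp: freq_space_def fun_eq_iff vec_eq_iff\<close>)

lemma Metric_space_freq: "Metric_space (freq_space :: ('d::finite) freq set) freq_dist"
proof
  show "0 \<le> freq_dist p q" for p q :: "'d freq"
    by (auto simp: freq_dist_coords intro!: add_nonneg_nonneg sum_nonneg)
  show "freq_dist p q = freq_dist q p" for p q :: "'d freq"
    by (simp add: freq_dist_coords abs_minus_commute)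
  show "(freq_dist p q = 0) = (p = q)" if "p \<in> freq_space" "q \<in> freq_space" for p q :: "'d freq"
  proof
    assume "freq_dist p q = 0"
    hence "(\<Sum>j\<in>UNIV. \<bar>fst (freq_coords p) j - fst (freq_coords q) j\<bar>) = 0 \<and>
      (\<Sum>j\<in>UNIV. \<bar>fst (snd (freq_coords p)) j - fst (snd (freq_coords q)) j\<bar>) = 0 \<and>
      \<bar>snd (snd (freq_coords p)) - snd (snd (freq_coords q))\<bar> = 0"
      unfolding freq_dist_coords
      by (smt (verit) abs_ge_zero sum_nonneg)
    hence "freq_coords p = freq_coords q"
      by (auto simp: prod_eq_iff fun_eq_iff sum_nonneg_eq_0_iff)
    thus "p = q" using that freq_coords_inj by blast
  qed (simp add: freq_dist_coords)
  show "freq_dist p r \<le> freq_dist p q + freq_dist q r" for p q r :: "'d freq"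
  proof -
    have *: "(\<Sum>j\<in>UNIV. \<bar>f j - h j\<bar>) \<le> (\<Sum>j\<in>UNIV. \<bar>f j - g j\<bar>) + (\<Sum>j\<in>UNIV. \<bar>g j - h j\<bar>)"
      for f g h :: "'d \<Rightarrow> real"
      unfolding sum.distrib[symmetric] by (rule sum_mono) linarith
    show ?thesis
      unfolding freq_dist_coords
      using *[of "fst (freq_coords p)" "fst (freq_coords r)" "fst (freq_coords q)"]
        *[of "fst (snd (freq_coords p))" "fst (snd (freq_coords r))" "fst (snd (freq_coords q))"]
      by linarith
  qed
qed

abbreviation freq_topology :: "('d::finite) freq topology" where
  "freq_topology \<equiv> Metric_space.mtopology freq_space freq_dist"


subsection \<open>The space \<open>\<S>\<close> on the frequency side and its dual\<close>

definition hat_Delta ::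
  "(nat^'d \<Rightarrow> nat^'d \<Rightarrow> real \<Rightarrow> complex) \<Rightarrow> nat^'d \<Rightarrow> nat^'d \<Rightarrow> real \<Rightarrow> complex" where
  "hat_Delta \<theta> n m l =
     - of_real (((\<Sum>j\<in>UNIV. real (n $ j) + real (m $ j)) + real CARD('d)) / (2 * \<bar>l\<bar>)) * \<theta> n m l
     + of_real (1 / (2 * \<bar>l\<bar>)) * (\<Sum>j\<in>UNIV.
         of_real (sqrt ((real (n $ j) + 1) * (real (m $ j) + 1))) * \<theta> (n + axis j 1) (m + axis j 1) l
       + of_real (sqrt (real (n $ j) * real (m $ j))) * \<theta> (n - axis j 1) (m - axis j 1) l)"

definition lambda_deriv ::
  "(nat^'d \<Rightarrow> nat^'d \<Rightarrow> real \<Rightarrow> complex) \<Rightarrow> nat^'d \<Rightarrow> nat^'d \<Rightarrow> real \<Rightarrow> complex" where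
  "lambda_deriv \<theta> n m l = vector_derivative (\<theta> n m) (at l)"

definition hat_D ::
  "(nat^'d \<Rightarrow> nat^'d \<Rightarrow> real \<Rightarrow> complex) \<Rightarrow> nat^'d \<Rightarrow> nat^'d \<Rightarrow> real \<Rightarrow> complex" where
  "hat_D \<theta> n m l =
     lambda_deriv \<theta> n m l
     + of_real (real CARD('d) / (2 * l)) * \<theta> n m l
     + of_real (1 / (2 * l)) * (\<Sum>j\<in>UNIV.
         of_real (sqrt (real (n $ j) * real (m $ j))) * \<theta> (n - axis j 1) (m - axis j 1) l
       - of_real (sqrt ((real (n $ j) + 1) * (real (m $ j) + 1))) * \<theta> (n + axis j 1) (m + axis j 1) l)"

definition hat_Sigma0 ::
  "(nat^'d \<Rightarrow> nat^'d \<Rightarrow> real \<Rightarrow> complex) \<Rightarrow> nat^'d \<Rightarrow> nat^'d \<Rightarrow> real \<Rightarrow> complex" where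
  "hat_Sigma0 \<theta> n m l =
     of_real (inverse l) * (\<theta> n m l - (-1) ^ (\<Sum>j\<in>UNIV. n $ j + m $ j) * \<theta> m n (- l))"

definition hat_d0 :: "nat^'d \<Rightarrow> nat^'d \<Rightarrow> real \<Rightarrow> real" where
  "hat_d0 n m l = \<bar>l\<bar> * ((\<Sum>j\<in>UNIV. real (n $ j) + real (m $ j)) + real CARD('d))
     + (\<Sum>j\<in>UNIV. \<bar>real (m $ j) - real (n $ j)\<bar>)"

definition hat_weight ::
  "nat \<Rightarrow> nat \<Rightarrow> (nat^'d \<Rightarrow> nat^'d \<Rightarrow> real \<Rightarrow> complex) \<Rightarrow> (nat^'d) \<times> (nat^'d) \<times> real \<Rightarrow> real" where
  "hat_weight N N' \<theta> = (\<lambda>(n, m, l). (1 + hat_d0 n m l) ^ N *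
     (norm ((hat_Delta ^^ N') \<theta> n m l) + norm ((hat_D ^^ N') \<theta> n m l)
      + norm (hat_Sigma0 ((hat_D ^^ N') \<theta>) n m l)))"

definition hat_seminorm ::
  "nat \<Rightarrow> nat \<Rightarrow> (nat^'d \<Rightarrow> nat^'d \<Rightarrow> real \<Rightarrow> complex) \<Rightarrow> real" where
  "hat_seminorm N N' \<theta> = (SUP p\<in>{(n, m, l). l \<noteq> 0}. hat_weight N N' \<theta> p)"

definition schwartz_tilde :: "(nat^'d \<Rightarrow> nat^'d \<Rightarrow> real \<Rightarrow> complex) set" where
  "schwartz_tilde = {\<theta>.
     (\<forall>i n m l. l \<noteq> 0 \<longrightarrow> (lambda_deriv ^^ i) \<theta> n m differentiable (at l)) \<and>
     (\<forall>N N'. bdd_above (hat_weight N N' \<theta> ` {(n, m, l). l \<noteq> 0}))}"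

definition schwartz_hat :: "(('d::finite) freq \<Rightarrow> complex) set" where
  "schwartz_hat = {\<theta>. (\<lambda>n m l. \<theta> (Freq n m l)) \<in> schwartz_tilde \<and>
     continuous_map freq_topology euclidean \<theta>}"

definition tempered_hat :: "((('d::finite) freq \<Rightarrow> complex) \<Rightarrow> complex) set" where
  "tempered_hat = continuous_forms schwartz_hat
     (\<lambda>M \<theta>. \<Sum>N\<le>M. \<Sum>N'\<le>M. hat_seminorm N N' (\<lambda>n m l. \<theta> (Freq n m l)))"


subsection \<open>The Fourier transform of tempered distributions\<close>

text \<open>The measure gives no mass to the boundary points, so only the values at \<open>Freq n m \<lambda>\<close>
  enter.\<close>

definition freq_integral :: "(nat^('d::finite) \<Rightarrow> nat^'d \<Rightarrow> real \<Rightarrow> complex) \<Rightarrow> complex" where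
  "freq_integral \<theta> = (\<Sum>\<^sub>\<infinity>(n, m)\<in>UNIV.
     LINT l|lebesgue. \<theta> n m l * of_real (\<bar>l\<bar> ^ CARD('d)))"

definition fourier_transpose :: "(('d::finite) freq \<Rightarrow> complex) \<Rightarrow> 'd heis \<Rightarrow> complex" where
  "fourier_transpose \<theta> = (\<lambda>(Y, s). freq_integral (\<lambda>n m l.
     cnj (exp (\<i> * of_real (s * l)) * W_kernel n m l Y) * \<theta> (Freq n m l)))"

definition fourier_H ::
  "(('d::finite heis \<Rightarrow> complex) \<Rightarrow> complex) \<Rightarrow> ('d freq \<Rightarrow> complex) \<Rightarrow> complex" where
  "fourier_H T = (\<lambda>\<theta>. T (fourier_transpose \<theta>))"


subsection \<open>The boundary measure and the transform \<open>\<G>\<close>\<close>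

text \<open>
  Integration with respect to the boundary measure \<open>\<mu>\<close>.  On the normalisation: integrating
  \<open>e\<^sup>-\<^sup>i\<^sup>s\<^sup>\<lambda>\<close> over \<open>s\<close> gives \<open>2 \<pi>\<close> times evaluation at \<open>\<lambda> = 0\<close>, while the sum of the two orthant
  integrals is the sum of the two equal one-sided limits at \<open>\<lambda> = 0\<close>, i.e. twice the value there.
  Hence, with the unnormalised Lebesgue measures used in this theory, the Fourier transform of
  \<open>g \<otimes> 1\<close> has density \<open>\<pi> \<G>g\<close> with respect to \<open>\<mu>\<close>.
\<close>

definition mu_integral :: "(real^('d::finite) \<Rightarrow> int^'d \<Rightarrow> complex) \<Rightarrow> complex" where
  "mu_integral F = 1 / 2 ^ CARD('d) * (\<Sum>\<^sub>\<infinity>k\<in>UNIV.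
     (LINT x:neg_orthant|lebesgue. F x k) + (LINT x:pos_orthant|lebesgue. F x k))"

definition mu_times ::
  "(real^('d::finite) \<Rightarrow> int^'d \<Rightarrow> complex) \<Rightarrow> ('d freq \<Rightarrow> complex) \<Rightarrow> complex" where
  "mu_times G = (\<lambda>\<theta>. mu_integral (\<lambda>x k. \<theta> (Bdry x k) * G x k))"

definition K_one :: "real \<Rightarrow> int \<Rightarrow> real \<Rightarrow> real \<Rightarrow> complex" where
  "K_one x k y \<eta> = of_real (1 / (2 * pi)) * (LINT z:{-pi..pi}|lebesgue.
     exp (\<i> * of_real (2 * sqrt \<bar>x\<bar> * (y * sin z + \<eta> * sgn x * cos z) + of_int k * z)))"

definition K_kernel :: "real^('d::finite) \<Rightarrow> int^'d \<Rightarrow> 'd phase \<Rightarrow> complex" where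
  "K_kernel x k Y = (\<Prod>j\<in>UNIV. K_one (x $ j) (k $ j) (fst Y $ j) (snd Y $ j))"

definition G_transform ::
  "('d::finite phase \<Rightarrow> complex) \<Rightarrow> real^'d \<Rightarrow> int^'d \<Rightarrow> complex" where
  "G_transform g x k = (LINT Y|lebesgue. cnj (K_kernel x k Y) * g Y)"

end

theory Submission
  imports Defs "HOL-Probability.Probability"
begin

text \<open>
  Fix a test function \<open>\<theta>\<close> and a point \<open>Y\<close>, and consider the function of one real variable
  \<open>u(\<lambda>) = \<Sum>\<^sub>n\<^sub>,\<^sub>m cnj (\<W>(n, m, \<lambda>, Y)) \<theta>(n, m, \<lambda>) |\<lambda>|\<^sup>d\<close>, called \<open>freq_sum\<close> below.  The transposed Fourier
  transform of \<open>\<theta>\<close> at \<open>(Y, s)\<close> is the ordinary one-dimensional transform of \<open>u\<close> at \<open>s\<close>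
  (\<open>fourier_transpose_eq_line_transform\<close>).  Pairing with \<open>g \<otimes> 1\<close> integrates it over all \<open>s\<close>, and on
  the line such an integral is \<open>\<pi>\<close> times the sum of the two one-sided limits of \<open>u\<close> at \<open>0\<close>
  (\<open>line_transform_inversion\<close>).  The theorem therefore rests on two facts: the transform of \<open>u\<close> is
  integrable in \<open>s\<close>, and the one-sided limits of \<open>u\<close> at \<open>0\<close> are integrals of the boundary values of
  \<open>\<theta>\<close> over the two orthants.

  Integrability.  The kernel \<open>\<W>\<close> is a product over the coordinates of a kernel which Gaussian integrals
  bring to the closed form \<open>exp (a b / 2)\<close> times a polynomial in \<open>a\<close> and \<open>b\<close> (\<open>W_kernel_prod\<close>).  Since
  \<open>\<lambda>\<close> only dilates \<open>a\<close> and \<open>b\<close>, the derivative of \<open>\<W>\<close> in \<open>\<lambda>\<close> is a combination of \<open>\<W>\<close> at shifted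
  indices.  Moving the shifts over to \<open>\<theta>\<close> by a rearrangement of the sum shows that \<open>u\<close> has as derivative
  the same sum formed with \<open>hat_D \<theta>\<close> (\<open>freq_sum_has_derivative\<close>).  The parity of \<open>\<W>\<close> under
  \<open>(n, m, \<lambda>) \<mapsto> (m, n, -\<lambda>)\<close> shows that the jump \<open>u(\<lambda>) - u(-\<lambda>)\<close> is \<open>\<lambda>\<close> times the sum formed with
  \<open>hat_Sigma0 \<theta>\<close>, hence tends to \<open>0\<close> (\<open>freq_sum_jump\<close>).  So one may integrate by parts twice across
  the origin, and the transform of \<open>u\<close> is \<open>O(1 / (1 + s\<^sup>2))\<close> uniformly in \<open>Y\<close>
  (\<open>line_transform_freq_sum_decay\<close>).

  Boundary values.  Group the pairs \<open>(n, m)\<close> by their difference \<open>k = m - n\<close> and by the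
  componentwise minimum \<open>i\<close>.  For fixed \<open>k\<close> the sum over \<open>i\<close> with the factor \<open>|\<lambda>|\<^sup>d\<close> is \<open>2\<^sup>-\<^sup>d\<close> times a
  Riemann sum of mesh \<open>2 |\<lambda>|\<close> over an orthant, because \<open>|\<lambda>| (n + m)\<close> grows by \<open>2 |\<lambda>|\<close> from one \<open>i\<close> to
  the next.  As \<open>\<lambda>\<close> tends to \<open>0\<close> from either side with \<open>\<lambda> (n + m)\<close> tending to \<open>x\<close>, the value of \<open>\<theta>\<close>
  tends to its value at \<open>(x, k)\<close>, and a Mehler--Heine limit turns the one-dimensional kernels into the
  Bessel-type kernel \<open>\<K>\<close> (\<open>kern1_tendsto_K_one\<close>).  The weights in the semi-norms supply a dominating
  function, integrable in \<open>x\<close> and summable in \<open>k\<close> (\<open>freq_sum_tendsto\<close>).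

  Fubini's theorem finally carries the integral over \<open>Y\<close> inside, where it produces \<open>\<G>g\<close>
  (\<open>boundary_limit_pairing\<close>).
\<close>

section \<open>Sums over countable index types\<close>

text \<open>Sums over a countable index type are turned into series along \<open>to_nat\<close>, which makes the
  convergence theorems for series available for them.\<close>

lemma infsum_as_suminf:
  fixes f :: "'i::countable \<Rightarrow> 'b::banach"
  assumes "(\<lambda>i. norm (f i)) summable_on UNIV"
  shows "summable (\<lambda>k. norm (if k \<in> range (to_nat :: 'i \<Rightarrow> nat) then f (from_nat k :: 'i) else 0))"
    and "infsum f UNIV = (\<Sum>k. if k \<in> range (to_nat :: 'i \<Rightarrow> nat) then f (from_nat k :: 'i) else 0)"
proof -
  define g where "g = (\<lambda>k. if k \<in> range (to_nat :: 'i \<Rightarrow> nat) then f (from_nat k :: 'i) else 0)"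
  have inj: "inj (to_nat :: 'i \<Rightarrow> nat)" by simp
  have "(\<lambda>k. norm (g k)) summable_on range (to_nat :: 'i \<Rightarrow> nat)"
    by (subst summable_on_reindex[OF inj]) (use assms in \<open>simp add: g_def o_def\<close>)
  hence gs: "(\<lambda>k. norm (g k)) summable_on UNIV"
    by (subst summable_on_cong_neutral[where T = "range (to_nat :: 'i \<Rightarrow> nat)" and g = "\<lambda>k. norm (g k)"])
       (auto simp: g_def)
  thus s: "summable (\<lambda>k. norm (g k))" by (rule summable_on_imp_summable)
  have "infsum f UNIV = infsum g (range (to_nat :: 'i \<Rightarrow> nat))"
    by (subst infsum_reindex[OF inj]) (simp add: g_def o_def)
  also have "\<dots> = infsum g UNIV" by (rule infsum_cong_neutral) (auto simp: g_def)
  also have "\<dots> = suminf g"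
    using gs by (metis has_sum_infsum has_sum_imp_sums abs_summable_summable sums_unique)
  finally show "infsum f UNIV = suminf g" .
qed

lemma borel_measurable_infsum_countable:
  fixes f :: "'i::countable \<Rightarrow> 'a \<Rightarrow> complex"
  assumes [measurable]: "\<And>i. f i \<in> borel_measurable M"
    and "\<And>x. x \<in> space M \<Longrightarrow> (\<lambda>i. norm (f i x)) summable_on UNIV"
  shows "(\<lambda>x. \<Sum>\<^sub>\<infinity>i. f i x) \<in> borel_measurable M"
proof -
  have "(\<lambda>x. \<Sum>k. if k \<in> range (to_nat :: 'i \<Rightarrow> nat) then f (from_nat k) x else 0) \<in> borel_measurable M"
    by measurable
  thus ?thesis
    by (rule measurable_cong[THEN iffD1, rotated]) (simp add: infsum_as_suminf(2)[OF assms(2)])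
qed

text \<open>Fubini's theorem for the product with a counting measure.  The bound concerns finite partial sums,
  so that it can be verified before the integrals are known to be summable.\<close>

lemma integral_infsum_swap:
  fixes f :: "'i::countable \<Rightarrow> 'a \<Rightarrow> complex"
  assumes int: "\<And>i. integrable M (f i)"
    and bound: "\<And>F. finite F \<Longrightarrow> (\<Sum>i\<in>F. \<integral>x. norm (f i x) \<partial>M) \<le> C"
    and abs: "\<And>x. x \<in> space M \<Longrightarrow> (\<lambda>i. norm (f i x)) summable_on UNIV"
  shows "integrable M (\<lambda>x. \<Sum>\<^sub>\<infinity>i. f i x)" (is ?th1)
    and "(\<integral>x. (\<Sum>\<^sub>\<infinity>i. f i x) \<partial>M) = (\<Sum>\<^sub>\<infinity>i. \<integral>x. f i x \<partial>M)" (is ?th2)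
    and "(\<lambda>i. norm (\<integral>x. f i x \<partial>M)) summable_on UNIV" (is ?th3)
proof -
  let ?R = "range (to_nat :: 'i \<Rightarrow> nat)"
  define g where "g = (\<lambda>k x. if k \<in> ?R then f (from_nat k) x else 0)"
  have s1: "(\<lambda>i. \<integral>x. norm (f i x) \<partial>M) summable_on UNIV"
    by (rule nonneg_bdd_above_summable_on) (use bound in \<open>auto intro!: bdd_aboveI[of _ C]\<close>)
  show s2: ?th3
    by (rule summable_on_comparison_test[OF s1]) auto
  have gi: "integrable M (g k)" for k
    by (cases "k \<in> ?R") (simp_all add: g_def int)
  have eq: "\<And>x. x \<in> space M \<Longrightarrow> (\<Sum>\<^sub>\<infinity>i. f i x) = (\<Sum>k. g k x)"
    using infsum_as_suminf(2)[OF abs] by (simp add: g_def)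
  have ga: "AE x in M. summable (\<lambda>k. norm (g k x))"
    using infsum_as_suminf(1)[OF abs] by (auto simp: g_def)
  have "summable (\<lambda>k. norm (if k \<in> ?R then \<integral>x. norm (f (from_nat k) x) \<partial>M else 0))"
    by (rule infsum_as_suminf(1)) (use s1 in simp)
  also have "(\<lambda>k. norm (if k \<in> ?R then \<integral>x. norm (f (from_nat k) x) \<partial>M else 0)) = (\<lambda>k. \<integral>x. norm (g k x) \<partial>M)"
    by (auto simp: g_def fun_eq_iff)
  finally have gs: "summable (\<lambda>k. \<integral>x. norm (g k x) \<partial>M)" .
  show ?th1
    using integrable_suminf[OF gi ga gs] by (subst Bochner_Integration.integrable_cong[OF refl eq]) auto
  have "(\<integral>x. (\<Sum>\<^sub>\<infinity>i. f i x) \<partial>M) = (\<Sum>k. \<integral>x. g k x \<partial>M)"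
    using integral_suminf[OF gi ga gs] by (subst Bochner_Integration.integral_cong[OF refl eq]) auto
  also have "\<dots> = (\<Sum>\<^sub>\<infinity>i. \<integral>x. f i x \<partial>M)"
    by (subst infsum_as_suminf(2)[OF s2]) (auto simp: g_def intro!: suminf_cong)
  finally show ?th2 .
qed

lemma integral_infsum_swap_dominated:
  fixes f :: "'i::countable \<Rightarrow> 'a \<Rightarrow> complex"
  assumes meas: "\<And>i. f i \<in> borel_measurable M"
    and B: "integrable M B"
    and abs: "\<And>x. x \<in> space M \<Longrightarrow> (\<lambda>i. norm (f i x)) summable_on UNIV"
    and le: "\<And>x. x \<in> space M \<Longrightarrow> (\<Sum>\<^sub>\<infinity>i. norm (f i x)) \<le> B x"
  shows "integrable M (\<lambda>x. \<Sum>\<^sub>\<infinity>i. f i x)" (is ?th1)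
    and "(\<integral>x. (\<Sum>\<^sub>\<infinity>i. f i x) \<partial>M) = (\<Sum>\<^sub>\<infinity>i. \<integral>x. f i x \<partial>M)"
    and "(\<lambda>i. norm (\<integral>x. f i x \<partial>M)) summable_on UNIV"
proof -
  have part: "(\<Sum>i\<in>F. norm (f i x)) \<le> B x" if "finite F" "x \<in> space M" for F x
    using finite_sum_le_infsum[OF abs[OF that(2)] that(1)] le[OF that(2)] by force
  have int: "integrable M (f i)" for i
    by (rule Bochner_Integration.integrable_bound[OF B meas]) (use part[of "{i}"] in force)
  have "(\<Sum>i\<in>F. \<integral>x. norm (f i x) \<partial>M) \<le> (\<integral>x. B x \<partial>M)" if "finite F" for F
    by (subst Bochner_Integration.integral_sum[symmetric])
       (auto intro!: integral_mono int B integrable_norm Bochner_Integration.integrable_sum part that)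
  from integral_infsum_swap[OF int this abs]
  show ?th1
    and "(\<integral>x. (\<Sum>\<^sub>\<infinity>i. f i x) \<partial>M) = (\<Sum>\<^sub>\<infinity>i. \<integral>x. f i x \<partial>M)"
    and "(\<lambda>i. norm (\<integral>x. f i x \<partial>M)) summable_on UNIV" by blast+
qed

text \<open>Tannery's theorem, for sums over a countable type and limits along any filter.\<close>

lemma tendsto_infsum_dominated:
  fixes f :: "'i::countable \<Rightarrow> 'a \<Rightarrow> complex"
  assumes lim: "\<And>i. ((\<lambda>x. f i x) \<longlongrightarrow> b i) F"
    and bound: "eventually (\<lambda>x. \<forall>i. norm (f i x) \<le> M i) F"
    and M: "M summable_on UNIV" and F: "F \<noteq> bot"
  shows "((\<lambda>x. \<Sum>\<^sub>\<infinity>i. f i x) \<longlongrightarrow> (\<Sum>\<^sub>\<infinity>i. b i)) F"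
proof -
  let ?R = "range (to_nat :: 'i \<Rightarrow> nat)"
  let ?e = "\<lambda>h k. if k \<in> ?R then h (from_nat k :: 'i) else 0"
  have b: "norm (b i) \<le> M i" for i
    by (rule tendsto_upperbound[OF tendsto_norm[OF lim] _ F]) (use bound in eventually_elim, auto)
  have M0: "M i \<ge> 0" for i using b[of i] norm_ge_zero order_trans by blast
  have Ms: "summable (?e M)"
    using infsum_as_suminf(1)[of M] M summable_on_iff_abs_summable_on_real[of M UNIV]
    by (intro summable_norm_cancel[of "?e M"]) blast
  have "((\<lambda>x. \<Sum>k. ?e (\<lambda>i. f i x) k) \<longlongrightarrow> (\<Sum>k. ?e b k)) F"
  proof (rule tannerys_theorem[THEN conjunct2, THEN conjunct2, OF _ _ Ms F])
    show "((\<lambda>n. ?e (\<lambda>i. f i n) k) \<longlongrightarrow> ?e b k) F" for k using lim by auto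
    have "eventually (\<lambda>x. \<forall>k. norm (?e (\<lambda>i. f i x) k) \<le> ?e M k) F"
      using bound by eventually_elim (auto simp: M0)
    thus "\<forall>\<^sub>F (k, n) in sequentially \<times>\<^sub>F F. norm (?e (\<lambda>i. f i n) k) \<le> ?e M k"
      unfolding eventually_prod_filter case_prod_conv
      by (intro exI[of _ "\<lambda>_. True"] exI[of _ "\<lambda>x. \<forall>k. norm (?e (\<lambda>i. f i x) k) \<le> ?e M k"]) simp
  qed
  moreover have "(\<Sum>k. ?e b k) = (\<Sum>\<^sub>\<infinity>i. b i)"
    by (subst infsum_as_suminf(2)) (auto intro: summable_on_comparison_test[OF M] b)
  moreover have "eventually (\<lambda>x. (\<Sum>k. ?e (\<lambda>i. f i x) k) = (\<Sum>\<^sub>\<infinity>i. f i x)) F"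
    using bound
    by eventually_elim (subst infsum_as_suminf(2), auto intro: summable_on_comparison_test[OF M])
  ultimately show ?thesis using Lim_transform_eventually by force
qed

lemma has_vector_derivative_infsum:
  fixes f :: "'i::countable \<Rightarrow> real \<Rightarrow> complex"
  assumes S: "open S" "convex S"
    and der: "\<And>i x. x \<in> S \<Longrightarrow> (f i has_vector_derivative f' i x) (at x)"
    and bf: "\<And>i x. x \<in> S \<Longrightarrow> norm (f i x) \<le> M i" and M: "M summable_on UNIV"
    and bf': "\<And>i x. x \<in> S \<Longrightarrow> norm (f' i x) \<le> M' i" and M': "M' summable_on UNIV"
    and x: "x \<in> S"
  shows "((\<lambda>x. \<Sum>\<^sub>\<infinity>i. f i x) has_vector_derivative (\<Sum>\<^sub>\<infinity>i. f' i x)) (at x)"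
proof -
  let ?R = "range (to_nat :: 'i \<Rightarrow> nat)"
  let ?e = "\<lambda>h k. if k \<in> ?R then h (from_nat k :: 'i) else 0"
  have nn: "(\<lambda>i. norm (M i)) summable_on UNIV" "(\<lambda>i. norm (M' i)) summable_on UNIV"
    using M M' summable_on_iff_abs_summable_on_real by blast+
  have sM': "summable (?e M')"
    by (rule summable_norm_cancel[OF infsum_as_suminf(1)[OF nn(2)]])
  have abs: "(\<lambda>i. norm (f i y)) summable_on UNIV" "(\<lambda>i. norm (f' i y)) summable_on UNIV" if "y \<in> S" for y
    using that by (auto intro: summable_on_comparison_test[OF M] summable_on_comparison_test[OF M'] bf bf')
  define g' where "g' = (\<lambda>y. \<Sum>k. ?e (\<lambda>i. f' i y) k)"
  have ul: "uniform_limit S (\<lambda>n y. \<Sum>k<n. ?e (\<lambda>i. f' i y) k) g' sequentially"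
    unfolding g'_def by (rule Weierstrass_m_test[OF _ sM']) (auto intro: bf' order_trans[OF norm_ge_zero bf'[OF x]])
  have "\<exists>g. \<forall>y\<in>S. (\<lambda>k. ?e (\<lambda>i. f i y) k) sums (g y) \<and> (g has_derivative (\<lambda>h. h *\<^sub>R g' y)) (at y within S)"
  proof (rule has_derivative_series[OF S(2) _ _ x])
    show "((\<lambda>y. ?e (\<lambda>i. f i y) n) has_derivative (\<lambda>h. h *\<^sub>R ?e (\<lambda>i. f' i y) n)) (at y within S)" if "y \<in> S" for n y
      using der[OF that, of "from_nat n"]
      by (auto simp: has_vector_derivative_def intro: has_derivative_at_withinI)
    show "(\<lambda>n. ?e (\<lambda>i. f i x) n) sums (\<Sum>k. ?e (\<lambda>i. f i x) k)"
      by (rule summable_sums[OF summable_norm_cancel[OF infsum_as_suminf(1)[OF abs(1)[OF x]]]])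
    fix e :: real assume e: "e > 0"
    from ul e have "eventually (\<lambda>n. \<forall>y\<in>S. dist (\<Sum>k<n. ?e (\<lambda>i. f' i y) k) (g' y) < e) sequentially"
      unfolding uniform_limit_iff by blast
    thus "\<forall>\<^sub>F n in sequentially. \<forall>y\<in>S. \<forall>h. norm ((\<Sum>i<n. h *\<^sub>R ?e (\<lambda>j. f' j y) i) - h *\<^sub>R g' y) \<le> e * norm h"
    proof eventually_elim
      case (elim n)
      show ?case
      proof (intro ballI allI)
        fix y h assume "y \<in> S"
        have "norm ((\<Sum>i<n. h *\<^sub>R ?e (\<lambda>j. f' j y) i) - h *\<^sub>R g' y)
            = norm h * norm ((\<Sum>i<n. ?e (\<lambda>j. f' j y) i) - g' y)"
          by (simp only: scaleR_right.sum[symmetric] scaleR_diff_right[symmetric] norm_scaleR real_norm_def)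
        also have "\<dots> \<le> norm h * e"
          using elim \<open>y \<in> S\<close> by (intro mult_left_mono) (auto simp: dist_norm less_imp_le)
        finally show "norm ((\<Sum>i<n. h *\<^sub>R ?e (\<lambda>j. f' j y) i) - h *\<^sub>R g' y) \<le> e * norm h"
          by (simp add: mult.commute)
      qed
    qed
  qed
  then obtain g where g: "\<And>y. y \<in> S \<Longrightarrow> (\<lambda>k. ?e (\<lambda>i. f i y) k) sums (g y)"
    "(g has_derivative (\<lambda>h. h *\<^sub>R g' x)) (at x within S)" using x by blast
  have "(\<Sum>\<^sub>\<infinity>i. f i y) = g y" if "y \<in> S" for y
    using infsum_as_suminf(2)[OF abs(1)[OF that]] sums_unique[OF g(1)[OF that]] by simp
  hence "((\<lambda>y. \<Sum>\<^sub>\<infinity>i. f i y) has_derivative (\<lambda>h. h *\<^sub>R g' x)) (at x within S)"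
    by (intro has_derivative_transform[OF x _ g(2)]) auto
  moreover have "g' x = (\<Sum>\<^sub>\<infinity>i. f' i x)"
    using infsum_as_suminf(2)[OF abs(2)[OF x]] by (simp add: g'_def)
  ultimately show ?thesis
    using at_within_open[OF x S(1)] by (simp add: has_vector_derivative_def)
qed

section \<open>Products over the coordinates\<close>

lemma bij_vec_nth: "bij_betw (vec_nth :: 'a^'d \<Rightarrow> 'd \<Rightarrow> 'a) UNIV (UNIV \<rightarrow>\<^sub>E UNIV)"
  by (rule bij_betwI[of _ _ _ vec_lambda]) (auto simp: vec_eq_iff)

lemma infsum_vec_prod:
  fixes f :: "'d::finite \<Rightarrow> 'a::countable \<Rightarrow> real"
  assumes nn: "\<And>j a. f j a \<ge> 0" and s: "\<And>j. f j summable_on UNIV"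
  shows "(\<lambda>n::'a^'d. \<Prod>j\<in>UNIV. f j (n $ j)) summable_on UNIV" (is ?th1)
    and "(\<Sum>\<^sub>\<infinity>n::'a^'d. \<Prod>j\<in>UNIV. f j (n $ j)) = (\<Prod>j\<in>UNIV. infsum (f j) UNIV)" (is ?th2)
proof -
  have s': "(\<lambda>a. norm (f j a)) summable_on UNIV" for j
    using s[of j] nn by simp
  have "Infinite_Set_Sum.abs_summable_on (\<lambda>g. \<Prod>j\<in>UNIV. f j (g j)) (UNIV \<rightarrow>\<^sub>E UNIV)"
    by (rule abs_summable_on_prod_PiE) (auto intro: abs_summable_equivalent[THEN iffD1] s')
  from abs_summable_equivalent[THEN iffD2, OF this]
  have "(\<lambda>g. \<Prod>j\<in>UNIV. f j (g j)) summable_on (UNIV \<rightarrow>\<^sub>E UNIV)"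
    by (rule abs_summable_summable)
  thus ?th1
    using summable_on_reindex_bij_betw[OF bij_vec_nth, of "\<lambda>g. \<Prod>j\<in>UNIV. f j (g j)"] by simp
  have "(\<Sum>\<^sub>\<infinity>n::'a^'d. \<Prod>j\<in>UNIV. f j (n $ j)) = infsum (\<lambda>g. \<Prod>j\<in>UNIV. f j (g j)) (UNIV \<rightarrow>\<^sub>E UNIV)"
    using infsum_reindex_bij_betw[OF bij_vec_nth, of "\<lambda>g. \<Prod>j\<in>UNIV. f j (g j)"] by simp
  also have "\<dots> = (\<Prod>j\<in>UNIV. infsum (f j) UNIV)"
    by (intro infsum_prod_PiE_abs finite s')
  finally show ?th2 .
qed

text \<open>Lebesgue measure on \<open>real^'d\<close> is the image of a product measure indexed by the standard basis;
  identifying basis vectors with coordinates turns this into Fubini's theorem for products.\<close>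

lemma lborel_vec_prod:
  fixes f :: "'d::finite \<Rightarrow> real \<Rightarrow> 'b::{real_normed_field,banach,second_countable_topology}"
  assumes int: "\<And>j. integrable lborel (f j)"
  shows "integrable lborel (\<lambda>x::real^'d. \<Prod>j\<in>UNIV. f j (x $ j))" (is ?th1)
    and "(\<integral>x. (\<Prod>j\<in>UNIV. f j (x $ j)) \<partial>(lborel :: (real^'d) measure)) = (\<Prod>j\<in>UNIV. \<integral>t. f j t \<partial>lborel)" (is ?th2)
proof -
  interpret P: product_sigma_finite "\<lambda>b::real^'d. (lborel :: real measure)" ..
  have [measurable]: "f j \<in> borel_measurable borel" for j using int[of j] by (simp add: borel_measurable_integrable)
  let ?ax = "\<lambda>j::'d. axis j (1::real)"
  have B: "Basis = range ?ax" by (auto simp: Basis_vec_def)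
  have inj: "inj ?ax" by (auto simp: inj_on_def axis_eq_axis)
  define F where "F b = f (inv ?ax b)" for b
  have F: "F (?ax j) = f j" for j by (simp add: F_def inv_f_f[OF inj])
  have Fi: "b \<in> Basis \<Longrightarrow> integrable lborel (F b)" for b by (simp add: F_def int)
  have co: "(\<Sum>b\<in>Basis. g b *\<^sub>R b) $ j = g (?ax j)" for g :: "real^'d \<Rightarrow> real" and j
  proof -
    have "(\<Sum>b\<in>Basis. g b *\<^sub>R b) $ j = (\<Sum>i\<in>UNIV. (g (?ax i) *\<^sub>R ?ax i) $ j)"
      unfolding B by (subst sum.reindex[OF inj]) simp
    also have "\<dots> = (\<Sum>i\<in>UNIV. if i = j then g (?ax i) else 0)"
      by (rule sum.cong) (auto simp: axis_def)
    finally show ?thesis by simp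
  qed
  have pr: "(\<Prod>j\<in>UNIV. f j ((\<Sum>b\<in>Basis. g b *\<^sub>R b) $ j)) = (\<Prod>b\<in>Basis. F b (g b))" for g
    unfolding co unfolding B by (subst prod.reindex[OF inj]) (simp add: F)
  have eq: "(lborel :: (real^'d) measure) = distr (\<Pi>\<^sub>M b\<in>Basis. lborel) borel (\<lambda>g. \<Sum>b\<in>Basis. g b *\<^sub>R b)"
    by (rule lborel_eq)
  show ?th1
    by (subst eq, subst integrable_distr_eq) (simp_all only: pr, auto intro!: P.product_integrable_prod Fi)
  have "(\<integral>x. (\<Prod>j\<in>UNIV. f j (x $ j)) \<partial>(lborel :: (real^'d) measure)) = (\<Prod>b\<in>Basis. \<integral>t. F b t \<partial>lborel)"
    by (subst eq, subst integral_distr) (simp_all only: pr, auto intro!: P.product_integral_prod Fi)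
  also have "\<dots> = (\<Prod>j\<in>UNIV. \<integral>t. f j t \<partial>lborel)"
    unfolding B by (subst prod.reindex[OF inj]) (simp add: F)
  finally show ?th2 .
qed

section \<open>Hermite functions\<close>

text \<open>The physicists' Hermite polynomials: the recursion is that of the operator \<open>x - d/dx\<close> applied to
  a polynomial times \<open>exp (- x\<^sup>2 / 2)\<close>.\<close>

fun hermite_poly :: "nat \<Rightarrow> real poly" where
  "hermite_poly 0 = 1"
| "hermite_poly (Suc n) = [:0, 2:] * hermite_poly n - pderiv (hermite_poly n)"

definition herm_unnorm :: "nat \<Rightarrow> real \<Rightarrow> real" where
  "herm_unnorm n x = pi powr (-1/4) * (poly (hermite_poly n) x * exp (- x\<^sup>2 / 2))"

definition herm :: "nat \<Rightarrow> real \<Rightarrow> real" where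
  "herm n x = herm_unnorm n x / sqrt (2 ^ n * fact n)"

lemma pderiv_hermite_poly: "pderiv (hermite_poly n) = smult (2 * of_nat n) (hermite_poly (n - 1))"
proof (induction n)
  case (Suc n)
  show ?case
  proof (cases n)
    case (Suc k)
    have "pderiv (hermite_poly (Suc n)) = smult 2 (hermite_poly n) + [:0, 2:] * pderiv (hermite_poly n)
        - pderiv (pderiv (hermite_poly n))"
      by (simp add: pderiv_diff pderiv_mult pderiv_pCons pderiv_smult algebra_simps)
    also have "\<dots> = smult 2 (hermite_poly n) + smult (2 * of_nat n) (hermite_poly n)"
      unfolding Suc.IH pderiv_smult using Suc by (simp add: algebra_simps smult_diff_right)
    finally show ?thesis by (simp add: smult_add_left[symmetric] algebra_simps)
  qed (simp add: pderiv_pCons pderiv_diff pderiv_mult)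
qed simp

lemma herm_unnorm_deriv:
  "(herm_unnorm n has_real_derivative (x * herm_unnorm n x - herm_unnorm (Suc n) x)) (at x)"
  unfolding herm_unnorm_def
  by (rule derivative_eq_intros poly_DERIV refl | simp)+ (simp add: algebra_simps)

lemma has_derivative_prod_coords:
  fixes g :: "'d::finite \<Rightarrow> real \<Rightarrow> real"
  assumes "\<And>j. (g j has_real_derivative g' j) (at (x $ j))"
  shows "((\<lambda>x::real^'d. \<Prod>j\<in>UNIV. g j (x $ j)) has_derivative
      (\<lambda>h. \<Sum>i\<in>UNIV. g' i * h $ i * (\<Prod>j\<in>UNIV - {i}. g j (x $ j)))) (at x)"
proof -
  have "((\<lambda>x::real^'d. g j (x $ j)) has_derivative (\<lambda>h. g' j * h $ j)) (at x)" for j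
    using has_derivative_compose[OF bounded_linear.has_derivative[OF bounded_linear_vec_nth has_derivative_ident], of "g j" "(*) (g' j)"]
      assms[of j] by (simp add: has_field_derivative_def)
  thus ?thesis
    by (intro has_derivative_prod[where f = "\<lambda>j x. g j (x $ j)" and f' = "\<lambda>j h. g' j * h $ j"])
qed

text \<open>On a product of one-variable Hermite functions the creation operator in direction \<open>j\<close> raises the
  degree of the \<open>j\<close>-th factor only.  This is why \<open>hermite\<close> factorises.\<close>

lemma creation_prod:
  "creation j (\<lambda>x::real^'d::finite. \<Prod>i\<in>UNIV. herm_unnorm (k i) (x $ i))
    = (\<lambda>x. \<Prod>i\<in>UNIV. herm_unnorm ((k(j := Suc (k j))) i) (x $ i))"
proof
  fix x :: "real^'d"
  let ?R = "\<Prod>i\<in>UNIV - {j}. herm_unnorm (k i) (x $ i)"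
  have "dir_deriv (axis j 1) (\<lambda>x::real^'d. \<Prod>i\<in>UNIV. herm_unnorm (k i) (x $ i)) x
     = (\<Sum>i\<in>UNIV. (x $ i * herm_unnorm (k i) (x $ i) - herm_unnorm (Suc (k i)) (x $ i)) * axis j 1 $ i
        * (\<Prod>l\<in>UNIV - {i}. herm_unnorm (k l) (x $ l)))"
    unfolding dir_deriv_def
    by (subst frechet_derivative_at[OF has_derivative_prod_coords[OF herm_unnorm_deriv], symmetric]) simp
  also have "\<dots> = (\<Sum>i\<in>UNIV. if i = j then (x $ i * herm_unnorm (k i) (x $ i) - herm_unnorm (Suc (k i)) (x $ i))
        * (\<Prod>l\<in>UNIV - {i}. herm_unnorm (k l) (x $ l)) else 0)"
    by (rule sum.cong) (auto simp: axis_def)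
  also have "\<dots> = (x $ j * herm_unnorm (k j) (x $ j) - herm_unnorm (Suc (k j)) (x $ j)) * ?R" by simp
  finally have d: "dir_deriv (axis j 1) (\<lambda>x::real^'d. \<Prod>i\<in>UNIV. herm_unnorm (k i) (x $ i)) x = \<dots>" .
  have p: "(\<Prod>i\<in>UNIV. herm_unnorm (k i) (x $ i)) = herm_unnorm (k j) (x $ j) * ?R"
    by (rule prod.remove) auto
  have "(\<Prod>i\<in>UNIV. herm_unnorm ((k(j := Suc (k j))) i) (x $ i))
     = herm_unnorm (Suc (k j)) (x $ j) * (\<Prod>i\<in>UNIV - {j}. herm_unnorm ((k(j := Suc (k j))) i) (x $ i))"
    by (subst prod.remove[of _ j]) auto
  also have "(\<Prod>i\<in>UNIV - {j}. herm_unnorm ((k(j := Suc (k j))) i) (x $ i)) = ?R"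
    by (rule prod.cong) auto
  finally show "creation j (\<lambda>x::real^'d::finite. \<Prod>i\<in>UNIV. herm_unnorm (k i) (x $ i)) x
    = (\<Prod>i\<in>UNIV. herm_unnorm ((k(j := Suc (k j))) i) (x $ i))"
    unfolding creation_def d p by (simp add: algebra_simps)
qed

lemma creation_pow_prod:
  "(creation j ^^ r) (\<lambda>x::real^'d::finite. \<Prod>i\<in>UNIV. herm_unnorm (k i) (x $ i))
    = (\<lambda>x. \<Prod>i\<in>UNIV. herm_unnorm ((k(j := k j + r)) i) (x $ i))"
proof (induction r)
  case (Suc r)
  show ?case
    by (simp only: funpow.simps o_apply Suc.IH creation_prod) (simp add: fun_upd_def cong: if_cong)
qed simp

lemma hermite0_prod: "hermite0 = (\<lambda>x::real^'d::finite. \<Prod>i\<in>UNIV. herm_unnorm 0 (x $ i))"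
proof
  fix x :: "real^'d"
  have "(pi powr (-1/4)) ^ CARD('d) = pi powr (- (real CARD('d) / 4))"
    by (simp add: powr_realpow[symmetric] powr_powr)
  moreover have "(\<Prod>i\<in>(UNIV::'d set). exp (- (x $ i)\<^sup>2 / 2)) = exp (- (norm x)\<^sup>2 / 2)"
  proof -
    have "(norm x)\<^sup>2 = (\<Sum>i\<in>UNIV. (x $ i)\<^sup>2)"
      by (simp add: norm_vec_def L2_set_def sum_nonneg)
    thus ?thesis by (simp add: exp_sum[symmetric] sum_negf sum_divide_distrib)
  qed
  ultimately show "hermite0 x = (\<Prod>i\<in>UNIV. herm_unnorm 0 (x $ i))"
    unfolding hermite0_def herm_unnorm_def by (simp add: prod.distrib)
qed

text \<open>The creation operators do not commute on functions which fail to be smooth, so the fold defining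
  \<open>hermite\<close> cannot be unfolded by commutativity.  Its graph is enough: every order of application leads to the
  same product.\<close>

lemma hermite_fold_graph:
  fixes n :: "nat^'d::finite"
  assumes "fold_graph (\<lambda>j f. (creation j ^^ (n $ j)) f) hermite0 A y"
  shows "y = (\<lambda>x. \<Prod>i\<in>UNIV. herm_unnorm (if i \<in> A then n $ i else 0) (x $ i))"
  using assms
proof (induction rule: fold_graph.induct)
  case (insertI j A y)
  have "(\<lambda>i. if i \<in> A then n $ i else 0)(j := (if j \<in> A then n $ j else 0) + n $ j)
     = (\<lambda>i. if i \<in> insert j A then n $ i else 0)"
    using insertI.hyps by (auto simp: fun_eq_iff)
  thus ?case unfolding insertI.IH creation_pow_prod by simp
qed (simp add: hermite0_prod)

lemma sqrt_prod: "sqrt (\<Prod>i\<in>A. f i) = (\<Prod>i\<in>A. sqrt (f i))"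
  by (induction A rule: infinite_finite_induct) (simp_all add: real_sqrt_mult)

lemma hermite_prod: "hermite n x = (\<Prod>j\<in>UNIV. herm (n $ j) (x $ j))" for x :: "real^'d::finite"
proof -
  let ?f = "\<lambda>j f. (creation j ^^ (n $ j)) f"
  let ?y = "\<lambda>x::real^'d. \<Prod>i\<in>UNIV. herm_unnorm (n $ i) (x $ i)"
  from finite_imp_fold_graph[of "UNIV :: 'd set" ?f hermite0]
  obtain y where y: "fold_graph ?f hermite0 (UNIV :: 'd set) y" by (auto simp del: fold_graph.simps)
  hence f: "fold_graph ?f hermite0 (UNIV :: 'd set) ?y" using hermite_fold_graph[OF y] by simp
  have "Finite_Set.fold ?f hermite0 (UNIV :: 'd set) = ?y"
    unfolding Finite_Set.fold_def if_P[OF finite[of "UNIV :: 'd set"]]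
    by (rule the_equality[of "fold_graph ?f hermite0 (UNIV :: 'd set)" ?y, OF f]) (use hermite_fold_graph[where A = "UNIV :: 'd set" and n = n] in simp)
  hence "hermite n x = (\<Prod>i\<in>UNIV. herm_unnorm (n $ i) (x $ i))
      / sqrt (2 ^ (\<Sum>j\<in>UNIV. n $ j) * (\<Prod>j\<in>UNIV. fact (n $ j)))"
    by (simp add: hermite_def)
  also have "sqrt (2 ^ (\<Sum>j\<in>UNIV. n $ j) * (\<Prod>j\<in>UNIV. fact (n $ j)))
     = (\<Prod>j\<in>UNIV. sqrt (2 ^ (n $ j) * fact (n $ j)))"
    by (simp add: power_sum prod.distrib[symmetric] sqrt_prod)
  finally show ?thesis by (simp add: herm_def prod_dividef)
qed

section \<open>Gaussian integrals\<close>

lemma integrable_poly_gauss: "integrable lborel (\<lambda>z::real. poly P z * exp (- z\<^sup>2))"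
proof -
  have m: "integrable lborel (\<lambda>z::real. z ^ k * exp (- z\<^sup>2))" for k
  proof -
    have "integrable lborel (\<lambda>x. std_normal_density (0 + sqrt 2 * x) * (0 + sqrt 2 * x) ^ k)"
      using integrable_std_normal_moment[of k]
      by (rule lborel_integrable_real_affine) simp
    hence "integrable lborel (\<lambda>x. (sqrt (2 * pi) / sqrt 2 ^ k) * (std_normal_density (0 + sqrt 2 * x) * (0 + sqrt 2 * x) ^ k))"
      by (rule integrable_mult_right)
    also have "(\<lambda>x. (sqrt (2 * pi) / sqrt 2 ^ k) * (std_normal_density (0 + sqrt 2 * x) * (0 + sqrt 2 * x) ^ k))
        = (\<lambda>z. z ^ k * exp (- z\<^sup>2))"
      by (auto simp: std_normal_density_def power_mult_distrib fun_eq_iff field_simps)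
    finally show ?thesis .
  qed
  have "(\<lambda>z. poly P z * exp (- z\<^sup>2)) = (\<lambda>z. \<Sum>k\<le>degree P. coeff P k * (z ^ k * exp (- z\<^sup>2)))"
    by (auto simp: poly_altdef sum_distrib_right mult.assoc)
  thus ?thesis by (simp only:) (intro Bochner_Integration.integrable_sum integrable_mult_right m)
qed

lemma integrable_poly_gauss_exp:
  "integrable lborel (\<lambda>z::real. exp (2 * \<i> * of_real (q * z)) * of_real (poly P z * exp (- z\<^sup>2)) :: complex)"
  by (rule Bochner_Integration.integrable_bound[OF integrable_poly_gauss[of P]])
     (auto simp: norm_mult abs_mult borel_measurable_continuous_onI intro!: borel_measurable_times borel_measurable_continuous_onI continuous_intros)

lemma poly_gauss_tendsto: "((\<lambda>z::real. poly P z * exp (- z\<^sup>2)) \<longlongrightarrow> 0) at_infinity"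
proof -
  have fa: "filterlim (abs :: real \<Rightarrow> real) at_top at_infinity"
  proof -
    have "(abs :: real \<Rightarrow> real) = norm" by (simp add: fun_eq_iff)
    thus ?thesis by (simp only: filterlim_norm_at_top)
  qed
  have m: "((\<lambda>z::real. z ^ k * exp (- z\<^sup>2)) \<longlongrightarrow> 0) at_infinity" for k
  proof (rule Lim_null_comparison)
    have "((\<lambda>x. exp 1 * (\<bar>x\<bar> ^ k / exp \<bar>x\<bar>)) \<longlongrightarrow> exp 1 * 0) (at_infinity :: real filter)"
      by (intro tendsto_mult tendsto_const filterlim_compose[OF tendsto_power_div_exp_0 fa])
    thus "((\<lambda>x. exp 1 * (\<bar>x\<bar> ^ k / exp \<bar>x\<bar>)) \<longlongrightarrow> 0) (at_infinity :: real filter)" by simp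
    have "norm (x ^ k * exp (- x\<^sup>2)) \<le> exp 1 * (\<bar>x\<bar> ^ k / exp \<bar>x\<bar>)" for x :: real
    proof -
      have "0 \<le> (\<bar>x\<bar> - 1/2)\<^sup>2" by simp
      hence "\<bar>x\<bar> - 1 \<le> x\<^sup>2" by (simp add: power2_eq_square algebra_simps)
      hence "exp (- x\<^sup>2) \<le> exp (1 - \<bar>x\<bar>)" by simp
      hence "\<bar>x\<bar> ^ k * exp (- x\<^sup>2) \<le> \<bar>x\<bar> ^ k * exp (1 - \<bar>x\<bar>)" by (rule mult_left_mono) simp
      thus ?thesis by (simp add: abs_mult power_abs exp_diff field_simps)
    qed
    thus "\<forall>\<^sub>F x in at_infinity. norm (x ^ k * exp (- x\<^sup>2)) \<le> exp 1 * (\<bar>x\<bar> ^ k / exp \<bar>x\<bar>)"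
      by simp
  qed
  have "(\<lambda>z. poly P z * exp (- z\<^sup>2)) = (\<lambda>z. \<Sum>k\<le>degree P. coeff P k * (z ^ k * exp (- z\<^sup>2)))"
    by (auto simp: poly_altdef sum_distrib_right mult.assoc)
  moreover have "((\<lambda>z. \<Sum>k\<le>degree P. coeff P k * (z ^ k * exp (- z\<^sup>2))) \<longlongrightarrow> (\<Sum>k\<le>degree P. coeff P k * 0)) at_infinity"
    by (intro tendsto_intros m)
  ultimately show ?thesis by simp
qed

definition gauss_integral :: "real \<Rightarrow> real poly \<Rightarrow> complex" where
  "gauss_integral q P = (LINT z|lborel. exp (2 * \<i> * of_real (q * z)) * of_real (poly P z * exp (- z\<^sup>2)))"

lemma gauss_integral_linear:
  "gauss_integral q (P + R) = gauss_integral q P + gauss_integral q R"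
  "gauss_integral q (smult c P) = of_real c * gauss_integral q P"
  "gauss_integral q (P - R) = gauss_integral q P - gauss_integral q R" (is ?th3)
  "gauss_integral q (- P) = - gauss_integral q P"
proof -
  show a: "gauss_integral q (P + R) = gauss_integral q P + gauss_integral q R" for P R
    unfolding gauss_integral_def
    by (subst Bochner_Integration.integral_add[symmetric, OF integrable_poly_gauss_exp integrable_poly_gauss_exp])
       (simp add: algebra_simps)
  show s: "gauss_integral q (smult c P) = of_real c * gauss_integral q P" for c P
    unfolding gauss_integral_def
    by (subst integral_mult_right_zero[symmetric]) (simp add: algebra_simps)
  show u: "gauss_integral q (- P) = - gauss_integral q P" for P
    using s[of "-1" P] by simp
  show ?th3
    using a[of P "- R"] u[of R] by simp
qed

text \<open>The integral over the line of the derivative of \<open>exp (2 i q z) P(z) exp (- z\<^sup>2)\<close> vanishes.\<close>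

lemma gauss_integral_by_parts:
  "gauss_integral q (pderiv P - [:0, 2:] * P) + 2 * \<i> * of_real q * gauss_integral q P = 0"
proof -
  let ?F = "\<lambda>z::real. exp (2 * \<i> * of_real (q * z)) * of_real (poly P z * exp (- z\<^sup>2)) :: complex"
  let ?f = "\<lambda>z::real. exp (2 * \<i> * of_real (q * z)) * of_real (poly (pderiv P - [:0, 2:] * P) z * exp (- z\<^sup>2))
     + 2 * \<i> * of_real q * ?F z :: complex"
  have i1: "integrable lborel ?f"
    by (intro Bochner_Integration.integrable_add integrable_mult_right integrable_poly_gauss_exp)
  have d: "(?F has_vector_derivative ?f z) (at z)" for z
  proof -
    have 1: "((\<lambda>z. exp (2 * \<i> * of_real (q * z)) :: complex) has_vector_derivative
        (2 * \<i> * of_real q * exp (2 * \<i> * of_real (q * z)))) (at z)"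
      by (rule has_vector_derivative_real_field derivative_eq_intros refl | simp)+
    have 2: "((\<lambda>z. poly P z * exp (- z\<^sup>2)) has_real_derivative
        (poly (pderiv P - [:0, 2:] * P) z * exp (- z\<^sup>2))) (at z)"
      by (rule derivative_eq_intros poly_DERIV refl | simp)+ (simp add: algebra_simps)
    have 3: "((\<lambda>z. of_real (poly P z * exp (- z\<^sup>2)) :: complex) has_vector_derivative
        of_real (poly (pderiv P - [:0, 2:] * P) z * exp (- z\<^sup>2))) (at z)"
      by (rule has_vector_derivative_of_real) (use 2 in \<open>simp add: has_real_derivative_iff_has_vector_derivative\<close>)
    show ?thesis
      using has_vector_derivative_mult[OF 1 3] by (simp add: algebra_simps)
  qed
  have l: "(?F \<longlongrightarrow> 0) at_infinity"
    by (rule Lim_null_comparison[OF _ tendsto_norm_zero[OF poly_gauss_tendsto[of P]]])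
       (auto simp: norm_mult abs_mult)
  have "interval_lebesgue_integral lborel (-\<infinity>) \<infinity> ?f = 0 - 0"
  proof (rule interval_integral_FTC_integrable)
    show "isCont ?f x" for x by (intro continuous_intros)
    show "((?F \<circ> real_of_ereal) \<longlongrightarrow> 0) (at_right (-\<infinity>))"
      using filterlim_mono[OF l order_refl at_bot_le_at_infinity]
      by (simp only: ereal_tendsto_simps)
    show "((?F \<circ> real_of_ereal) \<longlongrightarrow> 0) (at_left \<infinity>)"
      using filterlim_mono[OF l order_refl at_top_le_at_infinity]
      by (simp only: ereal_tendsto_simps)
  qed (use i1 d in \<open>auto simp: set_integrable_def\<close>)
  hence "integral\<^sup>L lborel ?f = 0"
    by (simp add: interval_lebesgue_integral_def set_lebesgue_integral_def)
  thus ?thesis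
    unfolding gauss_integral_def
    by (subst (asm) Bochner_Integration.integral_add[OF integrable_poly_gauss_exp integrable_mult_right[OF integrable_poly_gauss_exp]])
       (simp only: integral_mult_right_zero)
qed

text \<open>This is the characteristic function of the standard normal distribution after the substitution
  \<open>x = sqrt 2 z\<close>.\<close>

lemma gauss_integral_1: "gauss_integral q 1 = of_real (sqrt pi * exp (- q\<^sup>2))"
proof -
  let ?t = "sqrt 2 * q"
  have "of_real (exp (- q\<^sup>2)) = char std_normal_distribution ?t"
    by (simp add: char_std_normal_distribution power_mult_distrib)
  also have "\<dots> = (LINT x|lborel. of_real (std_normal_density x) * iexp (?t * x))"
    unfolding char_def by (subst integral_density) (auto simp: scaleR_conv_of_real normal_density_nonneg)
  also have "\<dots> = \<bar>sqrt 2\<bar> *\<^sub>R (LINT z|lborel. of_real (std_normal_density (0 + sqrt 2 * z)) * iexp (?t * (0 + sqrt 2 * z)))"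
    by (rule lborel_integral_real_affine) simp
  also have "(LINT z|lborel. of_real (std_normal_density (0 + sqrt 2 * z)) * iexp (?t * (0 + sqrt 2 * z)))
     = (LINT z|lborel. of_real (1 / sqrt (2 * pi)) * (exp (2 * \<i> * of_real (q * z)) * of_real (poly 1 z * exp (- z\<^sup>2))))"
  proof (rule Bochner_Integration.integral_cong[OF refl])
    fix z :: real
    have "?t * (sqrt 2 * z) = 2 * q * z"
      by (metis mult.assoc mult.commute mult.left_commute real_sqrt_mult_self abs_numeral)
    thus "of_real (std_normal_density (0 + sqrt 2 * z)) * iexp (?t * (0 + sqrt 2 * z))
       = of_real (1 / sqrt (2 * pi)) * (exp (2 * \<i> * of_real (q * z)) * of_real (poly 1 z * exp (- z\<^sup>2)))"
      by (simp add: std_normal_density_def power_mult_distrib algebra_simps)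
  qed
  also have "\<bar>sqrt 2\<bar> *\<^sub>R \<dots> = of_real (1 / sqrt pi) * gauss_integral q 1"
    unfolding gauss_integral_def
    by (subst integral_mult_right_zero) (simp add: real_sqrt_mult scaleR_conv_of_real)
  finally show ?thesis by (simp add: field_simps)
qed

section \<open>The one-dimensional kernel in closed form\<close>

text \<open>The polynomial part of the product of two translated Hermite functions, see \<open>herm_pair\<close>.\<close>

definition herm_prod :: "nat \<Rightarrow> nat \<Rightarrow> real \<Rightarrow> real poly" where
  "herm_prod n m p = pcompose (hermite_poly n) [:p, 1:] * pcompose (hermite_poly m) [:- p, 1:]"

text \<open>Raising an index replaces \<open>H\<close> by \<open>2 x H - H'\<close>.  The derivative is integrated by parts; it then
  falls on the exponentials, which together with the translation gives the first term, and on the other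
  Hermite polynomial, whose index it lowers.\<close>

lemma gauss_integral_herm_rec:
  "gauss_integral q (herm_prod (Suc n) m p)
     = of_real 2 * (of_real p + \<i> * of_real q) * gauss_integral q (herm_prod n m p)
       + of_nat (2 * m) * gauss_integral q (herm_prod n (m - 1) p)" (is ?th1)
  "gauss_integral q (herm_prod n (Suc m) p)
     = of_real 2 * (- of_real p + \<i> * of_real q) * gauss_integral q (herm_prod n m p)
       + of_nat (2 * n) * gauss_integral q (herm_prod (n - 1) m p)" (is ?th2)
proof -
  let ?P = "herm_prod n m p"
  have dP: "pderiv (pcompose (hermite_poly k) [:c, 1:]) = smult (2 * of_nat k) (pcompose (hermite_poly (k - 1)) [:c, 1:])" for k c
    by (simp add: pderiv_pcompose pderiv_hermite_poly pcompose_smult pderiv_pCons)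
  have S: "pcompose (hermite_poly (Suc k)) [:c, 1:] = [:2 * c, 2:] * pcompose (hermite_poly k) [:c, 1:]
      - pderiv (pcompose (hermite_poly k) [:c, 1:])" for k c
    by (simp add: pcompose_diff pcompose_mult pcompose_pCons pderiv_pcompose pderiv_pCons del: mult_pCons_left)
  have lin: "[:2 * c, 2:] = [:0, 2:] + [:2 * c:]" for c :: real by simp
  have "herm_prod (Suc n) m p = smult (2 * p) ?P - (pderiv ?P - [:0,2:] * ?P) + smult (2 * of_nat m) (herm_prod n (m - 1) p)"
    unfolding herm_prod_def S pderiv_mult dP lin by (simp add: algebra_simps)
  thus ?th1
    using gauss_integral_by_parts[of q ?P]
    by (simp only: gauss_integral_linear) (simp add: algebra_simps eq_neg_iff_add_eq_0)
  have "herm_prod n (Suc m) p = smult (- 2 * p) ?P - (pderiv ?P - [:0,2:] * ?P) + smult (2 * of_nat n) (herm_prod (n - 1) m p)"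
    unfolding herm_prod_def S pderiv_mult dP lin by (simp add: algebra_simps)
  thus ?th2
    using gauss_integral_by_parts[of q ?P]
    by (simp only: gauss_integral_linear) (simp add: algebra_simps eq_neg_iff_add_eq_0)
qed

text \<open>For \<open>m \<le> n\<close> this is \<open>m! a^(n - m) L\<^sub>m(- a b)\<close> with the associated Laguerre polynomial of order
  \<open>n - m\<close>.  In the present form the roles of \<open>(n, a)\<close> and \<open>(m, b)\<close> are symmetric and no case
  distinction is needed.\<close>

definition lag_sum :: "nat \<Rightarrow> nat \<Rightarrow> complex \<Rightarrow> complex \<Rightarrow> complex" where
  "lag_sum n m a b = (\<Sum>i\<le>n. of_nat (fact i * (n choose i) * (m choose i)) * a ^ (n - i) * b ^ (m - i))"

lemma lag_sum_0: "lag_sum 0 m a b = b ^ m"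
  by (simp add: lag_sum_def)

lemma lag_sum_Suc: "lag_sum (Suc n) m a b = a * lag_sum n m a b + of_nat m * lag_sum n (m - 1) a b"
proof -
  let ?t = "\<lambda>n m i. of_nat (fact i * (n choose i) * (m choose i)) * a ^ (n - i) * b ^ (m - i)"
  have split: "?t (Suc n) m i = a * ?t n m i + (if i = 0 then 0 else of_nat m * ?t n (m - 1) (i - 1))" if "i \<le> Suc n" for i
  proof (cases i)
    case (Suc k)
    have m: "of_nat m * of_nat (fact k * (n choose k) * ((m - 1) choose k)) = (of_nat (fact i * (n choose k) * (m choose i)) :: complex)"
    proof (cases m)
      case (Suc m')
      have "m * (fact k * (n choose k) * ((m - 1) choose k)) = fact k * (n choose k) * (Suc m' * (m' choose k))"
        by (simp only: Suc diff_Suc_1 mult_ac)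
      also have "Suc m' * (m' choose k) = Suc k * (Suc m' choose Suc k)" by (rule Suc_times_binomial[symmetric])
      also have "fact k * (n choose k) * (Suc k * (Suc m' choose Suc k)) = fact i * (n choose k) * (m choose i)"
        by (simp only: Suc \<open>i = Suc k\<close> fact_Suc of_nat_id mult_ac)
      finally show ?thesis by (simp only: of_nat_mult[symmetric])
    qed (simp add: Suc)
    have "?t (Suc n) m i = of_nat (fact i * (n choose i) * (m choose i)) * a ^ (Suc n - i) * b ^ (m - i)
       + of_nat (fact i * (n choose k) * (m choose i)) * a ^ (Suc n - i) * b ^ (m - i)"
      unfolding Suc by (simp add: algebra_simps)
    also have "of_nat (fact i * (n choose i) * (m choose i)) * a ^ (Suc n - i) * b ^ (m - i) = a * ?t n m i"
    proof (cases "i \<le> n")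
      case True
      thus ?thesis by (simp add: Suc_diff_le)
    qed (simp add: binomial_eq_0)
    also have "of_nat (fact i * (n choose k) * (m choose i)) * a ^ (Suc n - i) * b ^ (m - i) = of_nat m * ?t n (m - 1) k"
      unfolding m[symmetric] by (simp add: Suc algebra_simps)
    finally show ?thesis using Suc by simp
  qed simp
  have "lag_sum (Suc n) m a b = (\<Sum>i\<le>Suc n. a * ?t n m i) + (\<Sum>i\<le>Suc n. if i = 0 then 0 else of_nat m * ?t n (m - 1) (i - 1))"
    unfolding lag_sum_def sum.distrib[symmetric] by (rule sum.cong[OF refl]) (use split in auto)
  also have "(\<Sum>i\<le>Suc n. a * ?t n m i) = a * lag_sum n m a b"
    by (simp add: lag_sum_def sum_distrib_left binomial_eq_0)
  also have "(\<Sum>i\<le>Suc n. if i = 0 then 0 else of_nat m * ?t n (m - 1) (i - 1)) = of_nat m * lag_sum n (m - 1) a b"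
    by (subst sum.atMost_Suc_shift) (simp add: lag_sum_def sum_distrib_left)
  finally show ?thesis .
qed

lemma lag_sum_commute: "lag_sum n m a b = lag_sum m n b a"
proof -
  have "lag_sum n m a b = (\<Sum>i\<le>max n m. of_nat (fact i * (n choose i) * (m choose i)) * a ^ (n - i) * b ^ (m - i))" for n m a b
    unfolding lag_sum_def by (rule sum.mono_neutral_left) (auto simp: binomial_eq_0)
  from this[of n m a b] this[of m n b a] show ?thesis by (simp add: max.commute mult_ac)
qed

lemma lag_sum_Suc2: "lag_sum n (Suc m) a b = b * lag_sum n m a b + of_nat n * lag_sum (n - 1) m a b"
  using lag_sum_Suc[of m n b a] by (simp add: lag_sum_commute)

definition lag :: "nat \<Rightarrow> nat \<Rightarrow> complex \<Rightarrow> complex \<Rightarrow> complex" where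
  "lag n m a b = exp (a * b / 2) * lag_sum n m a b / of_real (sqrt (fact n * fact m))"

text \<open>Both sides satisfy the same recursion in either index and agree for \<open>n = m = 0\<close>.\<close>

lemma gauss_integral_herm:
  fixes p q :: real
  defines "a \<equiv> of_real (sqrt 2) * (of_real p + \<i> * of_real q)"
    and "b \<equiv> of_real (sqrt 2) * (- of_real p + \<i> * of_real q)"
  shows "gauss_integral q (herm_prod n m p)
    = of_real (sqrt pi * exp (- q\<^sup>2)) * of_real (sqrt 2 ^ (n + m)) * lag_sum n m a b"
proof -
  have s2: "of_real (sqrt 2) * of_real (sqrt 2) = (2 :: complex)"
    by (simp only: of_real_mult[symmetric] real_sqrt_mult_self) simp
  have a2: "of_real 2 * (of_real p + \<i> * of_real q) = of_real (sqrt 2) * a"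
    unfolding a_def mult.assoc[symmetric] s2 by simp
  have b2: "of_real 2 * (- of_real p + \<i> * of_real q) = of_real (sqrt 2) * b"
    unfolding b_def mult.assoc[symmetric] s2 by simp
  show ?thesis
  proof (induction n arbitrary: m)
    case 0
    have h00: "herm_prod 0 0 p = 1" by (simp add: herm_prod_def one_pCons)
    show ?case
    proof (induction m)
      case 0
      show ?case by (simp add: h00 gauss_integral_1 lag_sum_0)
    next
      case (Suc m)
      show ?case unfolding gauss_integral_herm_rec(2) Suc.IH lag_sum_0 b2 by (simp add: algebra_simps)
    qed
  next
    case (Suc n)
    show ?case
    proof (cases m)
      case 0
      show ?thesis unfolding gauss_integral_herm_rec(1) Suc.IH a2 0 lag_sum_Suc by (simp add: algebra_simps)
    next
      case (Suc k)
      have c2: "of_nat (2 * m) = of_real (sqrt 2) * of_real (sqrt 2) * (of_nat m :: complex)"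
        unfolding s2 by simp
      show ?thesis unfolding gauss_integral_herm_rec(1) Suc.IH a2 lag_sum_Suc c2
        by (simp add: algebra_simps \<open>m = Suc k\<close>)
    qed
  qed
qed

lemma lag_sum_00: "lag_sum n n 0 0 = fact n"
proof -
  have "lag_sum n n 0 0 = (\<Sum>i\<le>n. if i = n then fact n else 0)"
    unfolding lag_sum_def by (rule sum.cong) auto
  thus ?thesis by simp
qed

lemma herm_pair:
  "herm n (p + z) * herm m (- p + z)
    = exp (- p\<^sup>2) / (sqrt pi * sqrt (2 ^ n * fact n * (2 ^ m * fact m))) * (poly (herm_prod n m p) z * exp (- z\<^sup>2))"
proof -
  have "(pi powr (-1/4)) * (pi powr (-1/4)) = pi powr (- (1/2))" by (simp add: powr_add[symmetric])
  also have "\<dots> = 1 / sqrt pi" by (simp only: powr_minus_divide powr_half_sqrt pi_ge_zero)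
  finally have cc: "pi powr (-1/4) * (pi powr (-1/4)) = 1 / sqrt pi" .
  have pp: "pi powr (-1/4) * (pi powr (-1/4) * x) = x / sqrt pi" for x
    unfolding mult.assoc[symmetric] cc by simp
  have ee: "exp (- (p + z)\<^sup>2 / 2) * exp (- (- p + z)\<^sup>2 / 2) = exp (- p\<^sup>2) * exp (- z\<^sup>2)"
    by (simp add: exp_add[symmetric] power2_eq_square field_simps)
  have "herm n (p + z) * herm m (- p + z)
     = pi powr (-1/4) * (pi powr (-1/4) * (poly (hermite_poly n) (p + z) * poly (hermite_poly m) (- p + z)
       * (exp (- (p + z)\<^sup>2 / 2) * exp (- (- p + z)\<^sup>2 / 2)))) / (sqrt (2 ^ n * fact n) * sqrt (2 ^ m * fact m))"
    unfolding herm_def herm_unnorm_def by (simp only: times_divide_times_eq mult_ac)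
  also have "\<dots> = poly (hermite_poly n) (p + z) * poly (hermite_poly m) (- p + z) * (exp (- p\<^sup>2) * exp (- z\<^sup>2))
      / sqrt pi / (sqrt (2 ^ n * fact n) * sqrt (2 ^ m * fact m))"
    unfolding pp ee ..
  finally show ?thesis by (simp add: herm_prod_def poly_pcompose real_sqrt_mult)
qed

lemma herm_pair_integral:
  fixes p q :: real
  defines "a \<equiv> of_real (sqrt 2) * (of_real p + \<i> * of_real q)"
    and "b \<equiv> of_real (sqrt 2) * (of_real (- p) + \<i> * of_real q)"
  shows "integrable lborel (\<lambda>z. exp (2 * \<i> * of_real (q * z)) * of_real (herm n (p + z) * herm m (- p + z)) :: complex)" (is ?th1)
    and "(LINT z|lborel. exp (2 * \<i> * of_real (q * z)) * of_real (herm n (p + z) * herm m (- p + z))) = lag n m a b" (is ?th2)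
proof -
  define c where "c = exp (- p\<^sup>2) / (sqrt pi * sqrt (2 ^ n * fact n * (2 ^ m * fact m)))"
  have eq: "(\<lambda>z. exp (2 * \<i> * of_real (q * z)) * of_real (herm n (p + z) * herm m (- p + z)) :: complex)
     = (\<lambda>z. of_real c * (exp (2 * \<i> * of_real (q * z)) * of_real (poly (herm_prod n m p) z * exp (- z\<^sup>2))))"
    unfolding herm_pair c_def[symmetric] by (simp add: fun_eq_iff)
  show ?th1
    unfolding eq by (intro integrable_mult_right integrable_poly_gauss_exp)
  have s2: "of_real (sqrt 2) * (of_real (sqrt 2) * x) = (2 * x :: complex)" for x
    by (metis mult.assoc of_real_mult of_real_numeral real_sqrt_mult_self abs_numeral)
  have "a * b = of_real (sqrt 2) * (of_real (sqrt 2) * ((of_real p + \<i> * of_real q) * (- of_real p + \<i> * of_real q)))"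
    unfolding a_def b_def by simp
  also have "\<dots> = 2 * of_real (- p\<^sup>2 - q\<^sup>2)"
    unfolding s2 by (simp add: power2_eq_square algebra_simps)
  finally have ab: "exp (a * b / 2) = of_real (exp (- p\<^sup>2) * exp (- q\<^sup>2))"
    by (simp add: exp_of_real[symmetric] exp_add[symmetric] exp_diff exp_minus field_simps)
  have sq: "sqrt (2 ^ n * fact n * (2 ^ m * fact m)) = sqrt 2 ^ (n + m) * sqrt (fact n * fact m)"
    by (simp add: real_sqrt_mult real_sqrt_power power_add)
  have "(LINT z|lborel. exp (2 * \<i> * of_real (q * z)) * of_real (herm n (p + z) * herm m (- p + z)))
      = of_real c * gauss_integral q (herm_prod n m p)"
    unfolding eq gauss_integral_def by (rule integral_mult_right_zero)
  also have "\<dots> = of_real c * (of_real (sqrt pi * exp (- q\<^sup>2)) * of_real (sqrt 2 ^ (n + m)) * lag_sum n m a b)"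
    unfolding gauss_integral_herm a_def b_def by simp
  also have "\<dots> = of_real (c * (sqrt pi * exp (- q\<^sup>2)) * sqrt 2 ^ (n + m)) * lag_sum n m a b"
    by (simp only: of_real_mult mult.assoc)
  also have "c * (sqrt pi * exp (- q\<^sup>2)) * sqrt 2 ^ (n + m) = exp (- p\<^sup>2) * exp (- q\<^sup>2) / sqrt (fact n * fact m)"
    unfolding c_def sq by (simp add: field_simps)
  also have "of_real \<dots> * lag_sum n m a b = lag n m a b"
    unfolding lag_def ab by simp
  finally show ?th2 .
qed

lemma continuous_herm: "isCont (herm n) x"
  unfolding herm_def herm_unnorm_def by (intro continuous_intros) auto

lemma herm_measurable [measurable]: "herm n \<in> borel_measurable borel"
  by (rule borel_measurable_continuous_onI) (simp add: continuous_at_imp_continuous_on continuous_herm)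

text \<open>The normalisation of the Hermite functions is the case \<open>p = q = 0\<close> of the pairing.\<close>

lemma herm_square: "integrable lborel (\<lambda>z. (herm n z)\<^sup>2)" (is ?th1) "(LINT z|lborel. (herm n z)\<^sup>2) = 1"
proof -
  have eq: "(\<lambda>z. exp (2 * \<i> * of_real (0 * z)) * of_real (herm n (0 + z) * herm n (- 0 + z)) :: complex)
      = (\<lambda>z. of_real ((herm n z)\<^sup>2))"
    by (simp add: power2_eq_square fun_eq_iff)
  have i: "integrable lborel (\<lambda>z. of_real ((herm n z)\<^sup>2) :: complex)"
    using herm_pair_integral(1)[of 0 n 0 n] unfolding eq .
  thus ?th1 by (simp only: complex_of_real_integrable_eq)
  have "(LINT z|lborel. of_real ((herm n z)\<^sup>2) :: complex) = lag n n 0 0"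
    using herm_pair_integral(2)[of 0 n 0 n] unfolding eq by simp
  also have "\<dots> = 1" by (simp add: lag_def lag_sum_00)
  finally show "(LINT z|lborel. (herm n z)\<^sup>2) = 1"
    by (metis integral_complex_of_real of_real_eq_1_iff)
qed

text \<open>The left side is the modulus of an integral of a product of two functions of \<open>L\<^sup>2\<close> norm one; the
  pointwise inequality \<open>|u v| \<le> (u\<^sup>2 + v\<^sup>2) / 2\<close> is enough.\<close>

lemma norm_lag_le_1:
  "norm (lag n m (of_real (sqrt 2) * (of_real p + \<i> * of_real q)) (of_real (sqrt 2) * (of_real (- p) + \<i> * of_real q))) \<le> 1"
proof -
  have tr: "integrable lborel (\<lambda>z. (herm k (c + z))\<^sup>2)" "(LINT z|lborel. (herm k (c + z))\<^sup>2) = 1" for k c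
    using lborel_integrable_real_affine[OF herm_square(1)[of k], of 1 c]
      lborel_integral_real_affine[of 1 "\<lambda>z. (herm k z)\<^sup>2" c] herm_square(2)[of k] by simp_all
  have "norm (LINT z|lborel. exp (2 * \<i> * of_real (q * z)) * of_real (herm n (p + z) * herm m (- p + z)))
     \<le> (LINT z|lborel. norm (exp (2 * \<i> * of_real (q * z)) * of_real (herm n (p + z) * herm m (- p + z)) :: complex))"
    by (rule integral_norm_bound)
  also have "\<dots> \<le> (LINT z|lborel. ((herm n (p + z))\<^sup>2 + (herm m (- p + z))\<^sup>2) / 2)"
  proof (rule integral_mono)
    show "integrable lborel (\<lambda>z. norm (exp (2 * \<i> * of_real (q * z)) * of_real (herm n (p + z) * herm m (- p + z)) :: complex))"
      by (intro integrable_norm herm_pair_integral)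
    show "integrable lborel (\<lambda>z. ((herm n (p + z))\<^sup>2 + (herm m (- p + z))\<^sup>2) / 2)"
      by (intro Bochner_Integration.integrable_add integrable_divide tr)
    fix z
    have "0 \<le> (\<bar>herm n (p + z)\<bar> - \<bar>herm m (- p + z)\<bar>)\<^sup>2" by simp
    hence "\<bar>herm n (p + z)\<bar> * \<bar>herm m (- p + z)\<bar> \<le> (\<bar>herm n (p + z)\<bar>\<^sup>2 + \<bar>herm m (- p + z)\<bar>\<^sup>2) / 2"
      by (simp add: power2_diff)
    thus "norm (exp (2 * \<i> * of_real (q * z)) * of_real (herm n (p + z) * herm m (- p + z)) :: complex)
        \<le> ((herm n (p + z))\<^sup>2 + (herm m (- p + z))\<^sup>2) / 2"
      by (simp add: norm_mult abs_mult)
  qed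
  also have "\<dots> = 1"
    using tr[of n p] tr[of m "- p"]
    by (subst integral_divide_zero, subst Bochner_Integration.integral_add) simp_all
  finally show ?thesis unfolding herm_pair_integral(2) .
qed

text \<open>The phase space point \<open>(y, e)\<close> as a complex number, dilated by the square root of \<open>2 \<bar>l\<bar>\<close> and
  conjugated for negative \<open>l\<close>.\<close>

definition amp :: "real \<Rightarrow> real \<Rightarrow> real \<Rightarrow> complex" where
  "amp l y e = of_real (sqrt (2 * \<bar>l\<bar>)) * (of_real y + \<i> * of_real (sgn l * e))"

text \<open>The one-dimensional factor of \<open>W_kernel\<close>, see \<open>W_kernel_prod\<close>.  Taking the closed form as the
  definition makes it visibly measurable in all real arguments, including at \<open>l = 0\<close>.\<close>

definition kern1 :: "nat \<Rightarrow> nat \<Rightarrow> real \<Rightarrow> real \<Rightarrow> real \<Rightarrow> complex" where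
  "kern1 n m l y e = lag n m (amp l y e) (amp l (- y) e)"

lemma amp_eq: "amp l y e = of_real (sqrt 2) * (of_real (sqrt \<bar>l\<bar> * y) + \<i> * of_real (sgn l * sqrt \<bar>l\<bar> * e))"
  by (simp add: amp_def real_sqrt_mult algebra_simps)

lemma norm_kern1_le_1: "norm (kern1 n m l y e) \<le> 1"
  unfolding kern1_def amp_eq using norm_lag_le_1[of n m "sqrt \<bar>l\<bar> * y" "sgn l * sqrt \<bar>l\<bar> * e"] by simp

text \<open>The substitution \<open>z \<mapsto> sqrt \<bar>l\<bar> z\<close> reduces the integral to \<open>herm_pair_integral\<close>.\<close>

lemma kern1_integral:
  assumes "l \<noteq> 0"
  shows "integrable lborel (\<lambda>z. exp (2 * \<i> * of_real (l * (e * z))) *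
      of_real (sqrt \<bar>l\<bar> * (herm n (sqrt \<bar>l\<bar> * (y + z)) * herm m (sqrt \<bar>l\<bar> * (- y + z)))))" (is ?th1)
    and "(LINT z|lborel. exp (2 * \<i> * of_real (l * (e * z))) *
      of_real (sqrt \<bar>l\<bar> * (herm n (sqrt \<bar>l\<bar> * (y + z)) * herm m (sqrt \<bar>l\<bar> * (- y + z))))) = kern1 n m l y e" (is ?th2)
proof -
  define p q where "p = sqrt \<bar>l\<bar> * y" and "q = sgn l * sqrt \<bar>l\<bar> * e"
  let ?f = "\<lambda>z. exp (2 * \<i> * of_real (q * z)) * of_real (herm n (p + z) * herm m (- p + z)) :: complex"
  let ?g = "\<lambda>z. exp (2 * \<i> * of_real (l * (e * z))) * of_real (herm n (sqrt \<bar>l\<bar> * (y + z)) * herm m (sqrt \<bar>l\<bar> * (- y + z)))"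
  have c: "sqrt \<bar>l\<bar> \<noteq> 0" using assms by simp
  have eq: "?f (0 + sqrt \<bar>l\<bar> * z) = ?g z" for z
  proof -
    have "q * (sqrt \<bar>l\<bar> * z) = (sgn l * (sqrt \<bar>l\<bar> * sqrt \<bar>l\<bar>)) * (e * z)" unfolding q_def by (simp only: mult_ac)
    also have "\<dots> = l * (e * z)" by (simp add: sgn_mult_abs)
    finally have e1: "q * (sqrt \<bar>l\<bar> * z) = l * (e * z)" .
    show ?thesis by (simp only: add_0_left e1 p_def distrib_left mult_minus_right)
  qed
  have "integrable lborel (\<lambda>z. ?f (0 + sqrt \<bar>l\<bar> * z))"
    by (rule lborel_integrable_real_affine[OF herm_pair_integral(1) c])
  hence "integrable lborel (\<lambda>z. of_real (sqrt \<bar>l\<bar>) * ?g z)"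
    unfolding eq by (rule integrable_mult_right)
  thus ?th1
    by (simp add: mult_ac)
  have "kern1 n m l y e = integral\<^sup>L lborel ?f"
    unfolding herm_pair_integral(2) kern1_def amp_eq p_def q_def by simp
  also have "\<dots> = \<bar>sqrt \<bar>l\<bar>\<bar> *\<^sub>R (LINT z|lborel. ?f (0 + sqrt \<bar>l\<bar> * z))"
    by (rule lborel_integral_real_affine[OF c])
  also have "\<dots> = of_real (sqrt \<bar>l\<bar>) * integral\<^sup>L lborel ?g"
    unfolding eq by (simp add: scaleR_conv_of_real)
  also have "\<dots> = (LINT z|lborel. of_real (sqrt \<bar>l\<bar>) * ?g z)" by simp
  finally show ?th2
    by (simp add: mult_ac)
qed

lemma W_kernel_prod:
  fixes Y :: "'d::finite phase"
  assumes l: "l \<noteq> 0"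
  shows "W_kernel n m l Y = (\<Prod>j\<in>UNIV. kern1 (n $ j) (m $ j) l (fst Y $ j) (snd Y $ j))"
proof -
  let ?h = "\<lambda>j z. exp (2 * \<i> * of_real (l * (snd Y $ j * z))) * of_real (sqrt \<bar>l\<bar> *
     (herm (n $ j) (sqrt \<bar>l\<bar> * (fst Y $ j + z)) * herm (m $ j) (sqrt \<bar>l\<bar> * (- (fst Y $ j) + z)))) :: complex"
  have "\<bar>l\<bar> powr (real CARD('d) / 4) = (\<Prod>j\<in>(UNIV::'d set). \<bar>l\<bar> powr (1/4))"
    using l by (simp add: powr_realpow[symmetric] powr_powr)
  hence hs: "hermite_scaled k l x = (\<Prod>j\<in>UNIV. \<bar>l\<bar> powr (1/4) * herm (k $ j) (sqrt \<bar>l\<bar> * x $ j))" for k and x :: "real^'d"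
    unfolding hermite_scaled_def hermite_prod by (simp only: prod.distrib vector_scaleR_component real_scaleR_def)
  have "\<bar>l\<bar> powr (1/4) * \<bar>l\<bar> powr (1/4) = \<bar>l\<bar> powr (1/2)" by (simp add: powr_add[symmetric])
  also have "\<dots> = sqrt \<bar>l\<bar>" by (rule powr_half_sqrt) simp
  finally have q: "\<bar>l\<bar> powr (1/4) * u * (\<bar>l\<bar> powr (1/4) * v) = sqrt \<bar>l\<bar> * (u * v)" for u v
    by (metis mult.assoc mult.left_commute)
  have eq: "exp (2 * \<i> * of_real (l * (snd Y \<bullet> z))) * of_real (hermite_scaled n l (fst Y + z) * hermite_scaled m l (- fst Y + z))
     = (\<Prod>j\<in>UNIV. ?h j (z $ j))" for z
  proof -
    have e: "exp (2 * \<i> * of_real (l * (snd Y \<bullet> z))) = (\<Prod>j\<in>UNIV. exp (2 * \<i> * of_real (l * (snd Y $ j * z $ j))))"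
      by (simp add: exp_sum[symmetric] inner_vec_def sum_distrib_left)
    show ?thesis unfolding e hs prod.distrib[symmetric] of_real_prod
      by (intro prod.cong refl) (simp only: q vector_add_component vector_uminus_component)
  qed
  have "W_kernel n m l Y = (LINT z|lebesgue. (\<Prod>j\<in>UNIV. ?h j (z $ j)))"
    unfolding W_kernel_def eq ..
  also have "\<dots> = (LINT z|(lborel::(real^'d) measure). (\<Prod>j\<in>UNIV. ?h j (z $ j)))"
    by (rule integral_completion) measurable
  also have "\<dots> = (\<Prod>j\<in>UNIV. LINT z|lborel. ?h j z)"
    by (rule lborel_vec_prod(2)) (rule kern1_integral(1)[OF l])
  finally show ?thesis unfolding kern1_integral(2)[OF l] .
qed

lemma norm_W_kernel_le_1: "l \<noteq> 0 \<Longrightarrow> norm (W_kernel n m l Y) \<le> 1"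
  by (simp add: W_kernel_prod prod_norm[symmetric] norm_kern1_le_1 prod_le_1)

lemma lag_sum_uminus: "lag_sum n m (- a) (- b) = (-1) ^ (n + m) * lag_sum n m a b"
  unfolding lag_sum_def sum_distrib_left
proof (rule sum.cong[OF refl])
  fix i assume "i \<in> {..n}"
  show "of_nat (fact i * (n choose i) * (m choose i)) * (- a) ^ (n - i) * (- b) ^ (m - i)
      = (-1) ^ (n + m) * (of_nat (fact i * (n choose i) * (m choose i)) * a ^ (n - i) * b ^ (m - i))"
  proof (cases "i \<le> m")
    case True
    have "n + m = (n - i) + (m - i) + 2 * i"
      using True \<open>i \<in> {..n}\<close> by simp
    hence "(-1 :: complex) ^ (n + m) = (-1) ^ ((n - i) + (m - i) + 2 * i)" by (rule arg_cong)
    also have "\<dots> = (-1) ^ (n - i) * (-1) ^ (m - i)" by (simp add: power_add)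
    finally have e: "(-1 :: complex) ^ (n + m) = (-1) ^ (n - i) * (-1) ^ (m - i)" .
    have "(- a) ^ (n - i) = (-1) ^ (n - i) * a ^ (n - i)" "(- b) ^ (m - i) = (-1) ^ (m - i) * b ^ (m - i)"
      by (rule power_minus)+
    thus ?thesis unfolding e by (simp only: mult_ac)
  qed (simp add: binomial_eq_0)
qed

lemma kern1_uminus: "kern1 m n (- l) y e = (-1) ^ (n + m) * kern1 n m l y e"
proof -
  have a: "amp (- l) y e = - amp l (- y) e" "amp (- l) (- y) e = - amp l y e"
    by (simp_all add: amp_def sgn_minus algebra_simps)
  show ?thesis unfolding kern1_def a lag_def
    by (subst lag_sum_commute, subst lag_sum_uminus) (simp add: mult_ac)
qed

text \<open>The symmetry on which \<open>hat_Sigma0\<close> is built: reversing \<open>\<lambda>\<close> sends \<open>(a, b)\<close> to \<open>(- b, - a)\<close>, and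
  the polynomial part has the parity of \<open>n + m\<close>.\<close>

lemma W_kernel_uminus:
  "l \<noteq> 0 \<Longrightarrow> W_kernel m n (- l) Y = (-1) ^ (\<Sum>j\<in>UNIV. n $ j + m $ j) * W_kernel n m l Y"
  by (simp add: W_kernel_prod kern1_uminus prod.distrib power_sum)

section \<open>The dilation derivative of the kernel\<close>

text \<open>As a function of \<open>a\<close> the polynomials form an Appell sequence in \<open>n\<close>: differentiation lowers \<open>n\<close> and
  multiplies by \<open>n\<close>.  The same holds for \<open>b\<close> and \<open>m\<close>.\<close>

lemma lag_sum_has_derivative:
  assumes A: "(A has_vector_derivative A') (at t)" and B: "(B has_vector_derivative B') (at t)"
  shows "((\<lambda>t. lag_sum n m (A t) (B t)) has_vector_derivative
     (A' * (of_nat n * lag_sum (n - 1) m (A t) (B t)) + B' * (of_nat m * lag_sum n (m - 1) (A t) (B t)))) (at t)"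
proof (induction n arbitrary: m)
  case 0
  have "((\<lambda>t. B t ^ m) has_vector_derivative (of_nat m * B t ^ (m - 1) * B')) (at t)"
    using field_vector_diff_chain_at[OF B, of "\<lambda>x. x ^ m" "of_nat m * B t ^ (m - 1)"]
    by (simp add: o_def DERIV_power[OF DERIV_ident, simplified] mult_ac)
  thus ?case by (simp add: lag_sum_0 mult_ac)
next
  case (Suc n)
  let ?Q = "\<lambda>n m. lag_sum n m (A t) (B t)"
  have n: "of_nat n * ?Q n m = of_nat n * (A t * ?Q (n - 1) m + of_nat m * ?Q (n - 1) (m - 1))" for m
    by (cases n) (simp_all add: lag_sum_Suc)
  have m: "of_nat m * ?Q (Suc n) (m - 1) = of_nat m * (A t * ?Q n (m - 1) + of_nat (m - 1) * ?Q n (m - 1 - 1))"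
    by (simp only: lag_sum_Suc)
  have "((\<lambda>t. A t * lag_sum n m (A t) (B t) + of_nat m * lag_sum n (m - 1) (A t) (B t)) has_vector_derivative
    (A t * (A' * (of_nat n * ?Q (n - 1) m) + B' * (of_nat m * ?Q n (m - 1))) + A' * ?Q n m
    + of_nat m * (A' * (of_nat n * ?Q (n - 1) (m - 1)) + B' * (of_nat (m - 1) * ?Q n (m - 1 - 1))))) (at t)"
    by (intro has_vector_derivative_add has_vector_derivative_mult A Suc.IH
        has_vector_derivative_mult_right)
  also have "(A t * (A' * (of_nat n * ?Q (n - 1) m) + B' * (of_nat m * ?Q n (m - 1))) + A' * ?Q n m
    + of_nat m * (A' * (of_nat n * ?Q (n - 1) (m - 1)) + B' * (of_nat (m - 1) * ?Q n (m - 1 - 1))))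
    = A' * (of_nat n * (A t * ?Q (n - 1) m + of_nat m * ?Q (n - 1) (m - 1)) + ?Q n m)
      + B' * (of_nat m * (A t * ?Q n (m - 1) + of_nat (m - 1) * ?Q n (m - 1 - 1)))"
    by (simp only: distrib_left distrib_right mult_ac add_ac)
  also have "\<dots> = A' * (of_nat (Suc n) * ?Q n m) + B' * (of_nat m * ?Q (Suc n) (m - 1))"
    unfolding n[symmetric] m[symmetric] by (simp add: algebra_simps)
  finally show ?case by (simp add: lag_sum_Suc)
qed

text \<open>On each half-line \<open>amp\<close> is homogeneous of degree \<open>1/2\<close> in \<open>l\<close>.\<close>

lemma amp_has_derivative:
  assumes "l \<noteq> 0"
  shows "((\<lambda>l. amp l y e) has_vector_derivative (amp l y e / of_real (2 * l))) (at l)"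
proof -
  let ?c = "of_real y + \<i> * of_real (sgn l * e) :: complex"
  let ?s = "\<lambda>l'. sqrt (2 * (sgn l * l'))"
  have sl: "sgn l * l = \<bar>l\<bar>" by (simp add: abs_sgn)
  have "(?s has_real_derivative (sqrt (2 * \<bar>l\<bar>) / (2 * l))) (at l)"
  proof -
    have "(?s has_real_derivative (inverse (sqrt (2 * (sgn l * l))) / 2 * (2 * sgn l))) (at l)"
      using assms sl by (auto intro!: derivative_eq_intros)
    also have "inverse (sqrt (2 * (sgn l * l))) / 2 * (2 * sgn l) = sqrt (2 * \<bar>l\<bar>) / (2 * l)"
    proof -
      define r where "r = sqrt (2 * \<bar>l\<bar>)"
      have "r * r = 2 * \<bar>l\<bar>" "r > 0" using assms by (simp_all add: r_def)
      thus ?thesis unfolding sl r_def[symmetric] using assms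
        by (cases l "0 :: real" rule: linorder_cases) (simp_all add: field_simps)
    qed
    finally show ?thesis .
  qed
  from has_vector_derivative_of_real[OF this]
  have "((\<lambda>l'. of_real (?s l') * ?c) has_vector_derivative (of_real (sqrt (2 * \<bar>l\<bar>) / (2 * l)) * ?c)) (at l)"
    by (rule has_vector_derivative_mult_left)
  moreover have "eventually (\<lambda>l'. of_real (?s l') * ?c = amp l' y e) (nhds l)"
  proof -
    have "open {l'. 0 < l' * l}" by (intro open_Collect_less continuous_intros)
    hence "eventually (\<lambda>l'. l' \<in> {l'. 0 < l' * l}) (nhds l)"
      using assms by (intro eventually_nhds_in_open) (auto simp: zero_less_mult_iff linorder_neq_iff)
    thus ?thesis
      by eventually_elim (auto simp: amp_def sgn_if zero_less_mult_iff)
  qed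
  ultimately have "((\<lambda>l. amp l y e) has_vector_derivative (of_real (sqrt (2 * \<bar>l\<bar>) / (2 * l)) * ?c)) (at l)"
    by (subst (asm) has_vector_derivative_cong_ev[where g = "\<lambda>l. amp l y e"])
       (auto elim: eventually_mono dest: eventually_nhds_x_imp_x)
  thus ?thesis by (simp add: amp_def)
qed

text \<open>Because \<open>l\<close> acts by dilation, the derivative is \<open>1 / (2 l)\<close> times the Euler field in \<open>(a, b)\<close>
  applied to \<open>exp (a b / 2)\<close> times \<open>lag_sum\<close>.  The recursions of \<open>lag_sum\<close> express the result through
  the neighbours \<open>(n + 1, m + 1)\<close> and \<open>(n - 1, m - 1)\<close>.\<close>

lemma kern1_has_derivative:
  assumes l: "l \<noteq> 0"
  shows "((\<lambda>l. kern1 n m l y e) has_vector_derivative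
     (of_real (1 / (2 * l)) * (of_real (sqrt ((real n + 1) * (real m + 1))) * kern1 (n + 1) (m + 1) l y e
       - of_real (sqrt (real n * real m)) * kern1 (n - 1) (m - 1) l y e - kern1 n m l y e))) (at l)"
proof -
  let ?A = "\<lambda>l. amp l y e" and ?B = "\<lambda>l. amp l (- y) e"
  define a b where "a = ?A l" and "b = ?B l"
  let ?Q = "\<lambda>n m. lag_sum n m a b"
  let ?h = "of_real (2 * l) :: complex"
  have h: "?h \<noteq> 0" using l by simp
  define S where "S = (of_real (sqrt (fact n * fact m)) :: complex)"
  define E where "E = exp (a * b / 2)"
  have S: "S \<noteq> 0" by (simp add: S_def)
  have dQ: "((\<lambda>l. lag_sum n m (?A l) (?B l)) has_vector_derivative
     (a / ?h * (of_nat n * ?Q (n - 1) m) + b / ?h * (of_nat m * ?Q n (m - 1)))) (at l)"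
    unfolding a_def b_def by (intro lag_sum_has_derivative amp_has_derivative l)
  have "((\<lambda>l. ?A l * ?B l / 2) has_vector_derivative ((a * (b / ?h) + a / ?h * b) / 2)) (at l)"
    unfolding a_def b_def
    by (intro has_vector_derivative_divide has_vector_derivative_mult amp_has_derivative l)
  from field_vector_diff_chain_at[OF this, of exp E]
  have "((\<lambda>l. exp (?A l * ?B l / 2)) has_vector_derivative ((a * (b / ?h) + a / ?h * b) / 2 * E)) (at l)"
    by (simp add: o_def E_def a_def b_def DERIV_exp)
  from has_vector_derivative_divide[OF has_vector_derivative_mult[OF this dQ], of S]
  have d: "((\<lambda>l. kern1 n m l y e) has_vector_derivative
    (E * (a / ?h * (of_nat n * ?Q (n - 1) m) + b / ?h * (of_nat m * ?Q n (m - 1))) + (a * (b / ?h) + a / ?h * b) / 2 * E * ?Q n m) / S) (at l)"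
    by (simp add: kern1_def lag_def S_def E_def a_def b_def)
  have n: "of_nat n * (a * ?Q (n - 1) m) = of_nat n * ?Q n m - of_nat n * of_nat m * ?Q (n - 1) (m - 1)"
    by (cases n) (simp_all add: lag_sum_Suc algebra_simps)
  have m: "of_nat m * (b * ?Q n (m - 1)) = of_nat m * ?Q n m - of_nat n * of_nat m * ?Q (n - 1) (m - 1)"
    by (cases m) (simp_all add: lag_sum_Suc2 algebra_simps)
  \<comment> \<open>Here the product \<open>a b\<close>, which comes from the exponential, is traded for the upper neighbour.\<close>
  have pp: "?Q (n + 1) (m + 1) = a * b * ?Q n m + of_nat n * ?Q n m - of_nat n * of_nat m * ?Q (n - 1) (m - 1) + (of_nat m + 1) * ?Q n m"
  proof -
    have "?Q (n + 1) (m + 1) = a * (b * ?Q n m + of_nat n * ?Q (n - 1) m) + of_nat (m + 1) * ?Q n m"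
      using lag_sum_Suc[of n "m + 1" a b] lag_sum_Suc2[of n m a b] by simp
    also have "\<dots> = a * b * ?Q n m + of_nat n * (a * ?Q (n - 1) m) + (of_nat m + 1) * ?Q n m"
      by (simp add: algebra_simps)
    finally show ?thesis unfolding n by (simp add: algebra_simps)
  qed
  have kpp: "of_real (sqrt ((real n + 1) * (real m + 1))) * kern1 (n + 1) (m + 1) l y e = E * ?Q (n + 1) (m + 1) / S"
  proof -
    have "fact (n + 1) * fact (m + 1) = ((real n + 1) * (real m + 1)) * (fact n * fact m)"
      by (simp add: algebra_simps)
    hence "sqrt (fact (n + 1) * fact (m + 1)) = sqrt ((real n + 1) * (real m + 1)) * sqrt (fact n * fact m)"
      by (simp only: real_sqrt_mult)
    moreover have "sqrt ((real n + 1) * (real m + 1)) \<noteq> 0"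
      by (simp add: add_nonneg_eq_0_iff)
    ultimately show ?thesis
      unfolding kern1_def lag_def S_def E_def a_def b_def by simp
  qed
  have kmm: "of_real (sqrt (real n * real m)) * kern1 (n - 1) (m - 1) l y e = E * (of_nat n * of_nat m * ?Q (n - 1) (m - 1)) / S"
  proof (cases "n = 0 \<or> m = 0")
    case False
    have "sqrt (fact n * fact m) = sqrt (real n * real m) * sqrt (fact (n - 1) * fact (m - 1))"
      using False by (simp add: real_sqrt_mult[symmetric] fact_reduce[of n] fact_reduce[of m] algebra_simps)
    moreover have "real n * real m = sqrt (real n * real m) * sqrt (real n * real m)" by simp
    hence "of_nat n * of_nat m = (of_real (sqrt (real n * real m)) * of_real (sqrt (real n * real m)) :: complex)"
      by (metis of_real_mult of_real_of_nat_eq)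
    moreover have "sqrt (real n * real m) \<noteq> 0" using False by simp
    ultimately show ?thesis
      unfolding kern1_def lag_def S_def E_def a_def b_def by simp
  qed auto
  have "(E * (a / ?h * (of_nat n * ?Q (n - 1) m) + b / ?h * (of_nat m * ?Q n (m - 1))) + (a * (b / ?h) + a / ?h * b) / 2 * E * ?Q n m) / S
    = E / ?h / S * (of_nat n * (a * ?Q (n - 1) m) + of_nat m * (b * ?Q n (m - 1)) + a * b * ?Q n m)"
    using h S by (simp add: field_simps)
  also have "\<dots> = E / ?h / S * (?Q (n + 1) (m + 1) - of_nat n * of_nat m * ?Q (n - 1) (m - 1) - ?Q n m)"
    unfolding n m pp by (simp add: algebra_simps)
  also have "\<dots> = of_real (1 / (2 * l)) * (E * ?Q (n + 1) (m + 1) / S - E * (of_nat n * of_nat m * ?Q (n - 1) (m - 1)) / S - E * ?Q n m / S)"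
    using h S by (simp add: field_simps)
  finally show ?thesis
    using d unfolding kpp kmm by (simp add: kern1_def lag_def S_def E_def a_def b_def)
qed

section \<open>The Bessel-type kernel as a power series\<close>

lemma infsum_times:
  fixes f :: "'a::countable \<Rightarrow> 'c::{real_normed_field,banach,second_countable_topology}"
    and g :: "'b::countable \<Rightarrow> 'c"
  assumes f: "(\<lambda>a. norm (f a)) summable_on UNIV" and g: "(\<lambda>b. norm (g b)) summable_on UNIV"
  shows "(\<lambda>p. norm (f (fst p) * g (snd p))) summable_on UNIV" (is ?th1)
    and "(\<Sum>\<^sub>\<infinity>p. f (fst p) * g (snd p)) = infsum f UNIV * infsum g UNIV" (is ?th2)
proof -
  have f': "Infinite_Set_Sum.abs_summable_on f UNIV" and g': "Infinite_Set_Sum.abs_summable_on g UNIV"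
    using f g by (auto intro: abs_summable_equivalent[THEN iffD1])
  have eq: "(\<lambda>(x, y). f x * g y) = (\<lambda>p. f (fst p) * g (snd p))" by auto
  have s: "Infinite_Set_Sum.abs_summable_on (\<lambda>p. f (fst p) * g (snd p)) UNIV"
    using abs_summable_on_product[of UNIV UNIV f g] f' g' unfolding eq by simp
  thus ?th1
    by (rule abs_summable_equivalent[THEN iffD2])
  have "(\<Sum>\<^sub>\<infinity>p. f (fst p) * g (snd p)) = infsetsum (\<lambda>p. f (fst p) * g (snd p)) UNIV"
    by (rule infsetsum_infsum[symmetric]) fact
  also have "\<dots> = infsetsum f UNIV * infsetsum g UNIV"
    using infsetsum_product[of UNIV UNIV f g] f' g' unfolding eq by simp
  also have "\<dots> = infsum f UNIV * infsum g UNIV"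
    using f' g' by (simp add: infsetsum_infsum)
  finally show ?th2 .
qed

lemma exp_infsum:
  fixes z :: complex
  shows "(\<lambda>n. norm (z ^ n / fact n)) summable_on UNIV" (is ?th1) and "(\<Sum>\<^sub>\<infinity>n. z ^ n / fact n) = exp z" (is ?th2)
proof -
  have eq: "z ^ n /\<^sub>R fact n = z ^ n / fact n" for n
    by (simp add: scaleR_conv_of_real divide_inverse mult.commute)
  have s: "summable (\<lambda>n. norm (z ^ n / fact n))"
    using summable_norm_exp[of z] unfolding eq .
  show ?th1
    by (rule norm_summable_imp_summable_on) (use s in simp)
  have "((\<lambda>n. z ^ n / fact n) has_sum exp z) UNIV"
    by (rule norm_summable_imp_has_sum[OF s]) (use exp_converges[of z] in \<open>simp only: eq\<close>)
  thus ?th2 by (rule infsumI)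
qed

lemma fourier_orthogonality:
  fixes j :: int
  shows "(LINT z|lborel. indicator {-pi..pi} z *\<^sub>R exp (\<i> * of_real (of_int j * z))) = (if j = 0 then of_real (2 * pi) else 0 :: complex)"
proof (cases "j = 0")
  case True
  have "(LINT z|lborel. indicator {-pi..pi} z *\<^sub>R (1 :: complex)) = of_real pi - of_real (-pi)"
    by (rule integral_FTC_Icc) (auto intro!: derivative_eq_intros)
  thus ?thesis using True by simp
next
  case False
  let ?F = "\<lambda>z. exp (\<i> * of_real (of_int j * z)) / (\<i> * of_int j) :: complex"
  have "(LINT z|lborel. indicator {-pi..pi} z *\<^sub>R exp (\<i> * of_real (of_int j * z))) = ?F pi - ?F (- pi)"
  proof (rule integral_FTC_Icc)
    show "(?F has_vector_derivative exp (\<i> * of_real (of_int j * x))) (at x within {-pi..pi})" for x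
    proof -
      have "((\<lambda>z. exp (\<i> * of_real (of_int j * z)) :: complex) has_vector_derivative
          (\<i> * of_int j * exp (\<i> * of_real (of_int j * x)))) (at x)"
        by (rule has_vector_derivative_real_field derivative_eq_intros refl | simp)+
      from has_vector_derivative_divide[OF this, of "\<i> * of_int j"]
      have "(?F has_vector_derivative (\<i> * of_int j * exp (\<i> * of_real (of_int j * x)) / (\<i> * of_int j))) (at x)" .
      thus ?thesis using False by (simp add: has_vector_derivative_at_within)
    qed
  qed (auto intro!: continuous_intros)
  moreover have "exp (\<i> * of_real (of_int j * pi)) = exp (\<i> * of_real (of_int j * (- pi)))"
    unfolding exp_eq by (rule exI[of _ j]) (simp add: algebra_simps)
  ultimately show ?thesis using False by simp
qed

lemma K_one_eq_lborel:
  "K_one x k y e = of_real (1 / (2 * pi)) * (LINT z|lborel. indicator {-pi..pi} z *\<^sub>R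
     exp (\<i> * of_real (2 * sqrt \<bar>x\<bar> * (y * sin z + e * sgn x * cos z) + of_int k * z)))"
  unfolding K_one_def set_lebesgue_integral_def by (subst integral_completion) auto

text \<open>The phase is \<open>A exp (i z) + B exp (- i z) + i k z\<close>.  Both exponentials are expanded, and the integral
  over a period retains only the pairs of exponents whose difference cancels \<open>k\<close>; these are
  \<open>(r + nat (- k), r + nat k)\<close> for \<open>r\<close> in the natural numbers.\<close>

lemma K_one_series:
  fixes x y e :: real and k :: int
  defines "A \<equiv> of_real (sqrt \<bar>x\<bar>) * (of_real y + \<i> * of_real (sgn x * e))"
    and "B \<equiv> of_real (sqrt \<bar>x\<bar>) * (of_real (- y) + \<i> * of_real (sgn x * e))"
  shows "K_one x k y e = (\<Sum>\<^sub>\<infinity>r. A ^ (r + nat (- k)) * B ^ (r + nat k) / (fact (r + nat (- k)) * fact (r + nat k)))"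
proof -
  let ?c = "\<lambda>p. (A ^ fst p / fact (fst p)) * (B ^ snd p / fact (snd p))"
  let ?f = "\<lambda>p z. ?c p * (indicator {-pi..pi} z *\<^sub>R exp (\<i> * of_real (of_int (int (fst p) - int (snd p) + k) * z))) :: complex"
  have ind: "norm (indicator {-pi..pi} z *\<^sub>R exp (\<i> * of_real t) :: complex) \<le> indicator {-pi..pi} z" for z t :: real
    by (simp add: norm_exp_i_times)
  have cs: "(\<lambda>p. norm (?c p)) summable_on UNIV"
    by (rule infsum_times(1)) (rule exp_infsum(1))+
  have fb: "norm (?f p z) \<le> norm (?c p) * indicator {-pi..pi} z" for p z
    unfolding norm_mult[of "?c p"] by (rule mult_left_mono[OF ind]) simp
  have abs: "(\<lambda>p. norm (?f p z)) summable_on UNIV" for z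
    by (rule summable_on_comparison_test[OF summable_on_cmult_left[OF cs, of "indicator {-pi..pi} z"]])
       (use fb in auto)
  have pt: "(\<Sum>\<^sub>\<infinity>p. ?f p z) = indicator {-pi..pi} z *\<^sub>R
     exp (\<i> * of_real (2 * sqrt \<bar>x\<bar> * (y * sin z + e * sgn x * cos z) + of_int k * z))" for z
  proof -
    let ?w = "exp (\<i> * of_real z)" and ?v = "exp (- (\<i> * of_real z))"
    have "?f p z = (((A * ?w) ^ fst p / fact (fst p)) * ((B * ?v) ^ snd p / fact (snd p)))
        * (indicator {-pi..pi} z *\<^sub>R exp (\<i> * of_real (of_int k * z)))" for p
    proof -
      have "exp (\<i> * of_real (of_int (int (fst p) - int (snd p) + k) * z)) = ?w ^ fst p * ?v ^ snd p * exp (\<i> * of_real (of_int k * z))"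
        by (simp add: exp_of_nat_mult[symmetric] exp_add[symmetric] algebra_simps)
      thus ?thesis by (simp add: power_mult_distrib)
    qed
    hence "(\<Sum>\<^sub>\<infinity>p. ?f p z) = (\<Sum>\<^sub>\<infinity>p. ((A * ?w) ^ fst p / fact (fst p)) * ((B * ?v) ^ snd p / fact (snd p)))
        * (indicator {-pi..pi} z *\<^sub>R exp (\<i> * of_real (of_int k * z)))"
      by (simp only: infsum_cmult_left')
    also have "(\<Sum>\<^sub>\<infinity>p. ((A * ?w) ^ fst p / fact (fst p)) * ((B * ?v) ^ snd p / fact (snd p))) = exp (A * ?w) * exp (B * ?v)"
      by (subst infsum_times(2)) (simp_all only: exp_infsum)
    also have "\<dots> * (indicator {-pi..pi} z *\<^sub>R exp (\<i> * of_real (of_int k * z)))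
       = indicator {-pi..pi} z *\<^sub>R exp (A * ?w + B * ?v + \<i> * of_real (of_int k * z))"
      by (simp add: exp_add)
    also have "A * ?w + B * ?v = \<i> * of_real (2 * sqrt \<bar>x\<bar> * (y * sin z + e * sgn x * cos z))"
    proof -
      have w: "?w = of_real (cos z) + \<i> * of_real (sin z)" "?v = of_real (cos z) - \<i> * of_real (sin z)"
        unfolding exp_Euler exp_minus_Euler cos_of_real sin_of_real by simp_all
      show ?thesis unfolding w A_def B_def by (simp add: algebra_simps)
    qed
    finally show ?thesis by (simp add: distrib_left)
  qed
  have int_ind: "integrable lborel (indicator {-pi..pi} :: real \<Rightarrow> real)"
    by (rule integrable_real_indicator) (auto simp: emeasure_lborel_Icc_eq)
  have sum: "(LINT z|lborel. (\<Sum>\<^sub>\<infinity>p. ?f p z)) = (\<Sum>\<^sub>\<infinity>p. LINT z|lborel. ?f p z)"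
  proof (rule integral_infsum_swap_dominated(2)[where B = "\<lambda>z. (\<Sum>\<^sub>\<infinity>p. norm (?c p)) * indicator {-pi..pi} z"])
    show "integrable lborel (\<lambda>z. (\<Sum>\<^sub>\<infinity>p. norm (?c p)) * indicator {-pi..pi} z)"
      by (rule integrable_mult_right[OF int_ind])
    show "(\<Sum>\<^sub>\<infinity>p. norm (?f p z)) \<le> (\<Sum>\<^sub>\<infinity>p. norm (?c p)) * indicator {-pi..pi} z" for z
      unfolding infsum_cmult_left'[symmetric]
      by (rule infsum_mono[OF abs summable_on_cmult_left[OF cs]]) (rule fb)
  qed (use abs in auto)
  have "K_one x k y e = of_real (1 / (2 * pi)) * (\<Sum>\<^sub>\<infinity>p. LINT z|lborel. ?f p z)"
    unfolding K_one_eq_lborel pt[symmetric] sum ..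
  also have "\<dots> = of_real (1 / (2 * pi)) * (\<Sum>\<^sub>\<infinity>p. ?c p * (if int (fst p) - int (snd p) + k = 0 then of_real (2 * pi) else 0))"
    by (simp only: integral_mult_right_zero fourier_orthogonality)
  also have "\<dots> = (\<Sum>\<^sub>\<infinity>p. if int (fst p) - int (snd p) + k = 0 then ?c p else 0)"
    unfolding infsum_cmult_right'[symmetric] by (rule infsum_cong) auto
  also have "\<dots> = infsum ?c (range (\<lambda>r. (r + nat (- k), r + nat k)))" (is "_ = infsum _ ?R")
  proof (rule infsum_cong_neutral)
    fix p assume "p \<in> UNIV - range (\<lambda>r. (r + nat (- k), r + nat k))"
    moreover have "p = (min (fst p) (snd p) + nat (- k), min (fst p) (snd p) + nat k)" if "int (fst p) - int (snd p) + k = 0"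
      using that by (cases p) auto
    ultimately show "(if int (fst p) - int (snd p) + k = 0 then ?c p else 0) = 0" by auto
  next
    fix p assume "p \<in> UNIV \<inter> ?R"
    then obtain r where "p = (r + nat (- k), r + nat k)" by auto
    hence "int (fst p) - int (snd p) + k = 0" by (cases "k \<ge> 0") auto
    thus "(if int (fst p) - int (snd p) + k = 0 then ?c p else 0) = ?c p" by simp
  qed auto
  also have "\<dots> = (\<Sum>\<^sub>\<infinity>r. A ^ (r + nat (- k)) * B ^ (r + nat k) / (fact (r + nat (- k)) * fact (r + nat k)))"
    by (subst infsum_reindex) (auto simp: inj_on_def o_def)
  finally show ?thesis .
qed

lemma norm_K_one_le_1: "norm (K_one x k y e) \<le> 1"
proof -
  have int_ind: "integrable lborel (indicator {-pi..pi} :: real \<Rightarrow> real)"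
    by (rule integrable_real_indicator) (auto simp: emeasure_lborel_Icc_eq)
  have "norm (LINT z|lborel. indicator {-pi..pi} z *\<^sub>R
     exp (\<i> * of_real (2 * sqrt \<bar>x\<bar> * (y * sin z + e * sgn x * cos z) + of_int k * z))) \<le> (LINT z|lborel. indicator {-pi..pi} z)"
    by (rule order_trans[OF integral_norm_bound integral_mono[OF _ int_ind]])
       (auto intro!: Bochner_Integration.integrable_bound[OF int_ind] simp: norm_exp_i_times simp del: of_real_add of_real_mult of_real_diff)
  also have "\<dots> = 2 * pi" by simp
  finally have I: "norm (LINT z|lborel. indicator {-pi..pi} z *\<^sub>R
     exp (\<i> * of_real (2 * sqrt \<bar>x\<bar> * (y * sin z + e * sgn x * cos z) + of_int k * z))) \<le> 2 * pi" .
  have "norm (K_one x k y e) \<le> \<bar>1 / (2 * pi)\<bar> * (2 * pi)"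
    unfolding K_one_eq_lborel norm_mult norm_of_real by (rule mult_left_mono[OF I]) simp
  thus ?thesis by simp
qed

section \<open>The Mehler--Heine limit of the kernel\<close>

lemma fact_eq_prod_real: "r \<le> N \<Longrightarrow> (fact N :: real) = fact (N - r) * (\<Prod>j<r. real N - real j)"
proof (induction r)
  case (Suc r)
  have "fact (N - r) = (real N - real r) * fact (N - Suc r)"
    using Suc.prems by (subst fact_reduce) (auto simp: of_nat_diff)
  thus ?case using Suc by simp
qed simp

lemma fact_add_eq_prod_real: "(fact (N + q) :: real) = fact N * (\<Prod>j<q. real N + 1 + real j)"
  by (induction q) (simp_all add: algebra_simps)

text \<open>Counted from the top index, \<open>i = N - r\<close>, the \<open>r\<close>-th coefficient is a product of a fixed number of
  factors \<open>t (N + const)\<close>.  They all have the same limit when \<open>N\<close> grows and \<open>t N\<close> converges, so in this form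
  a limit can be taken term by term.  One of the offsets vanishes because \<open>N\<close> will be the minimum of
  the two indices.\<close>

lemma lag_sum_reindex:
  fixes \<alpha> \<beta> :: complex and t :: real
  assumes q: "q1 = 0 \<or> q2 = 0" and t: "t \<ge> 0"
  shows "lag_sum (N + q1) (N + q2) (of_real (sqrt t) * \<alpha>) (of_real (sqrt t) * \<beta>) / of_real (sqrt (fact (N + q1) * fact (N + q2)))
    = (\<Sum>\<^sub>\<infinity>r. of_real ((\<Prod>j<r. t * (real N - real j)) * sqrt (\<Prod>j<q1 + q2. t * (real N + 1 + real j)))
        * (\<alpha> ^ (r + q1) * \<beta> ^ (r + q2) / (fact (r + q1) * fact (r + q2))))"
proof -
  define n m where "n = N + q1" and "m = N + q2"
  let ?a = "of_real (sqrt t) * \<alpha>" and ?b = "of_real (sqrt t) * \<beta>"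
  let ?S = "of_real (sqrt (fact n * fact m)) :: complex"
  let ?t = "\<lambda>i. of_nat (fact i * (n choose i) * (m choose i)) * ?a ^ (n - i) * ?b ^ (m - i)"
  let ?T = "\<lambda>r. of_real ((\<Prod>j<r. t * (real N - real j)) * sqrt (\<Prod>j<q1 + q2. t * (real N + 1 + real j)))
        * (\<alpha> ^ (r + q1) * \<beta> ^ (r + q2) / (fact (r + q1) * fact (r + q2)))"
  have "lag_sum n m ?a ?b = (\<Sum>i\<le>N. ?t i)"
    unfolding lag_sum_def by (rule sum.mono_neutral_right) (use q in \<open>auto simp: n_def m_def binomial_eq_0\<close>)
  also have "\<dots> = (\<Sum>r\<le>N. ?t (N - r))"
    by (rule sum.reindex_bij_witness[of _ "\<lambda>r. N - r" "\<lambda>r. N - r"]) auto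
  finally have ls: "lag_sum n m ?a ?b / ?S = (\<Sum>r\<le>N. ?t (N - r) / ?S)" by (simp add: sum_divide_distrib)
  have tm: "?t (N - r) / ?S = ?T r" if "r \<le> N" for r
  proof -
    have nr: "n - (N - r) = r + q1" "m - (N - r) = r + q2" using that by (auto simp: n_def m_def)
    have le: "N - r \<le> n" "N - r \<le> m" by (auto simp: n_def m_def)
    have ff: "fact n * fact m = (fact N * fact N * (\<Prod>j<q1 + q2. real N + 1 + real j) :: real)"
      using q fact_add_eq_prod_real[of N q1] fact_add_eq_prod_real[of N q2] by (auto simp: n_def m_def)
    have sf: "sqrt (fact n * fact m) = fact N * sqrt (\<Prod>j<q1 + q2. real N + 1 + real j)"
      unfolding ff by (simp add: real_sqrt_mult)
    have "real (fact (N - r) * (n choose (N - r)) * (m choose (N - r)))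
       = fact n * fact m / (fact (N - r) * fact (r + q1) * fact (r + q2))"
      using binomial_fact[OF le(1), where 'a = real] binomial_fact[OF le(2), where 'a = real] by (simp add: nr)
    also have "\<dots> = sqrt (fact n * fact m) * sqrt (fact n * fact m) / (fact (N - r) * fact (r + q1) * fact (r + q2))"
      by simp
    finally have c': "real (fact (N - r) * (n choose (N - r)) * (m choose (N - r)))
       = sqrt (fact n * fact m) * sqrt (fact n * fact m) / (fact (N - r) * fact (r + q1) * fact (r + q2))" .
    have c: "of_nat (fact (N - r) * (n choose (N - r)) * (m choose (N - r)))
       = (of_real (sqrt (fact n * fact m) * sqrt (fact n * fact m) / (fact (N - r) * fact (r + q1) * fact (r + q2))) :: complex)"
      using arg_cong[OF c', of complex_of_real] by (simp only: of_real_of_nat_eq)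
    have pw: "sqrt t ^ (r + q1) * sqrt t ^ (r + q2) = t ^ r * sqrt (t ^ (q1 + q2))"
    proof -
      have "sqrt t ^ (r + q1) * sqrt t ^ (r + q2) = (sqrt t * sqrt t) ^ r * sqrt t ^ (q1 + q2)"
        by (simp only: power_add power_mult_distrib mult_ac)
      thus ?thesis using t by (simp add: real_sqrt_power)
    qed
    have "sqrt (fact n * fact m) / fact (N - r) * (sqrt t ^ (r + q1) * sqrt t ^ (r + q2))
       = (t ^ r * (\<Prod>j<r. real N - real j)) * (sqrt (\<Prod>j<q1 + q2. real N + 1 + real j) * sqrt (t ^ (q1 + q2)))"
      unfolding pw sf fact_eq_prod_real[OF that] by simp
    also have "\<dots> = (\<Prod>j<r. t * (real N - real j)) * sqrt (\<Prod>j<q1 + q2. t * (real N + 1 + real j))"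
      by (simp add: prod.distrib real_sqrt_mult[symmetric] mult.commute)
    finally have key: "sqrt (fact n * fact m) / fact (N - r) * (sqrt t ^ (r + q1) * sqrt t ^ (r + q2)) = \<dots>" .
    define z where "z = sqrt (fact n * fact m)"
    have z: "z \<noteq> 0" by (simp add: z_def)
    have "?t (N - r) / ?S = of_real (sqrt (fact n * fact m) / fact (N - r) * (sqrt t ^ (r + q1) * sqrt t ^ (r + q2)))
        * (\<alpha> ^ (r + q1) * \<beta> ^ (r + q2) / (fact (r + q1) * fact (r + q2)))"
      unfolding c nr z_def[symmetric] using z by (simp add: power_mult_distrib divide_simps)
    thus ?thesis unfolding key .
  qed
  have "(\<Sum>\<^sub>\<infinity>r. ?T r) = infsum ?T {..N}"
  proof (rule infsum_cong_neutral)
    fix r assume "r \<in> UNIV - {..N}"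
    hence "(\<Prod>j<r. t * (real N - real j)) = 0" by (intro prod_zero) auto
    thus "?T r = 0" by simp
  qed auto
  also have "\<dots> = (\<Sum>r\<le>N. ?T r)" by simp
  also have "\<dots> = (\<Sum>r\<le>N. ?t (N - r) / ?S)" by (rule sum.cong) (use tm in auto)
  finally have "lag_sum n m ?a ?b / ?S = (\<Sum>\<^sub>\<infinity>r. ?T r)" unfolding ls by (rule sym)
  thus ?thesis unfolding n_def m_def .
qed

text \<open>The number of the cell of length \<open>2 \<epsilon>\<close> that contains \<open>x\<close>.\<close>

definition grid_index :: "real \<Rightarrow> real \<Rightarrow> nat" where
  "grid_index \<epsilon> x = nat \<lfloor>x / (2 * \<epsilon>)\<rfloor>"

lemma grid_index_bounds:
  assumes "\<epsilon> > 0" "x \<ge> 0"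
  shows "2 * \<epsilon> * real (grid_index \<epsilon> x) \<le> x" (is ?th1) "x - 2 * \<epsilon> \<le> 2 * \<epsilon> * real (grid_index \<epsilon> x)"
proof -
  have "real (grid_index \<epsilon> x) = of_int \<lfloor>x / (2 * \<epsilon>)\<rfloor>"
    using assms by (simp add: grid_index_def)
  hence "real (grid_index \<epsilon> x) \<le> x / (2 * \<epsilon>)" "x / (2 * \<epsilon>) - 1 \<le> real (grid_index \<epsilon> x)" by linarith+
  thus ?th1 "x - 2 * \<epsilon> \<le> 2 * \<epsilon> * real (grid_index \<epsilon> x)"
    using assms by (simp_all add: field_simps)
qed

lemma eventually_small: "c > 0 \<Longrightarrow> eventually (\<lambda>\<epsilon>::real. 0 < \<epsilon> \<and> \<epsilon> < c) (at_right 0)"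
  using eventually_at_right_real[of 0 c] by (auto elim: eventually_mono)

lemma grid_index_tendsto:
  assumes "x \<ge> 0"
  shows "((\<lambda>\<epsilon>. 2 * \<epsilon> * (real (grid_index \<epsilon> x) + c)) \<longlongrightarrow> x) (at_right 0)"
proof -
  have id: "((\<lambda>\<epsilon>::real. \<epsilon>) \<longlongrightarrow> 0) (at_right 0)" by (rule tendsto_ident_at)
  have "((\<lambda>\<epsilon>. 2 * \<epsilon> * real (grid_index \<epsilon> x)) \<longlongrightarrow> x) (at_right 0)"
  proof (rule tendsto_sandwich)
    show "((\<lambda>\<epsilon>. x - 2 * \<epsilon>) \<longlongrightarrow> x) (at_right 0)"
      using tendsto_diff[OF tendsto_const tendsto_mult[OF tendsto_const id], of x 2] by simp
    show "((\<lambda>_. x) \<longlongrightarrow> x) (at_right 0)" by simp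
    show "\<forall>\<^sub>F \<epsilon> in at_right 0. x - 2 * \<epsilon> \<le> 2 * \<epsilon> * real (grid_index \<epsilon> x)"
      "\<forall>\<^sub>F \<epsilon> in at_right 0. 2 * \<epsilon> * real (grid_index \<epsilon> x) \<le> x"
      using eventually_small[OF zero_less_one] by (auto elim!: eventually_mono intro: grid_index_bounds[OF _ assms])
  qed
  from tendsto_add[OF this tendsto_mult[OF tendsto_mult[OF tendsto_const id] tendsto_const], of 2 c]
  show ?thesis by (simp add: algebra_simps)
qed

text \<open>The Mehler--Heine limit.  With \<open>N\<close> the cell number of \<open>x\<close>, so that \<open>2 \<epsilon> N\<close> tends to \<open>x\<close>, the sum of
  \<open>lag_sum_reindex\<close> tends term by term to the series of \<open>K_one_series\<close>, and the exponential prefactor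
  tends to one.  The terms are dominated by those of an exponential series.\<close>

theorem kern1_tendsto_K_one:
  assumes x: "x > 0" and s: "s = 1 \<or> s = -1"
  shows "((\<lambda>\<epsilon>. kern1 (grid_index \<epsilon> x + nat (- k)) (grid_index \<epsilon> x + nat k) (s * \<epsilon>) y e) \<longlongrightarrow> K_one (s * x) k y e) (at_right 0)"
proof -
  define q1 q2 where "q1 = nat (- k)" and "q2 = nat k"
  define \<alpha> \<beta> :: complex where "\<alpha> = of_real y + \<i> * of_real (s * e)" and "\<beta> = of_real (- y) + \<i> * of_real (s * e)"
  let ?N = "\<lambda>\<epsilon>. grid_index \<epsilon> x"
  let ?C = "\<lambda>r. \<alpha> ^ (r + q1) * \<beta> ^ (r + q2) / (fact (r + q1) * fact (r + q2))"
  let ?p = "\<lambda>r \<epsilon>. (\<Prod>j<r. 2 * \<epsilon> * (real (?N \<epsilon>) - real j)) * sqrt (\<Prod>j<q1 + q2. 2 * \<epsilon> * (real (?N \<epsilon>) + 1 + real j))"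
  have q: "q1 = 0 \<or> q2 = 0" by (auto simp: q1_def q2_def)
  have sgn: "sgn s = s" "\<bar>s\<bar> = 1" using s by auto
  have id: "((\<lambda>\<epsilon>::real. \<epsilon>) \<longlongrightarrow> 0) (at_right 0)" by (rule tendsto_ident_at)
  have K: "K_one (s * x) k y e = (\<Sum>\<^sub>\<infinity>r. of_real (x ^ r * sqrt (x ^ (q1 + q2))) * ?C r)"
  proof -
    have e1: "sqrt \<bar>s * x\<bar> = sqrt x" "sgn (s * x) * e = s * e"
      using x sgn by (simp_all add: abs_mult sgn_mult)
    have p: "sqrt x ^ (r + q1) * sqrt x ^ (r + q2) = x ^ r * sqrt (x ^ (q1 + q2))" for r
    proof -
      have "sqrt x ^ (r + q1) * sqrt x ^ (r + q2) = (sqrt x * sqrt x) ^ r * sqrt x ^ (q1 + q2)"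
        by (simp only: power_add power_mult_distrib mult_ac)
      thus ?thesis using x by (simp add: real_sqrt_power)
    qed
    have "(of_real (sqrt x) * \<alpha>) ^ (r + q1) * (of_real (sqrt x) * \<beta>) ^ (r + q2) / (fact (r + q1) * fact (r + q2))
       = of_real (sqrt x ^ (r + q1) * sqrt x ^ (r + q2)) * ?C r" for r
      by (simp add: power_mult_distrib)
    thus ?thesis
      unfolding K_one_series e1 q1_def[symmetric] q2_def[symmetric] \<alpha>_def[symmetric] \<beta>_def[symmetric] p
      by simp
  qed
  have lim: "((\<lambda>\<epsilon>. \<Sum>\<^sub>\<infinity>r. of_real (?p r \<epsilon>) * ?C r) \<longlongrightarrow> (\<Sum>\<^sub>\<infinity>r. of_real (x ^ r * sqrt (x ^ (q1 + q2))) * ?C r)) (at_right 0)"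
  proof (rule tendsto_infsum_dominated)
    show "((\<lambda>\<epsilon>. of_real (?p r \<epsilon>) * ?C r) \<longlongrightarrow> of_real (x ^ r * sqrt (x ^ (q1 + q2))) * ?C r) (at_right 0)" for r
    proof -
      have "((\<lambda>\<epsilon>. \<Prod>j<r. 2 * \<epsilon> * (real (?N \<epsilon>) - real j)) \<longlongrightarrow> (\<Prod>j<r. x)) (at_right 0)"
        using grid_index_tendsto[of x "- real j" for j] x by (intro tendsto_prod) simp
      moreover have "((\<lambda>\<epsilon>. \<Prod>j<q1 + q2. 2 * \<epsilon> * (real (?N \<epsilon>) + 1 + real j)) \<longlongrightarrow> (\<Prod>j<q1 + q2. x)) (at_right 0)"
        using grid_index_tendsto[of x "1 + real j" for j] x by (intro tendsto_prod) (simp add: add.assoc)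
      ultimately show ?thesis by (intro tendsto_intros) simp_all
    qed
    \<comment> \<open>A bound, valid for \<open>\<epsilon> < 1\<close>, for all factors of the products in \<open>?p\<close> that can occur in a nonzero term.\<close>
    define X where "X = x + 2 * (1 + real (q1 + q2))"
    have X: "X \<ge> 1" "X \<ge> x" using x by (auto simp: X_def)
    define M where "M = (\<lambda>r. X ^ r * sqrt (X ^ (q1 + q2)) * norm (?C r))"
    show "\<forall>\<^sub>F \<epsilon> in at_right 0. \<forall>r. norm (of_real (?p r \<epsilon>) * ?C r) \<le> M r"
      using eventually_small[OF zero_less_one]
    proof (eventually_elim, intro allI)
      fix \<epsilon> :: real and r :: nat assume e: "0 < \<epsilon> \<and> \<epsilon> < 1"
      have N: "2 * \<epsilon> * real (?N \<epsilon>) \<le> x" using grid_index_bounds(1)[of \<epsilon> x] e x by simp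
      have "\<bar>\<Prod>j<r. 2 * \<epsilon> * (real (?N \<epsilon>) - real j)\<bar> \<le> X ^ r"
      proof (cases "r \<le> ?N \<epsilon>")
        case True
        have "\<bar>\<Prod>j<r. 2 * \<epsilon> * (real (?N \<epsilon>) - real j)\<bar> \<le> (\<Prod>j<r. X)"
          unfolding abs_prod
        proof (rule prod_mono)
          fix j assume "j \<in> {..<r}"
          hence j: "0 \<le> real (?N \<epsilon>) - real j" using True by auto
          have "2 * \<epsilon> * (real (?N \<epsilon>) - real j) \<le> 2 * \<epsilon> * real (?N \<epsilon>)"
            using e by (intro mult_left_mono) auto
          hence le: "2 * \<epsilon> * (real (?N \<epsilon>) - real j) \<le> X" using N X by linarith
          have "0 \<le> 2 * \<epsilon> * (real (?N \<epsilon>) - real j)" using j e by simp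
          with le have "\<bar>2 * \<epsilon> * (real (?N \<epsilon>) - real j)\<bar> \<le> X" by (simp only: abs_of_nonneg)
          thus "0 \<le> \<bar>2 * \<epsilon> * (real (?N \<epsilon>) - real j)\<bar> \<and> \<bar>2 * \<epsilon> * (real (?N \<epsilon>) - real j)\<bar> \<le> X" by simp
        qed
        thus ?thesis by simp
      next
        case False
        hence z: "(\<Prod>j<r. 2 * \<epsilon> * (real (?N \<epsilon>) - real j)) = 0" by (intro prod_zero) auto
        show ?thesis unfolding z using X by simp
      qed
      moreover have "\<bar>sqrt (\<Prod>j<q1 + q2. 2 * \<epsilon> * (real (?N \<epsilon>) + 1 + real j))\<bar> \<le> sqrt (X ^ (q1 + q2))"
      proof -
        have "(\<Prod>j<q1 + q2. 2 * \<epsilon> * (real (?N \<epsilon>) + 1 + real j)) \<le> (\<Prod>j<q1 + q2. X)"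
        proof (rule prod_mono)
          fix j assume j: "j \<in> {..<q1 + q2}"
          have 0: "0 \<le> 2 * \<epsilon> * (real (?N \<epsilon>) + 1 + real j)" using e by simp
          have "\<epsilon> * (1 + real j) \<le> 1 * (1 + real (q1 + q2))" using e j by (intro mult_mono) auto
          hence "2 * \<epsilon> * (real (?N \<epsilon>) + 1 + real j) \<le> X" using N by (simp add: X_def algebra_simps)
          with 0 show "0 \<le> 2 * \<epsilon> * (real (?N \<epsilon>) + 1 + real j) \<and> 2 * \<epsilon> * (real (?N \<epsilon>) + 1 + real j) \<le> X" ..
        qed
        moreover have "0 \<le> (\<Prod>j<q1 + q2. 2 * \<epsilon> * (real (?N \<epsilon>) + 1 + real j))"
          using e by (intro prod_nonneg) auto
        ultimately show ?thesis by simp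
      qed
      ultimately have "\<bar>?p r \<epsilon>\<bar> \<le> X ^ r * sqrt (X ^ (q1 + q2))"
        unfolding abs_mult using X by (intro mult_mono) auto
      thus "norm (of_real (?p r \<epsilon>) * ?C r) \<le> M r"
        unfolding M_def norm_mult norm_of_real by (rule mult_right_mono) simp
    qed
    define R where "R = norm \<alpha> * norm \<beta> * X"
    have "(\<lambda>r. norm (of_real R ^ r / fact r :: complex)) summable_on UNIV" by (rule exp_infsum(1))
    hence "(\<lambda>r. (sqrt (X ^ (q1 + q2)) * norm \<alpha> ^ q1 * norm \<beta> ^ q2) * norm (of_real R ^ r / fact r :: complex)) summable_on UNIV"
      by (rule summable_on_cmult_right)
    thus "M summable_on UNIV"
    proof (rule summable_on_comparison_test)
      fix r
      have R: "R \<ge> 0" using X by (simp add: R_def)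
      have f: "(fact r :: real) \<le> fact (r + q1) * fact (r + q2)"
      proof -
        have "(fact r :: real) * 1 \<le> fact (r + q1) * fact (r + q2)"
          by (intro mult_mono fact_mono) (auto simp: fact_ge_1)
        thus ?thesis by simp
      qed
      have "M r = (sqrt (X ^ (q1 + q2)) * norm \<alpha> ^ q1 * norm \<beta> ^ q2) * (R ^ r / (fact (r + q1) * fact (r + q2)))"
        by (simp add: M_def R_def norm_mult norm_divide norm_power power_add power_mult_distrib mult_ac)
      also have "\<dots> \<le> (sqrt (X ^ (q1 + q2)) * norm \<alpha> ^ q1 * norm \<beta> ^ q2) * (R ^ r / fact r)"
        using R X f by (intro mult_left_mono divide_left_mono) auto
      also have "R ^ r / fact r = norm (of_real R ^ r / fact r :: complex)"
        using R by (simp add: norm_divide norm_power)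
      finally show "M r \<le> (sqrt (X ^ (q1 + q2)) * norm \<alpha> ^ q1 * norm \<beta> ^ q2) * norm (of_real R ^ r / fact r :: complex)" .
      show "0 \<le> M r" using X by (simp add: M_def)
    qed
  qed simp
  have pref: "((\<lambda>\<epsilon>. exp (of_real \<epsilon> * (\<alpha> * \<beta>))) \<longlongrightarrow> exp (of_real 0 * (\<alpha> * \<beta>))) (at_right 0)"
    by (intro tendsto_intros id)
  have "((\<lambda>\<epsilon>. exp (of_real \<epsilon> * (\<alpha> * \<beta>)) * (\<Sum>\<^sub>\<infinity>r. of_real (?p r \<epsilon>) * ?C r)) \<longlongrightarrow> exp (of_real 0 * (\<alpha> * \<beta>)) * K_one (s * x) k y e) (at_right 0)"
    unfolding K by (rule tendsto_mult[OF pref lim])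
  hence L: "((\<lambda>\<epsilon>. exp (of_real \<epsilon> * (\<alpha> * \<beta>)) * (\<Sum>\<^sub>\<infinity>r. of_real (?p r \<epsilon>) * ?C r)) \<longlongrightarrow> K_one (s * x) k y e) (at_right 0)"
    by simp
  have "eventually (\<lambda>\<epsilon>. exp (of_real \<epsilon> * (\<alpha> * \<beta>)) * (\<Sum>\<^sub>\<infinity>r. of_real (?p r \<epsilon>) * ?C r)
      = kern1 (grid_index \<epsilon> x + nat (- k)) (grid_index \<epsilon> x + nat k) (s * \<epsilon>) y e) (at_right 0)"
    using eventually_small[OF zero_less_one]
  proof eventually_elim
    fix \<epsilon> :: real assume e: "0 < \<epsilon> \<and> \<epsilon> < 1"
    have am: "amp (s * \<epsilon>) y e = of_real (sqrt (2 * \<epsilon>)) * \<alpha>" "amp (s * \<epsilon>) (- y) e = of_real (sqrt (2 * \<epsilon>)) * \<beta>"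
      using e sgn by (simp_all add: amp_def \<alpha>_def \<beta>_def abs_mult sgn_mult)
    have "of_real (sqrt (2 * \<epsilon>)) * of_real (sqrt (2 * \<epsilon>)) = (of_real (2 * \<epsilon>) :: complex)"
      using e by (simp only: of_real_mult[symmetric]) simp
    hence "(of_real (sqrt (2 * \<epsilon>)) * \<alpha>) * (of_real (sqrt (2 * \<epsilon>)) * \<beta>) / 2 = of_real (2 * \<epsilon>) * (\<alpha> * \<beta>) / 2"
      by (metis mult.assoc mult.left_commute)
    hence ab: "(of_real (sqrt (2 * \<epsilon>)) * \<alpha>) * (of_real (sqrt (2 * \<epsilon>)) * \<beta>) / 2 = of_real \<epsilon> * (\<alpha> * \<beta>)" by simp
    have e2: "0 \<le> 2 * \<epsilon>" using e by simp
    show "exp (of_real \<epsilon> * (\<alpha> * \<beta>)) * (\<Sum>\<^sub>\<infinity>r. of_real (?p r \<epsilon>) * ?C r)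
      = kern1 (grid_index \<epsilon> x + nat (- k)) (grid_index \<epsilon> x + nat k) (s * \<epsilon>) y e"
      unfolding kern1_def lag_def am ab q1_def[symmetric] q2_def[symmetric]
        lag_sum_reindex[OF q e2, symmetric] by simp
  qed
  from Lim_transform_eventually[OF L this] show ?thesis .
qed

section \<open>Rapid decay on the frequency space\<close>

abbreviation raise_coeff :: "nat^'d \<Rightarrow> nat^'d \<Rightarrow> 'd \<Rightarrow> complex" where
  "raise_coeff n m j \<equiv> of_real (sqrt ((real (n $ j) + 1) * (real (m $ j) + 1)))"

abbreviation lower_coeff :: "nat^'d \<Rightarrow> nat^'d \<Rightarrow> 'd \<Rightarrow> complex" where
  "lower_coeff n m j \<equiv> of_real (sqrt (real (n $ j) * real (m $ j)))"

text \<open>The decay which the semi-norms impose on a test function and on its images under \<open>hat_D\<close> and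
  \<open>hat_Sigma0\<close>.\<close>

definition rapid :: "(nat^'d::finite \<Rightarrow> nat^'d \<Rightarrow> real \<Rightarrow> complex) \<Rightarrow> bool" where
  "rapid \<theta> \<longleftrightarrow> (\<forall>N. \<exists>C. \<forall>n m l. l \<noteq> 0 \<longrightarrow> (1 + hat_d0 n m l) ^ N * norm (\<theta> n m l) \<le> C)"

text \<open>A summable weight on pairs of one-dimensional indices.  As \<open>t\<close> tends to \<open>0\<close> its sum grows like \<open>1 / t\<close>
  only, which the density \<open>\<bar>\<lambda>\<bar>\<close> compensates.\<close>

definition cell_weight :: "real \<Rightarrow> nat \<times> nat \<Rightarrow> real" where
  "cell_weight t p = 1 / ((1 + t * (real (fst p) + real (snd p)))\<^sup>2 * (1 + \<bar>real (snd p) - real (fst p)\<bar>)\<^sup>2)"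

lemma cell_weight_nonneg: "cell_weight t p \<ge> 0"
  by (simp add: cell_weight_def)

text \<open>Comparison with the telescoping series of \<open>1 / (t a) - 1 / (t b) = 1 / (a b)\<close> for consecutive
  \<open>a\<close> and \<open>b\<close>.\<close>

lemma inverse_square_partial_sum:
  assumes t: "t > 0"
  shows "(\<Sum>n\<le>N. 1 / (1 + t * real n)\<^sup>2) \<le> 1 + 1 / t - 1 / (t * (1 + t * real N))"
proof (induction N)
  case (Suc N)
  let ?a = "1 + t * real N" and ?b = "1 + t * real (Suc N)"
  have a: "?a > 0" "?b > 0" "?a \<le> ?b" using t by (auto simp: add_pos_nonneg algebra_simps)
  have ba: "?b - ?a = t" by (simp add: algebra_simps)
  have "1 / ?b\<^sup>2 \<le> 1 / (?a * ?b)"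
    using a by (intro divide_left_mono) (auto simp: power2_eq_square intro: mult_right_mono)
  also have "\<dots> = (?b - ?a) / (t * (?a * ?b))" unfolding ba using t by simp
  also have "\<dots> = 1 / (t * ?a) - 1 / (t * ?b)"
  proof -
    have "(y - x) / (t * (x * y)) = 1 / (t * x) - 1 / (t * y)" if "x > 0" "y > 0" for x y :: real
      using that t by (simp add: field_simps)
    thus ?thesis using a by blast
  qed
  finally have "1 / ?b\<^sup>2 \<le> 1 / (t * ?a) - 1 / (t * ?b)" .
  moreover have "(\<Sum>n\<le>Suc N. 1 / (1 + t * real n)\<^sup>2) = (\<Sum>n\<le>N. 1 / (1 + t * real n)\<^sup>2) + 1 / ?b\<^sup>2" by simp
  ultimately show ?case using Suc.IH by linarith
qed simp

lemma inverse_square_sum: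
  assumes t: "t > 0"
  shows "(\<lambda>n::nat. 1 / (1 + t * real n)\<^sup>2) summable_on UNIV" (is ?th1)
    and "(\<Sum>\<^sub>\<infinity>n::nat. 1 / (1 + t * real n)\<^sup>2) \<le> 1 + 1 / t" (is ?th2)
proof -
  have le: "(\<Sum>n\<in>F. 1 / (1 + t * real n)\<^sup>2) \<le> 1 + 1 / t" if F: "finite F" for F
  proof -
    obtain N where N: "F \<subseteq> {..N}" using F finite_nat_iff_bounded_le by blast
    have "(\<Sum>n\<in>F. 1 / (1 + t * real n)\<^sup>2) \<le> (\<Sum>n\<le>N. 1 / (1 + t * real n)\<^sup>2)"
      by (rule sum_mono2) (use N in auto)
    also have "\<dots> \<le> 1 + 1 / t - 1 / (t * (1 + t * real N))" by (rule inverse_square_partial_sum[OF t])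
    also have "\<dots> \<le> 1 + 1 / t" using t by simp
    finally show ?thesis .
  qed
  show s: ?th1
    by (rule nonneg_bdd_above_summable_on) (use le in \<open>auto intro!: bdd_aboveI[of _ "1 + 1 / t"]\<close>)
  show ?th2
    by (rule infsum_le_finite_sums[OF s]) (use le in auto)
qed

lemma inverse_square_sum_int: "(\<lambda>k::int. 1 / (1 + \<bar>real_of_int k\<bar>)\<^sup>2) summable_on UNIV"
proof -
  have s: "(\<lambda>n::nat. 1 / (1 + real n)\<^sup>2) summable_on UNIV" using inverse_square_sum(1)[of 1] by simp
  have "(\<lambda>k::int. 1 / (1 + \<bar>real_of_int k\<bar>)\<^sup>2) summable_on range int"
    by (subst summable_on_reindex) (use s in \<open>simp_all add: o_def\<close>)
  moreover have "(\<lambda>k::int. 1 / (1 + \<bar>real_of_int k\<bar>)\<^sup>2) summable_on range (\<lambda>n. - int n)"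
    by (subst summable_on_reindex) (use s in \<open>simp_all add: o_def inj_on_def\<close>)
  ultimately have "(\<lambda>k::int. 1 / (1 + \<bar>real_of_int k\<bar>)\<^sup>2) summable_on (range int \<union> range (\<lambda>n. - int n))"
    by (rule summable_on_union)
  moreover have "range int \<union> range (\<lambda>n. - int n) = UNIV"
  proof -
    have "k \<in> range int \<union> range (\<lambda>n. - int n)" for k
      by (cases "k \<ge> 0") (auto intro: image_eqI[of _ _ "nat k"] image_eqI[of _ _ "nat (- k)"])
    thus ?thesis by blast
  qed
  ultimately show ?thesis by simp
qed

definition int_weight_sum :: real where
  "int_weight_sum = (\<Sum>\<^sub>\<infinity>k::int. 1 / (1 + \<bar>real_of_int k\<bar>)\<^sup>2)"

lemma int_weight_sum_nonneg: "int_weight_sum \<ge> 0"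
  unfolding int_weight_sum_def by (rule infsum_nonneg) simp

text \<open>In the variables \<open>n\<close> and \<open>m - n\<close> the weight is bounded by a product.\<close>

lemma cell_weight_sum:
  assumes t: "t > 0"
  shows "cell_weight t summable_on UNIV" and "infsum (cell_weight t) UNIV \<le> int_weight_sum * (1 + 1 / t)" (is ?th2)
proof -
  let ?f = "\<lambda>n::nat. 1 / (1 + t * real n)\<^sup>2" and ?g = "\<lambda>k::int. 1 / (1 + \<bar>real_of_int k\<bar>)\<^sup>2"
  let ?h = "\<lambda>p. (fst p, int (snd p) - int (fst p))"
  have inj: "inj ?h" by (auto simp: inj_on_def prod_eq_iff)
  have fg: "(\<lambda>n. norm (?f n)) summable_on UNIV" "(\<lambda>k. norm (?g k)) summable_on UNIV"
    using inverse_square_sum(1)[OF t] inverse_square_sum_int by simp_all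
  have prod: "(\<lambda>q. ?f (fst q) * ?g (snd q)) summable_on UNIV"
    by (rule abs_summable_summable[OF infsum_times(1)[OF fg]])
  have r: "(\<lambda>q. ?f (fst q) * ?g (snd q)) summable_on range ?h"
    by (rule summable_on_subset_banach[OF prod]) simp
  hence rs: "(\<lambda>p. ?f (fst p) * ?g (int (snd p) - int (fst p))) summable_on UNIV"
    by (subst (asm) summable_on_reindex[OF inj]) (simp add: o_def)
  have le: "cell_weight t p \<le> ?f (fst p) * ?g (int (snd p) - int (fst p))" for p
  proof -
    have "(1 + t * real (fst p))\<^sup>2 \<le> (1 + t * (real (fst p) + real (snd p)))\<^sup>2"
      using t by (intro power_mono) (auto simp: algebra_simps)
    hence "1 / ((1 + t * (real (fst p) + real (snd p)))\<^sup>2 * (1 + \<bar>real (snd p) - real (fst p)\<bar>)\<^sup>2)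
        \<le> 1 / ((1 + t * real (fst p))\<^sup>2 * (1 + \<bar>real (snd p) - real (fst p)\<bar>)\<^sup>2)"
      using t by (intro divide_left_mono mult_right_mono mult_pos_pos zero_less_power) (auto simp: add_pos_nonneg)
    thus ?thesis by (simp add: cell_weight_def)
  qed
  show s: "cell_weight t summable_on UNIV"
    by (rule summable_on_comparison_test[OF rs]) (use le cell_weight_nonneg in auto)
  have "infsum (cell_weight t) UNIV \<le> (\<Sum>\<^sub>\<infinity>p. ?f (fst p) * ?g (int (snd p) - int (fst p)))"
    by (rule infsum_mono[OF s rs]) (rule le)
  also have "\<dots> = infsum (\<lambda>q. ?f (fst q) * ?g (snd q)) (range ?h)"
    by (subst infsum_reindex[OF inj]) (simp add: o_def)
  also have "\<dots> \<le> infsum (\<lambda>q. ?f (fst q) * ?g (snd q)) UNIV"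
    by (rule infsum_mono_neutral[OF r prod]) auto
  also have "\<dots> = infsum ?f UNIV * int_weight_sum"
    unfolding int_weight_sum_def by (rule infsum_times(2)[OF fg])
  also have "\<dots> \<le> (1 + 1 / t) * int_weight_sum"
    by (intro mult_right_mono inverse_square_sum(2)[OF t] int_weight_sum_nonneg)
  finally show ?th2 by (simp add: mult.commute)
qed

lemma infsum_vec_pair_prod:
  fixes f :: "nat \<times> nat \<Rightarrow> real"
  assumes nn: "\<And>p. f p \<ge> 0" and s: "f summable_on UNIV"
  shows "(\<lambda>p::(nat^'d::finite) \<times> (nat^'d). \<Prod>j\<in>UNIV. f (fst p $ j, snd p $ j)) summable_on UNIV"
    and "(\<Sum>\<^sub>\<infinity>p::(nat^'d) \<times> (nat^'d). \<Prod>j\<in>UNIV. f (fst p $ j, snd p $ j)) = infsum f UNIV ^ CARD('d)" (is ?th2)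
proof -
  let ?h = "\<lambda>p::(nat^'d) \<times> (nat^'d). \<chi> j. (fst p $ j, snd p $ j)"
  have bij: "bij_betw ?h UNIV UNIV"
    by (rule bij_betwI[of _ _ _ "\<lambda>v. (\<chi> j. fst (v $ j), \<chi> j. snd (v $ j))"]) (auto simp: vec_eq_iff)
  note V = infsum_vec_prod[where f = "\<lambda>_::'d. f", OF nn s]
  show "(\<lambda>p::(nat^'d) \<times> (nat^'d). \<Prod>j\<in>UNIV. f (fst p $ j, snd p $ j)) summable_on UNIV"
    using V(1) summable_on_reindex_bij_betw[OF bij, of "\<lambda>v. \<Prod>j\<in>UNIV. f (v $ j)"] by simp
  show ?th2
    using V(2) infsum_reindex_bij_betw[OF bij, of "\<lambda>v. \<Prod>j\<in>UNIV. f (v $ j)"] by simp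
qed

definition grid_weight :: "real \<Rightarrow> (nat^'d::finite) \<times> (nat^'d) \<Rightarrow> real" where
  "grid_weight t p = (\<Prod>j\<in>UNIV. cell_weight t (fst p $ j, snd p $ j))"

lemma grid_weight_nonneg: "grid_weight t p \<ge> 0"
  unfolding grid_weight_def by (intro prod_nonneg) (simp add: cell_weight_nonneg)

lemma grid_weight_sum:
  assumes t: "t > 0"
  shows "(grid_weight t :: (nat^'d::finite) \<times> (nat^'d) \<Rightarrow> real) summable_on UNIV" (is ?th1)
    and "infsum (grid_weight t :: (nat^'d::finite) \<times> (nat^'d) \<Rightarrow> real) UNIV \<le> (int_weight_sum * (1 + 1 / t)) ^ CARD('d)" (is ?th2)
proof -
  note c = infsum_vec_pair_prod[OF cell_weight_nonneg cell_weight_sum(1)[OF t], where 'd = 'd]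
  show ?th1
    using c(1) by (simp add: grid_weight_def[abs_def])
  show ?th2
    using c(2) by (simp add: grid_weight_def[abs_def] power_mono[OF cell_weight_sum(2)[OF t]] infsum_nonneg cell_weight_nonneg)
qed

text \<open>In each coordinate two powers of \<open>w\<close> pay for the sum of the indices and two for their difference.\<close>

lemma power_weight_le:
  fixes n m :: "nat^'d::finite"
  assumes t: "t \<ge> 0"
    and w: "\<And>j. 1 + t * (real (n $ j) + real (m $ j)) \<le> w" "\<And>j. 1 + \<bar>real (m $ j) - real (n $ j)\<bar> \<le> w"
  shows "1 \<le> grid_weight t (n, m) * w ^ (4 * CARD('d))"
proof -
  have pos: "1 + t * (real (n $ j) + real (m $ j)) > 0" for j using t by (simp add: add_pos_nonneg)
  have "grid_weight t (n, m) * w ^ (4 * CARD('d)) = (\<Prod>j\<in>UNIV. cell_weight t (n $ j, m $ j) * w ^ 4)"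
    by (simp add: grid_weight_def prod.distrib power_mult)
  also have "\<dots> \<ge> (\<Prod>j\<in>(UNIV::'d set). 1)"
  proof (rule prod_mono)
    fix j :: 'd
    have "(1 + t * (real (n $ j) + real (m $ j)))\<^sup>2 * (1 + \<bar>real (m $ j) - real (n $ j)\<bar>)\<^sup>2 \<le> w\<^sup>2 * w\<^sup>2"
      using w[of j] pos[of j] by (intro mult_mono power_mono) auto
    also have "\<dots> = w ^ 4" by (simp add: power_add[symmetric])
    finally have "(1 + t * (real (n $ j) + real (m $ j)))\<^sup>2 * (1 + \<bar>real (m $ j) - real (n $ j)\<bar>)\<^sup>2 \<le> w ^ 4" .
    moreover have "(1 + t * (real (n $ j) + real (m $ j)))\<^sup>2 * (1 + \<bar>real (m $ j) - real (n $ j)\<bar>)\<^sup>2 > 0"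
      using pos[of j] by (intro mult_pos_pos zero_less_power) auto
    ultimately show "0 \<le> (1::real) \<and> 1 \<le> cell_weight t (n $ j, m $ j) * w ^ 4"
      by (simp add: cell_weight_def)
  qed
  finally show ?thesis by simp
qed

lemma hat_d0_ge:
  fixes n m :: "nat^'d::finite"
  shows "\<bar>l\<bar> * (real (n $ j) + real (m $ j)) \<le> hat_d0 n m l" (is ?th1)
    and "\<bar>real (m $ j) - real (n $ j)\<bar> \<le> hat_d0 n m l" (is ?th2)
    and "\<bar>l\<bar> \<le> hat_d0 n m l" and "0 \<le> hat_d0 n m l"
    and "\<bar>l\<bar> * (\<Sum>j\<in>UNIV. real (n $ j) + real (m $ j)) \<le> hat_d0 n m l"
proof -
  let ?S = "\<Sum>j\<in>UNIV. real (n $ j) + real (m $ j)" and ?K = "\<Sum>j\<in>UNIV. \<bar>real (m $ j) - real (n $ j)\<bar>"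
  have S: "real (n $ j) + real (m $ j) \<le> ?S" for j by (rule member_le_sum) auto
  have S0: "0 \<le> ?S" by (intro sum_nonneg) auto
  have K: "\<bar>real (m $ j) - real (n $ j)\<bar> \<le> ?K" for j by (rule member_le_sum) auto
  have K0: "0 \<le> ?K" by (intro sum_nonneg) auto
  have l: "\<bar>l\<bar> * ?S \<ge> 0" using S0 by simp
  have D: "real CARD('d) \<ge> 1" by (simp add: Suc_leI)
  have lD: "\<bar>l\<bar> * 1 \<le> \<bar>l\<bar> * real CARD('d)" by (intro mult_left_mono D) simp
  have e: "hat_d0 n m l = \<bar>l\<bar> * ?S + \<bar>l\<bar> * real CARD('d) + ?K" by (simp add: hat_d0_def distrib_left)
  have "\<bar>l\<bar> * (real (n $ j) + real (m $ j)) \<le> \<bar>l\<bar> * ?S" by (intro mult_left_mono S) simp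
  thus ?th1 using e K0 lD by linarith
  show ?th2 using e K[of j] l lD by linarith
  show "\<bar>l\<bar> \<le> hat_d0 n m l" using e K0 l lD by linarith
  thus "0 \<le> hat_d0 n m l" by linarith
  show "\<bar>l\<bar> * ?S \<le> hat_d0 n m l" using e K0 lD by linarith
qed

text \<open>Of the available decay, the power \<open>4 d\<close> makes the sum over \<open>(n, m)\<close> at most a multiple of
  \<open>(1 + 1 / \<bar>l\<bar>)\<^sup>d\<close>.  Multiplied by the density this is \<open>(1 + \<bar>l\<bar>)\<^sup>d\<close>, and a further power \<open>d + 2\<close> of
  \<open>1 + \<bar>l\<bar>\<close> leaves an integrable function of \<open>l\<close>.\<close>

lemma rapid_sum_bound:
  fixes \<theta> :: "nat^'d::finite \<Rightarrow> nat^'d \<Rightarrow> real \<Rightarrow> complex"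
  assumes "rapid \<theta>"
  obtains C where "C \<ge> 0"
    "\<And>l. l \<noteq> 0 \<Longrightarrow> (\<lambda>p. norm (\<theta> (fst p) (snd p) l)) summable_on UNIV"
    "\<And>l. l \<noteq> 0 \<Longrightarrow> (\<Sum>\<^sub>\<infinity>p. norm (\<theta> (fst p) (snd p) l)) * \<bar>l\<bar> ^ CARD('d) \<le> C / (1 + l\<^sup>2)"
proof -
  let ?D = "CARD('d)"
  obtain C0 where C0: "\<And>n m l. l \<noteq> 0 \<Longrightarrow> (1 + hat_d0 n m l) ^ (4 * ?D + (?D + 2)) * norm (\<theta> n m l) \<le> C0"
    using assms unfolding rapid_def by blast
  have C0': "C0 \<ge> 0"
  proof -
    have "0 \<le> 1 + hat_d0 (0 :: nat^'d) 0 1" using hat_d0_ge(4)[of "0 :: nat^'d" 0 1] by linarith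
    hence "0 \<le> (1 + hat_d0 (0 :: nat^'d) 0 1) ^ (4 * ?D + (?D + 2)) * norm (\<theta> 0 0 1)"
      by (intro mult_nonneg_nonneg zero_le_power norm_ge_zero)
    also have "\<dots> \<le> C0" by (rule C0) simp
    finally show ?thesis .
  qed
  have b: "norm (\<theta> n m l) \<le> C0 / (1 + \<bar>l\<bar>) ^ (?D + 2) * grid_weight \<bar>l\<bar> (n, m)" if l: "l \<noteq> 0" for n m l
  proof -
    let ?w = "1 + hat_d0 n m l"
    have w: "?w > 0" using hat_d0_ge(4)[of n m l] by linarith
    have "1 \<le> grid_weight \<bar>l\<bar> (n, m) * ?w ^ (4 * ?D)"
      by (rule power_weight_le) (auto intro: hat_d0_ge)
    hence "norm (\<theta> n m l) * 1 \<le> norm (\<theta> n m l) * (grid_weight \<bar>l\<bar> (n, m) * ?w ^ (4 * ?D))"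
      by (rule mult_left_mono) simp
    hence "(1 + \<bar>l\<bar>) ^ (?D + 2) * norm (\<theta> n m l) \<le> (1 + \<bar>l\<bar>) ^ (?D + 2) * (norm (\<theta> n m l) * (grid_weight \<bar>l\<bar> (n, m) * ?w ^ (4 * ?D)))"
      by (intro mult_left_mono) simp_all
    also have "\<dots> \<le> ?w ^ (?D + 2) * (norm (\<theta> n m l) * (grid_weight \<bar>l\<bar> (n, m) * ?w ^ (4 * ?D)))"
      using hat_d0_ge(3)[of l n m] w by (intro mult_right_mono power_mono mult_nonneg_nonneg grid_weight_nonneg) auto
    also have "\<dots> = grid_weight \<bar>l\<bar> (n, m) * (?w ^ (4 * ?D + (?D + 2)) * norm (\<theta> n m l))"
      unfolding power_add by (simp only: mult_ac)
    also have "\<dots> \<le> grid_weight \<bar>l\<bar> (n, m) * C0"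
      by (rule mult_left_mono[OF C0[OF l] grid_weight_nonneg])
    finally have f: "(1 + \<bar>l\<bar>) ^ (?D + 2) * norm (\<theta> n m l) \<le> grid_weight \<bar>l\<bar> (n, m) * C0" .
    have X: "(1 + \<bar>l\<bar>) ^ (?D + 2) > 0" by simp
    have "norm (\<theta> n m l) \<le> grid_weight \<bar>l\<bar> (n, m) * C0 / (1 + \<bar>l\<bar>) ^ (?D + 2)"
      unfolding pos_le_divide_eq[OF X] using f by (simp only: mult.commute)
    thus ?thesis by (metis mult.commute times_divide_eq_right)
  qed
  have s: "(\<lambda>p. C0 / (1 + \<bar>l\<bar>) ^ (?D + 2) * grid_weight \<bar>l\<bar> (p :: (nat^'d) \<times> (nat^'d))) summable_on UNIV" if "l \<noteq> 0" for l
  proof -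
    have "0 < \<bar>l\<bar>" using that by simp
    from grid_weight_sum(1)[OF this] show ?thesis by (rule summable_on_cmult_right)
  qed
  have sn: "(\<lambda>p. norm (\<theta> (fst p) (snd p) l)) summable_on UNIV" if l: "l \<noteq> 0" for l
  proof (rule summable_on_comparison_test[OF s[OF l]])
    fix p :: "(nat^'d) \<times> (nat^'d)"
    show "norm (\<theta> (fst p) (snd p) l) \<le> C0 / (1 + \<bar>l\<bar>) ^ (?D + 2) * grid_weight \<bar>l\<bar> p"
      using b[OF l, of "fst p" "snd p"] by (simp only: prod.collapse)
  qed simp
  have "(\<Sum>\<^sub>\<infinity>p. norm (\<theta> (fst p) (snd p) l)) * \<bar>l\<bar> ^ ?D \<le> C0 * int_weight_sum ^ ?D / (1 + l\<^sup>2)" if l: "l \<noteq> 0" for l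
  proof -
    let ?a = "1 + \<bar>l\<bar>"
    have "(\<Sum>\<^sub>\<infinity>p. norm (\<theta> (fst p) (snd p) l)) \<le> (\<Sum>\<^sub>\<infinity>p. C0 / ?a ^ (?D + 2) * grid_weight \<bar>l\<bar> (p :: (nat^'d) \<times> (nat^'d)))"
    proof (rule infsum_mono[OF sn[OF l] s[OF l]])
      fix p :: "(nat^'d) \<times> (nat^'d)"
      show "norm (\<theta> (fst p) (snd p) l) \<le> C0 / ?a ^ (?D + 2) * grid_weight \<bar>l\<bar> p"
        using b[OF l, of "fst p" "snd p"] by (simp only: prod.collapse)
    qed
    also have "\<dots> = C0 / ?a ^ (?D + 2) * infsum (grid_weight \<bar>l\<bar> :: (nat^'d) \<times> (nat^'d) \<Rightarrow> real) UNIV"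
      by (rule infsum_cmult_right')
    also have "\<dots> \<le> C0 / ?a ^ (?D + 2) * (int_weight_sum * (1 + 1 / \<bar>l\<bar>)) ^ ?D"
      using C0' l by (intro mult_left_mono grid_weight_sum(2)) auto
    finally have "(\<Sum>\<^sub>\<infinity>p. norm (\<theta> (fst p) (snd p) l)) * \<bar>l\<bar> ^ ?D
        \<le> C0 / ?a ^ (?D + 2) * (int_weight_sum * (1 + 1 / \<bar>l\<bar>)) ^ ?D * \<bar>l\<bar> ^ ?D"
      by (rule mult_right_mono) simp
    also have "\<dots> = C0 * int_weight_sum ^ ?D * (((1 + 1 / \<bar>l\<bar>) * \<bar>l\<bar>) ^ ?D / ?a ^ (?D + 2))"
      by (simp add: power_mult_distrib)
    also have "(1 + 1 / \<bar>l\<bar>) * \<bar>l\<bar> = ?a" using l by (simp add: field_simps)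
    also have "?a ^ ?D / ?a ^ (?D + 2) = 1 / ?a\<^sup>2"
      unfolding power_add by simp
    also have "C0 * int_weight_sum ^ ?D * (1 / ?a\<^sup>2) \<le> C0 * int_weight_sum ^ ?D * (1 / (1 + l\<^sup>2))"
    proof (rule mult_left_mono)
      have "1 + l\<^sup>2 \<le> ?a\<^sup>2" by (simp add: power2_eq_square algebra_simps)
      thus "1 / ?a\<^sup>2 \<le> 1 / (1 + l\<^sup>2)" by (intro divide_left_mono mult_pos_pos) (auto simp: add_pos_nonneg)
      show "0 \<le> C0 * int_weight_sum ^ ?D" using C0' int_weight_sum_nonneg by simp
    qed
    finally show ?thesis by simp
  qed
  with sn that[of "C0 * int_weight_sum ^ ?D"] C0' int_weight_sum_nonneg show ?thesis by simp
qed

definition size_weight :: "nat^'d::finite \<Rightarrow> nat^'d \<Rightarrow> real" where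
  "size_weight n m = 1 + (\<Sum>j\<in>UNIV. real (n $ j) + real (m $ j))"

lemma size_weight_ge_1: "size_weight n m \<ge> 1"
  unfolding size_weight_def by (simp add: sum_nonneg)

lemma size_weight_ge: "1 + (real (n $ j) + real (m $ j)) \<le> size_weight n m"
  unfolding size_weight_def by (intro add_mono member_le_sum[of j UNIV "\<lambda>j. real (n $ j) + real (m $ j)"]) auto

text \<open>When \<open>\<bar>l\<bar>\<close> stays away from zero and bounded, decay in \<open>hat_d0\<close> is decay in the indices,
  uniformly in \<open>l\<close>.  In this form it is stable under the shifts and the ladder coefficients that
  occur in \<open>hat_D\<close>.\<close>

definition rapid_away :: "real \<Rightarrow> real \<Rightarrow> (nat^'d::finite \<Rightarrow> nat^'d \<Rightarrow> real \<Rightarrow> complex) \<Rightarrow> bool" where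
  "rapid_away a b \<theta> \<longleftrightarrow> (\<forall>N. \<exists>C. \<forall>n m l. a \<le> \<bar>l\<bar> \<and> \<bar>l\<bar> \<le> b \<longrightarrow> size_weight n m ^ N * norm (\<theta> n m l) \<le> C)"

lemma rapid_away_rapid:
  assumes "rapid \<theta>" "a > 0"
  shows "rapid_away a b \<theta>"
  unfolding rapid_away_def
proof
  fix N
  obtain C where C: "\<And>n m l. l \<noteq> 0 \<Longrightarrow> (1 + hat_d0 n m l) ^ N * norm (\<theta> n m l) \<le> C"
    using assms unfolding rapid_def by blast
  define c where "c = min 1 a"
  have c: "c > 0" "c \<le> 1" "c \<le> a" using assms by (auto simp: c_def)
  have "size_weight n m ^ N * norm (\<theta> n m l) \<le> C / c ^ N" if l: "a \<le> \<bar>l\<bar>" for n m l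
  proof -
    let ?S = "\<Sum>j\<in>UNIV. real (n $ j) + real (m $ j)"
    have S0: "0 \<le> ?S" by (intro sum_nonneg) auto
    have "c * ?S \<le> \<bar>l\<bar> * ?S" using c l S0 by (intro mult_right_mono) auto
    hence "c * size_weight n m \<le> 1 + hat_d0 n m l"
      unfolding size_weight_def using hat_d0_ge(5)[of l n m] c by (simp add: distrib_left)
    hence "(c * size_weight n m) ^ N * norm (\<theta> n m l) \<le> (1 + hat_d0 n m l) ^ N * norm (\<theta> n m l)"
      using c size_weight_ge_1[of n m] by (intro mult_right_mono power_mono) auto
    also have "\<dots> \<le> C" by (rule C) (use l assms in auto)
    finally show ?thesis using c by (simp add: power_mult_distrib field_simps)
  qed
  thus "\<exists>C. \<forall>n m l. a \<le> \<bar>l\<bar> \<and> \<bar>l\<bar> \<le> b \<longrightarrow> size_weight n m ^ N * norm (\<theta> n m l) \<le> C" by blast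
qed

lemma rapid_away_summable:
  fixes \<theta> :: "nat^'d::finite \<Rightarrow> nat^'d \<Rightarrow> real \<Rightarrow> complex"
  assumes "rapid_away a b \<theta>"
  obtains M where "M summable_on (UNIV :: ((nat^'d) \<times> (nat^'d)) set)"
    "\<And>n m l. a \<le> \<bar>l\<bar> \<Longrightarrow> \<bar>l\<bar> \<le> b \<Longrightarrow> norm (\<theta> n m l) \<le> M (n, m)"
proof -
  obtain C where C: "\<And>n m l. a \<le> \<bar>l\<bar> \<Longrightarrow> \<bar>l\<bar> \<le> b \<Longrightarrow> size_weight n m ^ (4 * CARD('d)) * norm (\<theta> n m l) \<le> C"
    using assms unfolding rapid_away_def by blast
  have "norm (\<theta> n m l) \<le> C * grid_weight 1 (n, m)" if "a \<le> \<bar>l\<bar>" "\<bar>l\<bar> \<le> b" for n m l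
  proof -
    have "1 \<le> grid_weight 1 (n, m) * size_weight n m ^ (4 * CARD('d))"
    proof (rule power_weight_le)
      fix j
      show "1 + 1 * (real (n $ j) + real (m $ j)) \<le> size_weight n m" using size_weight_ge[of n j m] by simp
      show "1 + \<bar>real (m $ j) - real (n $ j)\<bar> \<le> size_weight n m" using size_weight_ge[of n j m] by linarith
    qed simp
    hence "norm (\<theta> n m l) * 1 \<le> norm (\<theta> n m l) * (grid_weight 1 (n, m) * size_weight n m ^ (4 * CARD('d)))"
      by (rule mult_left_mono) simp
    also have "\<dots> = grid_weight 1 (n, m) * (size_weight n m ^ (4 * CARD('d)) * norm (\<theta> n m l))"
      by (simp only: mult_ac)
    also have "\<dots> \<le> grid_weight 1 (n, m) * C"
      by (rule mult_left_mono[OF C[OF that] grid_weight_nonneg])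
    finally show ?thesis by (simp add: mult.commute)
  qed
  moreover have "(\<lambda>p :: (nat^'d) \<times> (nat^'d). C * grid_weight 1 p) summable_on UNIV"
    by (rule summable_on_cmult_right) (rule grid_weight_sum(1)[OF zero_less_one])
  ultimately show ?thesis using that by blast
qed

lemma rapid_away_family_summable:
  fixes F :: "'j \<Rightarrow> nat^'d::finite \<Rightarrow> nat^'d \<Rightarrow> real \<Rightarrow> complex"
  assumes "\<And>j. rapid_away a b (F j)"
  obtains M where "\<And>j. M j summable_on UNIV"
    "\<And>j n m l. a \<le> \<bar>l\<bar> \<Longrightarrow> \<bar>l\<bar> \<le> b \<Longrightarrow> norm (F j n m l) \<le> M j (n, m)"
proof -
  have "\<exists>M. M summable_on UNIV \<and> (\<forall>n m l. a \<le> \<bar>l\<bar> \<longrightarrow> \<bar>l\<bar> \<le> b \<longrightarrow> norm (F j n m l) \<le> M (n, m))" for j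
    by (rule rapid_away_summable[OF assms[of j]]) blast
  hence "\<exists>M. \<forall>j. M j summable_on UNIV \<and> (\<forall>n m l. a \<le> \<bar>l\<bar> \<longrightarrow> \<bar>l\<bar> \<le> b \<longrightarrow> norm (F j n m l) \<le> M j (n, m))"
    by (intro choice allI)
  thus ?thesis using that by blast
qed

text \<open>One power of the weight absorbs the coefficient, and the shift costs a constant factor.\<close>

lemma rapid_away_ladder:
  assumes \<theta>: "rapid_away a b \<theta>" and c: "\<And>n m. norm (c n m) \<le> size_weight n m"
    and fg: "\<And>n m. c n m \<noteq> 0 \<Longrightarrow> size_weight n m \<le> 3 * size_weight (f n) (g m)"
  shows "rapid_away a b (\<lambda>n m l. c n m * \<theta> (f n) (g m) l)"
  unfolding rapid_away_def
proof
  fix N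
  obtain C where C: "\<And>n m l. a \<le> \<bar>l\<bar> \<and> \<bar>l\<bar> \<le> b \<Longrightarrow> size_weight n m ^ Suc N * norm (\<theta> n m l) \<le> C"
    using \<theta> unfolding rapid_away_def by blast
  have "size_weight n m ^ N * norm (c n m * \<theta> (f n) (g m) l) \<le> 3 ^ Suc N * \<bar>C\<bar>"
    if l: "a \<le> \<bar>l\<bar> \<and> \<bar>l\<bar> \<le> b" for n m l
  proof (cases "c n m = 0")
    case False
    let ?w = "size_weight n m" and ?v = "size_weight (f n) (g m)"
    have "?w ^ N * (norm (c n m) * norm (\<theta> (f n) (g m) l)) \<le> (3 * ?v) ^ N * ((3 * ?v) * norm (\<theta> (f n) (g m) l))"
      using fg[OF False] order_trans[OF c fg[OF False]] size_weight_ge_1[of n m] size_weight_ge_1[of "f n" "g m"]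
      by (intro mult_mono power_mono) auto
    also have "\<dots> = 3 ^ Suc N * (?v ^ Suc N * norm (\<theta> (f n) (g m) l))" by (simp add: power_mult_distrib)
    also have "\<dots> \<le> 3 ^ Suc N * \<bar>C\<bar>" using C[OF l, of "f n" "g m"] by (intro mult_left_mono) auto
    finally show ?thesis by (simp add: norm_mult)
  qed simp
  thus "\<exists>C. \<forall>n m l. a \<le> \<bar>l\<bar> \<and> \<bar>l\<bar> \<le> b \<longrightarrow> size_weight n m ^ N * norm (c n m * \<theta> (f n) (g m) l) \<le> C" by blast
qed

lemma norm_raise_coeff_le: "norm (raise_coeff n m j) \<le> size_weight n m"
proof -
  have "sqrt ((real (n $ j) + 1) * (real (m $ j) + 1)) \<le> ((real (n $ j) + 1) + (real (m $ j) + 1)) / 2"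
    by (rule arith_geo_mean_sqrt) auto
  also have "\<dots> \<le> size_weight n m" using size_weight_ge[of n j m] by simp
  finally show ?thesis by simp
qed

lemma norm_lower_coeff_le: "norm (lower_coeff n m j) \<le> norm (raise_coeff n m j)"
proof -
  have "real (n $ j) * real (m $ j) \<le> (real (n $ j) + 1) * (real (m $ j) + 1)" by (intro mult_mono) auto
  thus ?thesis by simp
qed

lemma rapid_away_weight:
  assumes "rapid_away a b \<theta>"
  shows "rapid_away a b (\<lambda>n m l. raise_coeff n m j * \<theta> n m l)"
proof (rule rapid_away_ladder[OF assms norm_raise_coeff_le, of _ "\<lambda>n. n" "\<lambda>m. m"])
  show "size_weight n m \<le> 3 * size_weight n m" for n m :: "nat^'a" using size_weight_ge_1[of n m] by linarith
qed

lemma rapid_away_up: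
  assumes "rapid_away a b \<theta>"
  shows "rapid_away a b (\<lambda>n m l. raise_coeff n m j * \<theta> (n + axis j 1) (m + axis j 1) l)"
proof (rule rapid_away_ladder[OF assms norm_raise_coeff_le, of _ "\<lambda>n. n + axis j 1" "\<lambda>m. m + axis j 1"])
  fix n m :: "nat^'a"
  have "size_weight n m \<le> size_weight (n + axis j 1) (m + axis j 1)"
    unfolding size_weight_def by (intro add_left_mono sum_mono) simp
  thus "size_weight n m \<le> 3 * size_weight (n + axis j 1) (m + axis j 1)" using size_weight_ge_1[of n m] by linarith
qed

lemma rapid_away_down:
  assumes "rapid_away a b \<theta>"
  shows "rapid_away a b (\<lambda>n m l. lower_coeff n m j * \<theta> (n - axis j 1) (m - axis j 1) l)"
proof (rule rapid_away_ladder[OF assms order_trans[OF norm_lower_coeff_le norm_raise_coeff_le], of _ "\<lambda>n. n - axis j 1" "\<lambda>m. m - axis j 1"])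
  fix n m :: "nat^'a" assume nz: "lower_coeff n m j \<noteq> 0"
  let ?n = "n - axis j 1" and ?m = "m - axis j 1"
  \<comment> \<open>A nonzero coefficient forces both \<open>j\<close>-th components to be positive, so the truncated difference is exact.\<close>
  have "size_weight n m = 1 + (\<Sum>i\<in>UNIV. (real (?n $ i) + real (?m $ i)) + (if i = j then 2 else 0))"
    unfolding size_weight_def using nz
    by (intro arg_cong[of _ _ "(+) 1"] sum.cong) (auto simp: axis_def of_nat_diff)
  also have "\<dots> = size_weight ?n ?m + 2" unfolding size_weight_def by (simp add: sum.distrib)
  finally show "size_weight n m \<le> 3 * size_weight ?n ?m" using size_weight_ge_1[of ?n ?m] by linarith
qed

lemma infsum_shift_pair:
  fixes f :: "(nat^'d::finite) \<times> (nat^'d) \<Rightarrow> complex"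
  shows "(\<Sum>\<^sub>\<infinity>p. if fst p $ j = 0 \<or> snd p $ j = 0 then 0 else f (fst p - axis j 1, snd p - axis j 1)) = infsum f UNIV"
proof -
  let ?h = "\<lambda>p :: (nat^'d) \<times> (nat^'d). (fst p + axis j 1, snd p + axis j 1)"
  let ?g = "\<lambda>p. if fst p $ j = 0 \<or> snd p $ j = 0 then 0 else f (fst p - axis j 1, snd p - axis j 1)"
  have inj: "inj ?h" by (auto simp: inj_on_def prod_eq_iff)
  have "infsum ?g UNIV = infsum ?g (range ?h)"
  proof (rule infsum_cong_neutral)
    fix p assume p: "p \<in> UNIV - range ?h"
    have "fst p $ j = 0 \<or> snd p $ j = 0"
    proof (rule ccontr)
      assume "\<not> (fst p $ j = 0 \<or> snd p $ j = 0)"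
      hence "p = ?h (fst p - axis j 1, snd p - axis j 1)"
        by (auto simp: prod_eq_iff vec_eq_iff axis_def)
      hence "p \<in> range ?h" by (rule range_eqI)
      thus False using p by blast
    qed
    thus "?g p = 0" by simp
  qed auto
  also have "\<dots> = infsum (?g \<circ> ?h) UNIV" by (rule infsum_reindex[OF inj])
  also have "?g \<circ> ?h = f"
    by (auto simp: fun_eq_iff axis_def vec_eq_iff intro!: arg_cong[of _ _ f])
  finally show ?thesis .
qed

text \<open>Summation by parts for the diagonal shift in direction \<open>j\<close>: the shifted family is a rearrangement of
  the original one, extended by zero to the pairs that are not reached.\<close>

lemma shift_difference_has_sum:
  fixes f g :: "(nat^'d::finite) \<times> (nat^'d) \<Rightarrow> complex"
  assumes f: "(\<lambda>p. norm (f p)) summable_on UNIV" and g: "(\<lambda>p. norm (g p)) summable_on UNIV"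
    and shift: "\<And>p. g p = (if fst p $ j = 0 \<or> snd p $ j = 0 then 0 else f (fst p - axis j 1, snd p - axis j 1))"
  shows "((\<lambda>p. f p - g p) has_sum 0) UNIV"
proof -
  have "infsum g UNIV = infsum f UNIV" unfolding shift[abs_def] by (rule infsum_shift_pair)
  moreover have "(f has_sum infsum f UNIV) UNIV" "(g has_sum infsum g UNIV) UNIV"
    using f g by (auto intro: has_sum_infsum abs_summable_summable)
  hence "((\<lambda>p. f p + - g p) has_sum (infsum f UNIV + - infsum g UNIV)) UNIV"
    by (intro has_sum_add has_sum_uminus[THEN iffD2]) auto
  ultimately show ?thesis by simp
qed

section \<open>The frequency sum and its derivative\<close>

lemma has_vector_derivative_prod_family:
  fixes f :: "'i::finite \<Rightarrow> real \<Rightarrow> complex"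
  assumes "\<And>i. (f i has_vector_derivative f' i) (at x)"
  shows "((\<lambda>x. \<Prod>i\<in>UNIV. f i x) has_vector_derivative (\<Sum>i\<in>UNIV. f' i * (\<Prod>j\<in>UNIV - {i}. f j x))) (at x)"
proof -
  have "((\<lambda>x. \<Prod>i\<in>UNIV. f i x) has_derivative (\<lambda>y. \<Sum>i\<in>UNIV. y *\<^sub>R f' i * (\<Prod>j\<in>UNIV - {i}. f j x))) (at x)"
    using assms by (intro has_derivative_prod[where f' = "\<lambda>i y. y *\<^sub>R f' i"]) (simp add: has_vector_derivative_def)
  thus ?thesis unfolding has_vector_derivative_def by (simp add: scaleR_sum_right)
qed

lemma eventually_nonzero_nhds: "l \<noteq> 0 \<Longrightarrow> eventually (\<lambda>l'::real. l' \<noteq> 0) (nhds l)"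
  by (rule t1_space_nhds)

lemma W_kernel_has_derivative:
  fixes n m :: "nat^'d::finite"
  assumes l: "l \<noteq> 0"
  shows "((\<lambda>l. W_kernel n m l Y) has_vector_derivative (of_real (1 / (2 * l)) *
    (\<Sum>j\<in>UNIV. raise_coeff n m j * W_kernel (n + axis j 1) (m + axis j 1) l Y
       - lower_coeff n m j * W_kernel (n - axis j 1) (m - axis j 1) l Y
       - W_kernel n m l Y))) (at l)"
proof -
  define k where "k = (\<lambda>j a b l. kern1 a b l (fst Y $ j) (snd Y $ j))"
  let ?R = "\<lambda>j. \<Prod>i\<in>UNIV - {j}. k i (n $ i) (m $ i) l"
  let ?k' = "\<lambda>j. of_real (1 / (2 * l)) * (raise_coeff n m j * k j (n $ j + 1) (m $ j + 1) l
       - lower_coeff n m j * k j (n $ j - 1) (m $ j - 1) l - k j (n $ j) (m $ j) l)"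
  have split: "W_kernel n' m' l Y = k j (n' $ j) (m' $ j) l * ?R j"
    if "\<And>i. i \<noteq> j \<Longrightarrow> n' $ i = n $ i" "\<And>i. i \<noteq> j \<Longrightarrow> m' $ i = m $ i" for n' m' j
  proof -
    have "W_kernel n' m' l Y = k j (n' $ j) (m' $ j) l * (\<Prod>i\<in>UNIV - {j}. k i (n' $ i) (m' $ i) l)"
      unfolding W_kernel_prod[OF l] k_def by (rule prod.remove) auto
    also have "(\<Prod>i\<in>UNIV - {j}. k i (n' $ i) (m' $ i) l) = ?R j"
      using that by (intro prod.cong) auto
    finally show ?thesis .
  qed
  have "((\<lambda>l. \<Prod>j\<in>UNIV. k j (n $ j) (m $ j) l) has_vector_derivative (\<Sum>j\<in>UNIV. ?k' j * ?R j)) (at l)"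
    by (rule has_vector_derivative_prod_family) (use kern1_has_derivative[OF l] in \<open>simp add: k_def\<close>)
  moreover have "?k' j * ?R j = of_real (1 / (2 * l)) * (raise_coeff n m j * W_kernel (n + axis j 1) (m + axis j 1) l Y
       - lower_coeff n m j * W_kernel (n - axis j 1) (m - axis j 1) l Y
       - W_kernel n m l Y)" for j
  proof -
    have "W_kernel (n + axis j 1) (m + axis j 1) l Y = k j (n $ j + 1) (m $ j + 1) l * ?R j"
      using split[of j "n + axis j 1" "m + axis j 1"] by (simp add: axis_def)
    moreover have "W_kernel (n - axis j 1) (m - axis j 1) l Y = k j (n $ j - 1) (m $ j - 1) l * ?R j"
      using split[of j "n - axis j 1" "m - axis j 1"] by (simp add: axis_def)
    moreover have "W_kernel n m l Y = k j (n $ j) (m $ j) l * ?R j" by (rule split) auto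
    ultimately show ?thesis by (simp only: left_diff_distrib mult.assoc)
  qed
  ultimately have "((\<lambda>l. \<Prod>j\<in>UNIV. k j (n $ j) (m $ j) l) has_vector_derivative (of_real (1 / (2 * l)) *
    (\<Sum>j\<in>UNIV. raise_coeff n m j * W_kernel (n + axis j 1) (m + axis j 1) l Y
       - lower_coeff n m j * W_kernel (n - axis j 1) (m - axis j 1) l Y
       - W_kernel n m l Y))) (at l)"
    by (simp only: sum_distrib_left)
  thus ?thesis
    by (subst has_vector_derivative_cong_ev[where g = "\<lambda>l. \<Prod>j\<in>UNIV. k j (n $ j) (m $ j) l"])
       (use eventually_nonzero_nhds[OF l] l in \<open>auto simp: k_def W_kernel_prod elim: eventually_mono\<close>)
qed

lemma abs_power_has_derivative:
  assumes l: "l \<noteq> 0"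
  shows "((\<lambda>l. of_real (\<bar>l\<bar> ^ D) :: complex) has_vector_derivative (of_real (real D / l * \<bar>l\<bar> ^ D))) (at l)"
proof -
  have sl: "sgn l * l = \<bar>l\<bar>" by (simp add: abs_sgn)
  have "((\<lambda>l'. (sgn l * l') ^ D) has_real_derivative (real D * (sgn l * l) ^ (D - 1) * sgn l)) (at l)"
    by (auto intro!: derivative_eq_intros)
  also have "real D * (sgn l * l) ^ (D - 1) * sgn l = real D / l * \<bar>l\<bar> ^ D"
    using l unfolding sl by (cases D; cases l "0::real" rule: linorder_cases) auto
  finally have "((\<lambda>l'. of_real ((sgn l * l') ^ D) :: complex) has_vector_derivative (of_real (real D / l * \<bar>l\<bar> ^ D))) (at l)"
    by (rule has_vector_derivative_of_real)
  moreover have "eventually (\<lambda>l'. of_real ((sgn l * l') ^ D) = (of_real (\<bar>l'\<bar> ^ D) :: complex)) (nhds l)"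
  proof -
    have "open {l'. 0 < l' * l}" by (intro open_Collect_less continuous_intros)
    hence "eventually (\<lambda>l'. l' \<in> {l'. 0 < l' * l}) (nhds l)"
      using assms by (intro eventually_nhds_in_open) (auto simp: zero_less_mult_iff linorder_neq_iff)
    thus ?thesis by eventually_elim (auto simp: sgn_if zero_less_mult_iff)
  qed
  ultimately show ?thesis
    by (subst has_vector_derivative_cong_ev[where g = "\<lambda>l'. of_real ((sgn l * l') ^ D)"])
       (auto elim: eventually_mono dest: eventually_nhds_x_imp_x)
qed

abbreviation freq_term ::
  "(nat^'d::finite \<Rightarrow> nat^'d \<Rightarrow> real \<Rightarrow> complex) \<Rightarrow> 'd phase \<Rightarrow> real \<Rightarrow> (nat^'d) \<times> (nat^'d) \<Rightarrow> complex" where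
  "freq_term \<theta> Y l p \<equiv> cnj (W_kernel (fst p) (snd p) l Y) * \<theta> (fst p) (snd p) l * of_real (\<bar>l\<bar> ^ CARD('d))"

text \<open>The function \<open>u\<close> of the introduction.  Its value \<open>0\<close> at \<open>l = 0\<close> comes from the density and carries no
  information.\<close>

definition freq_sum :: "(nat^'d::finite \<Rightarrow> nat^'d \<Rightarrow> real \<Rightarrow> complex) \<Rightarrow> 'd phase \<Rightarrow> real \<Rightarrow> complex" where
  "freq_sum \<theta> Y l = (\<Sum>\<^sub>\<infinity>p. freq_term \<theta> Y l p)"

lemma freq_sum_term_le:
  fixes Y :: "'d::finite phase"
  shows "norm (cnj (W_kernel n m l Y) * t * of_real (\<bar>l\<bar> ^ CARD('d))) \<le> norm t * \<bar>l\<bar> ^ CARD('d)"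
proof (cases "l = 0")
  case False
  have "norm (W_kernel n m l Y) * norm t \<le> 1 * norm t"
    by (rule mult_right_mono[OF norm_W_kernel_le_1[OF False]]) simp
  thus ?thesis by (simp add: norm_mult norm_power mult_right_mono)
qed (simp add: power_0_left)

lemma freq_sum_bound:
  fixes \<theta> :: "nat^'d::finite \<Rightarrow> nat^'d \<Rightarrow> real \<Rightarrow> complex"
  assumes "rapid \<theta>"
  obtains C where "C \<ge> 0"
    "\<And>Y l. (\<lambda>p. norm (freq_term \<theta> Y l p)) summable_on UNIV"
    "\<And>Y l. (\<Sum>\<^sub>\<infinity>p. norm (freq_term \<theta> Y l p)) \<le> C / (1 + l\<^sup>2)"
    "\<And>Y l. norm (freq_sum \<theta> Y l) \<le> C / (1 + l\<^sup>2)"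
proof -
  from rapid_sum_bound[OF assms] obtain C where C: "C \<ge> 0"
    "\<And>l. l \<noteq> 0 \<Longrightarrow> (\<lambda>p. norm (\<theta> (fst p) (snd p) l)) summable_on UNIV"
    "\<And>l. l \<noteq> 0 \<Longrightarrow> (\<Sum>\<^sub>\<infinity>p. norm (\<theta> (fst p) (snd p) l)) * \<bar>l\<bar> ^ CARD('d) \<le> C / (1 + l\<^sup>2)" by blast
  let ?f = "\<lambda>Y l p. freq_term \<theta> Y l p"
  have s': "(\<lambda>p. norm (\<theta> (fst p) (snd p) l) * \<bar>l\<bar> ^ CARD('d)) summable_on UNIV" if "l \<noteq> 0" for l
    by (rule summable_on_cmult_left[OF C(2)[OF that]])
  have s: "(\<lambda>p. norm (?f Y l p)) summable_on UNIV" for Y l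
  proof (cases "l = 0")
    case False
    show ?thesis
      by (rule summable_on_comparison_test[OF s'[OF False]]) (rule freq_sum_term_le, simp)
  qed (simp add: power_0_left)
  have b: "(\<Sum>\<^sub>\<infinity>p. norm (?f Y l p)) \<le> C / (1 + l\<^sup>2)" for Y l
  proof (cases "l = 0")
    case False
    have "(\<Sum>\<^sub>\<infinity>p. norm (?f Y l p)) \<le> (\<Sum>\<^sub>\<infinity>p. norm (\<theta> (fst p) (snd p) l) * \<bar>l\<bar> ^ CARD('d))"
      by (rule infsum_mono[OF s s'[OF False]]) (rule freq_sum_term_le)
    also have "\<dots> = (\<Sum>\<^sub>\<infinity>p. norm (\<theta> (fst p) (snd p) l)) * \<bar>l\<bar> ^ CARD('d)" by (rule infsum_cmult_left')
    also have "\<dots> \<le> C / (1 + l\<^sup>2)" by (rule C(3)[OF False])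
    finally show ?thesis .
  qed (use C(1) in \<open>simp add: power_0_left\<close>)
  have "norm (freq_sum \<theta> Y l) \<le> C / (1 + l\<^sup>2)" for Y l
    unfolding freq_sum_def by (rule order_trans[OF norm_infsum_bound[OF s] b])
  with C(1) s b that show ?thesis by blast
qed

lemma has_sum_sum_family:
  fixes f :: "'j \<Rightarrow> 'i \<Rightarrow> complex"
  assumes "\<And>j. j \<in> J \<Longrightarrow> (f j has_sum s j) A"
  shows "((\<lambda>p. \<Sum>j\<in>J. f j p) has_sum (\<Sum>j\<in>J. s j)) A"
  using assms by (induction J rule: infinite_finite_induct) (auto intro: has_sum_add)

text \<open>The operator \<open>hat_D\<close> is made for this identity.  Differentiating term by term, one obtains
  \<open>cnj \<W> * hat_D \<theta>\<close> up to terms in which the shifts of the index act on \<open>\<W>\<close> instead of \<open>\<theta>\<close>.  These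
  combine to differences of a family and its shift, whose sum is zero.\<close>

theorem freq_sum_has_derivative:
  fixes \<theta> :: "nat^'d::finite \<Rightarrow> nat^'d \<Rightarrow> real \<Rightarrow> complex" and Y :: "'d phase"
  assumes r: "rapid \<theta>" and rD: "rapid (hat_D \<theta>)"
    and diff: "\<And>n m l. l \<noteq> 0 \<Longrightarrow> \<theta> n m differentiable (at l)" and l0: "l0 \<noteq> 0"
  shows "(freq_sum \<theta> Y has_vector_derivative freq_sum (hat_D \<theta>) Y l0) (at l0)"
proof -
  define D where "D = CARD('d)"
  define a b where "a = \<bar>l0\<bar> / 2" and "b = 2 * \<bar>l0\<bar>"
  \<comment> \<open>On this ball \<open>\<bar>l\<bar>\<close> stays away from zero, and the Weierstrass bounds are uniform.\<close>
  define S where "S = ball l0 (\<bar>l0\<bar> / 2)"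
  have S: "open S" "convex S" "l0 \<in> S" using l0 by (auto simp: S_def)
  have Sl: "a \<le> \<bar>l\<bar>" "\<bar>l\<bar> \<le> b" "l \<noteq> 0" if "l \<in> S" for l
    using that l0 by (auto simp: S_def a_def b_def dist_real_def abs_if split: if_splits)
  have a: "a > 0" using l0 by (simp add: a_def)
  define up where "up = (\<lambda>j (p :: (nat^'d) \<times> (nat^'d)). raise_coeff (fst p) (snd p) j :: complex)"
  define dn where "dn = (\<lambda>j (p :: (nat^'d) \<times> (nat^'d)). lower_coeff (fst p) (snd p) j :: complex)"
  define W where "W = (\<lambda>p l. cnj (W_kernel (fst p) (snd p) l Y))"
  define t where "t = (\<lambda>p l. \<theta> (fst p) (snd p) l)"
  define tD where "tD = (\<lambda>p l. hat_D \<theta> (fst p) (snd p) l)"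
  define pu where "pu = (\<lambda>j (p :: (nat^'d) \<times> (nat^'d)). (fst p + axis j 1, snd p + axis j 1))"
  define pd where "pd = (\<lambda>j (p :: (nat^'d) \<times> (nat^'d)). (fst p - axis j 1, snd p - axis j 1))"
  have W1: "norm (W p l) \<le> 1" if "l \<in> S" for p l
    using norm_W_kernel_le_1[OF Sl(3)[OF that]] by (simp add: W_def)
  \<comment> \<open>\<open>P'\<close> is the shift of \<open>P\<close> and \<open>R'\<close> the shift of \<open>R\<close>; see \<open>shiftP\<close> and \<open>shiftR\<close>.  The derivative of the
  \<open>p\<close>-th term is \<open>G p\<close>.\<close>
  define P where "P = (\<lambda>l j p. up j p * W p l * t (pu j p) l)"
  define P' where "P' = (\<lambda>l j p. dn j p * W (pd j p) l * t p l)"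
  define R where "R = (\<lambda>l j p. up j p * W (pu j p) l * t p l)"
  define R' where "R' = (\<lambda>l j p. dn j p * W p l * t (pd j p) l)"
  define G where "G = (\<lambda>p l. of_real (\<bar>l\<bar> ^ D) * (W p l * tD p l
      + of_real (1 / (2 * l)) * (\<Sum>j\<in>UNIV. (P l j p - P' l j p) + (R l j p - R' l j p))))"
  note ra = rapid_away_rapid[OF r a, of b] and raD = rapid_away_rapid[OF rD a, of b]
  obtain M0 where M0: "M0 summable_on UNIV" "\<And>p l. l \<in> S \<Longrightarrow> norm (t p l) \<le> M0 p"
    using rapid_away_summable[OF ra] Sl unfolding t_def by (metis prod.collapse)
  obtain MD where MD: "MD summable_on UNIV" "\<And>p l. l \<in> S \<Longrightarrow> norm (tD p l) \<le> MD p"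
    using rapid_away_summable[OF raD] Sl unfolding tD_def by (metis prod.collapse)
  obtain Mu where Mu: "\<And>j. Mu j summable_on UNIV"
    "\<And>j n m l. a \<le> \<bar>l\<bar> \<Longrightarrow> \<bar>l\<bar> \<le> b \<Longrightarrow> norm (raise_coeff n m j * \<theta> (n + axis j 1) (m + axis j 1) l) \<le> Mu j (n, m)"
    by (rule rapid_away_family_summable[OF rapid_away_up[OF ra]]) (rule that)
  obtain Md where Md: "\<And>j. Md j summable_on UNIV"
    "\<And>j n m l. a \<le> \<bar>l\<bar> \<Longrightarrow> \<bar>l\<bar> \<le> b \<Longrightarrow> norm (lower_coeff n m j * \<theta> (n - axis j 1) (m - axis j 1) l) \<le> Md j (n, m)"
    by (rule rapid_away_family_summable[OF rapid_away_down[OF ra]]) (rule that)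
  obtain Mw where Mw: "\<And>j. Mw j summable_on UNIV"
    "\<And>j n m l. a \<le> \<bar>l\<bar> \<Longrightarrow> \<bar>l\<bar> \<le> b \<Longrightarrow> norm (raise_coeff n m j * \<theta> n m l) \<le> Mw j (n, m)"
    by (rule rapid_away_family_summable[OF rapid_away_weight[OF ra]]) (rule that)
  have M: "norm (up j p * t (pu j p) l) \<le> Mu j p" "norm (dn j p * t (pd j p) l) \<le> Md j p" "norm (up j p * t p l) \<le> Mw j p"
    if "l \<in> S" for l j p
    using Mu(2)[OF Sl(1,2)[OF that], where n = "fst p" and m = "snd p" and j = j] Md(2)[OF Sl(1,2)[OF that], where n = "fst p" and m = "snd p" and j = j]
      Mw(2)[OF Sl(1,2)[OF that], where n = "fst p" and m = "snd p" and j = j]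
    by (simp_all add: up_def dn_def t_def pu_def pd_def)
  have dn_up: "norm (dn j p) \<le> norm (up j p)" for j p
    unfolding dn_def up_def by (rule norm_lower_coeff_le)
  have shrink: "norm (c * w * x) \<le> B" if "norm (w :: complex) \<le> 1" "norm (c * x) \<le> B" for c w x :: complex and B
  proof -
    have "norm (c * w * x) = norm w * norm (c * x)" by (simp add: norm_mult)
    also have "\<dots> \<le> 1 * norm (c * x)" using that(1) by (intro mult_right_mono) auto
    finally show ?thesis using that(2) by simp
  qed
  have bP: "norm (P l j p) \<le> Mu j p" if "l \<in> S" for l j p
    unfolding P_def by (rule shrink[OF W1[OF that] M(1)[OF that]])
  have bR: "norm (R l j p) \<le> Mw j p" if "l \<in> S" for l j p
    unfolding R_def by (rule shrink[OF W1[OF that] M(3)[OF that]])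
  have bR': "norm (R' l j p) \<le> Md j p" if "l \<in> S" for l j p
    unfolding R'_def by (rule shrink[OF W1[OF that] M(2)[OF that]])
  have bP': "norm (P' l j p) \<le> Mw j p" if "l \<in> S" for l j p
    unfolding P'_def
  proof (rule shrink[OF W1[OF that]])
    have "norm (dn j p * t p l) \<le> norm (up j p * t p l)"
      unfolding norm_mult by (rule mult_right_mono[OF dn_up]) simp
    also note M(3)[OF that]
    finally show "norm (dn j p * t p l) \<le> Mw j p" .
  qed
  have shiftP: "P' l j p = (if fst p $ j = 0 \<or> snd p $ j = 0 then 0 else P l j (fst p - axis j 1, snd p - axis j 1))" for l j p
  proof (cases "fst p $ j = 0 \<or> snd p $ j = 0")
    case False
    hence "up j (pd j p) = dn j p" "pu j (pd j p) = p"
      by (auto simp: up_def dn_def pu_def pd_def axis_def of_nat_diff prod_eq_iff vec_eq_iff)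
    thus ?thesis using False by (simp add: P_def P'_def pd_def)
  qed (auto simp: P'_def dn_def)
  have shiftR: "R' l j p = (if fst p $ j = 0 \<or> snd p $ j = 0 then 0 else R l j (fst p - axis j 1, snd p - axis j 1))" for l j p
  proof (cases "fst p $ j = 0 \<or> snd p $ j = 0")
    case False
    hence "up j (pd j p) = dn j p" "pu j (pd j p) = p"
      by (auto simp: up_def dn_def pu_def pd_def axis_def of_nat_diff prod_eq_iff vec_eq_iff)
    thus ?thesis using False by (simp add: R_def R'_def pd_def)
  qed (auto simp: R'_def dn_def)
  have sumG: "(\<Sum>\<^sub>\<infinity>p. G p l0) = freq_sum (hat_D \<theta>) Y l0"
  proof -
    have su: "(\<lambda>p. norm (P l0 j p)) summable_on UNIV" "(\<lambda>p. norm (P' l0 j p)) summable_on UNIV"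
      "(\<lambda>p. norm (R l0 j p)) summable_on UNIV" "(\<lambda>p. norm (R' l0 j p)) summable_on UNIV" for j
      by (auto intro: summable_on_comparison_test[OF Mu(1)] summable_on_comparison_test[OF Md(1)]
           summable_on_comparison_test[OF Mw(1)] bP[OF S(3)] bP'[OF S(3)] bR[OF S(3)] bR'[OF S(3)])
    have "((\<lambda>p. P l0 j p - P' l0 j p) has_sum 0) UNIV" "((\<lambda>p. R l0 j p - R' l0 j p) has_sum 0) UNIV" for j
      by (rule shift_difference_has_sum[OF su(1) su(2) shiftP], rule shift_difference_has_sum[OF su(3) su(4) shiftR])
    hence "((\<lambda>p. (P l0 j p - P' l0 j p) + (R l0 j p - R' l0 j p)) has_sum (0 + 0)) UNIV" for j
      by (intro has_sum_add)
    hence "((\<lambda>p. \<Sum>j\<in>UNIV. (P l0 j p - P' l0 j p) + (R l0 j p - R' l0 j p)) has_sum (\<Sum>j\<in>(UNIV::'d set). 0 + 0)) UNIV"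
      by (intro has_sum_sum_family)
    hence z: "((\<lambda>p. of_real (1 / (2 * l0)) * (\<Sum>j\<in>UNIV. (P l0 j p - P' l0 j p) + (R l0 j p - R' l0 j p))) has_sum (of_real (1 / (2 * l0)) * 0)) UNIV"
      by (intro has_sum_cmult_right) simp
    have "(\<lambda>p. W p l0 * tD p l0) summable_on UNIV"
      by (rule abs_summable_summable, rule summable_on_comparison_test[OF MD(1)])
         (use shrink[OF W1[OF S(3)], of 1] MD(2)[OF S(3)] in \<open>auto simp: norm_mult\<close>)
    hence "((\<lambda>p. W p l0 * tD p l0) has_sum (\<Sum>\<^sub>\<infinity>p. W p l0 * tD p l0)) UNIV" by simp
    from has_sum_cmult_right[OF has_sum_add[OF this z], of "of_real (\<bar>l0\<bar> ^ D)"]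
    have "(\<Sum>\<^sub>\<infinity>p. G p l0) = of_real (\<bar>l0\<bar> ^ D) * (\<Sum>\<^sub>\<infinity>p. W p l0 * tD p l0)"
      unfolding G_def by (simp add: infsumI)
    also have "\<dots> = freq_sum (hat_D \<theta>) Y l0"
      unfolding freq_sum_def infsum_cmult_left' by (simp add: W_def tD_def D_def mult.commute)
    finally show ?thesis .
  qed
  have der: "((\<lambda>l. W p l * t p l * of_real (\<bar>l\<bar> ^ D)) has_vector_derivative G p l) (at l)" if l: "l \<in> S" for p l
  proof -
    note l' = Sl(3)[OF l]
    let ?h = "of_real (1 / (2 * l)) :: complex"
    define A where "A = (\<Sum>j\<in>UNIV. up j p * W (pu j p) l)"
    define B where "B = (\<Sum>j\<in>UNIV. dn j p * W (pd j p) l)"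
    define U where "U = (\<Sum>j\<in>UNIV. up j p * t (pu j p) l)"
    define V where "V = (\<Sum>j\<in>UNIV. dn j p * t (pd j p) l)"
    have dW: "((\<lambda>l. W p l) has_vector_derivative ?h * (A - B - of_nat D * W p l)) (at l)"
    proof -
      from has_vector_derivative_cnj[OF W_kernel_has_derivative[OF l', of "fst p" "snd p" Y]]
      show ?thesis
        by (simp add: W_def A_def B_def up_def dn_def pu_def pd_def D_def sum_subtractf)
    qed
    have dt: "(t p has_vector_derivative lambda_deriv \<theta> (fst p) (snd p) l) (at l)"
      using diff[OF l', of "fst p" "snd p"] unfolding t_def lambda_deriv_def by (simp add: vector_derivative_works)
    have tDe: "tD p l = lambda_deriv \<theta> (fst p) (snd p) l + ?h * (of_nat D * t p l) + ?h * (V - U)"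
      by (simp add: tD_def hat_D_def D_def t_def U_def V_def up_def dn_def pu_def pd_def sum_subtractf)
    have "((\<lambda>l. W p l * t p l * of_real (\<bar>l\<bar> ^ D)) has_vector_derivative
       (W p l * t p l * of_real (real D / l * \<bar>l\<bar> ^ D)
        + (W p l * lambda_deriv \<theta> (fst p) (snd p) l + ?h * (A - B - of_nat D * W p l) * t p l) * of_real (\<bar>l\<bar> ^ D))) (at l)"
      by (intro has_vector_derivative_mult dW dt abs_power_has_derivative l')
    moreover have "W p l * t p l * of_real (real D / l * \<bar>l\<bar> ^ D)
        + (W p l * lambda_deriv \<theta> (fst p) (snd p) l + ?h * (A - B - of_nat D * W p l) * t p l) * of_real (\<bar>l\<bar> ^ D) = G p l"
    proof -
      have s: "(\<Sum>j\<in>UNIV. (P l j p - P' l j p) + (R l j p - R' l j p)) = W p l * U - B * t p l + (A * t p l - W p l * V)"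
        by (simp add: P_def P'_def R_def R'_def A_def B_def U_def V_def sum.distrib sum_subtractf sum_distrib_left sum_distrib_right mult_ac)
      have e: "(of_real (real D / l * \<bar>l\<bar> ^ D) :: complex) = ?h * (2 * of_nat D) * of_real (\<bar>l\<bar> ^ D)" by simp
      have ld: "lambda_deriv \<theta> (fst p) (snd p) l = tD p l - ?h * (of_nat D * t p l) - ?h * (V - U)"
        unfolding tDe by simp
      show ?thesis unfolding G_def s e ld by (simp only: algebra_simps) simp
    qed
    ultimately show ?thesis by simp
  qed
  have "b \<ge> 0" by (simp add: b_def)
  have absD: "\<bar>l\<bar> ^ D \<le> b ^ D" if "l \<in> S" for l
    using Sl[OF that] by (intro power_mono) auto
  let ?N = "\<lambda>p. b ^ D * (MD p + 1 / a * (\<Sum>j\<in>UNIV. (Mu j p + Mw j p) + (Mw j p + Md j p)))"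
  have "((\<lambda>l. \<Sum>\<^sub>\<infinity>p. W p l * t p l * of_real (\<bar>l\<bar> ^ D)) has_vector_derivative (\<Sum>\<^sub>\<infinity>p. G p l0)) (at l0)"
  proof (rule has_vector_derivative_infsum[OF S(1,2) der _ _ _ _ S(3)])
    show "(\<lambda>p. M0 p * b ^ D) summable_on UNIV" by (rule summable_on_cmult_left[OF M0(1)])
    show "norm (W p l * t p l * of_real (\<bar>l\<bar> ^ D)) \<le> M0 p * b ^ D" if "l \<in> S" for p l
    proof -
      have "norm (W p l * t p l) \<le> M0 p" using shrink[OF W1[OF that], of 1 "t p l"] M0(2)[OF that] by simp
      hence "norm (W p l * t p l) * \<bar>l\<bar> ^ D \<le> M0 p * b ^ D"
        using absD[OF that] by (intro mult_mono) (auto intro: order_trans[OF norm_ge_zero])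
      thus ?thesis by (simp add: norm_mult norm_power)
    qed
    have "(\<lambda>p. \<Sum>j\<in>UNIV. (Mu j p + Mw j p) + (Mw j p + Md j p)) summable_on UNIV"
    proof -
      have "(\<lambda>p. \<Sum>j\<in>J. (Mu j p + Mw j p) + (Mw j p + Md j p)) summable_on UNIV" for J :: "'d set"
      proof (induction J rule: infinite_finite_induct)
        case (insert j J)
        show ?case unfolding sum.insert[OF insert.hyps]
          by (rule summable_on_add[OF _ insert.IH]) (rule summable_on_add[OF summable_on_add[OF Mu(1) Mw(1)] summable_on_add[OF Mw(1) Md(1)]])
      qed simp_all
      thus ?thesis .
    qed
    thus "?N summable_on UNIV"
      by (intro summable_on_cmult_right summable_on_add MD)
    show "norm (G p l) \<le> ?N p" if l: "l \<in> S" for p l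
    proof -
      have 1: "norm (W p l * tD p l) \<le> MD p" using shrink[OF W1[OF l], of 1 "tD p l"] MD(2)[OF l] by simp
      have 2: "norm (\<Sum>j\<in>UNIV. (P l j p - P' l j p) + (R l j p - R' l j p)) \<le> (\<Sum>j\<in>UNIV. (Mu j p + Mw j p) + (Mw j p + Md j p))"
        by (rule order_trans[OF norm_sum sum_mono])
           (intro order_trans[OF norm_triangle_ineq] add_mono order_trans[OF norm_triangle_ineq4] bP bP' bR bR' l)
      have 3: "norm (of_real (1 / (2 * l)) :: complex) \<le> 1 / a"
      proof -
        have "\<bar>1 / (2 * l)\<bar> = 1 / (2 * \<bar>l\<bar>)" by (simp add: abs_mult)
        also have "\<dots> \<le> 1 / a" using Sl(1)[OF l] a by (intro divide_left_mono) auto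
        finally show ?thesis by (simp only: norm_of_real)
      qed
      have "norm (of_real (1 / (2 * l)) * (\<Sum>j\<in>UNIV. (P l j p - P' l j p) + (R l j p - R' l j p)))
          \<le> 1 / a * (\<Sum>j\<in>UNIV. (Mu j p + Mw j p) + (Mw j p + Md j p))"
        unfolding norm_mult using a by (intro mult_mono 2 3) auto
      with 1 have "norm (W p l * tD p l + of_real (1 / (2 * l)) * (\<Sum>j\<in>UNIV. (P l j p - P' l j p) + (R l j p - R' l j p)))
          \<le> MD p + 1 / a * (\<Sum>j\<in>UNIV. (Mu j p + Mw j p) + (Mw j p + Md j p))"
        by (rule norm_triangle_mono)
      moreover have "norm (of_real (\<bar>l\<bar> ^ D) :: complex) \<le> b ^ D" using absD[OF l] by (simp add: norm_power)
      ultimately show ?thesis unfolding G_def norm_mult[of "of_real (\<bar>l\<bar> ^ D)"]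
        using \<open>b \<ge> 0\<close> by (intro mult_mono) auto
    qed
  qed
  moreover have "freq_sum \<theta> Y = (\<lambda>l. \<Sum>\<^sub>\<infinity>p. W p l * t p l * of_real (\<bar>l\<bar> ^ D))"
    by (simp add: fun_eq_iff freq_sum_def W_def t_def D_def)
  ultimately show ?thesis unfolding sumG by simp
qed

text \<open>In the sum at \<open>- l\<close> the roles of \<open>n\<close> and \<open>m\<close> are exchanged; by \<open>W_kernel_uminus\<close> both sums then
  contain the same kernels.\<close>

lemma freq_sum_jump:
  fixes \<theta> :: "nat^'d::finite \<Rightarrow> nat^'d \<Rightarrow> real \<Rightarrow> complex"
  assumes r: "rapid \<theta>" and l: "l \<noteq> 0"
  shows "freq_sum \<theta> Y l - freq_sum \<theta> Y (- l) = of_real l * freq_sum (hat_Sigma0 \<theta>) Y l"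
proof -
  let ?c = "of_real (\<bar>l\<bar> ^ CARD('d)) :: complex"
  let ?s = "\<lambda>p :: (nat^'d) \<times> (nat^'d). (-1) ^ (\<Sum>j\<in>UNIV. fst p $ j + snd p $ j) :: complex"
  let ?W = "\<lambda>p. cnj (W_kernel (fst p) (snd p) l Y)"
  have bij: "bij (prod.swap :: (nat^'d) \<times> (nat^'d) \<Rightarrow> _)" by (rule bij_swap)
  obtain C where s:
    "\<And>Y l. (\<lambda>p. norm (freq_term \<theta> Y l p)) summable_on UNIV"
    by (rule freq_sum_bound[OF r]) (rule that)
  have eq: "cnj (W_kernel (snd p) (fst p) (- l) Y) * \<theta> (snd p) (fst p) (- l) * of_real (\<bar>- l\<bar> ^ CARD('d))
      = ?W p * (?s p * \<theta> (snd p) (fst p) (- l)) * ?c" for p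
    by (simp add: W_kernel_uminus[OF l])
  have "freq_sum \<theta> Y (- l) = (\<Sum>\<^sub>\<infinity>p. cnj (W_kernel (snd p) (fst p) (- l) Y) * \<theta> (snd p) (fst p) (- l) * of_real (\<bar>- l\<bar> ^ CARD('d)))"
    unfolding freq_sum_def by (subst infsum_reindex_bij_betw[OF bij, symmetric]) simp
  hence m: "freq_sum \<theta> Y (- l) = (\<Sum>\<^sub>\<infinity>p. ?W p * (?s p * \<theta> (snd p) (fst p) (- l)) * ?c)"
    unfolding eq .
  have "(\<lambda>p. norm (cnj (W_kernel (snd p) (fst p) (- l) Y) * \<theta> (snd p) (fst p) (- l) * of_real (\<bar>- l\<bar> ^ CARD('d)))) summable_on UNIV"
    using s[of "- l" Y] by (subst (asm) summable_on_reindex_bij_betw[OF bij, symmetric]) simp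
  hence sm: "(\<lambda>p. ?W p * (?s p * \<theta> (snd p) (fst p) (- l)) * ?c) summable_on UNIV"
    unfolding eq by (rule abs_summable_summable)
  have sp: "(\<lambda>p. ?W p * \<theta> (fst p) (snd p) l * ?c) summable_on UNIV"
    by (rule abs_summable_summable[OF s])
  have "((\<lambda>p. ?W p * \<theta> (fst p) (snd p) l * ?c + - (?W p * (?s p * \<theta> (snd p) (fst p) (- l)) * ?c)) has_sum
      (freq_sum \<theta> Y l + - freq_sum \<theta> Y (- l))) UNIV"
    using sp sm unfolding m unfolding freq_sum_def
    by (intro has_sum_add has_sum_uminus[THEN iffD2]) auto
  hence "freq_sum \<theta> Y l - freq_sum \<theta> Y (- l)
     = (\<Sum>\<^sub>\<infinity>p. ?W p * \<theta> (fst p) (snd p) l * ?c + - (?W p * (?s p * \<theta> (snd p) (fst p) (- l)) * ?c))"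
    by (simp add: infsumI)
  also have "\<dots> = (\<Sum>\<^sub>\<infinity>p. of_real l * (?W p * hat_Sigma0 \<theta> (fst p) (snd p) l * ?c))"
    by (rule infsum_cong) (use l in \<open>simp add: hat_Sigma0_def field_simps\<close>)
  also have "\<dots> = of_real l * freq_sum (hat_Sigma0 \<theta>) Y l"
    unfolding freq_sum_def by (rule infsum_cmult_right')
  finally show ?thesis .
qed

section \<open>Integration by parts across the origin and Fourier inversion at a jump\<close>

definition line_transform :: "(real \<Rightarrow> complex) \<Rightarrow> real \<Rightarrow> complex" where
  "line_transform u s = (LINT l|lborel. exp (- (\<i> * of_real (s * l))) * u l)"

lemma norm_phase [simp]: "norm (exp (- (\<i> * of_real t))) = 1"
  by (simp add: norm_exp_eq_Re)

lemma integrable_inverse_square: "integrable lborel (\<lambda>l::real. C / (1 + l\<^sup>2))"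
proof -
  have "integrable lborel (\<lambda>l::real. inverse (1 + l\<^sup>2))"
    using integrable_inverse_1_plus_square by (simp add: set_integrable_def)
  hence "integrable lborel (\<lambda>l::real. C * inverse (1 + l\<^sup>2))" by (rule integrable_mult_right)
  thus ?thesis by (simp add: divide_inverse)
qed

lemma divide_one_plus_square_le:
  fixes C l :: real
  assumes "C \<ge> 0"
  shows "C / (1 + l\<^sup>2) \<le> C"
proof -
  have "C / (1 + l\<^sup>2) \<le> C / 1" using assms by (intro divide_left_mono) (auto simp: add_pos_nonneg)
  thus ?thesis by simp
qed

lemma borel_measurable_cnj [measurable]:
  assumes "f \<in> borel_measurable M"
  shows "(\<lambda>x. cnj (f x)) \<in> borel_measurable M"
  by (rule measurable_compose[OF assms borel_measurable_continuous_onI]) (intro continuous_intros)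

lemma integrable_line_transform:
  assumes "integrable lborel u"
  shows "integrable lborel (\<lambda>l. exp (- (\<i> * of_real (s * l))) * u l)"
proof (rule Bochner_Integration.integrable_bound[OF assms])
  have [measurable]: "u \<in> borel_measurable borel" using assms by (simp add: borel_measurable_integrable)
  show "(\<lambda>l. exp (- (\<i> * of_real (s * l))) * u l) \<in> borel_measurable lborel" by measurable
  show "AE l in lborel. norm (exp (- (\<i> * of_real (s * l))) * u l) \<le> norm (u l)"
    by (simp add: norm_mult del: of_real_mult)
qed

lemma norm_line_transform_le:
  assumes "integrable lborel u" "integrable lborel B" "\<And>l. norm (u l) \<le> B l"
  shows "norm (line_transform u s) \<le> (LINT l|lborel. B l)"
  unfolding line_transform_def
  by (rule order_trans[OF integral_norm_bound integral_mono])
     (use assms in \<open>auto intro!: integrable_norm integrable_line_transform simp: norm_mult simp del: of_real_mult\<close>)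

text \<open>The line is exhausted by pairs of segments that avoid the origin, where the functions to be
  integrated by parts may jump.\<close>

lemma cutoff_tendsto:
  fixes f :: "real \<Rightarrow> 'b::{banach, second_countable_topology}"
  assumes f: "integrable lborel f"
  shows "(\<lambda>k. (LINT l:{1 / real (Suc k)..real (Suc k)}|lborel. f l) + (LINT l:{- real (Suc k)..- (1 / real (Suc k))}|lborel. f l))
     \<longlonglongrightarrow> (LINT l|lborel. f l)"
proof -
  let ?A = "\<lambda>k. {1 / real (Suc k)..real (Suc k)}" and ?B = "\<lambda>k. {- real (Suc k)..- (1 / real (Suc k))}"
  have [measurable]: "f \<in> borel_measurable borel" using f by (simp add: borel_measurable_integrable)
  have int: "integrable lborel (\<lambda>l. indicator A l *\<^sub>R f l)" if "A \<in> sets borel" for A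
    by (rule integrable_mult_indicator) (use that f in auto)
  have disj: "indicator (?A k) l + indicator (?B k) l = (indicator (?A k \<union> ?B k) l :: real)" for k l
  proof (rule indicator_add)
    have "0 < 1 / real (Suc k)" by simp
    thus "?A k \<inter> ?B k = {}" by (auto simp del: of_nat_Suc)
  qed
  have "(\<lambda>k. LINT l|lborel. indicator (?A k \<union> ?B k) l *\<^sub>R f l) \<longlonglongrightarrow> (LINT l|lborel. f l)"
  proof (rule integral_dominated_convergence[where w = "\<lambda>l. norm (f l)"])
    show "AE l in lborel. (\<lambda>k. indicator (?A k \<union> ?B k) l *\<^sub>R f l) \<longlonglongrightarrow> f l"
      using AE_lborel_singleton[of "0::real"]
    proof eventually_elim
      fix l :: real assume l: "l \<noteq> 0"
      obtain K where K: "real K > \<bar>l\<bar>" "real K > 1 / \<bar>l\<bar>"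
        using reals_Archimedean2[of "max \<bar>l\<bar> (1 / \<bar>l\<bar>)"] by auto
      have "l \<in> ?A k \<union> ?B k" if "k \<ge> K" for k
      proof -
        have "real (Suc k) > \<bar>l\<bar>" "real (Suc k) > 1 / \<bar>l\<bar>" using K that by linarith+
        hence "\<bar>l\<bar> \<le> real (Suc k)" "1 / real (Suc k) \<le> \<bar>l\<bar>" using l by (simp_all add: field_simps)
        thus ?thesis using l by (auto simp: abs_if split: if_splits)
      qed
      hence "eventually (\<lambda>k. indicator (?A k \<union> ?B k) l *\<^sub>R f l = f l) sequentially"
        unfolding eventually_sequentially by (intro exI[of _ K]) auto
      thus "(\<lambda>k. indicator (?A k \<union> ?B k) l *\<^sub>R f l) \<longlonglongrightarrow> f l" by (rule tendsto_eventually)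
    qed
  qed (use f in \<open>auto simp: indicator_def\<close>)
  moreover have "(LINT l:?A k|lborel. f l) + (LINT l:?B k|lborel. f l) = (LINT l|lborel. indicator (?A k \<union> ?B k) l *\<^sub>R f l)" for k
    unfolding set_lebesgue_integral_def disj[symmetric] scaleR_add_left
    by (rule Bochner_Integration.integral_add[symmetric]) (auto intro: int)
  ultimately show ?thesis by simp
qed

lemma has_integral_by_parts_segment:
  fixes u v :: "real \<Rightarrow> complex" and s :: real
  assumes ab: "a \<le> b" and nz: "0 \<notin> {a..b}"
    and der: "\<And>l. l \<noteq> 0 \<Longrightarrow> (u has_vector_derivative v l) (at l)" and u: "integrable lborel u"
  defines "e \<equiv> \<lambda>l. exp (- (\<i> * of_real (s * l)))"
  shows "((\<lambda>l. e l * v l) has_integral (e b * u b - e a * u a + \<i> * of_real s * (LINT l:{a..b}|lborel. e l * u l))) {a..b}"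
proof -
  have de: "(e has_vector_derivative (- (\<i> * of_real s) * e l)) (at l)" for l
    unfolding e_def by (rule has_vector_derivative_real_field derivative_eq_intros refl | simp)+
  have "((\<lambda>l. e l * v l + (- (\<i> * of_real s) * e l) * u l) has_integral (e b * u b - e a * u a)) {a..b}"
  proof (rule fundamental_theorem_of_calculus[OF ab])
    fix x assume "x \<in> {a..b}"
    hence "x \<noteq> 0" using nz by auto
    thus "((\<lambda>l. e l * u l) has_vector_derivative e x * v x + (- (\<i> * of_real s) * e x) * u x) (at x within {a..b})"
      by (rule has_vector_derivative_at_within[OF has_vector_derivative_mult[OF de der]])
  qed
  moreover have si: "set_integrable lborel {a..b} (\<lambda>l. e l * u l)"
    unfolding set_integrable_def e_def
    by (rule integrable_mult_indicator) (use integrable_line_transform[OF u, of s] in auto)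
  have "((\<lambda>l. e l * u l) has_integral (LINT l:{a..b}|lborel. e l * u l)) {a..b}"
    unfolding set_borel_integral_eq_integral(2)[OF si]
    by (rule integrable_integral[OF set_borel_integral_eq_integral(1)[OF si]])
  hence "((\<lambda>l. \<i> * of_real s * (e l * u l)) has_integral \<i> * of_real s * (LINT l:{a..b}|lborel. e l * u l)) {a..b}"
    by (rule has_integral_mult_right)
  ultimately have "((\<lambda>l. (e l * v l + (- (\<i> * of_real s) * e l) * u l) + \<i> * of_real s * (e l * u l)) has_integral
      (e b * u b - e a * u a + \<i> * of_real s * (LINT l:{a..b}|lborel. e l * u l))) {a..b}"
    by (rule has_integral_add)
  thus ?thesis by simp
qed

text \<open>The boundary terms at infinity vanish by decay.  Those at the origin cancel in the limit because of the
  assumption on the jump, without \<open>u\<close> having one-sided limits there.  The first conclusion, which assumes only a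
  bound for \<open>v\<close>, is what the last of several integrations by parts provides.\<close>

lemma line_transform_by_parts:
  fixes u v :: "real \<Rightarrow> complex"
  assumes der: "\<And>l. l \<noteq> 0 \<Longrightarrow> (u has_vector_derivative v l) (at l)"
    and u: "integrable lborel u" and ub: "\<And>l. norm (u l) \<le> C / (1 + l\<^sup>2)"
    and jump: "((\<lambda>l. u l - u (- l)) \<longlongrightarrow> 0) (at_right 0)"
    and B: "integrable lborel B" and vb: "\<And>l. norm (v l) \<le> B l"
  shows "norm (of_real s * line_transform u s) \<le> (LINT l|lborel. B l)" (is ?th1)
    and "integrable lborel v \<Longrightarrow> line_transform v s = \<i> * of_real s * line_transform u s"
proof -
  define e where "e = (\<lambda>l. exp (- (\<i> * of_real (s * l))))"
  have ne: "norm (e l) = 1" for l unfolding e_def by (rule norm_phase)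
  define R where "R = (\<lambda>k. real (Suc k))"
  define \<epsilon> where "\<epsilon> = (\<lambda>k. 1 / real (Suc k))"
  have R: "R k \<ge> 1" "\<epsilon> k > 0" "\<epsilon> k \<le> 1" "\<epsilon> k \<le> R k" for k
    by (auto simp: R_def \<epsilon>_def field_simps)
  have e0: "\<epsilon> \<longlonglongrightarrow> 0" unfolding \<epsilon>_def by (rule LIMSEQ_Suc[OF lim_1_over_n])
  have er: "filterlim \<epsilon> (at_right 0) sequentially"
  proof -
    have "\<epsilon> k \<in> {0<..} \<and> \<epsilon> k \<noteq> 0" for k using R(2)[of k] by auto
    thus ?thesis by (simp add: filterlim_at e0)
  qed
  have C: "C \<ge> 0" using order_trans[OF norm_ge_zero ub[of 0]] by simp
  have uC: "norm (u l) \<le> C" for l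
    by (rule order_trans[OF ub]) (rule divide_one_plus_square_le[OF C])
  let ?A = "\<lambda>k. {\<epsilon> k..R k}" and ?A' = "\<lambda>k. {- R k..- \<epsilon> k}"
  \<comment> \<open>The boundary terms, the integrals of \<open>e u\<close>, and those of \<open>e v\<close> over the two segments.\<close>
  define bt where "bt = (\<lambda>k. (e (R k) * u (R k) - e (\<epsilon> k) * u (\<epsilon> k)) + (e (- \<epsilon> k) * u (- \<epsilon> k) - e (- R k) * u (- R k)))"
  define I where "I = (\<lambda>k. (LINT l:?A k|lborel. e l * u l) + (LINT l:?A' k|lborel. e l * u l))"
  define J where "J = (\<lambda>k. integral (?A k) (\<lambda>l. e l * v l) + integral (?A' k) (\<lambda>l. e l * v l))"
  have hp: "((\<lambda>l. e l * v l) has_integral (e (R k) * u (R k) - e (\<epsilon> k) * u (\<epsilon> k) + \<i> * of_real s * (LINT l:?A k|lborel. e l * u l))) (?A k)" for k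
    unfolding e_def by (rule has_integral_by_parts_segment[OF R(4) _ der u]) (use R(2)[of k] in auto)
  have hm: "((\<lambda>l. e l * v l) has_integral (e (- \<epsilon> k) * u (- \<epsilon> k) - e (- R k) * u (- R k) + \<i> * of_real s * (LINT l:?A' k|lborel. e l * u l))) (?A' k)" for k
    unfolding e_def by (rule has_integral_by_parts_segment[OF _ _ der u]) (use R(2)[of k] R(4)[of k] in auto)
  have J: "J k = bt k + \<i> * of_real s * I k" for k
    unfolding J_def integral_unique[OF hp] integral_unique[OF hm] bt_def I_def by (simp add: algebra_simps)
  have I: "I \<longlonglongrightarrow> line_transform u s"
    unfolding I_def R_def \<epsilon>_def line_transform_def e_def
    by (rule cutoff_tendsto[OF integrable_line_transform[OF u]])
  have bt0: "bt \<longlonglongrightarrow> 0"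
  proof -
    have Rinf: "(\<lambda>k. C / (1 + (R k)\<^sup>2)) \<longlonglongrightarrow> 0" 
    proof (rule Lim_null_comparison[OF always_eventually tendsto_mult_right_zero[OF e0, of C]])
      show "\<forall>k. norm (C / (1 + (R k)\<^sup>2)) \<le> C * \<epsilon> k"
      proof
        fix k
        have "R k * 1 \<le> R k * R k" using R(1)[of k] by (intro mult_left_mono) auto
        hence le: "R k \<le> 1 + (R k)\<^sup>2" by (simp add: power2_eq_square)
        have "0 < (1 + (R k)\<^sup>2) * R k"
          using R(1)[of k] by (intro mult_pos_pos) (auto simp: add_pos_nonneg)
        hence "C / (1 + (R k)\<^sup>2) \<le> C / R k" by (rule divide_left_mono[OF le C])
        moreover have "0 \<le> C / (1 + (R k)\<^sup>2)" using C by simp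
        ultimately show "norm (C / (1 + (R k)\<^sup>2)) \<le> C * \<epsilon> k" by (simp add: R_def \<epsilon>_def)
      qed
    qed
    have 1: "(\<lambda>k. e (R k) * u (R k)) \<longlonglongrightarrow> 0"
      by (rule Lim_null_comparison[OF always_eventually Rinf]) (use ub in \<open>auto simp: norm_mult ne\<close>)
    have 2: "(\<lambda>k. e (- R k) * u (- R k)) \<longlonglongrightarrow> 0"
      by (rule Lim_null_comparison[OF always_eventually Rinf]) (use ub[of "- R k" for k] in \<open>auto simp: norm_mult ne\<close>)
    have j: "(\<lambda>k. u (\<epsilon> k) - u (- \<epsilon> k)) \<longlonglongrightarrow> 0" by (rule filterlim_compose[OF jump er])
    have 3: "(\<lambda>k. e (\<epsilon> k) * (u (\<epsilon> k) - u (- \<epsilon> k))) \<longlonglongrightarrow> 0"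
      by (rule Lim_null_comparison[OF always_eventually tendsto_norm_zero[OF j]]) (auto simp: norm_mult ne)
    have "(\<lambda>k. e (\<epsilon> k) - e (- \<epsilon> k)) \<longlonglongrightarrow> exp (- (\<i> * of_real (s * 0))) - exp (- (\<i> * of_real (s * - 0)))"
      unfolding e_def by (intro tendsto_intros e0)
    hence ee: "(\<lambda>k. e (\<epsilon> k) - e (- \<epsilon> k)) \<longlonglongrightarrow> 0" by simp
    have 4: "(\<lambda>k. (e (\<epsilon> k) - e (- \<epsilon> k)) * u (- \<epsilon> k)) \<longlonglongrightarrow> 0"
      by (rule Lim_null_comparison[OF always_eventually tendsto_mult_left_zero[OF tendsto_norm_zero[OF ee], of C]])
         (auto simp: norm_mult intro!: mult_left_mono uC)
    \<comment> \<open>Near the origin the phases at \<open>\<epsilon>\<close> and \<open>- \<epsilon>\<close> agree in the limit, so only the jump of \<open>u\<close> remains.\<close>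
    have "bt = (\<lambda>k. e (R k) * u (R k) - e (- R k) * u (- R k) - (e (\<epsilon> k) * (u (\<epsilon> k) - u (- \<epsilon> k)) + (e (\<epsilon> k) - e (- \<epsilon> k)) * u (- \<epsilon> k)))"
      by (simp add: bt_def fun_eq_iff algebra_simps)
    moreover have "\<dots> \<longlonglongrightarrow> 0 - 0 - (0 + 0)" by (intro tendsto_diff tendsto_add 1 2 3 4)
    ultimately show ?thesis by simp
  qed
  have Jlim: "J \<longlonglongrightarrow> \<i> * of_real s * line_transform u s"
  proof -
    have "(\<lambda>k. bt k + \<i> * of_real s * I k) \<longlonglongrightarrow> 0 + \<i> * of_real s * line_transform u s"
      by (intro tendsto_add tendsto_mult tendsto_const bt0 I)
    moreover have "J = (\<lambda>k. bt k + \<i> * of_real s * I k)" using J by (rule ext)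
    ultimately show ?thesis by simp
  qed
  have Bset: "set_integrable lborel A B" if "A \<in> sets borel" for A
    unfolding set_integrable_def by (rule integrable_mult_indicator) (use that B in auto)
  have nJ: "norm (J k) \<le> (LINT l:?A k|lborel. B l) + (LINT l:?A' k|lborel. B l)" for k
  proof -
    have seg: "norm (integral A (\<lambda>l. e l * v l)) \<le> (LINT l:A|lborel. B l)"
      if "(\<lambda>l. e l * v l) integrable_on A" "A \<in> sets borel" for A
    proof -
      have "norm (integral A (\<lambda>l. e l * v l)) \<le> integral A B"
        by (rule Henstock_Kurzweil_Integration.integral_norm_bound_integral[OF that(1) set_borel_integral_eq_integral(1)[OF Bset[OF that(2)]]])
           (simp add: norm_mult ne vb)
      thus ?thesis by (simp only: set_borel_integral_eq_integral(2)[OF Bset[OF that(2)]])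
    qed
    show ?thesis unfolding J_def
      by (intro order_trans[OF norm_triangle_ineq] add_mono seg
          has_integral_integrable[OF hp] has_integral_integrable[OF hm]) simp_all
  qed
  have "norm (\<i> * of_real s * line_transform u s) \<le> (LINT l|lborel. B l)"
  proof (rule tendsto_le[OF _ _ tendsto_norm[OF Jlim]])
    show "(\<lambda>k. (LINT l:?A k|lborel. B l) + (LINT l:?A' k|lborel. B l)) \<longlonglongrightarrow> (LINT l|lborel. B l)"
      unfolding R_def \<epsilon>_def by (rule cutoff_tendsto[OF B])
  qed (use nJ in auto)
  thus ?th1 by (simp add: norm_mult)
  assume v: "integrable lborel v"
  have "J = (\<lambda>k. (LINT l:?A k|lborel. e l * v l) + (LINT l:?A' k|lborel. e l * v l))"
  proof
    fix k
    have "set_integrable lborel A (\<lambda>l. e l * v l)" if "A \<in> sets borel" for A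
      unfolding set_integrable_def e_def
      by (rule integrable_mult_indicator) (use that integrable_line_transform[OF v, of s] in auto)
    from set_borel_integral_eq_integral(2)[OF this]
    show "J k = (LINT l:?A k|lborel. e l * v l) + (LINT l:?A' k|lborel. e l * v l)" by (simp add: J_def)
  qed
  moreover have "\<dots> \<longlonglongrightarrow> line_transform v s"
    unfolding R_def \<epsilon>_def line_transform_def e_def
    by (rule cutoff_tendsto[OF integrable_line_transform[OF v]])
  ultimately show "line_transform v s = \<i> * of_real s * line_transform u s"
    using Jlim LIMSEQ_unique by metis
qed

lemma gauss_integral_0: "(LINT t|lborel. of_real (exp (- t\<^sup>2)) :: complex) = of_real (sqrt pi)"
  using gauss_integral_1[of 0] by (simp add: gauss_integral_def)

lemma integrable_gauss: "integrable lborel (\<lambda>t::real. exp (- t\<^sup>2))"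
  using integrable_poly_gauss[of 1] by simp

lemma gauss_kernel_transform:
  fixes \<delta> :: real
  assumes d: "\<delta> > 0"
  shows "(LINT s|lborel. of_real (exp (- (\<delta> * s)\<^sup>2)) * exp (- (\<i> * of_real (s * l)))) = of_real (sqrt pi / \<delta> * exp (- (l / (2 * \<delta>))\<^sup>2))"
proof -
  let ?f = "\<lambda>z. exp (2 * \<i> * of_real (- l / (2 * \<delta>) * z)) * of_real (poly 1 z * exp (- z\<^sup>2)) :: complex"
  have "gauss_integral (- l / (2 * \<delta>)) 1 = \<bar>\<delta>\<bar> *\<^sub>R (LINT s|lborel. ?f (0 + \<delta> * s))"
    unfolding gauss_integral_def by (rule lborel_integral_real_affine) (use d in simp)
  also have "(\<lambda>s. ?f (0 + \<delta> * s)) = (\<lambda>s. of_real (exp (- (\<delta> * s)\<^sup>2)) * exp (- (\<i> * of_real (s * l))))"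
  proof
    fix s
    have "- l / (2 * \<delta>) * (0 + \<delta> * s) = - (s * l) / 2" using d by simp
    moreover have "2 * \<i> * of_real (- (s * l) / 2) = - (\<i> * of_real (s * l))" by simp
    ultimately have e: "exp (2 * \<i> * of_real (- l / (2 * \<delta>) * (0 + \<delta> * s))) = exp (- (\<i> * of_real (s * l)))"
      by (simp only:)
    have p: "poly 1 (0 + \<delta> * s) * exp (- (0 + \<delta> * s)\<^sup>2) = exp (- (\<delta> * s)\<^sup>2)" by simp
    show "?f (0 + \<delta> * s) = of_real (exp (- (\<delta> * s)\<^sup>2)) * exp (- (\<i> * of_real (s * l)))"
      unfolding e p by (rule mult.commute)
  qed
  finally have "of_real \<delta> * (LINT s|lborel. of_real (exp (- (\<delta> * s)\<^sup>2)) * exp (- (\<i> * of_real (s * l))))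
      = of_real (sqrt pi * exp (- (l / (2 * \<delta>))\<^sup>2))"
    using d unfolding gauss_integral_1 by (simp add: scaleR_conv_of_real)
  hence "of_real \<delta> * (LINT s|lborel. of_real (exp (- (\<delta> * s)\<^sup>2)) * exp (- (\<i> * of_real (s * l))))
      = of_real \<delta> * of_real (sqrt pi / \<delta> * exp (- (l / (2 * \<delta>))\<^sup>2))"
    unfolding of_real_mult[symmetric] using d by simp
  thus ?thesis using d by (simp only: mult_cancel_left of_real_eq_0_iff) simp
qed

text \<open>The Gaussian \<open>exp (- (\<delta> s)\<^sup>2)\<close> is inserted into the integral over \<open>s\<close>.  Its transform is a Gaussian
  of width proportional to \<open>\<delta>\<close>, so by Fubini the integral is an average of \<open>u\<close> near the origin in which both half-lines have
  the same weight.\<close>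

theorem line_transform_inversion:
  fixes u :: "real \<Rightarrow> complex"
  assumes u: "integrable lborel u" and ub: "\<And>l. norm (u l) \<le> C"
    and hu: "integrable lborel (line_transform u)"
    and right: "(u \<longlongrightarrow> Lp) (at_right 0)" and left: "(u \<longlongrightarrow> Lm) (at_left 0)"
  shows "(LINT s|lborel. line_transform u s) = of_real pi * (Lp + Lm)"
proof -
  have [measurable]: "u \<in> borel_measurable borel" using u by (simp add: borel_measurable_integrable)
  have [measurable]: "line_transform u \<in> borel_measurable borel" using hu by (simp add: borel_measurable_integrable)
  define d where "d = (\<lambda>k. 1 / real (Suc k))"
  have d: "d k > 0" for k by (simp add: d_def)
  have d0: "d \<longlonglongrightarrow> 0" unfolding d_def by (rule LIMSEQ_Suc[OF lim_1_over_n])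
  let ?G = "\<lambda>k. LINT s|lborel. of_real (exp (- (d k * s)\<^sup>2)) * line_transform u s"
  have 1: "?G \<longlonglongrightarrow> (LINT s|lborel. line_transform u s)"
  proof (rule integral_dominated_convergence[where w = "\<lambda>s. norm (line_transform u s)"])
    show "AE s in lborel. (\<lambda>k. of_real (exp (- (d k * s)\<^sup>2)) * line_transform u s) \<longlonglongrightarrow> line_transform u s"
    proof (rule AE_I2)
      fix s :: real
      have "(\<lambda>k. of_real (exp (- (d k * s)\<^sup>2)) * line_transform u s) \<longlonglongrightarrow> of_real (exp (- (0 * s)\<^sup>2)) * line_transform u s"
        by (intro tendsto_intros d0)
      thus "(\<lambda>k. of_real (exp (- (d k * s)\<^sup>2)) * line_transform u s) \<longlonglongrightarrow> line_transform u s" by simp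
    qed
  qed (use hu in \<open>auto simp: norm_mult mult_left_le_one_le\<close>)
  have eq: "?G k = of_real (2 * sqrt pi) * (LINT t|lborel. of_real (exp (- t\<^sup>2)) * u (2 * d k * t))" for k
  proof -
    let ?F = "\<lambda>s l. of_real (exp (- (d k * s)\<^sup>2)) * (exp (- (\<i> * of_real (s * l))) * u l) :: complex"
    have gi: "integrable lborel (\<lambda>s. exp (- (d k * s)\<^sup>2))"
      using lborel_integrable_real_affine[OF integrable_gauss, of "d k" 0] d[of k] by simp
    have prod: "integrable (lborel \<Otimes>\<^sub>M lborel) (\<lambda>(s, l). ?F s l)"
    proof (rule lborel_pair.Fubini_integrable)
      show "(\<lambda>(s, l). ?F s l) \<in> borel_measurable (lborel \<Otimes>\<^sub>M lborel)" by measurable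
      have "integrable lborel (\<lambda>s. exp (- (d k * s)\<^sup>2) * (LINT l|lborel. norm (u l)))"
        by (rule integrable_mult_left) (rule gi)
      thus "integrable lborel (\<lambda>s. LINT l|lborel. norm (case (s, l) of (s, l) \<Rightarrow> ?F s l))"
        by (simp add: norm_mult del: of_real_mult)
      show "AE s in lborel. integrable lborel (\<lambda>l. case (s, l) of (s, l) \<Rightarrow> ?F s l)"
        using integrable_line_transform[OF u] by (auto intro!: integrable_mult_right)
    qed
    have "?G k = (LINT s|lborel. LINT l|lborel. ?F s l)"
      unfolding line_transform_def by simp
    also have "\<dots> = (LINT l|lborel. LINT s|lborel. ?F s l)"
      by (rule lborel_pair.Fubini_integral[symmetric]) (rule prod)
    also have "\<dots> = (LINT l|lborel. of_real (sqrt pi / d k * exp (- (l / (2 * d k))\<^sup>2)) * u l)"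
    proof (rule Bochner_Integration.integral_cong[OF refl])
      fix l
      have "(LINT s|lborel. ?F s l) = (LINT s|lborel. (of_real (exp (- (d k * s)\<^sup>2)) * exp (- (\<i> * of_real (s * l)))) * u l)"
        by (simp only: mult.assoc)
      also have "\<dots> = (LINT s|lborel. of_real (exp (- (d k * s)\<^sup>2)) * exp (- (\<i> * of_real (s * l)))) * u l"
        by (rule integral_mult_left_zero)
      finally show "(LINT s|lborel. ?F s l) = of_real (sqrt pi / d k * exp (- (l / (2 * d k))\<^sup>2)) * u l"
        unfolding gauss_kernel_transform[OF d] .
    qed
    also have "\<dots> = \<bar>2 * d k\<bar> *\<^sub>R (LINT t|lborel. of_real (sqrt pi / d k * exp (- ((0 + 2 * d k * t) / (2 * d k))\<^sup>2)) * u (0 + 2 * d k * t))"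
      using d[of k] by (intro lborel_integral_real_affine) simp
    also have "\<dots> = (LINT t|lborel. of_real (2 * sqrt pi) * (of_real (exp (- t\<^sup>2)) * u (2 * d k * t)))"
      unfolding scaleR_conv_of_real integral_mult_right_zero[symmetric]
      by (rule Bochner_Integration.integral_cong[OF refl]) (use d[of k] in \<open>simp add: field_simps\<close>)
    also have "\<dots> = of_real (2 * sqrt pi) * (LINT t|lborel. of_real (exp (- t\<^sup>2)) * u (2 * d k * t))"
      by (rule integral_mult_right_zero)
    finally show ?thesis .
  qed
  let ?L = "\<lambda>t. of_real (exp (- t\<^sup>2)) * Lm + of_real (indicator {0..} t *\<^sub>R exp (- t\<^sup>2)) * (Lp - Lm)"
  have lim: "(\<lambda>k. LINT t|lborel. of_real (exp (- t\<^sup>2)) * u (2 * d k * t)) \<longlonglongrightarrow> (LINT t|lborel. ?L t)"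
  proof (rule integral_dominated_convergence[where w = "\<lambda>t. exp (- t\<^sup>2) * C"])
    show "integrable lborel (\<lambda>t. exp (- t\<^sup>2) * C)" by (rule integrable_mult_left) (rule integrable_gauss)
    show "AE t in lborel. norm (of_real (exp (- t\<^sup>2)) * u (2 * d k * t)) \<le> exp (- t\<^sup>2) * C" for k
      using ub by (auto simp: norm_mult)
    show "AE t in lborel. (\<lambda>k. of_real (exp (- t\<^sup>2)) * u (2 * d k * t)) \<longlonglongrightarrow> ?L t"
      using AE_lborel_singleton[of "0::real"]
    proof eventually_elim
      fix t :: real assume t: "t \<noteq> 0"
      have z: "(\<lambda>k. 2 * d k * t) \<longlonglongrightarrow> 0"
        using tendsto_mult[OF tendsto_mult[OF tendsto_const d0] tendsto_const, of 2 t] by simp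
      show "(\<lambda>k. of_real (exp (- t\<^sup>2)) * u (2 * d k * t)) \<longlonglongrightarrow> ?L t"
      proof (cases "t > 0")
        case True
        have "filterlim (\<lambda>k. 2 * d k * t) (at_right 0) sequentially"
        proof -
          have "2 * d k * t \<in> {0<..} \<and> 2 * d k * t \<noteq> 0" for k
            using mult_pos_pos[of "2 * d k" t] d[of k] True by simp
          thus ?thesis using z by (simp add: filterlim_at)
        qed
        hence "(\<lambda>k. u (2 * d k * t)) \<longlonglongrightarrow> Lp" by (rule filterlim_compose[OF right])
        hence "(\<lambda>k. of_real (exp (- t\<^sup>2)) * u (2 * d k * t)) \<longlonglongrightarrow> of_real (exp (- t\<^sup>2)) * Lp" by (intro tendsto_mult tendsto_const)
        thus ?thesis using True by (simp add: algebra_simps)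
      next
        case False
        hence t: "t < 0" using t by simp
        have "2 * d k * t \<in> {..<0} \<and> 2 * d k * t \<noteq> 0" for k
          using mult_pos_neg[of "2 * d k" t] d[of k] t by simp
        hence "filterlim (\<lambda>k. 2 * d k * t) (at_left 0) sequentially"
          using z by (auto simp: filterlim_at intro!: always_eventually)
        hence "(\<lambda>k. u (2 * d k * t)) \<longlonglongrightarrow> Lm" by (rule filterlim_compose[OF left])
        hence "(\<lambda>k. of_real (exp (- t\<^sup>2)) * u (2 * d k * t)) \<longlonglongrightarrow> of_real (exp (- t\<^sup>2)) * Lm" by (intro tendsto_mult tendsto_const)
        thus ?thesis using t by simp
      qed
    qed
  qed measurable
  have Lint: "(LINT t|lborel. ?L t) = of_real (sqrt pi / 2) * (Lp + Lm)"
  proof -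
    have i1: "integrable lborel (\<lambda>t. of_real (exp (- t\<^sup>2)) :: complex)"
      using integrable_gauss by (simp only: complex_of_real_integrable_eq)
    have i2: "integrable lborel (\<lambda>t. of_real (indicator {0..} t *\<^sub>R exp (- t\<^sup>2)) :: complex)"
      "(LINT t|lborel. of_real (indicator {0..} t *\<^sub>R exp (- t\<^sup>2)) :: complex) = of_real (sqrt pi / 2)"
      using gaussian_moment_0 by (simp_all only: complex_of_real_integrable_eq integral_complex_of_real has_bochner_integral_iff)
    have "(LINT t|lborel. ?L t) = of_real (sqrt pi) * Lm + of_real (sqrt pi / 2) * (Lp - Lm)"
      using i1 i2(1) by (subst Bochner_Integration.integral_add) (simp_all only: integral_mult_left_zero integrable_mult_left gauss_integral_0 i2(2))
    thus ?thesis by (simp add: field_simps)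
  qed
  have A: "?G \<longlonglongrightarrow> of_real (2 * sqrt pi) * (of_real (sqrt pi / 2) * (Lp + Lm))"
    unfolding eq Lint[symmetric] by (intro tendsto_mult tendsto_const lim)
  have B: "of_real (2 * sqrt pi) * (of_real (sqrt pi / 2) * (Lp + Lm)) = of_real pi * (Lp + Lm)"
  proof -
    have "of_real (2 * sqrt pi) * of_real (sqrt pi / 2) = (of_real pi :: complex)"
      unfolding of_real_mult[symmetric] by simp
    thus ?thesis by (simp only: mult.assoc[symmetric])
  qed
  show ?thesis by (rule trans[OF LIMSEQ_unique[OF 1 A] B])
qed

section \<open>The transform of a regular frequency function\<close>

abbreviation frequencies :: "('d::finite freq \<Rightarrow> complex) \<Rightarrow> nat^'d \<Rightarrow> nat^'d \<Rightarrow> real \<Rightarrow> complex" where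
  "frequencies \<theta> \<equiv> \<lambda>n m l. \<theta> (Freq n m l)"

text \<open>What one differentiation of \<open>freq_sum\<close> and one integration by parts ask of a frequency function.\<close>

definition regular :: "(nat^'d::finite \<Rightarrow> nat^'d \<Rightarrow> real \<Rightarrow> complex) \<Rightarrow> bool" where
  "regular \<theta> \<longleftrightarrow> rapid \<theta> \<and> rapid (hat_D \<theta>) \<and> rapid (hat_Sigma0 \<theta>) \<and>
     (\<forall>n m l. l \<noteq> 0 \<longrightarrow> \<theta> n m differentiable (at l))"

lemma freq_sum_measurable:
  assumes "regular \<theta>"
  shows "freq_sum \<theta> Y \<in> borel_measurable borel"
proof (rule borel_measurable_continuous_countable_exceptions[of "{0}"])
  have "isCont (freq_sum \<theta> Y) l" if "l \<noteq> 0" for l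
    using freq_sum_has_derivative[of \<theta> l Y] assms that
    by (auto simp: regular_def intro: has_vector_derivative_continuous)
  thus "continuous_on (- {0}) (freq_sum \<theta> Y)"
    by (intro continuous_at_imp_continuous_on) auto
qed simp

lemma freq_sum_integrable:
  assumes "regular \<theta>"
  shows "integrable lborel (freq_sum \<theta> Y)"
proof -
  obtain C where C: "\<And>Y l. norm (freq_sum \<theta> Y l) \<le> C / (1 + l\<^sup>2)" "C \<ge> 0"
    using freq_sum_bound[of \<theta>] assms unfolding regular_def by metis
  show ?thesis
    by (rule Bochner_Integration.integrable_bound[OF integrable_inverse_square[of C]])
       (use freq_sum_measurable[OF assms] C in \<open>auto simp: add_nonneg_pos intro: order_trans\<close>)
qed

lemma freq_sum_jump_tendsto:
  assumes "regular \<theta>"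
  shows "((\<lambda>l. freq_sum \<theta> Y l - freq_sum \<theta> Y (- l)) \<longlongrightarrow> 0) (at_right 0)"
proof -
  obtain C where C: "\<And>Y l. norm (freq_sum (hat_Sigma0 \<theta>) Y l) \<le> C / (1 + l\<^sup>2)" "C \<ge> 0"
    using freq_sum_bound[of "hat_Sigma0 \<theta>"] assms unfolding regular_def by metis
  have C': "norm (freq_sum (hat_Sigma0 \<theta>) Y l) \<le> C" for l
    by (rule order_trans[OF C(1)]) (rule divide_one_plus_square_le[OF C(2)])
  have "((\<lambda>l::real. \<bar>l\<bar> * C) \<longlongrightarrow> \<bar>0\<bar> * C) (at_right 0)"
    by (intro tendsto_intros)
  hence z: "((\<lambda>l::real. \<bar>l\<bar> * C) \<longlongrightarrow> 0) (at_right 0)" by simp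
  show ?thesis
  proof (rule Lim_null_comparison[OF _ z])
    show "\<forall>\<^sub>F l in at_right 0. norm (freq_sum \<theta> Y l - freq_sum \<theta> Y (- l)) \<le> \<bar>l\<bar> * C"
      using eventually_small[OF zero_less_one]
    proof eventually_elim
      fix l :: real assume "0 < l \<and> l < 1"
      hence "freq_sum \<theta> Y l - freq_sum \<theta> Y (- l) = of_real l * freq_sum (hat_Sigma0 \<theta>) Y l"
        using assms by (intro freq_sum_jump) (auto simp: regular_def)
      thus "norm (freq_sum \<theta> Y l - freq_sum \<theta> Y (- l)) \<le> \<bar>l\<bar> * C"
        by (simp add: norm_mult mult_left_mono C')
    qed
  qed
qed

text \<open>The transform of the second derivative is \<open>- s\<^sup>2\<close> times that of \<open>freq_sum \<theta> Y\<close>, and the bounds of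
  \<open>freq_sum_bound\<close> do not depend on \<open>Y\<close>.\<close>

theorem line_transform_freq_sum_decay:
  fixes \<theta> :: "nat^'d::finite \<Rightarrow> nat^'d \<Rightarrow> real \<Rightarrow> complex"
  assumes r: "regular \<theta>" and rD: "regular (hat_D \<theta>)"
  obtains C where "\<And>Y s. norm (line_transform (freq_sum \<theta> Y) s) \<le> C / (1 + s\<^sup>2)"
proof -
  obtain C0 where C0: "\<And>Y l. norm (freq_sum \<theta> Y l) \<le> C0 / (1 + l\<^sup>2)"
    using freq_sum_bound[of \<theta>] r unfolding regular_def by metis
  obtain C1 where C1: "\<And>Y l. norm (freq_sum (hat_D \<theta>) Y l) \<le> C1 / (1 + l\<^sup>2)"
    using freq_sum_bound[of "hat_D \<theta>"] rD unfolding regular_def by metis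
  obtain C2 where C2: "\<And>Y l. norm (freq_sum (hat_D (hat_D \<theta>)) Y l) \<le> C2 / (1 + l\<^sup>2)"
    using freq_sum_bound[of "hat_D (hat_D \<theta>)"] rD unfolding regular_def by metis
  define K0 where "K0 = (LINT l|lborel. C0 / (1 + l\<^sup>2))"
  define K2 where "K2 = (LINT l|lborel. C2 / (1 + l\<^sup>2))"
  have "norm (line_transform (freq_sum \<theta> Y) s) \<le> (K0 + K2) / (1 + s\<^sup>2)" for Y s
  proof -
    let ?u = "freq_sum \<theta> Y" and ?v = "freq_sum (hat_D \<theta>) Y"
    have du: "(?u has_vector_derivative ?v l) (at l)" if "l \<noteq> 0" for l
      by (rule freq_sum_has_derivative) (use r that in \<open>auto simp: regular_def\<close>)
    have dv: "(?v has_vector_derivative freq_sum (hat_D (hat_D \<theta>)) Y l) (at l)" if "l \<noteq> 0" for l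
      by (rule freq_sum_has_derivative) (use rD that in \<open>auto simp: regular_def\<close>)
    have 0: "norm (line_transform ?u s) \<le> K0"
      unfolding K0_def by (rule norm_line_transform_le[OF freq_sum_integrable[OF r] integrable_inverse_square C0])
    have 1: "line_transform ?v s = \<i> * of_real s * line_transform ?u s"
      by (rule line_transform_by_parts(2)[OF du freq_sum_integrable[OF r] C0 freq_sum_jump_tendsto[OF r] integrable_inverse_square C1 freq_sum_integrable[OF rD]])
    have 2: "norm (of_real s * line_transform ?v s) \<le> K2"
      unfolding K2_def by (rule line_transform_by_parts(1)[OF dv freq_sum_integrable[OF rD] C1 freq_sum_jump_tendsto[OF rD] integrable_inverse_square C2])
    have "norm (of_real s * line_transform ?v s) = s\<^sup>2 * norm (line_transform ?u s)"
      unfolding 1 by (simp add: norm_mult power2_eq_square)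
    with 0 2 have "(1 + s\<^sup>2) * norm (line_transform ?u s) \<le> K0 + K2" by (simp add: distrib_right)
    moreover have "1 + s\<^sup>2 > 0" by (simp add: add_pos_nonneg)
    ultimately show ?thesis by (simp add: pos_le_divide_eq mult.commute)
  qed
  thus ?thesis by (rule that)
qed

lemma kern1_measurable [measurable]:
  assumes [measurable]: "f \<in> borel_measurable M" "g \<in> borel_measurable M" "h \<in> borel_measurable M"
  shows "(\<lambda>x. kern1 n m (f x) (g x) (h x)) \<in> borel_measurable M"
  unfolding kern1_def lag_def lag_sum_def amp_def by measurable

lemma phase_coord_measurable [measurable]:
  "(\<lambda>Y :: 'd::finite phase. fst Y $ j) \<in> borel_measurable borel"
  "(\<lambda>Y :: 'd::finite phase. snd Y $ j) \<in> borel_measurable borel"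
  by (intro borel_measurable_continuous_onI continuous_intros)+

lemma regular_measurable:
  assumes "regular \<theta>"
  shows "\<theta> n m \<in> borel_measurable borel"
proof (rule borel_measurable_continuous_countable_exceptions[of "{0}"])
  have "isCont (\<theta> n m) l" if "l \<noteq> 0" for l
    using assms that unfolding regular_def by (blast intro: differentiable_imp_continuous_within)
  thus "continuous_on (- {0}) (\<theta> n m)" by (intro continuous_at_imp_continuous_on) auto
qed simp

text \<open>At \<open>l = 0\<close> the kernel is not given by the closed form, but there the density vanishes.  Hence the term
  is measurable in \<open>l\<close> and \<open>Y\<close> jointly.\<close>

lemma freq_sum_term_eq:
  "cnj (W_kernel n m l Y) * t * of_real (\<bar>l\<bar> ^ CARD('d)) =
   cnj (\<Prod>j\<in>UNIV. kern1 (n $ j) (m $ j) l (fst Y $ j) (snd Y $ j)) * t * of_real (\<bar>l\<bar> ^ CARD('d))"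
  for n m :: "nat^'d::finite"
  by (cases "l = 0") (simp_all add: W_kernel_prod power_0_left)

lemma freq_sum_joint_measurable:
  fixes \<theta> :: "nat^'d::finite \<Rightarrow> nat^'d \<Rightarrow> real \<Rightarrow> complex"
  assumes r: "regular \<theta>"
  shows "(\<lambda>x. freq_sum \<theta> (fst x) (snd x)) \<in> borel_measurable (borel \<Otimes>\<^sub>M borel)"
  unfolding freq_sum_def
proof (rule borel_measurable_infsum_countable)
  note [measurable] = regular_measurable[OF r]
  show "(\<lambda>x. freq_term \<theta> (fst x) (snd x) p)
     \<in> borel_measurable (borel \<Otimes>\<^sub>M borel)" for p
    unfolding freq_sum_term_eq by measurable
  have rp: "rapid \<theta>" using r by (simp add: regular_def)
  show "(\<lambda>p. norm (freq_term \<theta> (fst x) (snd x) p)) summable_on UNIV" for x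
    by (rule freq_sum_bound[OF rp]) blast
qed

lemma line_transform_joint_measurable:
  fixes \<theta> :: "nat^'d::finite \<Rightarrow> nat^'d \<Rightarrow> real \<Rightarrow> complex"
  assumes r: "regular \<theta>"
  shows "(\<lambda>x. line_transform (freq_sum \<theta> (fst x)) (snd x)) \<in> borel_measurable (borel \<Otimes>\<^sub>M borel)"
proof -
  note [measurable] = freq_sum_joint_measurable[OF r]
  have "(\<lambda>x. freq_sum \<theta> (fst (fst x)) (snd x)) \<in> borel_measurable ((borel \<Otimes>\<^sub>M borel) \<Otimes>\<^sub>M borel)"
  proof -
    have "(\<lambda>x. (fst (fst x), snd x)) \<in> ((borel \<Otimes>\<^sub>M borel) \<Otimes>\<^sub>M borel) \<rightarrow>\<^sub>M ((borel :: 'd phase measure) \<Otimes>\<^sub>M (borel :: real measure))"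
      by measurable
    from measurable_compose[OF this freq_sum_joint_measurable[OF r]] show ?thesis by simp
  qed
  hence [measurable]: "(\<lambda>x. freq_sum \<theta> (fst (fst x)) (snd x)) \<in> borel_measurable (((borel :: 'd phase measure) \<Otimes>\<^sub>M (borel :: real measure)) \<Otimes>\<^sub>M lborel)"
    by (simp cong: measurable_cong_sets)
  have "(\<lambda>(x, l). exp (- (\<i> * of_real (snd x * l))) * freq_sum \<theta> (fst x) l) \<in> borel_measurable (((borel :: 'd phase measure) \<Otimes>\<^sub>M (borel :: real measure)) \<Otimes>\<^sub>M lborel)"
    unfolding case_prod_beta by measurable
  from lborel.borel_measurable_lebesgue_integral[OF this]
  show ?thesis by (simp add: line_transform_def)
qed

lemma fourier_transpose_eq_line_transform:
  fixes \<theta> :: "'d::finite freq \<Rightarrow> complex"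
  assumes r: "regular (frequencies \<theta>)"
  shows "fourier_transpose \<theta> (Y, s) = line_transform (freq_sum (frequencies \<theta>) Y) s"
proof -
  let ?t = "frequencies \<theta>"
  let ?D = "CARD('d)"
  note [measurable] = regular_measurable[OF r]
  let ?g = "\<lambda>p l. freq_term ?t Y l p"
  let ?f = "\<lambda>p l. exp (- (\<i> * of_real (s * l))) * ?g p l"
  have rp: "rapid ?t" using r by (simp add: regular_def)
  obtain C where s: "\<And>l. (\<lambda>p. norm (?g p l)) summable_on UNIV"
    and b: "\<And>l. (\<Sum>\<^sub>\<infinity>p. norm (?g p l)) \<le> C / (1 + l\<^sup>2)"
    by (rule freq_sum_bound[OF rp]) (rule that)
  have gm [measurable]: "?g p \<in> borel_measurable borel" for p
    unfolding freq_sum_term_eq by measurable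
  have fm: "?f p \<in> borel_measurable borel" for p
    by (intro borel_measurable_times gm) measurable
  have nf: "norm (?f p l) = norm (?g p l)" for p l unfolding norm_mult[of "exp _"] norm_phase by simp
  have tm: "(LINT l|lebesgue. cnj (exp (\<i> * of_real (s * l)) * W_kernel (fst p) (snd p) l Y) * ?t (fst p) (snd p) l * of_real (\<bar>l\<bar> ^ ?D))
      = (LINT l|lborel. ?f p l)" for p
  proof -
    have e: "(\<lambda>l. cnj (exp (\<i> * of_real (s * l)) * W_kernel (fst p) (snd p) l Y) * ?t (fst p) (snd p) l * of_real (\<bar>l\<bar> ^ ?D)) = ?f p"
    proof
      fix l
      have "cnj (exp (\<i> * of_real (s * l))) = exp (- (\<i> * of_real (s * l)))"
      proof -
        have "cnj (\<i> * of_real (s * l)) = - (\<i> * of_real (s * l))" by simp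
        thus ?thesis by (simp only: exp_cnj)
      qed
      thus "cnj (exp (\<i> * of_real (s * l)) * W_kernel (fst p) (snd p) l Y) * ?t (fst p) (snd p) l * of_real (\<bar>l\<bar> ^ ?D) = ?f p l"
        by (simp only: complex_cnj_mult mult.assoc)
    qed
    have "?f p \<in> borel_measurable lborel" using fm by simp
    thus ?thesis unfolding e by (rule integral_completion)
  qed
  have "fourier_transpose \<theta> (Y, s) = (\<Sum>\<^sub>\<infinity>p. LINT l|lborel. ?f p l)"
    unfolding fourier_transpose_def freq_integral_def case_prod_conv
    by (rule infsum_cong) (simp only: case_prod_beta tm)
  also have "\<dots> = (LINT l|lborel. (\<Sum>\<^sub>\<infinity>p. ?f p l))"
  proof (rule integral_infsum_swap_dominated(2)[symmetric])
    show "integrable lborel (\<lambda>l. C / (1 + l\<^sup>2))" by (rule integrable_inverse_square)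
    show "?f p \<in> borel_measurable lborel" for p using fm by simp
    show "(\<lambda>p. norm (?f p l)) summable_on UNIV" for l unfolding nf by (rule s)
    show "(\<Sum>\<^sub>\<infinity>p. norm (?f p l)) \<le> C / (1 + l\<^sup>2)" for l unfolding nf by (rule b)
  qed
  also have "\<dots> = line_transform (freq_sum ?t Y) s"
    unfolding line_transform_def freq_sum_def infsum_cmult_right' ..
  finally show ?thesis .
qed

section \<open>Grids on the orthant\<close>

definition grid_point :: "real \<Rightarrow> real^'d::finite \<Rightarrow> nat^'d" where
  "grid_point \<epsilon> x = (\<chi> j. grid_index \<epsilon> (x $ j))"

definition grid_cell :: "real \<Rightarrow> nat \<Rightarrow> real set" where
  "grid_cell \<epsilon> i = {2 * \<epsilon> * real i..<2 * \<epsilon> * (real i + 1)}"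

lemma pos_orthant_closed: "closed (pos_orthant :: (real^'d::finite) set)"
proof -
  have "pos_orthant = (\<Inter>j. {x :: real^'d. 0 \<le> x $ j})" by (auto simp: pos_orthant_def)
  also have "closed \<dots>" by (intro closed_INT ballI closed_Collect_le continuous_intros)
  finally show ?thesis .
qed

lemma pos_orthant_borel [measurable]: "(pos_orthant :: (real^'d::finite) set) \<in> sets borel"
  by (rule borel_closed[OF pos_orthant_closed])

lemma grid_cell_iff:
  assumes e: "\<epsilon> > 0" and x: "x \<ge> 0"
  shows "x \<in> grid_cell \<epsilon> i \<longleftrightarrow> grid_index \<epsilon> x = i"
proof -
  have "x \<in> grid_cell \<epsilon> i \<longleftrightarrow> real i \<le> x / (2 * \<epsilon>) \<and> x / (2 * \<epsilon>) < real i + 1"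
    using e by (auto simp: grid_cell_def field_simps)
  also have "\<dots> \<longleftrightarrow> \<lfloor>x / (2 * \<epsilon>)\<rfloor> = int i" by (auto simp: floor_eq_iff)
  also have "\<dots> \<longleftrightarrow> grid_index \<epsilon> x = i"
  proof -
    have "\<lfloor>x / (2 * \<epsilon>)\<rfloor> \<ge> 0" using e x by simp
    thus ?thesis unfolding grid_index_def by auto
  qed
  finally show ?thesis .
qed

lemma grid_indicator:
  fixes x :: "real^'d::finite"
  assumes e: "\<epsilon> > 0"
  shows "(\<Prod>j\<in>UNIV. indicator (grid_cell \<epsilon> (i $ j)) (x $ j)) = (if x \<in> pos_orthant \<and> grid_point \<epsilon> x = i then 1 else 0 :: complex)"
proof (cases "x \<in> pos_orthant \<and> grid_point \<epsilon> x = i")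
  case True
  have "x $ j \<in> grid_cell \<epsilon> (i $ j)" for j
    using True grid_cell_iff[OF e, of "x $ j" "i $ j"] by (auto simp: pos_orthant_def grid_point_def)
  thus ?thesis using True by simp
next
  case False
  have "\<exists>j. x $ j \<notin> grid_cell \<epsilon> (i $ j)"
  proof (rule ccontr)
    assume "\<not> ?thesis"
    hence c: "x $ j \<in> grid_cell \<epsilon> (i $ j)" for j by blast
    have p: "x $ j \<ge> 0" for j
    proof -
      have "0 \<le> 2 * \<epsilon> * real (i $ j)" using e by simp
      thus ?thesis using c[of j] unfolding grid_cell_def by (auto intro: order_trans)
    qed
    have "grid_index \<epsilon> (x $ j) = i $ j" for j using grid_cell_iff[OF e p] c by blast
    thus False using False p by (auto simp: pos_orthant_def grid_point_def vec_eq_iff)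
  qed
  then obtain j where "x $ j \<notin> grid_cell \<epsilon> (i $ j)" by blast
  hence "indicator (grid_cell \<epsilon> (i $ j)) (x $ j) = (0 :: complex)" by simp
  hence "\<exists>j\<in>UNIV. indicator (grid_cell \<epsilon> (i $ j)) (x $ j) = (0 :: complex)" by (intro bexI[of _ j]) auto
  from prod_zero[OF finite this] show ?thesis unfolding if_not_P[OF False] .
qed

lemma grid_function_expansion:
  fixes \<phi> :: "nat^'d::finite \<Rightarrow> complex"
  assumes e: "\<epsilon> > 0"
  shows "(\<lambda>i. norm (\<phi> i * (\<Prod>j\<in>UNIV. indicator (grid_cell \<epsilon> (i $ j)) (x $ j)))) summable_on UNIV"
    and "(\<Sum>\<^sub>\<infinity>i. \<phi> i * (\<Prod>j\<in>UNIV. indicator (grid_cell \<epsilon> (i $ j)) (x $ j))) = indicator pos_orthant x *\<^sub>R \<phi> (grid_point \<epsilon> x)"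
proof -
  let ?f = "\<lambda>i. \<phi> i * (\<Prod>j\<in>UNIV. indicator (grid_cell \<epsilon> (i $ j)) (x $ j))"
  have z: "?f i = 0" if "i \<noteq> grid_point \<epsilon> x" for i
    using that unfolding grid_indicator[OF e] by auto
  have "(\<lambda>i. norm (?f i)) summable_on {grid_point \<epsilon> x}" by simp
  thus "(\<lambda>i. norm (?f i)) summable_on UNIV"
    by (subst summable_on_cong_neutral[where T = "{grid_point \<epsilon> x}" and g = "\<lambda>i. norm (?f i)"]) (use z in auto)
  have "infsum ?f UNIV = infsum ?f {grid_point \<epsilon> x}"
    by (rule infsum_cong_neutral) (use z in auto)
  also have "\<dots> = indicator pos_orthant x *\<^sub>R \<phi> (grid_point \<epsilon> x)"
    unfolding grid_indicator[OF e] by (auto simp: indicator_def)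
  finally show "infsum ?f UNIV = indicator pos_orthant x *\<^sub>R \<phi> (grid_point \<epsilon> x)" .
qed

lemma vec_nth_measurable [measurable]: "(\<lambda>x :: real^'d::finite. x $ j) \<in> borel_measurable borel"
  by (intro borel_measurable_continuous_onI continuous_intros)

lemma grid_cell_borel [measurable]: "grid_cell \<epsilon> i \<in> sets borel"
  by (simp add: grid_cell_def)

lemma grid_term_measurable:
  "(\<lambda>x :: real^'d::finite. c * (\<Prod>j\<in>UNIV. indicator (grid_cell \<epsilon> (i $ j)) (x $ j)) :: complex) \<in> borel_measurable borel"
  by measurable

lemma grid_function_measurable:
  fixes \<phi> :: "nat^'d::finite \<Rightarrow> complex"
  assumes e: "\<epsilon> > 0"
  shows "(\<lambda>x. indicator pos_orthant x *\<^sub>R \<phi> (grid_point \<epsilon> x)) \<in> borel_measurable borel"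
  unfolding grid_function_expansion(2)[OF e, symmetric]
  by (rule borel_measurable_infsum_countable[OF grid_term_measurable grid_function_expansion(1)[OF e]])

text \<open>A function that is constant on the cells, which have volume \<open>(2 \<epsilon>)\<^sup>d\<close>, integrates to a Riemann sum.\<close>

lemma grid_integral:
  fixes \<phi> :: "nat^'d::finite \<Rightarrow> complex"
  assumes e: "\<epsilon> > 0" and s: "(\<lambda>i. norm (\<phi> i)) summable_on UNIV"
  shows "(LINT x|lborel. indicator pos_orthant x *\<^sub>R \<phi> (grid_point \<epsilon> x)) = of_real ((2 * \<epsilon>) ^ CARD('d)) * (\<Sum>\<^sub>\<infinity>i. \<phi> i)"
proof -
  let ?f = "\<lambda>i x. \<phi> i * (\<Prod>j\<in>UNIV. indicator (grid_cell \<epsilon> (i $ j)) (x $ j))"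
  let ?c = "(2 * \<epsilon>) ^ CARD('d)"
  have vol: "measure lborel (grid_cell \<epsilon> a) = 2 * \<epsilon>" for a
    using e by (simp add: grid_cell_def algebra_simps)
  have ind: "integrable lborel (indicator (grid_cell \<epsilon> a) :: real \<Rightarrow> complex)"
    "(LINT t|lborel. indicator (grid_cell \<epsilon> a) t :: complex) = of_real (2 * \<epsilon>)" for a
  proof -
    have r: "integrable lborel (indicator (grid_cell \<epsilon> a) :: real \<Rightarrow> real)"
      by (rule integrable_real_indicator) (use e in \<open>auto simp: grid_cell_def\<close>)
    have eq: "(indicator (grid_cell \<epsilon> a) :: real \<Rightarrow> complex) = (\<lambda>t. of_real (indicator (grid_cell \<epsilon> a) t))"
      by (auto simp: indicator_def fun_eq_iff)
    show "integrable lborel (indicator (grid_cell \<epsilon> a) :: real \<Rightarrow> complex)"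
      unfolding eq using r by (simp only: complex_of_real_integrable_eq)
    show "(LINT t|lborel. indicator (grid_cell \<epsilon> a) t :: complex) = of_real (2 * \<epsilon>)"
      unfolding eq integral_complex_of_real using vol by simp
  qed
  have int: "integrable lborel (?f i)" for i :: "nat^'d"
    by (intro integrable_mult_right lborel_vec_prod(1) ind)
  have val: "(LINT x|lborel. ?f i x) = \<phi> i * of_real ?c" for i
    by (simp only: integral_mult_right_zero lborel_vec_prod(2)[OF ind(1)] ind(2)) simp
  have nval: "(LINT x|lborel. norm (?f i x)) = norm (\<phi> i) * ?c" for i
  proof -
    have "(\<lambda>x. norm (?f i x)) = (\<lambda>x. norm (\<phi> i) * (\<Prod>j\<in>UNIV. indicator (grid_cell \<epsilon> (i $ j)) (x $ j)))"
      by (auto simp: norm_mult prod_norm[symmetric] fun_eq_iff indicator_def intro!: prod.cong)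
    moreover have ri: "integrable lborel (indicator (grid_cell \<epsilon> a) :: real \<Rightarrow> real)" for a
      by (rule integrable_real_indicator) (use e in \<open>auto simp: grid_cell_def\<close>)
    moreover have rv: "(LINT t|lborel. indicator (grid_cell \<epsilon> a) t :: real) = 2 * \<epsilon>" for a
      using vol by simp
    moreover have "(LINT x|lborel. (\<Prod>j\<in>UNIV. indicator (grid_cell \<epsilon> (i $ j)) (x $ j) :: real)) = ?c"
      by (subst lborel_vec_prod(2)[of "\<lambda>j. indicator (grid_cell \<epsilon> (i $ j))", OF ri]) (simp only: rv prod_constant)
    ultimately show ?thesis by (simp only: integral_mult_right_zero)
  qed
  have "(LINT x|lborel. (\<Sum>\<^sub>\<infinity>i. ?f i x)) = (\<Sum>\<^sub>\<infinity>i. LINT x|lborel. ?f i x)"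
  proof (rule integral_infsum_swap(2)[OF int])
    fix F :: "(nat^'d) set" assume F: "finite F"
    have "(\<Sum>i\<in>F. norm (\<phi> i)) \<le> (\<Sum>\<^sub>\<infinity>i. norm (\<phi> i))"
      by (rule finite_sum_le_infsum[OF s F]) auto
    hence "(\<Sum>i\<in>F. norm (\<phi> i)) * ?c \<le> (\<Sum>\<^sub>\<infinity>i. norm (\<phi> i)) * ?c"
      using e by (intro mult_right_mono) auto
    thus "(\<Sum>i\<in>F. LINT x|lborel. norm (?f i x)) \<le> (\<Sum>\<^sub>\<infinity>i. norm (\<phi> i)) * ?c"
      unfolding nval by (simp add: sum_distrib_right)
  qed (rule grid_function_expansion(1)[OF e])
  thus ?thesis
    unfolding grid_function_expansion(2)[OF e] val infsum_cmult_left' by (simp add: mult.commute)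
qed

section \<open>Weights on the boundary\<close>

definition orth_weight :: "real^'d::finite \<Rightarrow> real" where
  "orth_weight x = (\<Prod>j\<in>UNIV. 1 / (1 + \<bar>x $ j\<bar>)\<^sup>2)"

definition int_weight :: "int^'d::finite \<Rightarrow> real" where
  "int_weight k = (\<Prod>j\<in>UNIV. 1 / (1 + \<bar>real_of_int (k $ j)\<bar>)\<^sup>2)"

lemma orth_weight_nonneg: "orth_weight x \<ge> 0"
  unfolding orth_weight_def by (intro prod_nonneg) simp

lemma int_weight_nonneg: "int_weight k \<ge> 0"
  unfolding int_weight_def by (intro prod_nonneg) simp

lemma orth_weight_integrable: "integrable lborel (orth_weight :: real^'d::finite \<Rightarrow> real)"
proof -
  have "integrable lborel (\<lambda>t::real. 1 / (1 + \<bar>t\<bar>)\<^sup>2)"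
  proof (rule Bochner_Integration.integrable_bound[OF integrable_inverse_square[of 1]])
    show "AE t::real in lborel. norm (1 / (1 + \<bar>t\<bar>)\<^sup>2) \<le> norm (1 / (1 + t\<^sup>2))"
    proof (rule AE_I2)
      fix t :: real
      have "1 + t\<^sup>2 \<le> (1 + \<bar>t\<bar>)\<^sup>2" by (simp add: power2_eq_square algebra_simps)
      hence "1 / (1 + \<bar>t\<bar>)\<^sup>2 \<le> 1 / (1 + t\<^sup>2)"
        by (intro divide_left_mono mult_pos_pos zero_less_power) (auto simp: add_pos_nonneg)
      thus "norm (1 / (1 + \<bar>t\<bar>)\<^sup>2) \<le> norm (1 / (1 + t\<^sup>2))" by simp
    qed
  qed simp
  from lborel_vec_prod(1)[OF this] show ?thesis by (simp add: orth_weight_def[abs_def])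
qed

lemma int_weight_summable: "(int_weight :: int^'d::finite \<Rightarrow> real) summable_on UNIV"
  using infsum_vec_prod(1)[of "\<lambda>_ k. 1 / (1 + \<bar>real_of_int k\<bar>)\<^sup>2"] inverse_square_sum_int
  by (simp add: int_weight_def[abs_def])

text \<open>The analogue of \<open>power_weight_le\<close> in the coordinates \<open>(x, k)\<close> of the boundary.  The constant \<open>c\<close> leaves
  room for the distance between a point and its cell.\<close>

lemma boundary_weight_le:
  fixes x :: "real^'d::finite" and k :: "int^'d"
  assumes c: "c > 0" and w: "\<And>j. (1 + \<bar>x $ j\<bar>) / c \<le> w" "\<And>j. 1 + \<bar>real_of_int (k $ j)\<bar> \<le> w"
  shows "1 \<le> c ^ (2 * CARD('d)) * (orth_weight x * int_weight k) * w ^ (4 * CARD('d))"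
proof -
  have "c ^ (2 * CARD('d)) * (orth_weight x * int_weight k) * w ^ (4 * CARD('d))
     = (\<Prod>j\<in>(UNIV::'d set). c\<^sup>2 * ((1 / (1 + \<bar>x $ j\<bar>)\<^sup>2) * (1 / (1 + \<bar>real_of_int (k $ j)\<bar>)\<^sup>2)) * w ^ 4)"
    by (simp add: orth_weight_def int_weight_def prod.distrib power_mult prod_dividef power_mult_distrib)
  also have "\<dots> \<ge> (\<Prod>j\<in>(UNIV::'d set). 1)"
  proof (rule prod_mono)
    fix j :: 'd
    have "((1 + \<bar>x $ j\<bar>) / c)\<^sup>2 * (1 + \<bar>real_of_int (k $ j)\<bar>)\<^sup>2 \<le> w\<^sup>2 * w\<^sup>2"
      using w[of j] c by (intro mult_mono power_mono) auto
    also have "\<dots> = w ^ 4" by (simp add: power_add[symmetric])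
    finally have "(1 + \<bar>x $ j\<bar>)\<^sup>2 * (1 + \<bar>real_of_int (k $ j)\<bar>)\<^sup>2 \<le> c\<^sup>2 * w ^ 4"
      using c by (simp add: power_divide field_simps)
    moreover have "(1 + \<bar>x $ j\<bar>)\<^sup>2 * (1 + \<bar>real_of_int (k $ j)\<bar>)\<^sup>2 > 0"
      by (intro mult_pos_pos zero_less_power) auto
    ultimately show "0 \<le> (1::real) \<and> 1 \<le> c\<^sup>2 * ((1 / (1 + \<bar>x $ j\<bar>)\<^sup>2) * (1 / (1 + \<bar>real_of_int (k $ j)\<bar>)\<^sup>2)) * w ^ 4"
      by simp
  qed
  finally show ?thesis by simp
qed

section \<open>Approach to the boundary\<close>

text \<open>The pair \<open>(low i k, high i k)\<close> is the pair of indices with difference \<open>k\<close> and componentwise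
  minimum \<open>i\<close>.\<close>

definition low :: "(nat^'d::finite) \<Rightarrow> int^'d \<Rightarrow> nat^'d" where
  "low i k = (\<chi> j. i $ j + nat (- (k $ j)))"

definition high :: "(nat^'d::finite) \<Rightarrow> int^'d \<Rightarrow> nat^'d" where
  "high i k = (\<chi> j. i $ j + nat (k $ j))"

lemma low_high_sum: "real (low i k $ j) + real (high i k $ j) = 2 * real (i $ j) + \<bar>real_of_int (k $ j)\<bar>"
  by (cases "k $ j \<ge> 0") (auto simp: low_def high_def)

lemma low_high_diff: "real (high i k $ j) - real (low i k $ j) = real_of_int (k $ j)"
  by (cases "k $ j \<ge> 0") (auto simp: low_def high_def)

lemma grid_point_freq_tendsto:
  fixes x :: "real^'d::finite"
  assumes x: "x \<in> pos_orthant"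
  shows "((\<lambda>\<epsilon>. \<epsilon> * (real (low (grid_point \<epsilon> x) k $ j) + real (high (grid_point \<epsilon> x) k $ j))) \<longlongrightarrow> x $ j) (at_right 0)"
proof -
  have "((\<lambda>\<epsilon>. 2 * \<epsilon> * (real (grid_index \<epsilon> (x $ j)) + \<bar>real_of_int (k $ j)\<bar> / 2)) \<longlongrightarrow> x $ j) (at_right 0)"
    by (rule grid_index_tendsto) (use x in \<open>simp add: pos_orthant_def\<close>)
  thus ?thesis unfolding low_high_sum by (simp add: grid_point_def algebra_simps)
qed

lemma boundary_mem:
  fixes x :: "real^'d::finite"
  assumes "x \<in> pos_orthant" "s = 1 \<or> s = -1"
  shows "Bdry (s *\<^sub>R x) k \<in> freq_space"
  using assms by (auto simp: freq_space_def pos_orthant_def neg_orthant_def)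

text \<open>The frequencies attached to the cell of \<open>x\<close> converge to \<open>(s x, k)\<close> in the metric of the completed
  frequency space.\<close>

lemma freq_tendsto_boundary:
  fixes \<theta> :: "'d::finite freq \<Rightarrow> complex" and x :: "real^'d"
  assumes cont: "continuous_map freq_topology euclidean \<theta>" and x: "x \<in> pos_orthant" and s: "s = 1 \<or> s = -1"
  shows "((\<lambda>\<epsilon>. \<theta> (Freq (low (grid_point \<epsilon> x) k) (high (grid_point \<epsilon> x) k) (s * \<epsilon>))) \<longlongrightarrow> \<theta> (Bdry (s *\<^sub>R x) k)) (at_right 0)"
proof -
  interpret M: Metric_space "freq_space :: 'd freq set" freq_dist by (rule Metric_space_freq)
  let ?p = "\<lambda>\<epsilon>. Freq (low (grid_point \<epsilon> x) k) (high (grid_point \<epsilon> x) k) (s * \<epsilon>)"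
  let ?q = "Bdry (s *\<^sub>R x) k"
  let ?N = "\<lambda>\<epsilon> j. \<epsilon> * (real (low (grid_point \<epsilon> x) k $ j) + real (high (grid_point \<epsilon> x) k $ j))"
  have s1: "\<bar>s\<bar> = 1" using s by auto
  have dist: "freq_dist (?p \<epsilon>) ?q = (\<Sum>j\<in>UNIV. \<bar>?N \<epsilon> j - x $ j\<bar>) + \<bar>\<epsilon>\<bar>" for \<epsilon>
  proof -
    have "\<bar>s * \<epsilon> * (real (low (grid_point \<epsilon> x) k $ j) + real (high (grid_point \<epsilon> x) k $ j)) - (s *\<^sub>R x) $ j\<bar> = \<bar>?N \<epsilon> j - x $ j\<bar>" for j
    proof -
      have "s * \<epsilon> * (real (low (grid_point \<epsilon> x) k $ j) + real (high (grid_point \<epsilon> x) k $ j)) - (s *\<^sub>R x) $ j = s * (?N \<epsilon> j - x $ j)"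
        by (simp add: algebra_simps)
      thus ?thesis using s1 by (simp only: abs_mult) simp
    qed
    thus ?thesis using s1 by (simp add: low_high_diff abs_mult)
  qed
  have "((\<lambda>\<epsilon>. (\<Sum>j\<in>UNIV. \<bar>?N \<epsilon> j - x $ j\<bar>) + \<bar>\<epsilon>\<bar>) \<longlongrightarrow> (\<Sum>j\<in>(UNIV::'d set). \<bar>x $ j - x $ j\<bar>) + \<bar>0\<bar>) (at_right 0)"
    by (intro tendsto_intros grid_point_freq_tendsto[OF x])
  hence d0: "((\<lambda>\<epsilon>. freq_dist (?p \<epsilon>) ?q) \<longlongrightarrow> 0) (at_right 0)" unfolding dist by simp
  have "limitin freq_topology ?p ?q (at_right 0)"
    unfolding M.limitin_metric
  proof (intro conjI allI impI)
    show "?q \<in> freq_space" by (rule boundary_mem[OF x s])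
    fix e :: real assume "e > 0"
    with order_tendstoD(2)[OF d0] have "eventually (\<lambda>\<epsilon>. freq_dist (?p \<epsilon>) ?q < e) (at_right 0)" by blast
    thus "\<forall>\<^sub>F \<epsilon> in at_right 0. ?p \<epsilon> \<in> freq_space \<and> freq_dist (?p \<epsilon>) ?q < e"
      using eventually_small[OF zero_less_one]
      by eventually_elim (use s in \<open>auto simp: freq_space_def\<close>)
  qed
  from continuous_map_limit[OF cont this] show ?thesis by (simp add: o_def)
qed

lemma hat_d0_low_high_ge:
  fixes x :: "real^'d::finite"
  assumes e: "0 < \<epsilon>" "\<epsilon> < 1/2" and x: "x \<in> pos_orthant" and s: "s = 1 \<or> s = -1"
  shows "(1 + \<bar>x $ j\<bar>) / 2 \<le> 1 + hat_d0 (low (grid_point \<epsilon> x) k) (high (grid_point \<epsilon> x) k) (s * \<epsilon>)"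
    and "1 + \<bar>real_of_int (k $ j)\<bar> \<le> 1 + hat_d0 (low (grid_point \<epsilon> x) k) (high (grid_point \<epsilon> x) k) (s * \<epsilon>)"
proof -
  let ?n = "low (grid_point \<epsilon> x) k" and ?m = "high (grid_point \<epsilon> x) k"
  have xj: "x $ j \<ge> 0" using x by (simp add: pos_orthant_def)
  have se: "\<bar>s * \<epsilon>\<bar> = \<epsilon>" using s e by auto
  have "x $ j - 2 * \<epsilon> \<le> 2 * \<epsilon> * real (grid_index \<epsilon> (x $ j))" by (rule grid_index_bounds(2)[OF e(1) xj])
  also have "\<dots> = \<epsilon> * (2 * real (grid_point \<epsilon> x $ j))" by (simp add: grid_point_def)
  also have "\<dots> \<le> \<epsilon> * (real (?n $ j) + real (?m $ j))"
    unfolding low_high_sum using e by (intro mult_left_mono) auto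
  also have "\<dots> \<le> hat_d0 ?n ?m (s * \<epsilon>)"
    using hat_d0_ge(1)[of "s * \<epsilon>" ?n j ?m] unfolding se .
  \<comment> \<open>The left end of the cell may be \<open>2 \<epsilon>\<close> below \<open>x\<close>; this is where \<open>\<epsilon> < 1/2\<close> and the factor \<open>1/2\<close> of the
    first inequality come from.\<close>
  finally have "x $ j - 1 \<le> hat_d0 ?n ?m (s * \<epsilon>)" using e by linarith
  moreover have "0 \<le> hat_d0 ?n ?m (s * \<epsilon>)" by (rule hat_d0_ge(4))
  ultimately show "(1 + \<bar>x $ j\<bar>) / 2 \<le> 1 + hat_d0 ?n ?m (s * \<epsilon>)" using xj by simp
  show "1 + \<bar>real_of_int (k $ j)\<bar> \<le> 1 + hat_d0 ?n ?m (s * \<epsilon>)"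
    using hat_d0_ge(2)[of ?m j ?n "s * \<epsilon>"] unfolding low_high_diff by simp
qed

lemma weighted_bound:
  fixes v w a c :: real
  assumes "w * v \<le> c" "1 \<le> a * w" "v \<ge> 0" "a \<ge> 0"
  shows "v \<le> a * c"
proof -
  have "v * 1 \<le> v * (a * w)" by (rule mult_left_mono) fact+
  also have "\<dots> = a * (w * v)" by (simp only: mult_ac)
  also have "\<dots> \<le> a * c" by (rule mult_left_mono) fact+
  finally show ?thesis by simp
qed

lemma grid_value_bound:
  fixes \<theta> :: "nat^'d::finite \<Rightarrow> nat^'d \<Rightarrow> real \<Rightarrow> complex" and x :: "real^'d"
  assumes B: "\<And>n m l. l \<noteq> 0 \<Longrightarrow> (1 + hat_d0 n m l) ^ (4 * CARD('d)) * norm (\<theta> n m l) \<le> B"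
    and e: "0 < \<epsilon>" "\<epsilon> < 1/2" and x: "x \<in> pos_orthant" and s: "s = 1 \<or> s = -1"
  shows "norm (\<theta> (low (grid_point \<epsilon> x) k) (high (grid_point \<epsilon> x) k) (s * \<epsilon>)) \<le> 2 ^ (2 * CARD('d)) * (orth_weight x * int_weight k) * B"
proof (rule weighted_bound[OF B])
  show "s * \<epsilon> \<noteq> 0" using e s by auto
  show "1 \<le> 2 ^ (2 * CARD('d)) * (orth_weight x * int_weight k) * (1 + hat_d0 (low (grid_point \<epsilon> x) k) (high (grid_point \<epsilon> x) k) (s * \<epsilon>)) ^ (4 * CARD('d))"
    by (rule boundary_weight_le[OF _ hat_d0_low_high_ge(1)[OF e x s] hat_d0_low_high_ge(2)[OF e x s]]) simp
qed (simp_all add: orth_weight_nonneg int_weight_nonneg)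

text \<open>The bound of \<open>grid_value_bound\<close> is uniform in \<open>\<epsilon>\<close> and passes to the limit.\<close>

lemma boundary_value_bound:
  fixes \<theta> :: "'d::finite freq \<Rightarrow> complex" and x :: "real^'d"
  assumes cont: "continuous_map freq_topology euclidean \<theta>"
    and B: "\<And>n m l. l \<noteq> 0 \<Longrightarrow> (1 + hat_d0 n m l) ^ (4 * CARD('d)) * norm (\<theta> (Freq n m l)) \<le> B"
    and x: "x \<in> pos_orthant" and s: "s = 1 \<or> s = -1"
  shows "norm (\<theta> (Bdry (s *\<^sub>R x) k)) \<le> 2 ^ (2 * CARD('d)) * (orth_weight x * int_weight k) * B"
proof (rule tendsto_upperbound[OF tendsto_norm[OF freq_tendsto_boundary[OF cont x s]]])
  show "\<forall>\<^sub>F \<epsilon> in at_right 0. norm (\<theta> (Freq (low (grid_point \<epsilon> x) k) (high (grid_point \<epsilon> x) k) (s * \<epsilon>)))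
      \<le> 2 ^ (2 * CARD('d)) * (orth_weight x * int_weight k) * B"
  proof -
    have "(0::real) < 1/2" by simp
    from eventually_small[OF this] show ?thesis
      by eventually_elim (rule grid_value_bound[of "\<lambda>n m l. \<theta> (Freq n m l)", OF B _ _ x s], auto)
  qed
qed simp

text \<open>The boundary values are pointwise limits of functions that are constant on the cells of a grid.\<close>

lemma boundary_measurable:
  fixes \<theta> :: "'d::finite freq \<Rightarrow> complex"
  assumes cont: "continuous_map freq_topology euclidean \<theta>" and s: "s = 1 \<or> s = -1"
  shows "(\<lambda>x. indicator pos_orthant x *\<^sub>R \<theta> (Bdry (s *\<^sub>R x) k)) \<in> borel_measurable borel"
proof (rule borel_measurable_LIMSEQ_metric)
  let ?e = "\<lambda>i. 1 / real (Suc i)"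
  let ?f = "\<lambda>i x. indicator pos_orthant x *\<^sub>R \<theta> (Freq (low (grid_point (?e i) x) k) (high (grid_point (?e i) x) k) (s * ?e i))"
  show "?f i \<in> borel_measurable borel" for i
    by (rule grid_function_measurable[of "?e i" "\<lambda>p. \<theta> (Freq (low p k) (high p k) (s * ?e i))"]) simp
  fix x :: "real^'d"
  have e0: "?e \<longlonglongrightarrow> 0" by (rule LIMSEQ_Suc[OF lim_1_over_n])
  have er: "filterlim ?e (at_right 0) sequentially"
    using e0 by (simp add: filterlim_at)
  show "(\<lambda>i. ?f i x) \<longlonglongrightarrow> indicator pos_orthant x *\<^sub>R \<theta> (Bdry (s *\<^sub>R x) k)"
  proof (cases "x \<in> pos_orthant")
    case True
    from filterlim_compose[OF freq_tendsto_boundary[OF cont True s] er] True show ?thesis by simp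
  qed simp
qed

section \<open>The limit of the frequency sum at the origin\<close>

lemma bij_low_high: "bij (\<lambda>q :: (int^'d::finite) \<times> (nat^'d). (low (snd q) (fst q), high (snd q) (fst q)))"
proof (rule bij_betw_byWitness[where f' = "\<lambda>p. (\<chi> j. int (snd p $ j) - int (fst p $ j), \<chi> j. min (fst p $ j) (snd p $ j))"])
  show "\<forall>q\<in>UNIV. (\<lambda>p :: (nat^'d) \<times> (nat^'d). (\<chi> j. int (snd p $ j) - int (fst p $ j), \<chi> j. min (fst p $ j) (snd p $ j))) (low (snd q) (fst q), high (snd q) (fst q)) = q"
    by (auto simp: prod_eq_iff vec_eq_iff low_def high_def min_def)
  show "\<forall>p\<in>UNIV. (\<lambda>q :: (int^'d) \<times> (nat^'d). (low (snd q) (fst q), high (snd q) (fst q))) (\<chi> j. int (snd p $ j) - int (fst p $ j), \<chi> j. min (fst p $ j) (snd p $ j)) = p"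
    by (auto simp: prod_eq_iff vec_eq_iff low_def high_def min_def)
qed auto

text \<open>The sum over all pairs is arranged by their difference \<open>k\<close>.  The density \<open>\<epsilon>\<^sup>d\<close> is \<open>2\<^sup>-\<^sup>d\<close> times the
  volume of a cell, so the inner sum over the minimum is an integral over the orthant.\<close>

lemma freq_sum_grid_integral:
  fixes \<theta> :: "nat^'d::finite \<Rightarrow> nat^'d \<Rightarrow> real \<Rightarrow> complex"
  assumes r: "rapid \<theta>" and e: "\<epsilon> > 0" and s: "s = 1 \<or> s = -1"
  shows "freq_sum \<theta> Y (s * \<epsilon>) = (\<Sum>\<^sub>\<infinity>k. of_real (1 / 2 ^ CARD('d)) *
     (LINT x|lborel. indicator pos_orthant x *\<^sub>R
        (cnj (W_kernel (low (grid_point \<epsilon> x) k) (high (grid_point \<epsilon> x) k) (s * \<epsilon>) Y)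
          * \<theta> (low (grid_point \<epsilon> x) k) (high (grid_point \<epsilon> x) k) (s * \<epsilon>))))"
proof -
  let ?D = "CARD('d)"
  let ?h = "\<lambda>q :: (int^'d) \<times> (nat^'d). (low (snd q) (fst q), high (snd q) (fst q))"
  let ?F = "\<lambda>p. cnj (W_kernel (fst p) (snd p) (s * \<epsilon>) Y) * \<theta> (fst p) (snd p) (s * \<epsilon>)"
  let ?G = "\<lambda>k i. ?F (low i k, high i k)"
  have se: "\<bar>s * \<epsilon>\<bar> = \<epsilon>" "s * \<epsilon> \<noteq> 0" using s e by auto
  obtain C where sm: "\<And>Y l. (\<lambda>p. norm (freq_term \<theta> Y l p)) summable_on UNIV"
    by (rule freq_sum_bound[OF r]) (rule that)
  have "(\<lambda>p. norm (?F p * of_real (\<bar>s * \<epsilon>\<bar> ^ ?D)) * (1 / \<epsilon> ^ ?D)) summable_on UNIV"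
    by (rule summable_on_cmult_left[OF sm])
  hence "(\<lambda>p. norm (?F p)) summable_on UNIV" using e unfolding se(1) by (simp add: norm_mult norm_power)
  hence hs: "(\<lambda>q. norm (?F (?h q))) summable_on UNIV"
    using summable_on_reindex_bij_betw[OF bij_low_high, of "\<lambda>p. norm (?F p)"] by simp
  have eq: "(\<lambda>q. ?F (?h q)) = (\<lambda>(k, i). ?G k i)" by auto
  have inner: "(\<lambda>i. norm (?G k i)) summable_on UNIV" for k
  proof -
    have "(\<lambda>q. norm (?F (?h q))) summable_on range (Pair k)"
      by (rule summable_on_subset_banach[OF hs]) simp
    hence "((\<lambda>q. norm (?F (?h q))) \<circ> Pair k) summable_on UNIV"
      by (subst (asm) summable_on_reindex) (auto simp: inj_on_def)
    thus ?thesis by (simp add: o_def)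
  qed
  have "freq_sum \<theta> Y (s * \<epsilon>) = (\<Sum>\<^sub>\<infinity>p. ?F p) * of_real (\<epsilon> ^ ?D)"
    unfolding freq_sum_def se(1) by (rule infsum_cmult_left')
  also have "(\<Sum>\<^sub>\<infinity>p. ?F p) = (\<Sum>\<^sub>\<infinity>q. ?F (?h q))"
    by (rule infsum_reindex_bij_betw[OF bij_low_high, symmetric])
  also have "\<dots> = (\<Sum>\<^sub>\<infinity>k. \<Sum>\<^sub>\<infinity>i. ?G k i)"
    using infsum_Sigma'_banach[of ?G UNIV "\<lambda>_. UNIV"] abs_summable_summable[OF hs] unfolding eq by simp
  also have "\<dots> * of_real (\<epsilon> ^ ?D) = (\<Sum>\<^sub>\<infinity>k. (\<Sum>\<^sub>\<infinity>i. ?G k i) * of_real (\<epsilon> ^ ?D))"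
    by (rule infsum_cmult_left'[symmetric])
  also have "\<dots> = (\<Sum>\<^sub>\<infinity>k. of_real (1 / 2 ^ ?D) * (LINT x|lborel. indicator pos_orthant x *\<^sub>R ?G k (grid_point \<epsilon> x)))"
  proof (rule infsum_cong)
    fix k :: "int^'d"
    have "of_real (1 / 2 ^ ?D) * (LINT x|lborel. indicator pos_orthant x *\<^sub>R ?G k (grid_point \<epsilon> x))
       = of_real (1 / 2 ^ ?D * (2 * \<epsilon>) ^ ?D) * (\<Sum>\<^sub>\<infinity>i. ?G k i)"
      unfolding grid_integral[OF e inner] by (simp only: of_real_mult mult.assoc)
    also have "1 / 2 ^ ?D * (2 * \<epsilon>) ^ ?D = \<epsilon> ^ ?D" by (simp add: power_mult_distrib)
    finally show "(\<Sum>\<^sub>\<infinity>i. ?G k i) * of_real (\<epsilon> ^ ?D) = of_real (1 / 2 ^ ?D) * (LINT x|lborel. indicator pos_orthant x *\<^sub>R ?G k (grid_point \<epsilon> x))"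
      by (simp only: mult.commute)
  qed
  finally show ?thesis by simp
qed

lemma AE_coords_nonzero: "AE x :: real^'d::finite in lborel. \<forall>j. x $ j \<noteq> 0"
proof -
  have "AE x :: real^'d in lborel. x $ j \<noteq> 0" for j
  proof -
    have "negligible {x :: real^'d. x \<bullet> axis j 1 = 0}"
      by (rule negligible_standard_hyperplane) (auto simp: Basis_vec_def)
    hence "{x :: real^'d. x \<bullet> axis j 1 = 0} \<in> null_sets lebesgue" by (simp only: negligible_iff_null_sets)
    from AE_not_in[OF this] have "AE x :: real^'d in lebesgue. x $ j \<noteq> 0" by (simp add: inner_axis)
    thus ?thesis by (simp only: AE_completion_iff)
  qed
  hence "AE x :: real^'d in lborel. \<forall>j\<in>UNIV. x $ j \<noteq> 0" by (intro AE_finite_allI) auto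
  thus ?thesis by simp
qed

lemma K_one_measurable [measurable]:
  assumes [measurable]: "f \<in> borel_measurable M" "g \<in> borel_measurable M" "h \<in> borel_measurable M"
  shows "(\<lambda>x. K_one (f x) k (g x) (h x)) \<in> borel_measurable M"
proof -
  have "(\<lambda>(x, z). indicator {-pi..pi} z *\<^sub>R
     exp (\<i> * of_real (2 * sqrt \<bar>f x\<bar> * (g x * sin z + h x * sgn (f x) * cos z) + of_int k * z)) :: complex) \<in> borel_measurable (M \<Otimes>\<^sub>M lborel)"
    by measurable
  from lborel.borel_measurable_lebesgue_integral[OF this]
  show ?thesis unfolding K_one_eq_lborel by (intro borel_measurable_times) simp_all
qed

lemma norm_K_kernel_le_1: "norm (K_kernel x k Y) \<le> 1"
  unfolding K_kernel_def by (simp add: prod_norm[symmetric] norm_K_one_le_1 prod_le_1)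

lemma K_kernel_measurable [measurable]:
  fixes f :: "'a \<Rightarrow> real^'d::finite"
  assumes [measurable]: "f \<in> borel_measurable M" "g \<in> borel_measurable M"
  shows "(\<lambda>x. K_kernel (f x) k (g x)) \<in> borel_measurable M"
proof -
  have [measurable]: "(\<lambda>x. f x $ j) \<in> borel_measurable M" "(\<lambda>x. fst (g x) $ j) \<in> borel_measurable M"
    "(\<lambda>x. snd (g x) $ j) \<in> borel_measurable M" for j
    using measurable_compose[OF assms(1) vec_nth_measurable] measurable_compose[OF assms(2) phase_coord_measurable(1)]
      measurable_compose[OF assms(2) phase_coord_measurable(2)] by auto
  show ?thesis unfolding K_kernel_def by measurable
qed

lemma W_kernel_tendsto_K_kernel:
  fixes x :: "real^'d::finite"
  assumes x: "x \<in> pos_orthant" "\<And>j. x $ j \<noteq> 0" and s: "s = 1 \<or> s = -1"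
  shows "((\<lambda>\<epsilon>. W_kernel (low (grid_point \<epsilon> x) k) (high (grid_point \<epsilon> x) k) (s * \<epsilon>) Y) \<longlongrightarrow> K_kernel (s *\<^sub>R x) k Y) (at_right 0)"
proof -
  have xj: "x $ j > 0" for j using x by (auto simp: pos_orthant_def order_le_less)
  have "((\<lambda>\<epsilon>. \<Prod>j\<in>UNIV. kern1 (grid_index \<epsilon> (x $ j) + nat (- (k $ j))) (grid_index \<epsilon> (x $ j) + nat (k $ j)) (s * \<epsilon>) (fst Y $ j) (snd Y $ j))
     \<longlongrightarrow> (\<Prod>j\<in>UNIV. K_one (s * x $ j) (k $ j) (fst Y $ j) (snd Y $ j))) (at_right 0)"
    by (intro tendsto_prod kern1_tendsto_K_one xj s)
  hence "((\<lambda>\<epsilon>. \<Prod>j\<in>UNIV. kern1 (grid_index \<epsilon> (x $ j) + nat (- (k $ j))) (grid_index \<epsilon> (x $ j) + nat (k $ j)) (s * \<epsilon>) (fst Y $ j) (snd Y $ j))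
     \<longlongrightarrow> K_kernel (s *\<^sub>R x) k Y) (at_right 0)"
    by (simp add: K_kernel_def)
  moreover have "eventually (\<lambda>\<epsilon>. (\<Prod>j\<in>UNIV. kern1 (grid_index \<epsilon> (x $ j) + nat (- (k $ j))) (grid_index \<epsilon> (x $ j) + nat (k $ j)) (s * \<epsilon>) (fst Y $ j) (snd Y $ j))
      = W_kernel (low (grid_point \<epsilon> x) k) (high (grid_point \<epsilon> x) k) (s * \<epsilon>) Y) (at_right 0)"
    using eventually_small[OF zero_less_one]
  proof eventually_elim
    fix \<epsilon> :: real assume "0 < \<epsilon> \<and> \<epsilon> < 1"
    hence nz: "s * \<epsilon> \<noteq> 0" using s by auto
    show "(\<Prod>j\<in>UNIV. kern1 (grid_index \<epsilon> (x $ j) + nat (- (k $ j))) (grid_index \<epsilon> (x $ j) + nat (k $ j)) (s * \<epsilon>) (fst Y $ j) (snd Y $ j))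
      = W_kernel (low (grid_point \<epsilon> x) k) (high (grid_point \<epsilon> x) k) (s * \<epsilon>) Y"
      by (simp add: W_kernel_prod[OF nz] low_def high_def grid_point_def)
  qed
  ultimately show ?thesis by (rule Lim_transform_eventually)
qed

text \<open>Dominated convergence for the integral over \<open>x\<close> with fixed \<open>k\<close>, and then for the sum over \<open>k\<close>.  The
  bound \<open>?w\<close> serves for both.\<close>

theorem freq_sum_tendsto:
  fixes \<theta> :: "'d::finite freq \<Rightarrow> complex"
  assumes cont: "continuous_map freq_topology euclidean \<theta>"
    and r: "rapid (frequencies \<theta>)" and s: "s = 1 \<or> s = -1"
  shows "((\<lambda>\<epsilon>. freq_sum (frequencies \<theta>) Y (s * \<epsilon>)) \<longlongrightarrow>
     (\<Sum>\<^sub>\<infinity>k. of_real (1 / 2 ^ CARD('d)) * (LINT x|lborel. indicator pos_orthant x *\<^sub>R (cnj (K_kernel (s *\<^sub>R x) k Y) * \<theta> (Bdry (s *\<^sub>R x) k))))) (at_right 0)"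
proof -
  let ?t = "frequencies \<theta>"
  let ?D = "CARD('d)"
  obtain B where B: "\<And>n m l. l \<noteq> 0 \<Longrightarrow> (1 + hat_d0 n m l) ^ (4 * ?D) * norm (\<theta> (Freq n m l)) \<le> B"
    using r unfolding rapid_def by blast
  let ?F = "\<lambda>\<epsilon> k x. indicator pos_orthant x *\<^sub>R
        (cnj (W_kernel (low (grid_point \<epsilon> x) k) (high (grid_point \<epsilon> x) k) (s * \<epsilon>) Y)
          * \<theta> (Freq (low (grid_point \<epsilon> x) k) (high (grid_point \<epsilon> x) k) (s * \<epsilon>)))"
  let ?L = "\<lambda>k x. indicator pos_orthant x *\<^sub>R (cnj (K_kernel (s *\<^sub>R x) k Y) * \<theta> (Bdry (s *\<^sub>R x) k))"
  let ?w = "\<lambda>(k :: int^'d) (x :: real^'d). 2 ^ (2 * ?D) * (orth_weight x * int_weight k) * B"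
  have half: "(0::real) < 1/2" by simp
  have B0: "B \<ge> 0"
  proof -
    have "0 \<le> (1 + hat_d0 (0 :: nat^'d) 0 1) ^ (4 * ?D) * norm (\<theta> (Freq 0 0 1))"
      using hat_d0_ge(4)[of "0 :: nat^'d" 0 1] by (intro mult_nonneg_nonneg zero_le_power) auto
    also have "\<dots> \<le> B" by (rule B) simp
    finally show ?thesis .
  qed
  have bound: "norm (?F \<epsilon> k x) \<le> ?w k x" if e: "0 < \<epsilon>" "\<epsilon> < 1/2" for \<epsilon> k x
  proof (cases "x \<in> pos_orthant")
    case True
    have nz: "s * \<epsilon> \<noteq> 0" using e s by auto
    have "norm (W_kernel (low (grid_point \<epsilon> x) k) (high (grid_point \<epsilon> x) k) (s * \<epsilon>) Y)
        * norm (\<theta> (Freq (low (grid_point \<epsilon> x) k) (high (grid_point \<epsilon> x) k) (s * \<epsilon>))) \<le> 1 * ?w k x"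
      by (intro mult_mono grid_value_bound[of ?t, OF B e True s] norm_W_kernel_le_1[OF nz]) auto
    thus ?thesis using True by (simp add: norm_mult)
  qed (use B0 in \<open>simp add: orth_weight_nonneg int_weight_nonneg\<close>)
  have wint: "integrable lborel (?w k)" for k
    by (intro integrable_mult_left integrable_mult_right orth_weight_integrable)
  have meas: "?F \<epsilon> k \<in> borel_measurable borel" if "\<epsilon> > 0" for \<epsilon> k
    by (rule grid_function_measurable[OF that, of "\<lambda>p. cnj (W_kernel (low p k) (high p k) (s * \<epsilon>) Y) * \<theta> (Freq (low p k) (high p k) (s * \<epsilon>))"])
  have lmeas: "?L k \<in> borel_measurable borel" for k
  proof -
    have "(\<lambda>x. cnj (K_kernel (s *\<^sub>R x) k Y) * (indicator pos_orthant x *\<^sub>R \<theta> (Bdry (s *\<^sub>R x) k))) \<in> borel_measurable borel"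
      by (intro borel_measurable_times boundary_measurable[OF cont s]) measurable
    thus ?thesis by simp
  qed
  have ptw: "AE x in lborel. ((\<lambda>\<epsilon>. ?F \<epsilon> k x) \<longlongrightarrow> ?L k x) (at_right 0)" for k
    using AE_coords_nonzero
  proof eventually_elim
    fix x :: "real^'d" assume nz: "\<forall>j. x $ j \<noteq> 0"
    show "((\<lambda>\<epsilon>. ?F \<epsilon> k x) \<longlongrightarrow> ?L k x) (at_right 0)"
    proof (cases "x \<in> pos_orthant")
      case True
      show ?thesis
        by (intro tendsto_scaleR tendsto_const tendsto_mult tendsto_cnj W_kernel_tendsto_K_kernel freq_tendsto_boundary cont True s) (use nz in auto)
    qed simp
  qed
  have lim1: "((\<lambda>\<epsilon>. LINT x|lborel. ?F \<epsilon> k x) \<longlongrightarrow> (LINT x|lborel. ?L k x)) (at_right 0)" for k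
  proof -
    \<comment> \<open>Outside the range of the uniform bound the integral is replaced by its limit, so that every sequence
      can be treated.\<close>
    have "((\<lambda>\<epsilon>. if \<epsilon> < 1/2 then LINT x|lborel. ?F \<epsilon> k x else LINT x|lborel. ?L k x) \<longlongrightarrow> (LINT x|lborel. ?L k x)) (at_right 0)"
      unfolding tendsto_at_iff_sequentially
    proof (intro allI impI)
      fix X :: "nat \<Rightarrow> real" assume X: "\<forall>i. X i \<in> {0<..} - {0}" and X0: "X \<longlonglongrightarrow> 0"
      have Xp: "X i > 0" for i using X by auto
      have Xr: "filterlim X (at_right 0) sequentially"
      using X0 Xp less_imp_neq[OF Xp] by (auto simp: filterlim_at)
      obtain i0 where i0: "\<And>i. i \<ge> i0 \<Longrightarrow> X i < 1/2"
        using order_tendstoD(2)[OF X0 half] unfolding eventually_sequentially by blast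
      have "(\<lambda>i. LINT x|lborel. ?F (X (i + i0)) k x) \<longlonglongrightarrow> (LINT x|lborel. ?L k x)"
      proof (rule integral_dominated_convergence[where w = "?w k"])
        show "AE x in lborel. (\<lambda>i. ?F (X (i + i0)) k x) \<longlonglongrightarrow> ?L k x"
          using ptw by eventually_elim (rule LIMSEQ_ignore_initial_segment[OF filterlim_compose[OF _ Xr]])
        show "AE x in lborel. norm (?F (X (i + i0)) k x) \<le> ?w k x" for i
          by (rule AE_I2) (rule bound[OF Xp i0], simp)
      qed (use lmeas meas[OF Xp] wint in auto)
      hence "(\<lambda>i. LINT x|lborel. ?F (X i) k x) \<longlonglongrightarrow> (LINT x|lborel. ?L k x)"
        by (rule LIMSEQ_offset)
      moreover have "eventually (\<lambda>i. (LINT x|lborel. ?F (X i) k x) = ((\<lambda>\<epsilon>. if \<epsilon> < 1/2 then LINT x|lborel. ?F \<epsilon> k x else LINT x|lborel. ?L k x) \<circ> X) i) sequentially"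
        unfolding eventually_sequentially
        by (intro exI[of _ i0] allI impI) (simp only: o_def if_P[OF i0])
      ultimately show "((\<lambda>\<epsilon>. if \<epsilon> < 1/2 then LINT x|lborel. ?F \<epsilon> k x else LINT x|lborel. ?L k x) \<circ> X) \<longlonglongrightarrow> (LINT x|lborel. ?L k x)"
        by (rule Lim_transform_eventually)
    qed
    moreover have "eventually (\<lambda>\<epsilon>. (if \<epsilon> < 1/2 then LINT x|lborel. ?F \<epsilon> k x else LINT x|lborel. ?L k x) = (LINT x|lborel. ?F \<epsilon> k x)) (at_right 0)"
      using eventually_small[OF half] by eventually_elim simp
    ultimately show ?thesis by (rule Lim_transform_eventually)
  qed
  define W where "W = (LINT x|lborel. orth_weight (x :: real^'d))"
  define c where "c = (of_real (1 / 2 ^ ?D) :: complex)"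
  define M where "M = (\<lambda>k :: int^'d. norm c * (2 ^ (2 * ?D) * (W * int_weight k) * B))"
  have "((\<lambda>\<epsilon>. \<Sum>\<^sub>\<infinity>k. c * (LINT x|lborel. ?F \<epsilon> k x)) \<longlongrightarrow> (\<Sum>\<^sub>\<infinity>k. c * (LINT x|lborel. ?L k x))) (at_right 0)"
  proof (rule tendsto_infsum_dominated[where M = M])
    show "((\<lambda>\<epsilon>. c * (LINT x|lborel. ?F \<epsilon> k x)) \<longlongrightarrow> c * (LINT x|lborel. ?L k x)) (at_right 0)" for k
      by (intro tendsto_mult tendsto_const lim1)
    show "\<forall>\<^sub>F \<epsilon> in at_right 0. \<forall>k. norm (c * (LINT x|lborel. ?F \<epsilon> k x)) \<le> M k"
      using eventually_small[OF half]
    proof (eventually_elim, intro allI)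
      fix \<epsilon> :: real and k :: "int^'d" assume e: "0 < \<epsilon> \<and> \<epsilon> < 1/2"
      have "norm (LINT x|lborel. ?F \<epsilon> k x) \<le> (LINT x|lborel. norm (?F \<epsilon> k x))" by (rule integral_norm_bound)
      also have "\<dots> \<le> (LINT x|lborel. ?w k x)"
      proof (rule Bochner_Integration.integral_mono[OF _ wint[of k]])
        show "integrable lborel (\<lambda>x. norm (?F \<epsilon> k x))"
          by (rule integrable_norm, rule Bochner_Integration.integrable_bound[OF wint[of k]])
             (use meas e order_trans[OF bound abs_ge_self] in auto)
      qed (use bound e in auto)
      also have "\<dots> = 2 ^ (2 * ?D) * (W * int_weight k) * B" by (simp add: W_def)
      finally show "norm (c * (LINT x|lborel. ?F \<epsilon> k x)) \<le> M k"
        unfolding M_def norm_mult[of c] by (rule mult_left_mono) simp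
    qed
    show "M summable_on UNIV"
      unfolding M_def by (rule summable_on_cmult_right, rule summable_on_cmult_left, rule summable_on_cmult_right,
          rule summable_on_cmult_right, rule int_weight_summable)
  qed simp
  moreover have "eventually (\<lambda>\<epsilon>. (\<Sum>\<^sub>\<infinity>k. c * (LINT x|lborel. ?F \<epsilon> k x)) = freq_sum ?t Y (s * \<epsilon>)) (at_right 0)"
    using eventually_small[OF zero_less_one]
  proof eventually_elim
    fix \<epsilon> :: real assume "0 < \<epsilon> \<and> \<epsilon> < 1"
    thus "(\<Sum>\<^sub>\<infinity>k. c * (LINT x|lborel. ?F \<epsilon> k x)) = freq_sum ?t Y (s * \<epsilon>)"
      unfolding c_def by (intro freq_sum_grid_integral[OF r _ s, symmetric]) simp
  qed
  ultimately show ?thesis unfolding c_def by (rule Lim_transform_eventually)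
qed

section \<open>Schwartz functions on the frequency space\<close>

lemma schwartz_tilde_weight:
  assumes "\<theta> \<in> schwartz_tilde" "l \<noteq> 0"
  shows "hat_weight N N' \<theta> (n, m, l) \<le> hat_seminorm N N' \<theta>"
  unfolding hat_seminorm_def using assms by (intro cSUP_upper) (auto simp: schwartz_tilde_def)

lemma schwartz_tilde_pointwise:
  fixes \<theta> :: "nat^'d::finite \<Rightarrow> nat^'d \<Rightarrow> real \<Rightarrow> complex"
  assumes "\<theta> \<in> schwartz_tilde" "l \<noteq> 0"
  shows "(1 + hat_d0 n m l) ^ N * norm ((hat_Delta ^^ N') \<theta> n m l) \<le> hat_seminorm N N' \<theta>"
    and "(1 + hat_d0 n m l) ^ N * norm ((hat_D ^^ N') \<theta> n m l) \<le> hat_seminorm N N' \<theta>"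
    and "(1 + hat_d0 n m l) ^ N * norm (hat_Sigma0 ((hat_D ^^ N') \<theta>) n m l) \<le> hat_seminorm N N' \<theta>"
    and "0 \<le> hat_seminorm N N' \<theta>"
proof -
  let ?a = "norm ((hat_Delta ^^ N') \<theta> n m l)" and ?b = "norm ((hat_D ^^ N') \<theta> n m l)"
    and ?c = "norm (hat_Sigma0 ((hat_D ^^ N') \<theta>) n m l)" and ?w = "(1 + hat_d0 n m l) ^ N"
  have w: "?w \<ge> 0" using hat_d0_ge(4)[of n m l] by simp
  have s: "?w * (?a + ?b + ?c) \<le> hat_seminorm N N' \<theta>"
    using schwartz_tilde_weight[OF assms, of N N' n m] by (simp add: hat_weight_def)
  have "?w * ?a \<le> ?w * (?a + ?b + ?c)" "?w * ?b \<le> ?w * (?a + ?b + ?c)" "?w * ?c \<le> ?w * (?a + ?b + ?c)"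
    by (intro mult_left_mono w; simp)+
  thus "?w * ?a \<le> hat_seminorm N N' \<theta>" "?w * ?b \<le> hat_seminorm N N' \<theta>" "?w * ?c \<le> hat_seminorm N N' \<theta>"
    using s by linarith+
  have "0 \<le> ?w * ?a" using w by simp
  thus "0 \<le> hat_seminorm N N' \<theta>" using \<open>?w * ?a \<le> hat_seminorm N N' \<theta>\<close> by linarith
qed

lemma differentiable_of_real_inverse:
  assumes "l \<noteq> 0"
  shows "(\<lambda>l. of_real (c / (2 * l)) :: complex) differentiable (at l)"
proof -
  have "((\<lambda>l. c / (2 * l)) has_real_derivative - c / (2 * l\<^sup>2)) (at l)"
    using assms by (auto intro!: derivative_eq_intros simp: field_simps power2_eq_square)
  from has_vector_derivative_of_real[OF this] show ?thesis by (rule differentiableI_vector)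
qed

lemma hat_D_differentiable:
  fixes \<theta> :: "nat^'d::finite \<Rightarrow> nat^'d \<Rightarrow> real \<Rightarrow> complex"
  assumes "\<And>n m. \<theta> n m differentiable (at l)" "\<And>n m. lambda_deriv \<theta> n m differentiable (at l)" "l \<noteq> 0"
  shows "hat_D \<theta> n m differentiable (at l)"
proof -
  have eq: "hat_D \<theta> n m = (\<lambda>l. lambda_deriv \<theta> n m l
     + of_real (real CARD('d) / (2 * l)) * \<theta> n m l
     + of_real (1 / (2 * l)) * (\<Sum>j\<in>UNIV.
         lower_coeff n m j * \<theta> (n - axis j 1) (m - axis j 1) l
       - raise_coeff n m j * \<theta> (n + axis j 1) (m + axis j 1) l))"
    by (simp add: hat_D_def fun_eq_iff)
  show ?thesis
    unfolding eq
    by (intro differentiable_add differentiable_mult differentiable_sum differentiable_diff differentiable_const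
        differentiable_of_real_inverse assms finite ballI)
qed

lemma schwartz_tilde_regular:
  fixes \<theta> :: "nat^'d::finite \<Rightarrow> nat^'d \<Rightarrow> real \<Rightarrow> complex"
  assumes t: "\<theta> \<in> schwartz_tilde"
  shows "regular \<theta>" and "regular (hat_D \<theta>)"
proof -
  have r: "rapid ((hat_D ^^ k) \<theta>)" "rapid (hat_Sigma0 ((hat_D ^^ k) \<theta>))" for k
    unfolding rapid_def using schwartz_tilde_pointwise(2,3)[OF t] by blast+
  have d: "(lambda_deriv ^^ i) \<theta> n m differentiable (at l)" if "l \<noteq> 0" for i n m l
    using t that by (auto simp: schwartz_tilde_def)
  have d0: "\<theta> n m differentiable (at l)" if "l \<noteq> 0" for n m l using d[OF that, of 0] by simp
  have d1: "lambda_deriv \<theta> n m differentiable (at l)" if "l \<noteq> 0" for n m l using d[OF that, of 1] by simp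
  show "regular \<theta>" unfolding regular_def using r[of 0] r[of 1] d0 by auto
  show "regular (hat_D \<theta>)" unfolding regular_def
    using r[of 1] r[of 2] hat_D_differentiable[OF d0 d1] by (auto simp: numeral_2_eq_2)
qed

section \<open>Cylindrical distributions\<close>

text \<open>Fubini's theorem is applied on products of Borel spaces, so \<open>g\<close> is replaced by a Borel function.\<close>

lemma lebesgue_borel_representative:
  fixes g :: "'a::euclidean_space \<Rightarrow> complex"
  assumes "g \<in> borel_measurable lebesgue"
  obtains g' where "g' \<in> borel_measurable borel" "AE x in lborel. g x = g' x"
proof -
  have "(\<lambda>x. Re (g x)) \<in> borel_measurable (completion lborel)" "(\<lambda>x. Im (g x)) \<in> borel_measurable (completion lborel)"
    using assms by measurable
  from this[THEN completion_ex_borel_measurable_real] obtain a b where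
    a: "a \<in> borel_measurable lborel" "AE x in lborel. Re (g x) = a x" and
    b: "b \<in> borel_measurable lborel" "AE x in lborel. Im (g x) = b x" by blast
  show ?thesis
  proof (rule that[of "\<lambda>x. Complex (a x) (b x)"])
    have "(\<lambda>x. of_real (a x) + \<i> * of_real (b x)) \<in> borel_measurable borel"
      using a(1) b(1) by measurable
    thus "(\<lambda>x. Complex (a x) (b x)) \<in> borel_measurable borel" by (simp add: Complex_eq)
    show "AE x in lborel. g x = Complex (a x) (b x)"
      using a(2) b(2) by eventually_elim (simp add: complex_eq_iff)
  qed
qed

text \<open>Completeness of Lebesgue measure makes \<open>f\<close> measurable.\<close>

lemma lebesgue_integral_AE_borel:
  fixes f f' :: "'a::euclidean_space \<Rightarrow> complex"
  assumes m: "f' \<in> borel_measurable borel" and ae: "AE x in lborel. f x = f' x"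
  shows "(LINT x|lebesgue. f x) = (LINT x|lborel. f' x)"
    and "integrable lebesgue f \<longleftrightarrow> integrable lborel f'" (is ?th2)
proof -
  have m': "f' \<in> borel_measurable lborel" using m by simp
  have ml: "f' \<in> borel_measurable lebesgue" by (rule measurable_completion[OF m'])
  have ae': "AE x in lebesgue. f x = f' x" using ae by (rule AE_completion)
  have fm: "f \<in> borel_measurable lebesgue"
  proof (rule measurableI)
    fix A :: "complex set" assume A: "A \<in> sets borel"
    show "f -` A \<inter> space lebesgue \<in> sets lebesgue"
    proof (rule complete_measure.in_sets_AE)
      show "complete_measure (lebesgue :: 'a measure)" by (rule completion.complete_measure_axioms)
      show "AE x in lebesgue. (x \<in> f' -` A \<inter> space lebesgue) = (x \<in> f -` A \<inter> space lebesgue)"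
        using ae' by eventually_elim simp
      show "f' -` A \<inter> space lebesgue \<in> sets lebesgue" by (rule measurable_sets[OF ml A])
    qed simp
  qed simp
  have "(LINT x|lebesgue. f x) = (LINT x|lebesgue. f' x)" by (rule integral_cong_AE[OF fm ml ae'])
  also have "\<dots> = (LINT x|lborel. f' x)" by (rule integral_completion[OF m'])
  finally show "(LINT x|lebesgue. f x) = (LINT x|lborel. f' x)" .
  show ?th2
    unfolding integrable_cong_AE[OF fm ml ae'] by (rule integrable_completion[OF m'])
qed

lemma AE_lborel_fst:
  fixes P :: "'a::euclidean_space \<Rightarrow> bool"
  assumes "AE x in lborel. P x"
  shows "AE w in (lborel :: ('a \<times> 'b::euclidean_space) measure). P (fst w)"
proof -
  obtain N where N: "\<And>x. x \<in> space lborel - N \<Longrightarrow> P x" "N \<in> null_sets lborel" using AE_E3[OF assms] by blast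
  have "N \<times> (UNIV :: 'b set) \<in> null_sets (lborel \<Otimes>\<^sub>M lborel)"
    using N(2) by (intro lborel.times_in_null_sets1) auto
  hence "AE w in (lborel :: ('a \<times> 'b) measure). w \<notin> N \<times> UNIV" unfolding lborel_prod by (rule AE_not_in)
  thus ?thesis
  proof eventually_elim
    fix w :: "'a \<times> 'b" assume "w \<notin> N \<times> UNIV"
    thus "P (fst w)" using N(1)[of "fst w"] by (cases w) auto
  qed
qed

lemma dist_cylinder_eq:
  fixes g g' :: "'a::euclidean_space \<Rightarrow> complex" and \<phi> :: "'a \<times> real \<Rightarrow> complex"
  assumes "g' \<in> borel_measurable borel" "AE x in lborel. g x = g' x" "\<phi> \<in> borel_measurable borel"
  shows "dist_of_fun (\<lambda>(Y, s). g Y) \<phi> = (LINT w|lborel. g' (fst w) * \<phi> w)"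
  unfolding dist_of_fun_def
proof (rule lebesgue_integral_AE_borel(1))
  have [measurable]: "g' \<in> borel_measurable borel" "\<phi> \<in> borel_measurable borel" by fact+
  show "(\<lambda>w. g' (fst w) * \<phi> w) \<in> borel_measurable borel"
    unfolding borel_prod[symmetric] by (measurable; simp add: borel_prod)
  show "AE w in lborel. (case w of (Y, s) \<Rightarrow> g Y) * \<phi> w = g' (fst w) * \<phi> w"
    using AE_lborel_fst[OF assms(2)] by eventually_elim (auto simp: case_prod_beta)
qed

lemma cylinder_integral:
  fixes g :: "'a::euclidean_space \<Rightarrow> complex" and \<phi> :: "'a \<times> real \<Rightarrow> complex"
  assumes g: "integrable lborel g" and m: "\<phi> \<in> borel_measurable borel"
    and le: "\<And>Y s. norm (\<phi> (Y, s)) \<le> C / (1 + s\<^sup>2)"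
  shows "integrable lborel (\<lambda>w. g (fst w) * \<phi> w)" (is ?th1)
    and "(LINT w|lborel. g (fst w) * \<phi> w) = (LINT Y|lborel. g Y * (LINT s|lborel. \<phi> (Y, s)))" (is ?th2)
    and "norm (LINT w|lborel. g (fst w) * \<phi> w) \<le> C * ((LINT Y|lborel. norm (g Y)) * (LINT s::real|lborel. 1 / (1 + s\<^sup>2)))"
proof -
  have gm [measurable]: "g \<in> borel_measurable borel" using borel_measurable_integrable[OF g] by simp
  have m' [measurable]: "\<phi> \<in> borel_measurable (borel \<Otimes>\<^sub>M borel)" using m by (simp add: borel_prod)
  let ?b = "\<lambda>w :: 'a \<times> real. norm (g (fst w)) * (C / (1 + (snd w)\<^sup>2))"
  let ?I = "LINT s::real|lborel. 1 / (1 + s\<^sup>2)"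
  have bint: "integrable (lborel \<Otimes>\<^sub>M lborel) ?b"
  proof (rule lborel_pair.Fubini_integrable)
    show "?b \<in> borel_measurable (lborel \<Otimes>\<^sub>M lborel)" by measurable
    have "(LINT s|lborel. norm (?b (Y, s))) = norm (g Y) * (LINT s::real|lborel. \<bar>C\<bar> / (1 + s\<^sup>2))" for Y
    proof -
      have "norm (?b (Y, s)) = norm (g Y) * (\<bar>C\<bar> / (1 + s\<^sup>2))" for s by (simp add: abs_mult abs_divide)
      thus ?thesis by (simp only: integral_mult_right_zero)
    qed
    thus "integrable lborel (\<lambda>Y. LINT s|lborel. norm (?b (Y, s)))"
      using g by simp
    show "AE Y in lborel. integrable lborel (\<lambda>s. ?b (Y, s))"
      by (rule AE_I2) (simp add: integrable_inverse_square)
  qed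
  have fm: "(\<lambda>w. g (fst w) * \<phi> w) \<in> borel_measurable (lborel \<Otimes>\<^sub>M lborel)"
    by measurable
  have ble: "norm (g (fst w) * \<phi> w) \<le> ?b w" for w
    using mult_left_mono[OF le[of "fst w" "snd w"] norm_ge_zero[of "g (fst w)"]]
    by (simp only: norm_mult prod.collapse)
  have fint: "integrable (lborel \<Otimes>\<^sub>M lborel) (\<lambda>w. g (fst w) * \<phi> w)"
    by (rule Bochner_Integration.integrable_bound[OF bint fm]) (rule AE_I2, rule order_trans[OF ble], simp only: real_norm_def abs_ge_self)
  thus fi: ?th1 by (simp add: lborel_prod)
  have "(LINT w|lborel. g (fst w) * \<phi> w) = (LINT Y|lborel. LINT s|lborel. g Y * \<phi> (Y, s))"
    using lborel_pair.integral_fst'[OF fint] by (simp add: lborel_prod)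
  thus ?th2 by simp
  have "norm (LINT w|lborel. g (fst w) * \<phi> w) \<le> (LINT w|lborel. norm (g (fst w) * \<phi> w))"
    by (rule integral_norm_bound)
  also have "\<dots> \<le> (LINT w|lborel. ?b w)"
    by (rule Bochner_Integration.integral_mono) (use fi bint ble in \<open>auto simp: lborel_prod\<close>)
  also have "\<dots> = (LINT Y|lborel. LINT s|lborel. ?b (Y, s))"
    using lborel_pair.integral_fst'[OF bint] by (simp add: lborel_prod)
  also have "\<dots> = (LINT Y|lborel. norm (g Y) * (C * ?I))"
  proof (rule Bochner_Integration.integral_cong[OF refl])
    fix Y
    have "(LINT s|lborel. ?b (Y, s)) = (LINT s::real|lborel. (norm (g Y) * C) * (1 / (1 + s\<^sup>2)))" by simp
    also have "\<dots> = norm (g Y) * (C * ?I)" by (simp only: integral_mult_right_zero mult.assoc)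
    finally show "(LINT s|lborel. ?b (Y, s)) = norm (g Y) * (C * ?I)" .
  qed
  also have "\<dots> = (LINT Y|lborel. norm (g Y)) * (C * ?I)" by (rule integral_mult_left_zero)
  also have "\<dots> = C * ((LINT Y|lborel. norm (g Y)) * ?I)" by (rule mult.left_commute)
  finally show "norm (LINT w|lborel. g (fst w) * \<phi> w) \<le> C * ((LINT Y|lborel. norm (g Y)) * ?I)" .
qed

text \<open>The bound is the summand of the semi-norm without derivatives, since \<open>1 + s\<^sup>2 \<le> (1 + norm (Y, s))\<^sup>2\<close>.\<close>

lemma schwartz_decay:
  fixes \<phi> :: "'a::euclidean_space \<times> real \<Rightarrow> complex"
  assumes p: "\<phi> \<in> schwartz"
  shows "\<phi> \<in> borel_measurable borel" and "norm (\<phi> (Y, s)) \<le> schwartz_norm 2 \<phi> / (1 + s\<^sup>2)" (is ?th2)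
proof -
  have "\<phi> differentiable (at x)" for x
    using p[unfolded schwartz_def, simplified, rule_format, of "[]"] by (cases x) simp
  hence "continuous_on UNIV \<phi>" by (simp add: continuous_at_imp_continuous_on differentiable_imp_continuous_within)
  thus "\<phi> \<in> borel_measurable borel" by (rule borel_measurable_continuous_onI)
  let ?h = "\<lambda>vs x. (1 + norm x) ^ 2 * norm (foldr dir_deriv vs \<phi> x)"
  have bdd: "bdd_above (range (?h vs))" if "set vs \<subseteq> Basis" for vs
    using p that by (auto simp: schwartz_def)
  have nn: "0 \<le> (SUP x. ?h vs x)" if "set vs \<subseteq> Basis" for vs
    by (rule order_trans[OF _ cSUP_upper[OF UNIV_I bdd[OF that], of "0"]]) simp
  have fin: "finite {vs :: ('a \<times> real) list. set vs \<subseteq> Basis \<and> length vs \<le> 2}"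
    by (rule finite_lists_length_le) simp
  have "?h [] (Y, s) \<le> (SUP x. ?h [] x)" by (rule cSUP_upper[OF UNIV_I bdd]) simp
  also have "\<dots> \<le> schwartz_norm 2 \<phi>"
    unfolding schwartz_norm_def
    by (rule member_le_sum[of "[]" _ "\<lambda>vs. SUP x. ?h vs x"]) (use nn fin in auto)
  finally have h: "(1 + norm (Y, s))\<^sup>2 * norm (\<phi> (Y, s)) \<le> schwartz_norm 2 \<phi>" by simp
  have "\<bar>s\<bar> \<le> norm (Y, s)" using norm_snd_le[of s Y] by simp
  hence "s\<^sup>2 \<le> (norm (Y, s))\<^sup>2" by (metis abs_le_square_iff abs_norm_cancel)
  hence "1 + s\<^sup>2 \<le> 1 + (norm (Y, s))\<^sup>2 + 2 * norm (Y, s)" using norm_ge_zero[of "(Y, s)"] by linarith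
  hence "1 + s\<^sup>2 \<le> (1 + norm (Y, s))\<^sup>2" by (simp only: power2_sum one_power2 mult_1_right)
  hence "(1 + s\<^sup>2) * norm (\<phi> (Y, s)) \<le> (1 + norm (Y, s))\<^sup>2 * norm (\<phi> (Y, s))" by (rule mult_right_mono) simp
  moreover have "1 + s\<^sup>2 > 0" by (smt (verit) zero_le_power2)
  ultimately show ?th2
    using h by (simp add: pos_le_divide_eq mult.commute)
qed

text \<open>A Schwartz function decays like \<open>1 / (1 + s\<^sup>2)\<close> uniformly in \<open>Y\<close>, which makes up for the constant
  factor in the variable \<open>s\<close>.\<close>

lemma cylinder_tempered:
  fixes g g' :: "'a::euclidean_space \<Rightarrow> complex"
  assumes g: "integrable lborel g'" and ae: "AE x in lborel. g x = g' x"
  shows "dist_of_fun (\<lambda>(Y, s :: real). g Y) \<in> tempered"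
proof -
  have gm: "g' \<in> borel_measurable borel" using borel_measurable_integrable[OF g] by simp
  note int = cylinder_integral[OF g schwartz_decay]
  note eq = dist_cylinder_eq[OF gm ae]
  let ?T = "dist_of_fun (\<lambda>(Y, s :: real). g Y)"
  have add: "?T (\<lambda>x. \<phi> x + \<psi> x) = ?T \<phi> + ?T \<psi>" if "\<phi> \<in> schwartz" "\<psi> \<in> schwartz" for \<phi> \<psi>
  proof -
    have m: "\<phi> \<in> borel_measurable borel" "\<psi> \<in> borel_measurable borel" using that schwartz_decay(1) by blast+
    show ?thesis
      unfolding eq[OF m(1)] eq[OF m(2)] eq[OF borel_measurable_add[OF m]]
      using int(1)[OF that(1) that(1)] int(1)[OF that(2) that(2)] by (simp add: distrib_left)
  qed
  have scale: "?T (\<lambda>x. c * \<phi> x) = c * ?T \<phi>" if "\<phi> \<in> schwartz" for \<phi> c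
  proof -
    have m: "\<phi> \<in> borel_measurable borel" using that schwartz_decay(1) by blast
    have m': "(\<lambda>x. c * \<phi> x) \<in> borel_measurable borel" using m by measurable
    have "(LINT w|lborel. g' (fst w) * (c * \<phi> w)) = (LINT w|lborel. c * (g' (fst w) * \<phi> w))"
      by (simp only: mult.left_commute)
    thus ?thesis unfolding eq[OF m] eq[OF m'] by simp
  qed
  let ?c = "(LINT Y|lborel. norm (g' Y)) * (LINT s::real|lborel. 1 / (1 + s\<^sup>2))"
  have bound: "norm (?T \<phi>) \<le> ?c * schwartz_norm 2 \<phi>" if "\<phi> \<in> schwartz" for \<phi>
  proof -
    have m: "\<phi> \<in> borel_measurable borel" using that schwartz_decay(1) by blast
    show ?thesis unfolding eq[OF m] using int(3)[OF that that] by (simp only: mult.commute)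
  qed
  show ?thesis
    unfolding tempered_def continuous_forms_def mem_Collect_eq
    by (intro conjI ballI allI add scale exI[of _ ?c] exI[of _ "2::nat"] bound)
qed

section \<open>The boundary measure as a tempered distribution\<close>

lemma lborel_integral_reflect:
  fixes f :: "real^'d::finite \<Rightarrow> complex"
  assumes "f \<in> borel_measurable borel"
  shows "(LINT x|lborel. f (- x)) = (LINT x|lborel. f x)"
proof -
  have eq: "distr lborel borel (\<lambda>x :: real^'d. - x) = lborel"
    using lborel_affine[of "-1" "0 :: real^'d"] by (simp add: density_1)
  have "(LINT x|lborel. f x) = (LINT x|distr lborel borel (\<lambda>x :: real^'d. - x). f x)" by (simp only: eq)
  also have "\<dots> = (LINT x|lborel. f (- x))" by (rule integral_distr) (use assms in auto)
  finally show ?thesis by simp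
qed

text \<open>The negative orthant is reflected onto the positive one, so that the sign \<open>s\<close> can be carried along as a
  parameter.\<close>

lemma mu_integral_orthants:
  fixes F :: "real^'d::finite \<Rightarrow> int^'d \<Rightarrow> complex"
  assumes m: "\<And>s k. s = 1 \<or> s = -1 \<Longrightarrow> (\<lambda>x. indicator pos_orthant x *\<^sub>R F (s *\<^sub>R x) k) \<in> borel_measurable borel"
  shows "mu_integral F = (\<Sum>\<^sub>\<infinity>k. of_real (1 / 2 ^ CARD('d)) *
     ((LINT x|lborel. indicator pos_orthant x *\<^sub>R F ((-1) *\<^sub>R x) k) + (LINT x|lborel. indicator pos_orthant x *\<^sub>R F (1 *\<^sub>R x) k)))"
proof -
  have p: "(LINT x:pos_orthant|lebesgue. F x k) = (LINT x|lborel. indicator pos_orthant x *\<^sub>R F (1 *\<^sub>R x) k)" for k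
    unfolding set_lebesgue_integral_def scaleR_one
    by (rule integral_completion) (use m[of 1 k] in simp)
  have n: "(LINT x:neg_orthant|lebesgue. F x k) = (LINT x|lborel. indicator pos_orthant x *\<^sub>R F ((-1) *\<^sub>R x) k)" for k
  proof -
    let ?h = "\<lambda>x. indicator pos_orthant x *\<^sub>R F ((-1) *\<^sub>R x) k"
    have i: "indicator neg_orthant x = (indicator pos_orthant (- x) :: real)" for x :: "real^'d"
      by (auto simp: indicator_def pos_orthant_def neg_orthant_def)
    have e: "(\<lambda>x. indicator neg_orthant x *\<^sub>R F x k) = (\<lambda>x. ?h (- x))" by (simp add: i fun_eq_iff)
    have hm: "?h \<in> borel_measurable borel" by (rule m) simp
    have hm': "(\<lambda>x. ?h (- x)) \<in> borel_measurable lborel"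
      using measurable_compose[OF borel_measurable_uminus[OF measurable_ident_sets[OF refl]] hm] by simp
    have "(LINT x:neg_orthant|lebesgue. F x k) = (LINT x|lebesgue. ?h (- x))"
      unfolding set_lebesgue_integral_def by (simp only: e)
    also have "\<dots> = (LINT x|lborel. ?h (- x))" by (rule integral_completion[OF hm'])
    also have "\<dots> = (LINT x|lborel. ?h x)" by (rule lborel_integral_reflect[OF hm])
    finally show ?thesis .
  qed
  have c: "(1 / 2 ^ CARD('d) :: complex) = of_real (1 / 2 ^ CARD('d))" by simp
  show ?thesis
    unfolding mu_integral_def p n c by (rule infsum_cmult_right'[symmetric])
qed

lemma G_transform_borel:
  fixes g g' :: "'d::finite phase \<Rightarrow> complex"
  assumes g: "integrable lborel g'" and ae: "AE Y in lborel. g Y = g' Y"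
  shows "G_transform g x k = (LINT Y|lborel. cnj (K_kernel x k Y) * g' Y)"
    and "norm (G_transform g x k) \<le> (LINT Y|lborel. norm (g' Y))" (is ?th2)
    and "(\<lambda>x. G_transform g x k) \<in> borel_measurable borel" (is ?th3)
proof -
  have gm [measurable]: "g' \<in> borel_measurable borel" using borel_measurable_integrable[OF g] by simp
  have Km [measurable]: "K_kernel x k \<in> borel_measurable borel" for x
    using K_kernel_measurable[of "\<lambda>_. x" borel "\<lambda>Y. Y" k] by simp
  show eq: "G_transform g x k = (LINT Y|lborel. cnj (K_kernel x k Y) * g' Y)" for x
    unfolding G_transform_def
  proof (rule lebesgue_integral_AE_borel(1))
    show "AE Y in lborel. cnj (K_kernel x k Y) * g Y = cnj (K_kernel x k Y) * g' Y"
      using ae by eventually_elim simp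
    show "(\<lambda>Y. cnj (K_kernel x k Y) * g' Y) \<in> borel_measurable borel"
      by (intro borel_measurable_times borel_measurable_cnj Km gm)
  qed
  have le: "norm (cnj (K_kernel x k Y) * g' Y) \<le> norm (g' Y)" for Y
    using mult_right_mono[OF norm_K_kernel_le_1[of x k Y] norm_ge_zero[of "g' Y"]] by (simp add: norm_mult)
  show ?th2
    unfolding eq
  proof (rule order_trans[OF integral_norm_bound])
    show "(LINT Y|lborel. norm (cnj (K_kernel x k Y) * g' Y)) \<le> (LINT Y|lborel. norm (g' Y))"
      by (rule integral_mono'[OF integrable_norm[OF g] le]) simp
  qed
  have "(\<lambda>(x, Y). cnj (K_kernel x k Y) * g' Y) \<in> borel_measurable (borel \<Otimes>\<^sub>M lborel)"
    unfolding case_prod_beta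
    by (intro borel_measurable_times borel_measurable_cnj K_kernel_measurable measurable_fst
        measurable_compose[OF measurable_snd]) (use gm in simp_all)
  from lborel.borel_measurable_lebesgue_integral[OF this]
  show ?th3 unfolding eq .
qed

text \<open>The weights of \<open>boundary_value_bound\<close> are integrable in \<open>x\<close> and summable in \<open>k\<close>, so boundary values
  can be integrated against every bounded density \<open>G\<close>, with control by one semi-norm.\<close>

lemma orthant_pairing:
  fixes \<theta> :: "'d::finite freq \<Rightarrow> complex" and G :: "real^'d \<Rightarrow> int^'d \<Rightarrow> complex"
  assumes cont: "continuous_map freq_topology euclidean \<theta>"
    and B: "\<And>n m l. l \<noteq> 0 \<Longrightarrow> (1 + hat_d0 n m l) ^ (4 * CARD('d)) * norm (\<theta> (Freq n m l)) \<le> B"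
    and s: "s = 1 \<or> s = -1"
    and Gm: "\<And>k. (\<lambda>x. G x k) \<in> borel_measurable borel" and Gb: "\<And>x k. norm (G x k) \<le> c"
  shows "(\<lambda>x. indicator pos_orthant x *\<^sub>R (\<theta> (Bdry (s *\<^sub>R x) k) * G (s *\<^sub>R x) k)) \<in> borel_measurable borel"
    and "integrable lborel (\<lambda>x. indicator pos_orthant x *\<^sub>R (\<theta> (Bdry (s *\<^sub>R x) k) * G (s *\<^sub>R x) k))"
    and "norm (LINT x|lborel. indicator pos_orthant x *\<^sub>R (\<theta> (Bdry (s *\<^sub>R x) k) * G (s *\<^sub>R x) k))
      \<le> 2 ^ (2 * CARD('d)) * (LINT x|lborel. orth_weight (x :: real^'d)) * c * B * int_weight k"
proof -
  let ?f = "\<lambda>x. indicator pos_orthant x *\<^sub>R (\<theta> (Bdry (s *\<^sub>R x) k) * G (s *\<^sub>R x) k)"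
  let ?K = "2 ^ (2 * CARD('d)) * int_weight k * B * c"
  have c0: "c \<ge> 0" using order_trans[OF norm_ge_zero Gb] .
  have B0: "B \<ge> 0"
  proof -
    have "0 \<le> (1 + hat_d0 (0 :: nat^'d) 0 1) ^ (4 * CARD('d)) * norm (\<theta> (Freq 0 0 1))"
      using hat_d0_ge(4)[of "0 :: nat^'d" 0 1] by (intro mult_nonneg_nonneg zero_le_power) auto
    also have "\<dots> \<le> B" by (rule B) simp
    finally show ?thesis .
  qed
  have Gs: "(\<lambda>x. G (s *\<^sub>R x) k) \<in> borel_measurable borel"
    by (rule measurable_compose[OF _ Gm]) measurable
  have "(\<lambda>x. (indicator pos_orthant x *\<^sub>R \<theta> (Bdry (s *\<^sub>R x) k)) * G (s *\<^sub>R x) k) \<in> borel_measurable borel"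
    by (rule borel_measurable_times[OF boundary_measurable[OF cont s] Gs])
  thus m: "?f \<in> borel_measurable borel" by simp
  have le: "norm (?f x) \<le> orth_weight x * ?K" for x
  proof (cases "x \<in> pos_orthant")
    case True
    have "norm (\<theta> (Bdry (s *\<^sub>R x) k)) * norm (G (s *\<^sub>R x) k) \<le> 2 ^ (2 * CARD('d)) * (orth_weight x * int_weight k) * B * c"
      by (intro mult_mono boundary_value_bound[OF cont B True s] Gb mult_nonneg_nonneg orth_weight_nonneg
          int_weight_nonneg B0 zero_le_power zero_le_numeral norm_ge_zero)
    thus ?thesis using True by (simp add: norm_mult mult_ac)
  qed (use B0 c0 in \<open>simp add: orth_weight_nonneg int_weight_nonneg\<close>)
  have wint: "integrable lborel (\<lambda>x :: real^'d. orth_weight x * ?K)"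
    by (intro integrable_mult_left orth_weight_integrable)
  show "integrable lborel ?f"
    by (rule Bochner_Integration.integrable_bound[OF wint])
       (use m in simp, rule AE_I2, rule order_trans[OF le], simp only: real_norm_def abs_ge_self)
  have "norm (LINT x|lborel. ?f x) \<le> (LINT x|lborel. norm (?f x))" by (rule integral_norm_bound)
  also have "\<dots> \<le> (LINT x|lborel. orth_weight (x :: real^'d) * ?K)"
    by (rule integral_mono'[OF wint le]) (use B0 c0 in \<open>simp add: orth_weight_nonneg int_weight_nonneg\<close>)
  also have "\<dots> = (LINT x|lborel. orth_weight (x :: real^'d)) * ?K" by (rule integral_mult_left_zero)
  also have "\<dots> = 2 ^ (2 * CARD('d)) * (LINT x|lborel. orth_weight (x :: real^'d)) * c * B * int_weight k"
    by (simp only: mult_ac)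
  finally show "norm (LINT x|lborel. ?f x) \<le> 2 ^ (2 * CARD('d)) * (LINT x|lborel. orth_weight (x :: real^'d)) * c * B * int_weight k" .
qed

lemma mu_times_tempered:
  fixes G :: "real^'d::finite \<Rightarrow> int^'d \<Rightarrow> complex"
  assumes Gm: "\<And>k. (\<lambda>x. G x k) \<in> borel_measurable borel" and Gb: "\<And>x k. norm (G x k) \<le> c"
  shows "mu_times G \<in> tempered_hat"
proof -
  let ?p = "\<lambda>\<theta> :: 'd freq \<Rightarrow> complex. hat_seminorm (4 * CARD('d)) 0 (frequencies \<theta>)"
  let ?T = "\<lambda>s (\<theta> :: 'd freq \<Rightarrow> complex) k. LINT x|lborel. indicator pos_orthant x *\<^sub>R (\<theta> (Bdry (s *\<^sub>R x) k) * G (s *\<^sub>R x) k)"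
  let ?a = "of_real (1 / 2 ^ CARD('d)) :: complex"
  let ?W = "2 ^ (2 * CARD('d)) * (LINT x|lborel. orth_weight (x :: real^'d)) * c"
  have pm: "1 = (1 :: real) \<or> (1 :: real) = -1" "(-1) = (1 :: real) \<or> (-1 :: real) = -1" by auto
  have B: "(1 + hat_d0 n m l) ^ (4 * CARD('d)) * norm (\<theta> (Freq n m l)) \<le> ?p \<theta>"
    if "\<theta> \<in> schwartz_hat" "l \<noteq> 0" for \<theta> n m l
    using schwartz_tilde_pointwise(1)[of "\<lambda>n m l. \<theta> (Freq n m l)" l n m "4 * CARD('d)" 0] that
    by (simp add: schwartz_hat_def)
  have cont: "continuous_map freq_topology euclidean \<theta>" if "\<theta> \<in> schwartz_hat" for \<theta> :: "'d freq \<Rightarrow> complex"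
    using that by (simp add: schwartz_hat_def)
  have op: "(\<lambda>x. indicator pos_orthant x *\<^sub>R (\<theta> (Bdry (s *\<^sub>R x) k) * G (s *\<^sub>R x) k)) \<in> borel_measurable borel"
    "integrable lborel (\<lambda>x. indicator pos_orthant x *\<^sub>R (\<theta> (Bdry (s *\<^sub>R x) k) * G (s *\<^sub>R x) k))"
    "norm (?T s \<theta> k) \<le> ?W * ?p \<theta> * int_weight k"
    if t: "\<theta> \<in> schwartz_hat" and s: "s = 1 \<or> s = -1" for s \<theta> k
    by (rule orthant_pairing[OF cont[OF t] B[OF t] s Gm Gb]; assumption)+
  have eq: "mu_times G \<theta> = (\<Sum>\<^sub>\<infinity>k. ?a * (?T (-1) \<theta> k + ?T 1 \<theta> k))" if "\<theta> \<in> schwartz_hat" for \<theta>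
    unfolding mu_times_def by (rule mu_integral_orthants[OF op(1)]) (use that in auto)
  have le: "norm (?a * (?T (-1) \<theta> k + ?T 1 \<theta> k)) \<le> (2 * ?W * ?p \<theta>) * int_weight k" if t: "\<theta> \<in> schwartz_hat" for \<theta> k
  proof -
    have a: "norm ?a \<le> 1" by (simp add: norm_divide norm_power)
    have "norm (?T (-1) \<theta> k + ?T 1 \<theta> k) \<le> ?W * ?p \<theta> * int_weight k + ?W * ?p \<theta> * int_weight k"
      by (rule norm_triangle_le, rule add_mono) (rule op(3)[OF t pm(2)], rule op(3)[OF t pm(1)])
    hence "norm ?a * norm (?T (-1) \<theta> k + ?T 1 \<theta> k) \<le> 1 * (?W * ?p \<theta> * int_weight k + ?W * ?p \<theta> * int_weight k)"
      by (intro mult_mono a) auto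
    thus ?thesis unfolding norm_mult by (simp only: mult_1_left mult_2 distrib_right)
  qed
  have wsum: "(\<lambda>k :: int^'d. C * int_weight k) summable_on UNIV" for C
    by (rule summable_on_cmult_right[OF int_weight_summable])
  have nsum: "(\<lambda>k. norm (?a * (?T (-1) \<theta> k + ?T 1 \<theta> k))) summable_on UNIV" if "\<theta> \<in> schwartz_hat" for \<theta>
    by (rule summable_on_comparison_test[OF wsum[of "2 * ?W * ?p \<theta>"]]) (use le[OF that] in auto)
  have sum: "(\<lambda>k. ?a * (?T (-1) \<theta> k + ?T 1 \<theta> k)) summable_on UNIV" if "\<theta> \<in> schwartz_hat" for \<theta>
    by (rule abs_summable_summable[OF nsum[OF that]])
  have Tadd: "?T s (\<lambda>x. \<theta> x + \<eta> x) k = ?T s \<theta> k + ?T s \<eta> k"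
    if "\<theta> \<in> schwartz_hat" "\<eta> \<in> schwartz_hat" "s = 1 \<or> s = -1" for \<theta> \<eta> s k
    using op(2)[OF that(1) that(3), of k] op(2)[OF that(2) that(3), of k]
    by (simp add: distrib_right scaleR_add_right)
  have Tscale: "?T s (\<lambda>x. b * \<theta> x) k = b * ?T s \<theta> k" for \<theta> s k b
  proof -
    have "?T s (\<lambda>x. b * \<theta> x) k = (LINT x|lborel. b * (indicator pos_orthant x *\<^sub>R (\<theta> (Bdry (s *\<^sub>R x) k) * G (s *\<^sub>R x) k)))"
      by (simp add: mult.assoc)
    thus ?thesis by (simp only: integral_mult_right_zero)
  qed
  have eqg: "mu_times G \<theta> = (\<Sum>\<^sub>\<infinity>k. ?a * (?T (-1) \<theta> k + ?T 1 \<theta> k))"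
    if "\<And>s k. s = 1 \<or> s = -1 \<Longrightarrow> (\<lambda>x. indicator pos_orthant x *\<^sub>R (\<theta> (Bdry (s *\<^sub>R x) k) * G (s *\<^sub>R x) k)) \<in> borel_measurable borel" for \<theta>
    unfolding mu_times_def by (rule mu_integral_orthants[OF that])
  have add: "mu_times G (\<lambda>x. \<theta> x + \<eta> x) = mu_times G \<theta> + mu_times G \<eta>"
    if t: "\<theta> \<in> schwartz_hat" "\<eta> \<in> schwartz_hat" for \<theta> \<eta>
  proof -
    have "mu_times G (\<lambda>x. \<theta> x + \<eta> x) = (\<Sum>\<^sub>\<infinity>k. ?a * (?T (-1) (\<lambda>x. \<theta> x + \<eta> x) k + ?T 1 (\<lambda>x. \<theta> x + \<eta> x) k))"
    proof (rule eqg)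
      fix s :: real and k :: "int^'d" assume s: "s = 1 \<or> s = -1"
      from borel_measurable_add[OF op(1)[OF t(1) s, of k] op(1)[OF t(2) s, of k]]
      show "(\<lambda>x. indicator pos_orthant x *\<^sub>R ((\<theta> (Bdry (s *\<^sub>R x) k) + \<eta> (Bdry (s *\<^sub>R x) k)) * G (s *\<^sub>R x) k)) \<in> borel_measurable borel"
        by (simp add: distrib_right scaleR_add_right)
    qed
    also have "\<dots> = (\<Sum>\<^sub>\<infinity>k. ?a * (?T (-1) \<theta> k + ?T 1 \<theta> k) + ?a * (?T (-1) \<eta> k + ?T 1 \<eta> k))"
      unfolding Tadd[OF t pm(1)] Tadd[OF t pm(2)] by (rule infsum_cong) (simp only: distrib_left add_ac)
    also have "\<dots> = mu_times G \<theta> + mu_times G \<eta>"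
      unfolding eq[OF t(1)] eq[OF t(2)] by (rule infsum_add[OF sum[OF t(1)] sum[OF t(2)]])
    finally show ?thesis .
  qed
  have scale: "mu_times G (\<lambda>x. b * \<theta> x) = b * mu_times G \<theta>" if t: "\<theta> \<in> schwartz_hat" for \<theta> b
  proof -
    have "mu_times G (\<lambda>x. b * \<theta> x) = (\<Sum>\<^sub>\<infinity>k. ?a * (?T (-1) (\<lambda>x. b * \<theta> x) k + ?T 1 (\<lambda>x. b * \<theta> x) k))"
    proof (rule eqg)
      fix s :: real and k :: "int^'d" assume s: "s = 1 \<or> s = -1"
      from borel_measurable_times[OF borel_measurable_const[of b] op(1)[OF t s, of k]]
      show "(\<lambda>x. indicator pos_orthant x *\<^sub>R (b * \<theta> (Bdry (s *\<^sub>R x) k) * G (s *\<^sub>R x) k)) \<in> borel_measurable borel"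
        by (simp add: mult.assoc)
    qed
    also have "\<dots> = (\<Sum>\<^sub>\<infinity>k. b * (?a * (?T (-1) \<theta> k + ?T 1 \<theta> k)))"
      unfolding Tscale by (rule infsum_cong) (simp only: distrib_left mult.left_commute)
    also have "\<dots> = b * mu_times G \<theta>"
      unfolding eq[OF t] by (rule infsum_cmult_right')
    finally show ?thesis .
  qed
  \<comment> \<open>The semi-norm that controls the pairing is one of the nonnegative summands of the sum over \<open>N, N' \<le> M\<close>.\<close>
  let ?M = "4 * CARD('d)"
  let ?q = "\<lambda>\<theta> :: 'd freq \<Rightarrow> complex. \<Sum>N\<le>?M. \<Sum>N'\<le>?M. hat_seminorm N N' (frequencies \<theta>)"
  define S where "S = (\<Sum>\<^sub>\<infinity>k :: int^'d. int_weight k)"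
  have S0: "S \<ge> 0" unfolding S_def by (rule infsum_nonneg) (rule int_weight_nonneg)
  have c0: "c \<ge> 0" using order_trans[OF norm_ge_zero Gb] .
  have W0: "?W \<ge> 0" using c0 by (intro mult_nonneg_nonneg integral_nonneg) (auto simp: orth_weight_nonneg)
  have bound: "norm (mu_times G \<theta>) \<le> (2 * ?W * S) * ?q \<theta>" if t: "\<theta> \<in> schwartz_hat" for \<theta>
  proof -
    have nn: "0 \<le> hat_seminorm N N' (frequencies \<theta>)" for N N'
      by (rule schwartz_tilde_pointwise(4)[of _ "1::real"]) (use t in \<open>simp_all add: schwartz_hat_def\<close>)
    have "?p \<theta> \<le> (\<Sum>N'\<le>?M. hat_seminorm ?M N' (frequencies \<theta>))"
      by (rule member_le_sum[of 0 _ "\<lambda>N'. hat_seminorm ?M N' (frequencies \<theta>)"]) (use nn in auto)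
    also have "\<dots> \<le> ?q \<theta>"
      by (rule member_le_sum[of ?M _ "\<lambda>N. \<Sum>N'\<le>?M. hat_seminorm N N' (frequencies \<theta>)"])
         (use nn in \<open>auto intro: sum_nonneg\<close>)
    finally have pq: "?p \<theta> \<le> ?q \<theta>" .
    have "norm (mu_times G \<theta>) \<le> (\<Sum>\<^sub>\<infinity>k. norm (?a * (?T (-1) \<theta> k + ?T 1 \<theta> k)))"
      unfolding eq[OF t] by (rule norm_infsum_bound[OF nsum[OF t]])
    also have "\<dots> \<le> (\<Sum>\<^sub>\<infinity>k :: int^'d. (2 * ?W * ?p \<theta>) * int_weight k)"
      by (rule infsum_mono[OF nsum[OF t] wsum]) (rule le[OF t])
    also have "\<dots> = (2 * ?W * S) * ?p \<theta>"
      unfolding infsum_cmult_right' S_def by (simp only: mult_ac)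
    also have "\<dots> \<le> (2 * ?W * S) * ?q \<theta>"
      by (rule mult_left_mono[OF pq]) (intro mult_nonneg_nonneg W0 S0, simp)
    finally show ?thesis .
  qed
  show ?thesis
    unfolding tempered_hat_def continuous_forms_def mem_Collect_eq
    by (intro conjI ballI allI add scale exI[of _ "2 * ?W * S"] exI[of _ ?M] bound)
qed

section \<open>The Fourier transform of a cylindrical function\<close>

text \<open>The right (\<open>s = 1\<close>) and left (\<open>s = -1\<close>) limit of \<open>freq_sum\<close> at the origin.\<close>

definition boundary_limit :: "('d::finite freq \<Rightarrow> complex) \<Rightarrow> real \<Rightarrow> 'd phase \<Rightarrow> complex" where
  "boundary_limit \<theta> s Y = (\<Sum>\<^sub>\<infinity>k. of_real (1 / 2 ^ CARD('d)) * (LINT x|lborel. indicator pos_orthant x *\<^sub>R (cnj (K_kernel (s *\<^sub>R x) k Y) * \<theta> (Bdry (s *\<^sub>R x) k))))"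

lemma orthant_kernel_measurable:
  fixes \<theta> :: "'d::finite freq \<Rightarrow> complex"
  assumes cont: "continuous_map freq_topology euclidean \<theta>" and s: "s = 1 \<or> s = -1"
  shows "(\<lambda>(Y, x). indicator pos_orthant x *\<^sub>R (cnj (K_kernel (s *\<^sub>R x) k Y) * \<theta> (Bdry (s *\<^sub>R x) k))) \<in> borel_measurable (borel \<Otimes>\<^sub>M borel)"
proof -
  have sc: "(\<lambda>x :: real^'d. s *\<^sub>R x) \<in> borel_measurable borel" by measurable
  have K: "(\<lambda>p :: 'd phase \<times> (real^'d). K_kernel (s *\<^sub>R snd p) k (fst p)) \<in> borel_measurable (borel \<Otimes>\<^sub>M borel)"
    by (rule K_kernel_measurable[OF measurable_compose[OF measurable_snd sc] measurable_fst])
  have t: "(\<lambda>p :: 'd phase \<times> (real^'d). indicator pos_orthant (snd p) *\<^sub>R \<theta> (Bdry (s *\<^sub>R snd p) k)) \<in> borel_measurable (borel \<Otimes>\<^sub>M borel)"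
    by (rule measurable_compose[OF measurable_snd boundary_measurable[OF cont s]])
  show ?thesis
    using borel_measurable_times[OF borel_measurable_cnj[OF K] t] by (simp add: case_prod_beta)
qed

text \<open>The integral over \<open>Y\<close> is exchanged with the sum over \<open>k\<close> and then with the integral over \<open>x\<close>; the
  kernel is bounded by one, so \<open>g\<close> and the weights dominate everything.\<close>

lemma boundary_limit_pairing:
  fixes \<theta> :: "'d::finite freq \<Rightarrow> complex" and g :: "'d phase \<Rightarrow> complex"
  assumes cont: "continuous_map freq_topology euclidean \<theta>"
    and B: "\<And>n m l. l \<noteq> 0 \<Longrightarrow> (1 + hat_d0 n m l) ^ (4 * CARD('d)) * norm (\<theta> (Freq n m l)) \<le> B"
    and s: "s = 1 \<or> s = -1" and g: "integrable lborel g"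
  shows "integrable lborel (\<lambda>Y. g Y * boundary_limit \<theta> s Y)" (is ?th1)
    and "(LINT Y|lborel. g Y * boundary_limit \<theta> s Y) = (\<Sum>\<^sub>\<infinity>k. of_real (1 / 2 ^ CARD('d)) *
      (LINT x|lborel. indicator pos_orthant x *\<^sub>R (\<theta> (Bdry (s *\<^sub>R x) k) * (LINT Y|lborel. cnj (K_kernel (s *\<^sub>R x) k Y) * g Y))))"
    and "(\<lambda>k. of_real (1 / 2 ^ CARD('d)) *
      (LINT x|lborel. indicator pos_orthant x *\<^sub>R (\<theta> (Bdry (s *\<^sub>R x) k) * (LINT Y|lborel. cnj (K_kernel (s *\<^sub>R x) k Y) * g Y)))) summable_on UNIV"
proof -
  let ?a = "of_real (1 / 2 ^ CARD('d)) :: complex"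
  let ?h = "\<lambda>k Y x. indicator pos_orthant x *\<^sub>R (cnj (K_kernel (s *\<^sub>R x) k Y) * \<theta> (Bdry (s *\<^sub>R x) k))"
  let ?H = "\<lambda>k Y. LINT x|lborel. ?h k Y x"
  let ?t = "\<lambda>k x. indicator pos_orthant x *\<^sub>R \<theta> (Bdry (s *\<^sub>R x) k)"
  let ?W = "2 ^ (2 * CARD('d)) * (LINT x|lborel. orth_weight (x :: real^'d)) * 1 * B"
  have gm [measurable]: "g \<in> borel_measurable borel" using borel_measurable_integrable[OF g] by simp
  have hm [measurable]: "(\<lambda>(Y, x). ?h k Y x) \<in> borel_measurable (borel \<Otimes>\<^sub>M borel)" for k
    by (rule orthant_kernel_measurable[OF cont s])
  have Km: "(\<lambda>x. cnj (K_kernel x k Y)) \<in> borel_measurable borel" for k Y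
    by (intro borel_measurable_cnj K_kernel_measurable) simp_all
  have Kb: "norm (cnj (K_kernel x k Y)) \<le> 1" for x k and Y :: "'d phase" using norm_K_kernel_le_1[of x k Y] by simp
  have hb: "norm (?H k Y) \<le> ?W * int_weight k" for k Y
    using orthant_pairing(3)[OF cont B s, of "\<lambda>x k. cnj (K_kernel x k Y)" 1 k, OF _ Km Kb]
    by (simp add: mult.commute[of "\<theta> _"])
  have Hm: "(\<lambda>Y. ?H k Y) \<in> borel_measurable borel" for k
  proof -
    have "(\<lambda>(Y, x). ?h k Y x) \<in> borel_measurable (borel \<Otimes>\<^sub>M lborel)" using hm[of k] by simp
    from lborel.borel_measurable_lebesgue_integral[OF this] show ?thesis .
  qed
  have a1: "norm ?a \<le> 1" by (simp add: norm_divide norm_power)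
  have ab: "norm (?a * ?H k Y) \<le> ?W * int_weight k" for k Y
  proof -
    have "norm ?a * norm (?H k Y) \<le> 1 * (?W * int_weight k)" by (rule mult_mono[OF a1 hb]) simp_all
    thus ?thesis unfolding norm_mult by (simp only: mult_1_left)
  qed
  have ws: "(\<lambda>k :: int^'d. ?W * int_weight k) summable_on UNIV"
    by (rule summable_on_cmult_right[OF int_weight_summable])
  have as: "(\<lambda>k. norm (?a * ?H k Y)) summable_on UNIV" for Y
    by (rule summable_on_comparison_test[OF ws]) (use ab in auto)
  have fb: "norm (g Y * (?a * ?H k Y)) = norm (g Y) * norm (?a * ?H k Y)" for k Y by (rule norm_mult)
  have fs: "(\<lambda>k. norm (g Y * (?a * ?H k Y))) summable_on UNIV" for Y
    unfolding fb by (rule summable_on_cmult_right[OF as])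
  have fm: "(\<lambda>Y. g Y * (?a * ?H k Y)) \<in> borel_measurable lborel" for k
    using borel_measurable_times[OF gm borel_measurable_times[OF borel_measurable_const[of ?a] Hm[of k]]] by simp
  have fl: "(\<Sum>\<^sub>\<infinity>k. norm (g Y * (?a * ?H k Y))) \<le> norm (g Y) * (\<Sum>\<^sub>\<infinity>k :: int^'d. ?W * int_weight k)" for Y
    unfolding fb infsum_cmult_right'[of "norm (g Y)"]
    by (intro mult_left_mono infsum_mono as ws ab) simp
  note swap = integral_infsum_swap_dominated[OF fm integrable_mult_left[OF integrable_norm[OF g]] fs fl]
  have e: "g Y * boundary_limit \<theta> s Y = (\<Sum>\<^sub>\<infinity>k. g Y * (?a * ?H k Y))" for Y
    unfolding boundary_limit_def by (rule infsum_cmult_right'[symmetric])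
  show ?th1 unfolding e by (rule swap(1))
  have val: "(LINT Y|lborel. g Y * (?a * ?H k Y)) = ?a * (LINT x|lborel. indicator pos_orthant x *\<^sub>R (\<theta> (Bdry (s *\<^sub>R x) k) * (LINT Y|lborel. cnj (K_kernel (s *\<^sub>R x) k Y) * g Y)))" for k
  proof -
    let ?F = "\<lambda>Y x. g Y * ?h k Y x"
    have Fm: "(\<lambda>(Y, x). ?F Y x) \<in> borel_measurable (borel \<Otimes>\<^sub>M borel)"
      using borel_measurable_times[OF measurable_compose[OF measurable_fst gm] hm[of k]] by (simp add: case_prod_beta)
    have ti: "integrable lborel (?t k)"
      using orthant_pairing(2)[OF cont B s, of "\<lambda>x k. 1" 1 k] by simp
    have hle: "norm (?h k Y x) \<le> norm (?t k x)" for Y x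
      using mult_right_mono[OF Kb[of "s *\<^sub>R x" k Y] norm_ge_zero[of "\<theta> (Bdry (s *\<^sub>R x) k)"]]
      by (simp add: norm_mult indicator_def)
    have hmx: "?h k Y \<in> borel_measurable lborel" for Y
      using measurable_Pair2[OF hm[of k], of Y] by simp
    have hi: "integrable lborel (?h k Y)" for Y
      by (rule Bochner_Integration.integrable_bound[OF ti hmx]) (rule AE_I2, rule hle)
    have "integrable (lborel \<Otimes>\<^sub>M lborel) (\<lambda>(Y, x). ?F Y x)"
    proof (rule lborel_pair.Fubini_integrable)
      show "(\<lambda>(Y, x). ?F Y x) \<in> borel_measurable (lborel \<Otimes>\<^sub>M lborel)" using Fm by simp
      have ne: "(LINT x|lborel. norm (?F Y x)) = norm (g Y) * (LINT x|lborel. norm (?h k Y x))" for Y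
        unfolding norm_mult[of "g Y"] by (rule integral_mult_right_zero)
      have nm: "(\<lambda>Y. LINT x|lborel. norm (?F Y x)) \<in> borel_measurable lborel"
      proof -
        have "(\<lambda>(Y, x). norm (?F Y x)) \<in> borel_measurable (borel \<Otimes>\<^sub>M lborel)"
          using measurable_compose[OF Fm borel_measurable_norm] by (simp add: case_prod_beta)
        from lborel.borel_measurable_lebesgue_integral[OF this] show ?thesis by simp
      qed
      have "integrable lborel (\<lambda>Y. LINT x|lborel. norm (?F Y x))"
      proof (rule Bochner_Integration.integrable_bound[OF integrable_mult_left[OF integrable_norm[OF g], of "LINT x|lborel. norm (?t k x)"] nm])
        show "AE Y in lborel. norm (LINT x|lborel. norm (?F Y x)) \<le> norm (norm (g Y) * (LINT x|lborel. norm (?t k x)))"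
        proof (rule AE_I2)
          fix Y
          have i: "(LINT x|lborel. norm (?h k Y x)) \<le> (LINT x|lborel. norm (?t k x))"
            by (rule Bochner_Integration.integral_mono[OF integrable_norm[OF hi] integrable_norm[OF ti] hle])
          have "0 \<le> (LINT x|lborel. norm (?h k Y x))" by (rule Bochner_Integration.integral_nonneg) simp
          thus "norm (LINT x|lborel. norm (?F Y x)) \<le> norm (norm (g Y) * (LINT x|lborel. norm (?t k x)))"
            unfolding ne using i by (simp only: real_norm_def abs_mult abs_norm_cancel abs_of_nonneg) (intro mult_left_mono, auto)
        qed
      qed
      thus "integrable lborel (\<lambda>Y. LINT x|lborel. norm (case (Y, x) of (Y, x) \<Rightarrow> ?F Y x))" by (simp only: prod.case)
      show "AE Y in lborel. integrable lborel (\<lambda>x. case (Y, x) of (Y, x) \<Rightarrow> ?F Y x)"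
        unfolding prod.case by (rule AE_I2) (rule integrable_mult_right[OF hi])
    qed
    note fub = lborel_pair.Fubini_integral[OF this]
    have "(LINT Y|lborel. g Y * (?a * ?H k Y)) = (LINT Y|lborel. ?a * (LINT x|lborel. ?F Y x))"
      by (simp only: mult.left_commute integral_mult_right_zero)
    also have "\<dots> = ?a * (LINT Y|lborel. LINT x|lborel. ?F Y x)" by (rule integral_mult_right_zero)
    also have "\<dots> = ?a * (LINT x|lborel. LINT Y|lborel. ?F Y x)" unfolding fub[symmetric] ..
    also have "(LINT x|lborel. LINT Y|lborel. ?F Y x) = (LINT x|lborel. indicator pos_orthant x *\<^sub>R (\<theta> (Bdry (s *\<^sub>R x) k) * (LINT Y|lborel. cnj (K_kernel (s *\<^sub>R x) k Y) * g Y)))"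
    proof (rule Bochner_Integration.integral_cong[OF refl])
      fix x
      have "(LINT Y|lborel. ?F Y x) = (LINT Y|lborel. ?t k x * (cnj (K_kernel (s *\<^sub>R x) k Y) * g Y))"
        by (rule Bochner_Integration.integral_cong[OF refl]) (simp add: mult_ac)
      also have "\<dots> = ?t k x * (LINT Y|lborel. cnj (K_kernel (s *\<^sub>R x) k Y) * g Y)" by (rule integral_mult_right_zero)
      finally show "(LINT Y|lborel. ?F Y x) = indicator pos_orthant x *\<^sub>R (\<theta> (Bdry (s *\<^sub>R x) k) * (LINT Y|lborel. cnj (K_kernel (s *\<^sub>R x) k Y) * g Y))"
        by simp
    qed
    finally show ?thesis .
  qed
  show "(LINT Y|lborel. g Y * boundary_limit \<theta> s Y) = (\<Sum>\<^sub>\<infinity>k. ?a *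
      (LINT x|lborel. indicator pos_orthant x *\<^sub>R (\<theta> (Bdry (s *\<^sub>R x) k) * (LINT Y|lborel. cnj (K_kernel (s *\<^sub>R x) k Y) * g Y))))"
    unfolding e swap(2) val ..
  show "(\<lambda>k. ?a *
      (LINT x|lborel. indicator pos_orthant x *\<^sub>R (\<theta> (Bdry (s *\<^sub>R x) k) * (LINT Y|lborel. cnj (K_kernel (s *\<^sub>R x) k Y) * g Y)))) summable_on UNIV"
    using abs_summable_summable[OF swap(3)] unfolding val .
qed

lemma integral_fourier_transpose:
  fixes \<theta> :: "'d::finite freq \<Rightarrow> complex"
  assumes t: "\<theta> \<in> schwartz_hat"
  shows "(LINT s|lborel. fourier_transpose \<theta> (Y, s)) = of_real pi * (boundary_limit \<theta> 1 Y + boundary_limit \<theta> (-1) Y)"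
proof -
  let ?t = "frequencies \<theta>"
  have ts: "?t \<in> schwartz_tilde" and cont: "continuous_map freq_topology euclidean \<theta>"
    using t by (auto simp: schwartz_hat_def)
  note r = schwartz_tilde_regular[OF ts]
  have rt: "rapid ?t" using r(1) by (simp add: regular_def)
  obtain C where C: "\<And>Y s. norm (line_transform (freq_sum ?t Y) s) \<le> C / (1 + s\<^sup>2)"
    by (rule line_transform_freq_sum_decay[OF r]) (rule that)
  obtain C' where C0: "C' \<ge> 0" and C': "\<And>Y l. norm (freq_sum ?t Y l) \<le> C' / (1 + l\<^sup>2)"
    by (rule freq_sum_bound[OF rt]) (rule that; assumption)
  have lm: "line_transform (freq_sum ?t Y) \<in> borel_measurable lborel"
    using measurable_Pair2[OF line_transform_joint_measurable[OF r(1)], of Y] by simp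
  have li: "integrable lborel (line_transform (freq_sum ?t Y))"
    by (rule Bochner_Integration.integrable_bound[OF integrable_inverse_square[of C] lm])
       (rule AE_I2, rule order_trans[OF C], simp only: real_norm_def abs_ge_self)
  have right: "(freq_sum ?t Y \<longlongrightarrow> boundary_limit \<theta> 1 Y) (at_right 0)"
    using freq_sum_tendsto[OF cont rt, of 1 Y] by (simp only: boundary_limit_def mult_1_left disj_ac simp_thms)
  have left: "(freq_sum ?t Y \<longlongrightarrow> boundary_limit \<theta> (-1) Y) (at_left 0)"
    using freq_sum_tendsto[OF cont rt, of "-1" Y]
    by (simp only: boundary_limit_def filterlim_at_left_to_right minus_zero mult_minus1 simp_thms)
  have "(LINT s|lborel. line_transform (freq_sum ?t Y) s) = of_real pi * (boundary_limit \<theta> 1 Y + boundary_limit \<theta> (-1) Y)"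
    by (rule line_transform_inversion[OF freq_sum_integrable[OF r(1)] _ li right left])
       (rule order_trans[OF C' divide_one_plus_square_le[OF C0]])
  thus ?thesis by (simp only: fourier_transpose_eq_line_transform[OF r(1)])
qed

theorem theorem2p5:
  fixes g :: "'d::finite phase \<Rightarrow> complex"
  assumes "integrable lebesgue g"
  shows "dist_of_fun (\<lambda>(Y, s). g Y) \<in> (tempered :: (('d heis \<Rightarrow> complex) \<Rightarrow> complex) set)
    \<and> mu_times (\<lambda>x k. of_real pi * G_transform g x k) \<in> tempered_hat
    \<and> (\<forall>\<theta>\<in>schwartz_hat. fourier_H (dist_of_fun (\<lambda>(Y, s). g Y)) \<theta>
          = mu_times (\<lambda>x k. of_real pi * G_transform g x k) \<theta>)"
proof -
  obtain g' where gm: "g' \<in> borel_measurable borel" and ae: "AE Y in lborel. g Y = g' Y"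
    using lebesgue_borel_representative[OF borel_measurable_integrable[OF assms]] by blast
  have g': "integrable lborel g'" using lebesgue_integral_AE_borel(2)[OF gm ae] assms by simp
  note G = G_transform_borel[OF g' ae]
  let ?G = "\<lambda>x k. of_real pi * G_transform g x k"
  have Gm: "(\<lambda>x. ?G x k) \<in> borel_measurable borel" for k
    by (intro borel_measurable_times borel_measurable_const G(3))
  have Gb: "norm (?G x k) \<le> pi * (LINT Y|lborel. norm (g' Y))" for x k
    using mult_left_mono[OF G(2)[of x k], of pi] by (simp add: norm_mult)
  have "fourier_H (dist_of_fun (\<lambda>(Y, s). g Y)) \<theta> = mu_times ?G \<theta>" if t: "\<theta> \<in> schwartz_hat" for \<theta>
  proof -
    let ?t = "frequencies \<theta>"
    let ?a = "of_real (1 / 2 ^ CARD('d)) :: complex"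
    let ?T = "\<lambda>s k. LINT x|lborel. indicator pos_orthant x *\<^sub>R (\<theta> (Bdry (s *\<^sub>R x) k) * (LINT Y|lborel. cnj (K_kernel (s *\<^sub>R x) k Y) * g' Y))"
    have ts: "?t \<in> schwartz_tilde" and cont: "continuous_map freq_topology euclidean \<theta>"
      using t by (auto simp: schwartz_hat_def)
    note r = schwartz_tilde_regular[OF ts]
    have B: "(1 + hat_d0 n m l) ^ (4 * CARD('d)) * norm (\<theta> (Freq n m l)) \<le> hat_seminorm (4 * CARD('d)) 0 ?t" if "l \<noteq> 0" for n m l
      using schwartz_tilde_pointwise(1)[OF ts that, of n m "4 * CARD('d)" 0] by simp
    have pm: "(1 :: real) = 1 \<or> (1 :: real) = -1" "(-1 :: real) = 1 \<or> (-1 :: real) = -1" by auto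
    have p: "integrable lborel (\<lambda>Y. g' Y * boundary_limit \<theta> s Y)"
      "(LINT Y|lborel. g' Y * boundary_limit \<theta> s Y) = (\<Sum>\<^sub>\<infinity>k. ?a * ?T s k)"
      "(\<lambda>k. ?a * ?T s k) summable_on UNIV" if s: "s = 1 \<or> s = -1" for s
      by (rule boundary_limit_pairing[OF cont B s g']; assumption)+
    note p1 = p[OF pm(1)] and p2 = p[OF pm(2)]
    obtain C where C: "\<And>Y s. norm (line_transform (freq_sum ?t Y) s) \<le> C / (1 + s\<^sup>2)"
      by (rule line_transform_freq_sum_decay[OF r]) (rule that)
    have ft: "fourier_transpose \<theta> = (\<lambda>w. line_transform (freq_sum ?t (fst w)) (snd w))"
      by (rule ext) (metis fourier_transpose_eq_line_transform[OF r(1)] prod.collapse)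
    have fm: "fourier_transpose \<theta> \<in> borel_measurable borel"
      unfolding ft using line_transform_joint_measurable[OF r(1)] by (simp only: borel_prod)
    have fb: "norm (fourier_transpose \<theta> (Y, s)) \<le> C / (1 + s\<^sup>2)" for Y s
      unfolding fourier_transpose_eq_line_transform[OF r(1)] by (rule C)
    have "fourier_H (dist_of_fun (\<lambda>(Y, s). g Y)) \<theta> = (LINT w|lborel. g' (fst w) * fourier_transpose \<theta> w)"
      unfolding fourier_H_def by (rule dist_cylinder_eq[OF gm ae fm])
    also have "\<dots> = (LINT Y|lborel. g' Y * (LINT s|lborel. fourier_transpose \<theta> (Y, s)))"
      by (rule cylinder_integral(2)[OF g' fm fb])
    also have "\<dots> = (LINT Y|lborel. of_real pi * (g' Y * boundary_limit \<theta> 1 Y + g' Y * boundary_limit \<theta> (-1) Y))"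
      unfolding integral_fourier_transpose[OF t]
      by (rule Bochner_Integration.integral_cong[OF refl]) (simp only: distrib_left mult.left_commute)
    also have "\<dots> = of_real pi * (LINT Y|lborel. g' Y * boundary_limit \<theta> 1 Y + g' Y * boundary_limit \<theta> (-1) Y)"
      by (rule integral_mult_right_zero)
    also have "\<dots> = of_real pi * ((\<Sum>\<^sub>\<infinity>k. ?a * ?T 1 k) + (\<Sum>\<^sub>\<infinity>k. ?a * ?T (-1) k))"
      by (simp only: Bochner_Integration.integral_add[OF p1(1) p2(1)] p1(2) p2(2))
    also have "\<dots> = (\<Sum>\<^sub>\<infinity>k. of_real pi * (?a * ?T 1 k + ?a * ?T (-1) k))"
      unfolding infsum_add[OF p1(3) p2(3), symmetric] by (rule infsum_cmult_right'[symmetric])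
    also have "\<dots> = mu_times ?G \<theta>"
    proof -
      have m: "mu_times ?G \<theta> = (\<Sum>\<^sub>\<infinity>k. ?a *
        ((LINT x|lborel. indicator pos_orthant x *\<^sub>R (\<theta> (Bdry ((-1) *\<^sub>R x) k) * ?G ((-1) *\<^sub>R x) k))
        + (LINT x|lborel. indicator pos_orthant x *\<^sub>R (\<theta> (Bdry (1 *\<^sub>R x) k) * ?G (1 *\<^sub>R x) k))))"
        unfolding mu_times_def by (rule mu_integral_orthants) (rule orthant_pairing(1)[OF cont B _ Gm Gb])
      have v: "(LINT x|lborel. indicator pos_orthant x *\<^sub>R (\<theta> (Bdry (s *\<^sub>R x) k) * ?G (s *\<^sub>R x) k)) = of_real pi * ?T s k" for s k
      proof -
        have "(LINT x|lborel. indicator pos_orthant x *\<^sub>R (\<theta> (Bdry (s *\<^sub>R x) k) * ?G (s *\<^sub>R x) k))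
          = (LINT x|lborel. of_real pi * (indicator pos_orthant x *\<^sub>R (\<theta> (Bdry (s *\<^sub>R x) k) * (LINT Y|lborel. cnj (K_kernel (s *\<^sub>R x) k Y) * g' Y))))"
          unfolding G(1) by (simp only: mult.left_commute mult_scaleR_right)
        thus ?thesis by (simp only: integral_mult_right_zero)
      qed
      show ?thesis
        unfolding m v by (rule infsum_cong) (simp only: distrib_left mult.left_commute add.commute)
    qed
    finally show ?thesis .
  qed
  thus ?thesis
    using cylinder_tempered[OF g' ae] mu_times_tempered[of ?G, OF Gm Gb] by blast
qed

end
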